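(* Let $B_H=\{B_H(t)\}_{t\in\mathbb{R}}$ be a bivariate ($n=2$) time-reversible operator fractional Brownian motion with $H=P\,\mathrm{diag}(h_1,h_2)P^{-1}$, $0<h_1<h_2<1$, as described in the context. Let $j_1<\dots<j_m$, $m\in\mathbb{N}$, be a fixed set of octaves, and let $a(\nu)$ be a sequence of powers of $2$ with $a(\nu)\le \nu/2^j$ ($j=j_1,\dots,j_m$) and $\frac{a(\nu)}{\nu}+\frac{\nu}{a(\nu)^{1+2h_1}}\to0$ as $\nu\to\infty$. Let $\lambda_1(a(\nu)2^j)\le\lambda_2(a(\nu)2^j)$ be the eigenvalues of the sample wavelet variance $W(a(\nu)2^j)$, let $\lambda_1^E(a(\nu)2^j)\le\lambda_2^E(a(\nu)2^j)$ be the eigenvalues of $EW(a(\nu)2^j)$, and for $i=1,2$ put $$\widehat h_i(a(\nu)2^j)=\frac{\log\lambda_i(a(\nu)2^j)}{2\log(a(\nu)2^j)},\qquad h_i^E(a(\nu)2^j)=\frac{\log\lambda_i^E(a(\nu)2^j)}{2\log(a(\nu)2^j)}.$$ Then, as $\nu\to\infty$: (i) for $j=j_1,\dots,j_m$, $(\widehat h_1(a(\nu)2^j),\widehat h_2(a(\nu)2^j))\to(h_1,h_2)$ in probability, and $(h_1^E(a(\nu)2^j),h_2^E(a(\nu)2^j))\to(h_1,h_2)$; (ii) the $2m$-dimensional random vector $$\begin{pmatrix}2\log(a(\nu)2^j)\sqrt{K_{a,j}}\,[\widehat h_1(a(\nu)2^j)-h_1^E(a(\nu)2^j)]\\ 2\log(a(\nu)2^j)\sqrt{K_{a,j}}\,[\widehat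 h_2(a(\nu)2^j)-h_2^E(a(\nu)2^j)]\end{pmatrix}_{j=j_1,\dots,j_m}$$ converges in distribution to $N(0,\mathcal{Q}\,\Sigma_B(j_1,\dots,j_m)\,\mathcal{Q}^* )$, where $\Sigma_B(j_1,\dots,j_m)$ is the $3m\times3m$ matrix defined in the context, and $\mathcal{Q}=(\mathcal{Q}_{jj'})_{j,j'=j_1,\dots,j_m}$ is the block matrix with $2\times3$ blocks $\mathcal{Q}_{jj'}=0$ if $j\neq j'$ and $$\mathcal{Q}_{jj}=\begin{pmatrix}\frac{b_{22}(2^j)}{\det B(2^j)}&-\frac{2b_{12}(2^j)}{\det B(2^j)}&\Big(\frac{b_{11}(2^j)b_{22}(2^j)}{\det B(2^j)}-1\Big)\frac1{b_{22}(2^j)}\\0&0&\frac1{b_{22}(2^j)}\end{pmatrix},$$ with $B(2^j)=(b_{i_1,i_2}(2^j))_{i_1,i_2=1,2}:=P^{-1}EW(2^j)(P^* )^{-1}$.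
   Context: Matrix conventions: $^*$ is (Hermitian) transposition; $c^M=\exp(\log(c)M)$ for $c>0$; $x_\pm=\max\{\pm x,0\}$, and $x_\pm^{-D}$ is read as the zero matrix when $x_\pm=0$; $|0|^H\Sigma|0|^{H^*}=0$. For a symmetric $2\times2$ matrix $S$, $\mathrm{vec}_{\mathcal S}(S)=(s_{11},s_{12},s_{22})^*$. Operator fractional Brownian motion (OFBM). $B_H$ is the $\mathbb{R}^2$-valued centered Gaussian process with finite-dimensional distributions those of $\int_{\mathbb{R}}\frac{e^{itx}-1}{ix}(x_+^{-D}A+x_-^{-D}\overline A)\widetilde B(dx)$, where $D=H-\frac12I$, $A\in M(2,\mathbb{C})$, and $\widetilde B(dx)$ is a complex Gaussian random measure with $\widetilde B(-dx)=\overline{\widetilde B(dx)}$, $E\widetilde B(dx)\widetilde B(dx)^*=dx\,I$. Assumptions: $H=P\,\mathrm{diag}(h_1,h_2)P^{-1}$ with $0<h_1<h_2<1$, $P=(p_{i_1i_2})\in GL(2,\mathbb{R})$ having unit-vector columns; $\Re(AA^* )$ has full rank; $\Im(AA^* )=0$ (time reversibility). Put $\Sigma=EB_H(1)B_H(1)^*$. Wavelet. $\psi\in L^1(\mathbb{R})$ is real-valued with $\int\psi^2=1$, $\int t^q\psi(t)dt=0$ for $q=0,\dots,N_\psi-1$, $N_\psi\ge2$; $\mathrm{supp}(\psi)$ is a compact interval; $\sup_x|\widehat\psi(x)|(1+|x|)^\alpha<\infty$ for some $\alpha>1$. Wavelet coefficients: $D(2^j,k)=\int_{\mathbb{R}}\psi(z)B_H(2^jz+2^jk)dz$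 (mean-square sense), $j\in\mathbb{N}\cup\{0\}$, $k\in\mathbb{Z}$; $EW(2^j):=ED(2^j,0)D(2^j,0)^*$. Here $\nu$ (the number of data points) is a power of $2$, $K_{a,j}=\nu/(a(\nu)2^j)$, and $W(a(\nu)2^j)=\frac1{K_{a,j}}\sum_{k=1}^{K_{a,j}}D(a(\nu)2^j,k)D(a(\nu)2^j,k)^*$. Logarithms of eigenvalues are considered on the event that the eigenvalues are positive (its probability tends to 1). Asymptotic covariance. For octaves $j,j'$ and $z\in\mathbb{Z}$, with $g=\gcd(2^j,2^{j'})$, let $$\Omega_{j,j'}(z)=-\frac12\int_{\mathbb{R}}\int_{\mathbb{R}}\psi(t)\psi(t')\,|2^jt-2^{j'}t'+zg|^H\,\Sigma\,|2^jt-2^{j'}t'+zg|^{H^*}dt'dt .$$ Let $G_{jj'}$ be the $3\times3$ matrix with rows and columns indexed by $(1,1),(1,2),(2,2)$ in this order, whose entry at row $(i_1,i_2)$, column $(l_1,l_2)$ is $$2^{-(j+j')/2}\,g\sum_{z\in\mathbb{Z}}\big[\Omega_{j,j'}(z)_{i_1l_1}\Omega_{j,j'}(z)_{i_2l_2}+\Omega_{j,j'}(z)_{i_1l_2}\Omega_{j,j'}(z)_{i_2l_1}\big],$$ and $F=(G_{jj'})_{j,j'=j_1,\dots,j_m}$. With $(\pi_{i_1i_2})=P^{-1}$ and $$\mathcal P=\begin{pmatrix}\pi_{11}^2&2\pi_{11}\pi_{12}&\pi_{12}^2\\ \pi_{11}\pi_{21}&\pi_{11}\pi_{22}+\pi_{12}\pi_{21}&\pi_{12}\pi_{22}\\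 \pi_{21}^2&2\pi_{21}\pi_{22}&\pi_{22}^2\end{pmatrix},$$ $\Sigma_B(j_1,\dots,j_m)=\mathrm{diag}_m(\mathcal P)\,F\,\mathrm{diag}_m(\mathcal P)^*$, where $\mathrm{diag}_m(\mathcal P)$ is block diagonal with $m$ copies of $\mathcal P$. *)

theory Defs
  imports "HOL-Probability.Probability"
begin

section \<open>Matrices\<close>

text \<open>The ring multiplication of \<open>real^'n^'n\<close> is entrywise, so the library's \<open>exp\<close> and \<open>^\<close> are not
  the matrix exponential and matrix power.\<close>

definition mat_exp :: "real^'n^'n \<Rightarrow> real^'n^'n" where
  "mat_exp M = (\<Sum>k. (1 / fact k) *\<^sub>R (((**) M ^^ k) (mat 1)))"

text \<open>\<open>c\<^sup>M = exp (log c \<cdot> M)\<close> for \<open>c > 0\<close>, and the zero matrix for \<open>c = 0\<close>.\<close>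

definition mat_powr :: "real \<Rightarrow> real^'n^'n \<Rightarrow> real^'n^'n" where
  "mat_powr c M = (if c > 0 then mat_exp (ln c *\<^sub>R M) else 0)"

definition outer :: "real^'n \<Rightarrow> real^'m \<Rightarrow> real^'m^'n" where
  "outer x y = (\<chi> i k. x $ i * y $ k)"

definition cvec :: "real^'n \<Rightarrow> complex^'n" where
  "cvec x = (\<chi> i. complex_of_real (x $ i))"

definition cmat :: "real^'n^'m \<Rightarrow> complex^'n^'m" where
  "cmat A = (\<chi> i k. complex_of_real (A $ i $ k))"

definition cnj_mat :: "complex^'n^'m \<Rightarrow> complex^'n^'m" where
  "cnj_mat A = (\<chi> i k. cnj (A $ i $ k))"

definition Re_mat :: "complex^'n^'m \<Rightarrow> real^'n^'m" where
  "Re_mat A = (\<chi> i k. Re (A $ i $ k))"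

definition Im_mat :: "complex^'n^'m \<Rightarrow> real^'n^'m" where
  "Im_mat A = (\<chi> i k. Im (A $ i $ k))"

definition hermitian :: "complex^'n^'m \<Rightarrow> complex^'m^'n" where
  "hermitian A = transpose (cnj_mat A)"

definition diag2 :: "real \<Rightarrow> real \<Rightarrow> real^2^2" where
  "diag2 x y = vector [vector [x, 0], vector [0, y]]"

definition eigenvals :: "real^'n^'n \<Rightarrow> real set" where
  "eigenvals S = {x. \<exists>v. v \<noteq> 0 \<and> S *v v = x *\<^sub>R v}"

text \<open>A symmetric \<open>2\<times>2\<close> matrix has one or two distinct real eigenvalues, so minimum and maximum are
  its two eigenvalues, counted with multiplicity and in increasing order.\<close>

definition ord_eigenval :: "real^2^2 \<Rightarrow> 2 \<Rightarrow> real" where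
  "ord_eigenval S i = (if i = 1 then Min (eigenvals S) else Max (eigenvals S))"


section \<open>Gaussian laws and convergence of random elements\<close>

definition centered_normal :: "real \<Rightarrow> real measure" where
  "centered_normal \<sigma> = (if \<sigma> = 0 then return borel 0 else density lborel (normal_density 0 \<sigma>))"

text \<open>The law \<open>N(0,S)\<close>, where \<open>S\<close> may be singular.\<close>

definition is_mvnormal :: "(real^'n) measure \<Rightarrow> real^'n^'n \<Rightarrow> bool" where
  "is_mvnormal \<mu> S \<longleftrightarrow> prob_space \<mu> \<and> sets \<mu> = sets borel \<and>
     (\<forall>u. 0 \<le> u \<bullet> (S *v u) \<and>
          distr \<mu> borel (\<lambda>x. u \<bullet> x) = centered_normal (sqrt (u \<bullet> (S *v u))))"

text \<open>Both modes of convergence are for random elements \<open>X n\<close> that are considered only on events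
  \<open>E n\<close> whose probability tends to 1. Nothing is said about the values of \<open>X n\<close> outside \<open>E n\<close>.\<close>

definition conv_in_prob_on ::
  "'w measure \<Rightarrow> (nat \<Rightarrow> 'w set) \<Rightarrow> (nat \<Rightarrow> 'w \<Rightarrow> 'a::metric_space) \<Rightarrow> 'a \<Rightarrow> bool" where
  "conv_in_prob_on M E X x \<longleftrightarrow>
     (\<forall>n. E n \<in> sets M \<and> X n \<in> borel_measurable (restrict_space M (E n))) \<and>
     (\<lambda>n. measure M (E n)) \<longlonglongrightarrow> 1 \<and>
     (\<forall>\<epsilon>>0. (\<lambda>n. measure M {\<omega> \<in> E n. dist (X n \<omega>) x \<ge> \<epsilon>}) \<longlonglongrightarrow> 0)"

definition conv_in_distr_on ::
  "'w measure \<Rightarrow> (nat \<Rightarrow> 'w set) \<Rightarrow> (nat \<Rightarrow> 'w \<Rightarrow> 'a::metric_space) \<Rightarrow> 'a measure \<Rightarrow> bool" where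
  "conv_in_distr_on M E X \<mu> \<longleftrightarrow>
     (\<forall>n. E n \<in> sets M \<and> X n \<in> borel_measurable (restrict_space M (E n))) \<and>
     (\<lambda>n. measure M (E n)) \<longlonglongrightarrow> 1 \<and>
     (\<forall>f :: 'a \<Rightarrow> real. continuous_on UNIV f \<and> bounded (range f) \<longrightarrow>
        (\<lambda>n. LINT \<omega>:E n|M. f (X n \<omega>)) \<longlonglongrightarrow> (LINT x|\<mu>. f x))"


section \<open>Mean-square and Wiener integrals\<close>

definition sq_integrable :: "'w measure \<Rightarrow> ('w \<Rightarrow> 'a::real_normed_vector) \<Rightarrow> bool" where
  "sq_integrable M X \<longleftrightarrow> X \<in> borel_measurable M \<and> integrable M (\<lambda>\<omega>. (norm (X \<omega>))\<^sup>2)"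

definition L2_norm :: "'w measure \<Rightarrow> ('w \<Rightarrow> 'a::real_normed_vector) \<Rightarrow> real" where
  "L2_norm M X = sqrt (LINT \<omega>|M. (norm (X \<omega>))\<^sup>2)"

definition fin_borel :: "real set set" where
  "fin_borel = {E \<in> sets borel. emeasure lborel E < \<infinity>}"

text \<open>\<open>\<integral> X(z) dz = Y\<close> in the mean-square sense, i.e. as a Bochner integral with values in \<open>L\<^sup>2(M)\<close>:
  \<open>X\<close> is approximated by simple functions \<open>\<Sum>E\<in>\<E> n. 1\<^sub>E \<cdot> Z n E\<close> with values in \<open>L\<^sup>2(M)\<close>.\<close>

definition ms_integral ::
  "'w measure \<Rightarrow> (real \<Rightarrow> 'w \<Rightarrow> real^'n) \<Rightarrow> ('w \<Rightarrow> real^'n) \<Rightarrow> bool" where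
  "ms_integral M X Y \<longleftrightarrow>
     (\<forall>z. sq_integrable M (X z)) \<and> sq_integrable M Y \<and>
     (\<exists>(\<E> :: nat \<Rightarrow> real set set) (Z :: nat \<Rightarrow> real set \<Rightarrow> 'w \<Rightarrow> real^'n).
        (\<forall>n. finite (\<E> n) \<and> \<E> n \<subseteq> fin_borel \<and> (\<forall>E\<in>\<E> n. sq_integrable M (Z n E))) \<and>
        (\<forall>n. (\<lambda>z. L2_norm M (\<lambda>\<omega>. X z \<omega> - (\<Sum>E\<in>\<E> n. indicator E z *\<^sub>R Z n E \<omega>)))
               \<in> borel_measurable borel) \<and>
        (\<lambda>n. \<integral>\<^sup>+z. ennreal (L2_norm M (\<lambda>\<omega>. X z \<omega> - (\<Sum>E\<in>\<E> n. indicator E z *\<^sub>R Z n E \<omega>)))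
               \<partial>lborel) \<longlonglongrightarrow> 0 \<and>
        (\<lambda>n. L2_norm M (\<lambda>\<omega>. Y \<omega> - (\<Sum>E\<in>\<E> n. measure lborel E *\<^sub>R Z n E \<omega>))) \<longlonglongrightarrow> 0)"

text \<open>A complex Gaussian random measure \<open>R\<close> with \<open>R(-dx) = cnj R(dx)\<close> and
  \<open>E R(dx) R(dx)\<^sup>* = dx I\<close>. The complex coefficients \<open>c\<close> make the second clause say that real and
  imaginary parts are jointly Gaussian.\<close>

definition gaussian_random_measure :: "'v measure \<Rightarrow> (real set \<Rightarrow> 'v \<Rightarrow> complex^'n) \<Rightarrow> bool" where
  "gaussian_random_measure N R \<longleftrightarrow> prob_space N \<and>
     (\<forall>E\<in>fin_borel. R E \<in> borel_measurable N) \<and>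
     (\<forall>\<E> (c :: real set \<Rightarrow> complex^'n). finite \<E> \<and> \<E> \<subseteq> fin_borel \<longrightarrow>
        (\<exists>\<sigma>\<ge>0. distr N borel (\<lambda>\<omega>. Re (\<Sum>E\<in>\<E>. \<Sum>i\<in>UNIV. c E $ i * R E \<omega> $ i))
                  = centered_normal \<sigma>)) \<and>
     (\<forall>E\<in>fin_borel. \<forall>F\<in>fin_borel. E \<inter> F = {} \<longrightarrow>
        (AE \<omega> in N. R (E \<union> F) \<omega> = R E \<omega> + R F \<omega>)) \<and>
     (\<forall>E\<in>fin_borel. AE \<omega> in N. \<forall>i. R (uminus ` E) \<omega> $ i = cnj (R E \<omega> $ i)) \<and>
     (\<forall>E\<in>fin_borel. \<forall>F\<in>fin_borel. \<forall>i k.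
        (LINT \<omega>|N. R E \<omega> $ i * cnj (R F \<omega> $ k))
          = (if i = k then complex_of_real (measure lborel (E \<inter> F)) else 0))"

text \<open>\<open>\<integral> f(x) R(dx) = Y\<close>, as the \<open>L\<^sup>2\<close> limit of the integrals of simple matrix-valued functions.\<close>

definition wiener_integral ::
  "'v measure \<Rightarrow> (real set \<Rightarrow> 'v \<Rightarrow> complex^'n) \<Rightarrow> (real \<Rightarrow> complex^'n^'m) \<Rightarrow> ('v \<Rightarrow> complex^'m) \<Rightarrow> bool"
where
  "wiener_integral N R f Y \<longleftrightarrow>
     sq_integrable lborel f \<and> sq_integrable N Y \<and>
     (\<exists>(\<E> :: nat \<Rightarrow> real set set) (C :: nat \<Rightarrow> real set \<Rightarrow> complex^'n^'m).
        (\<forall>n. finite (\<E> n) \<and> \<E> n \<subseteq> fin_borel) \<and>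
        (\<lambda>n. L2_norm lborel (\<lambda>x. f x - (\<Sum>E\<in>\<E> n. indicator E x *\<^sub>R C n E))) \<longlonglongrightarrow> 0 \<and>
        (\<lambda>n. L2_norm N (\<lambda>\<omega>. Y \<omega> - (\<Sum>E\<in>\<E> n. C n E *v R E \<omega>))) \<longlonglongrightarrow> 0)"


section \<open>Operator fractional Brownian motion\<close>

definition ofbm_kernel :: "real^2^2 \<Rightarrow> complex^2^2 \<Rightarrow> real \<Rightarrow> real \<Rightarrow> complex^2^2" where
  "ofbm_kernel H A t x =
     (let D = H - (1/2) *\<^sub>R mat 1;
          S = cmat (mat_powr (max x 0) (- D)) ** A + cmat (mat_powr (max (- x) 0) (- D)) ** cnj_mat A
      in \<chi> i k. (exp (\<i> * complex_of_real (t * x)) - 1) / (\<i> * complex_of_real x) * S $ i $ k)"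

text \<open>\<open>B\<close> is a process on \<open>M\<close>. It has the finite-dimensional distributions of the Wiener integrals
  with respect to the random measure \<open>R\<close>, which may live on another probability space \<open>N\<close>.\<close>

definition ofbm ::
  "'v measure \<Rightarrow> (real set \<Rightarrow> 'v \<Rightarrow> complex^2) \<Rightarrow> 'w measure \<Rightarrow> real^2^2 \<Rightarrow> complex^2^2 \<Rightarrow>
   (real \<Rightarrow> 'w \<Rightarrow> real^2) \<Rightarrow> bool" where
  "ofbm N R M H A B \<longleftrightarrow>
     gaussian_random_measure N R \<and> prob_space M \<and>
     (\<forall>t. B t \<in> borel_measurable M) \<and>
     (\<exists>Y. (\<forall>t. wiener_integral N R (ofbm_kernel H A t) (Y t)) \<and>
          (\<forall>T. finite T \<longrightarrow>
             distr M (PiM T (\<lambda>_. borel)) (\<lambda>\<omega>. \<lambda>t\<in>T. cvec (B t \<omega>))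
               = distr N (PiM T (\<lambda>_. borel)) (\<lambda>\<omega>. \<lambda>t\<in>T. Y t \<omega>)))"

definition Sigma_BH :: "'w measure \<Rightarrow> (real \<Rightarrow> 'w \<Rightarrow> real^2) \<Rightarrow> real^2^2" where
  "Sigma_BH M B = (LINT \<omega>|M. outer (B 1 \<omega>) (B 1 \<omega>))"


section \<open>Wavelet analysis\<close>

definition fourier :: "(real \<Rightarrow> real) \<Rightarrow> real \<Rightarrow> complex" where
  "fourier \<psi> x = (LINT t|lborel. complex_of_real (\<psi> t) * exp (- \<i> * complex_of_real (t * x)))"

text \<open>The moment integrals exist since \<open>\<psi>\<close> is integrable with compact support.\<close>

definition wavelet :: "(real \<Rightarrow> real) \<Rightarrow> nat \<Rightarrow> real \<Rightarrow> bool" where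
  "wavelet \<psi> N\<^sub>\<psi> \<alpha> \<longleftrightarrow>
     integrable lborel \<psi> \<and>
     integrable lborel (\<lambda>t. (\<psi> t)\<^sup>2) \<and> (LINT t|lborel. (\<psi> t)\<^sup>2) = 1 \<and>
     N\<^sub>\<psi> \<ge> 2 \<and> (\<forall>q<N\<^sub>\<psi>. (LINT t|lborel. t ^ q * \<psi> t) = 0) \<and>
     (\<exists>a b. closure {t. \<psi> t \<noteq> 0} = {a..b}) \<and>
     \<alpha> > 1 \<and> bdd_above (range (\<lambda>x. cmod (fourier \<psi> x) * (1 + \<bar>x\<bar>) powr \<alpha>))"

text \<open>The first argument of \<open>D\<close> is the scale \<open>2\<^sup>j\<close>, not the octave \<open>j\<close>. Only scales that are powers
  of 2 are constrained. The coefficients are determined up to null sets.\<close>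

definition wavelet_coeffs ::
  "'w measure \<Rightarrow> (real \<Rightarrow> real) \<Rightarrow> (real \<Rightarrow> 'w \<Rightarrow> real^2) \<Rightarrow> (nat \<Rightarrow> int \<Rightarrow> 'w \<Rightarrow> real^2) \<Rightarrow> bool" where
  "wavelet_coeffs M \<psi> B D \<longleftrightarrow>
     (\<forall>(j::nat) (k::int).
        ms_integral M (\<lambda>z \<omega>. \<psi> z *\<^sub>R B (2 ^ j * z + 2 ^ j * of_int k) \<omega>) (D (2 ^ j) k))"

definition EW :: "'w measure \<Rightarrow> (nat \<Rightarrow> int \<Rightarrow> 'w \<Rightarrow> real^2) \<Rightarrow> nat \<Rightarrow> real^2^2" where
  "EW M D s = (LINT \<omega>|M. outer (D s 0 \<omega>) (D s 0 \<omega>))"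

text \<open>Below, \<open>\<nu>\<close> is the number of data points and \<open>s = a(\<nu>) 2\<^sup>j\<close> is the scale; both are powers of 2
  with \<open>s \<le> \<nu>\<close>, so that the division is exact.\<close>

definition K_eff :: "nat \<Rightarrow> nat \<Rightarrow> nat" where
  "K_eff \<nu> s = \<nu> div s"

definition W_sample :: "(nat \<Rightarrow> int \<Rightarrow> 'w \<Rightarrow> real^2) \<Rightarrow> nat \<Rightarrow> nat \<Rightarrow> 'w \<Rightarrow> real^2^2" where
  "W_sample D \<nu> s \<omega> =
     (1 / real (K_eff \<nu> s)) *\<^sub>R (\<Sum>k=1..K_eff \<nu> s. outer (D s (int k) \<omega>) (D s (int k) \<omega>))"

definition h_hat :: "(nat \<Rightarrow> int \<Rightarrow> 'w \<Rightarrow> real^2) \<Rightarrow> nat \<Rightarrow> nat \<Rightarrow> 2 \<Rightarrow> 'w \<Rightarrow> real" where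
  "h_hat D \<nu> s i \<omega> = ln (ord_eigenval (W_sample D \<nu> s \<omega>) i) / (2 * ln (real s))"

definition h_E :: "'w measure \<Rightarrow> (nat \<Rightarrow> int \<Rightarrow> 'w \<Rightarrow> real^2) \<Rightarrow> nat \<Rightarrow> 2 \<Rightarrow> real" where
  "h_E M D s i = ln (ord_eigenval (EW M D s) i) / (2 * ln (real s))"

definition pos_event :: "'w measure \<Rightarrow> (nat \<Rightarrow> int \<Rightarrow> 'w \<Rightarrow> real^2) \<Rightarrow> nat \<Rightarrow> nat \<Rightarrow> 'w set" where
  "pos_event M D \<nu> s = {\<omega> \<in> space M. \<forall>i. ord_eigenval (W_sample D \<nu> s \<omega>) i > 0}"


section \<open>Asymptotic covariance\<close>

definition Omega_mat ::
  "(real \<Rightarrow> real) \<Rightarrow> real^2^2 \<Rightarrow> real^2^2 \<Rightarrow> nat \<Rightarrow> nat \<Rightarrow> int \<Rightarrow> real^2^2" where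
  "Omega_mat \<psi> H \<Sigma> j j' z =
     (let d = (\<lambda>t t'. \<bar>2 ^ j * t - 2 ^ j' * t' + of_int z * real (gcd (2 ^ j) (2 ^ j'))\<bar>)
      in (- (1/2)) *\<^sub>R (LINT t|lborel. LINT t'|lborel.
           (\<psi> t * \<psi> t') *\<^sub>R (mat_powr (d t t') H ** \<Sigma> ** mat_powr (d t t') (transpose H))))"

text \<open>Order of the entries in \<open>vec\<^sub>S\<close>.\<close>

definition vecS_index :: "3 \<Rightarrow> 2 \<times> 2" where
  "vecS_index r = (if r = 1 then (1, 1) else if r = 2 then (1, 2) else (2, 2))"

definition G_mat :: "(real \<Rightarrow> real) \<Rightarrow> real^2^2 \<Rightarrow> real^2^2 \<Rightarrow> nat \<Rightarrow> nat \<Rightarrow> real^3^3" where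
  "G_mat \<psi> H \<Sigma> j j' = (\<chi> r s.
     (let (i1, i2) = vecS_index r; (l1, l2) = vecS_index s; \<Omega> = Omega_mat \<psi> H \<Sigma> j j'
      in 2 powr (- real (j + j') / 2) * real (gcd (2 ^ j) (2 ^ j')) *
         infsum (\<lambda>z. \<Omega> z $ i1 $ l1 * \<Omega> z $ i2 $ l2 + \<Omega> z $ i1 $ l2 * \<Omega> z $ i2 $ l1) UNIV))"

text \<open>Block matrices have index type \<open>'m \<times> 3\<close> or \<open>'m \<times> 2\<close>, where the first component is the block
  index; \<open>oct p\<close> is the octave of block \<open>p\<close>.\<close>

definition F_mat :: "(real \<Rightarrow> real) \<Rightarrow> real^2^2 \<Rightarrow> real^2^2 \<Rightarrow> ('m::finite \<Rightarrow> nat) \<Rightarrow>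
    real^('m \<times> 3)^('m \<times> 3)" where
  "F_mat \<psi> H \<Sigma> oct = (\<chi> u v. G_mat \<psi> H \<Sigma> (oct (fst u)) (oct (fst v)) $ snd u $ snd v)"

definition block_diag :: "('m::finite \<Rightarrow> real^'c^'r) \<Rightarrow> real^('m \<times> 'c)^('m \<times> 'r)" where
  "block_diag A = (\<chi> u v. if fst u = fst v then A (fst u) $ snd u $ snd v else 0)"

definition P_cal :: "real^2^2 \<Rightarrow> real^3^3" where
  "P_cal P = (let \<pi> = matrix_inv P in vector
     [vector [(\<pi>$1$1)\<^sup>2, 2 * \<pi>$1$1 * \<pi>$1$2, (\<pi>$1$2)\<^sup>2],
      vector [\<pi>$1$1 * \<pi>$2$1, \<pi>$1$1 * \<pi>$2$2 + \<pi>$1$2 * \<pi>$2$1, \<pi>$1$2 * \<pi>$2$2],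
      vector [(\<pi>$2$1)\<^sup>2, 2 * \<pi>$2$1 * \<pi>$2$2, (\<pi>$2$2)\<^sup>2]])"

definition Sigma_B :: "(real \<Rightarrow> real) \<Rightarrow> real^2^2 \<Rightarrow> real^2^2 \<Rightarrow> real^2^2 \<Rightarrow> ('m::finite \<Rightarrow> nat) \<Rightarrow>
    real^('m \<times> 3)^('m \<times> 3)" where
  "Sigma_B \<psi> P H \<Sigma> oct =
     block_diag (\<lambda>_. P_cal P) ** F_mat \<psi> H \<Sigma> oct ** transpose (block_diag (\<lambda>_. P_cal P))"

definition B_mat :: "real^2^2 \<Rightarrow> 'w measure \<Rightarrow> (nat \<Rightarrow> int \<Rightarrow> 'w \<Rightarrow> real^2) \<Rightarrow> nat \<Rightarrow> real^2^2" where
  "B_mat P M D s = matrix_inv P ** EW M D s ** matrix_inv (transpose P)"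

definition Q_block :: "real^2^2 \<Rightarrow> real^3^2" where
  "Q_block b = vector
     [vector [b$2$2 / det b, - (2 * b$1$2 / det b), (b$1$1 * b$2$2 / det b - 1) * (1 / b$2$2)],
      vector [0, 0, 1 / b$2$2]]"

definition Q_cal :: "real^2^2 \<Rightarrow> 'w measure \<Rightarrow> (nat \<Rightarrow> int \<Rightarrow> 'w \<Rightarrow> real^2) \<Rightarrow> ('m::finite \<Rightarrow> nat) \<Rightarrow>
    real^('m \<times> 3)^('m \<times> 2)" where
  "Q_cal P M D oct = block_diag (\<lambda>p. Q_block (B_mat P M D (2 ^ oct p)))"

end

theory Submission
  imports Defs
begin

text \<open>In the eigenbasis of \<open>H\<close> and after rescaling by \<open>a(\<nu>)\<^sup>h\<close>, the wavelet coefficients have a law that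
  does not depend on the scale: with \<open>a = a(\<nu>)\<close> the sample wavelet variance is
  \<open>P diag(a\<^sup>h\<^sup>1, a\<^sup>h\<^sup>2) V diag(a\<^sup>h\<^sup>1, a\<^sup>h\<^sup>2) P\<^sup>T\<close>, and \<open>EW\<close> is the same expression with \<open>B(2\<^sup>j)\<close> in place of
  \<open>V\<close>. The entries of \<open>\<surd>K (V - B)\<close> are quadratic forms in Gaussian variables. The two vanishing moments of
  the wavelet make the covariances of the coefficients decay quadratically, so the matrices of these forms have
  rows of order \<open>1/\<surd>K\<close>. Gaussian integration by parts then shows that all moments converge to those of a
  normal law, whose variance is a Toeplitz sum over the two scales.

  The larger eigenvalue is \<open>a\<^sup>2\<^sup>h\<^sup>2 f(e, V)\<close> with \<open>e = a\<^sup>h\<^sup>1 / a\<^sup>h\<^sup>2 \<longrightarrow> 0\<close>, where \<open>f(0, V) = v\<^sub>2\<^sub>2\<close>, and the product of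
  the eigenvalues is the determinant. Hence the logarithms of the eigenvalues are, up to deterministic terms,
  asymptotically \<open>ln (det V / v\<^sub>2\<^sub>2)\<close> and \<open>ln v\<^sub>2\<^sub>2\<close>. Their linearization at \<open>B\<close> is the matrix \<open>Q\<close>; it is uniform on
  bounded sets, and \<open>\<surd>K (V - B)\<close> is tight.\<close>

section \<open>Moments and characteristic functions\<close>

text \<open>The eigenvalues grow at different rates, along columns of \<open>P\<close> that need not
  be orthogonal, so no single normalisation of \<open>W\<close> makes a delta method applicable to
  both. The pair formed by the larger eigenvalue and the determinant avoids this: up to explicit
  powers of \<open>a\<close> both are smooth in \<open>V\<close> near \<open>e = 0\<close>, whereas
  the smaller eigenvalue by itself is a difference of nearly equal terms. Sample and expected
  eigenvalues are compared at the same \<open>e\<close>, so the terms containing \<open>e\<close>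
  cancel to first order. The logarithms require \<open>b_22 > 0\<close> and
  \<open>det B > 0\<close>. Definiteness of \<open>B\<close> is a spectral fact: a combination of
  variance 0 would force the Fourier transform of \<open>\<psi>\<close> to vanish almost everywhere.
  For joint convergence the coefficients of all octaves are pooled into one Gaussian family; each
  linear functional of the errors is then a single quadratic form. Its matrix is not symmetric, so
  bounds are carried along for the transpose as well. The expansion of the logarithms is proved for
  deterministic sequences, made uniform on balls by choosing worst points, and only then applied
  outcome by outcome.\<close>

lemma abs_mult_le_sum_squares: "\<bar>a * b\<bar> \<le> a\<^sup>2 + (b::real)\<^sup>2"
proof -
  have "\<bar>a\<bar> * \<bar>b\<bar> \<le> 2 * (\<bar>a\<bar> * \<bar>b\<bar>)" by simp
  also have "\<dots> \<le> a\<^sup>2 + b\<^sup>2" using sum_squares_bound[of "\<bar>a\<bar>" "\<bar>b\<bar>"] by simp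
  finally show ?thesis by (simp add: abs_mult)
qed

lemma tendsto_zero_sandwich:
  fixes f g :: "nat \<Rightarrow> real"
  assumes "\<And>n. \<bar>f n\<bar> \<le> g n" "g \<longlonglongrightarrow> 0" shows "f \<longlonglongrightarrow> 0"
  by (rule tendsto_rabs_zero_cancel, rule tendsto_sandwich[OF _ _ tendsto_const assms(2)])
    (auto intro!: always_eventually assms)

lemma norm_integral_le:
  fixes f :: "'w \<Rightarrow> 'b::{banach,second_countable_topology}" and g :: "'w \<Rightarrow> real"
  assumes "integrable M f" "integrable M g" "\<And>x. norm (f x) \<le> g x"
  shows "norm (\<integral>x. f x \<partial>M) \<le> (\<integral>x. g x \<partial>M)"
  by (rule order_trans[OF integral_norm_bound integral_mono]) (use assms in auto)

section \<open>Random variables with moments of all orders\<close>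

definition all_moments :: "'w measure \<Rightarrow> ('w \<Rightarrow> real) \<Rightarrow> bool" where
  "all_moments M X \<longleftrightarrow> X \<in> borel_measurable M \<and> (\<forall>p::nat. integrable M (\<lambda>w. \<bar>X w\<bar> ^ p))"

lemma all_moments_measurable: "all_moments M X \<Longrightarrow> X \<in> borel_measurable M"
  by (simp add: all_moments_def)

lemma all_moments_powerD: "all_moments M X \<Longrightarrow> integrable M (\<lambda>w. \<bar>X w\<bar> ^ p)"
  by (simp add: all_moments_def)

lemma all_moments_integrable:
  assumes "all_moments M X" shows "integrable M X"
proof -
  have "integrable M (\<lambda>w. \<bar>X w\<bar>)"
    using all_moments_powerD[OF assms, of 1] by simp
  then show ?thesis using all_moments_measurable[OF assms] by (rule integrable_abs_cancel)
qed

lemma all_moments_mult: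
  assumes "all_moments M X" "all_moments M Y"
  shows "all_moments M (\<lambda>w. X w * Y w)"
  unfolding all_moments_def
proof (intro conjI allI)
  note [measurable] = all_moments_measurable[OF assms(1)] all_moments_measurable[OF assms(2)]
  show "(\<lambda>w. X w * Y w) \<in> borel_measurable M" by measurable
  fix p :: nat
  have "integrable M (\<lambda>w. \<bar>X w\<bar> ^ (2 * p) + \<bar>Y w\<bar> ^ (2 * p))"
    using assms by (intro Bochner_Integration.integrable_add all_moments_powerD)
  then show "integrable M (\<lambda>w. \<bar>X w * Y w\<bar> ^ p)"
  proof (rule Bochner_Integration.integrable_bound)
    show "(\<lambda>w. \<bar>X w * Y w\<bar> ^ p) \<in> borel_measurable M" by measurable
    show "AE w in M. norm (\<bar>X w * Y w\<bar> ^ p) \<le> norm (\<bar>X w\<bar> ^ (2 * p) + \<bar>Y w\<bar> ^ (2 * p))"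
    proof (rule AE_I2)
      fix w
      have "\<bar>X w\<bar> ^ (2 * p) = (\<bar>X w\<bar> ^ p)\<^sup>2" "\<bar>Y w\<bar> ^ (2 * p) = (\<bar>Y w\<bar> ^ p)\<^sup>2"
        by (simp_all only: power_mult[symmetric] mult.commute)
      then show "norm (\<bar>X w * Y w\<bar> ^ p) \<le> norm (\<bar>X w\<bar> ^ (2 * p) + \<bar>Y w\<bar> ^ (2 * p))"
        using abs_mult_le_sum_squares[of "\<bar>X w\<bar> ^ p" "\<bar>Y w\<bar> ^ p"]
        by (simp add: abs_mult power_mult_distrib)
    qed
  qed
qed

lemma all_moments_add:
  assumes "all_moments M X" "all_moments M Y"
  shows "all_moments M (\<lambda>w. X w + Y w)"
  unfolding all_moments_def
proof (intro conjI allI)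
  note [measurable] = all_moments_measurable[OF assms(1)] all_moments_measurable[OF assms(2)]
  show "(\<lambda>w. X w + Y w) \<in> borel_measurable M" by measurable
  fix p :: nat
  have "integrable M (\<lambda>w. 2 ^ p * (\<bar>X w\<bar> ^ p + \<bar>Y w\<bar> ^ p))"
    using assms by (intro integrable_mult_right Bochner_Integration.integrable_add all_moments_powerD)
  then show "integrable M (\<lambda>w. \<bar>X w + Y w\<bar> ^ p)"
  proof (rule Bochner_Integration.integrable_bound)
    show "(\<lambda>w. \<bar>X w + Y w\<bar> ^ p) \<in> borel_measurable M" by measurable
    show "AE w in M. norm (\<bar>X w + Y w\<bar> ^ p) \<le> norm (2 ^ p * (\<bar>X w\<bar> ^ p + \<bar>Y w\<bar> ^ p))"
    proof (rule AE_I2)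
      fix w
      let ?m = "max \<bar>X w\<bar> \<bar>Y w\<bar>"
      have "\<bar>X w + Y w\<bar> ^ p \<le> (2 * ?m) ^ p" by (intro power_mono) auto
      also have "\<dots> = 2 ^ p * ?m ^ p" by (simp add: power_mult_distrib)
      also have "?m ^ p \<le> \<bar>X w\<bar> ^ p + \<bar>Y w\<bar> ^ p" by (simp add: max_def)
      finally show "norm (\<bar>X w + Y w\<bar> ^ p) \<le> norm (2 ^ p * (\<bar>X w\<bar> ^ p + \<bar>Y w\<bar> ^ p))"
        by simp
    qed
  qed
qed

lemma (in prob_space) all_moments_const: "all_moments M (\<lambda>_. c)"
  by (simp add: all_moments_def)

lemma (in prob_space) all_moments_cmult:
  "all_moments M X \<Longrightarrow> all_moments M (\<lambda>w. c * X w)"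
  by (intro all_moments_mult all_moments_const)

lemma (in prob_space) all_moments_diff:
  assumes "all_moments M X" "all_moments M Y" shows "all_moments M (\<lambda>w. X w - Y w)"
  using all_moments_add[OF assms(1) all_moments_cmult[OF assms(2), of "-1"]] by simp

lemma (in prob_space) all_moments_power: "all_moments M X \<Longrightarrow> all_moments M (\<lambda>w. X w ^ n)"
  by (induction n) (simp_all add: all_moments_const all_moments_mult)

lemma (in prob_space) all_moments_sum:
  "(\<And>i. i \<in> I \<Longrightarrow> all_moments M (X i)) \<Longrightarrow> all_moments M (\<lambda>w. \<Sum>i\<in>I. X i w)"
  by (induction I rule: infinite_finite_induct) (simp_all add: all_moments_const all_moments_add)

lemma (in prob_space) all_moments_prod_list:
  "(\<And>X. X \<in> set Xs \<Longrightarrow> all_moments M (f X)) \<Longrightarrow> all_moments M (\<lambda>w. \<Prod>X\<leftarrow>Xs. f X w)"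
  by (induction Xs) (simp_all add: all_moments_const all_moments_mult)

lemmas (in prob_space) all_moments_intros =
  all_moments_add all_moments_const all_moments_cmult all_moments_mult all_moments_diff
  all_moments_power all_moments_sum all_moments_prod_list

lemma (in prob_space) DERIV_expectation_power:
  assumes "all_moments M U" "all_moments M V" "all_moments M F"
  shows "((\<lambda>s. expectation (\<lambda>w. (U w + s * V w) ^ n * F w)) has_real_derivative
           real n * expectation (\<lambda>w. U w ^ (n - 1) * V w * F w)) (at 0)"
proof -
  define c where "c k = real (n choose k) * expectation (\<lambda>w. V w ^ k * U w ^ (n - k) * F w)" for k
  have int: "integrable M (\<lambda>w. V w ^ k * U w ^ (n - k) * F w)" for k
    by (intro all_moments_integrable all_moments_intros assms)
  have eq: "expectation (\<lambda>w. (U w + s * V w) ^ n * F w) = (\<Sum>k\<le>n. c k * s ^ k)" for s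
  proof -
    have "(U w + s * V w) ^ n * F w =
        (\<Sum>k\<le>n. (real (n choose k) * s ^ k) * (V w ^ k * U w ^ (n - k) * F w))" for w
      unfolding add.commute[of "U w"] binomial_ring
      by (simp add: sum_distrib_right sum_distrib_left power_mult_distrib mult_ac)
    then show ?thesis
      using int by (simp add: c_def) (simp add: mult_ac)
  qed
  have "((\<lambda>s. \<Sum>k\<le>n. c k * s ^ k) has_real_derivative (\<Sum>k\<le>n. c k * (real k * 0 ^ (k - 1)))) (at 0)"
    by (auto intro!: derivative_eq_intros sum.cong)
  \<comment> \<open>Only k = 1 survives: at k = 0 the truncated exponent gives
    \<open>0 ^ 0 = 1\<close>, but the factor \<open>real k\<close> is 0. For \<open>n = 0\<close>
    the intersection is empty, in agreement with the factor \<open>real n\<close> of the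
    claim.\<close>
  also have "(\<Sum>k\<le>n. c k * (real k * 0 ^ (k - 1))) = (\<Sum>k\<in>{..n} \<inter> {1}. c k)"
    by (subst sum.inter_restrict, simp, rule sum.cong) (auto simp: power_0_left)
  also have "\<dots> = real n * expectation (\<lambda>w. U w ^ (n - 1) * V w * F w)"
    by (cases n) (auto simp: c_def mult_ac)
  finally show ?thesis unfolding eq .
qed

text \<open>The moments of N(0,v), defined by the recursion that Gaussian integration by parts
  produces. As polynomials in \<open>v\<close> they make sense for every real \<open>v\<close> and
  can be differentiated also at variance 0.\<close>

fun gmom :: "real \<Rightarrow> nat \<Rightarrow> real" where
  "gmom v 0 = 1"
| "gmom v (Suc 0) = 0"
| "gmom v (Suc (Suc n)) = real (Suc n) * v * gmom v n"

lemma gmom_even: "gmom v (2 * k) = fact (2 * k) / (2 ^ k * fact k) * v ^ k"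
proof (induction k)
  case (Suc k)
  have "2 * Suc k = Suc (Suc (2 * k))" by simp
  then have "gmom v (2 * Suc k) = real (Suc (2 * k)) * v * gmom v (2 * k)"
    by (metis gmom.simps(3))
  also have "\<dots> = fact (2 * Suc k) / (2 ^ Suc k * fact (Suc k)) * v ^ Suc k"
    unfolding Suc.IH by (simp add: divide_simps)
  finally show ?case .
qed simp

lemma gmom_odd: "odd n \<Longrightarrow> gmom v n = 0"
  by (induction v n rule: gmom.induct) auto

lemma gmom_scale: "gmom (s\<^sup>2 * v) n = s ^ n * gmom v n"
  by (induction v n rule: gmom.induct) (auto simp: power2_eq_square)

text \<open>The heat equation on monomials: for a standard normal Z the derivative of E f(sqrt(v) Z)
  in v is E f''(sqrt(v) Z) / 2, here with f(x) = x^(n+1).\<close>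

lemma DERIV_gmom:
  "((\<lambda>v. gmom v (Suc n)) has_real_derivative real (Suc n) * real n / 2 * gmom v (n - 1)) (at v)"
proof (induction v n rule: gmom.induct)
  case (2 v)
  have "((\<lambda>v. v) has_real_derivative 1) (at v)" by simp
  then show ?case by simp
next
  case (3 v n)
  have *: "real n * v * gmom v (n - 1) = gmom v (Suc n)" by (cases n) auto
  have "((\<lambda>v. gmom v (Suc (Suc (Suc n)))) has_real_derivative
      real (Suc (Suc n)) * (gmom v (Suc n) + v * (real (Suc n) * real n / 2 * gmom v (n - 1)))) (at v)"
    unfolding gmom.simps(3)[of _ "Suc n"]
    by (rule derivative_eq_intros refl 3)+ (simp add: algebra_simps)
  also have "gmom v (Suc n) + v * (real (Suc n) * real n / 2 * gmom v (n - 1)) =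
      gmom v (Suc n) + real (Suc n) / 2 * gmom v (Suc n)"
    unfolding *[symmetric] by simp
  finally show ?case by (simp add: field_simps)
qed simp

text \<open>Presents degenerate and proper normal laws as images of one law, so that moments and
  characteristic functions need no case distinction on \<open>\<sigma>\<close>.\<close>

lemma centered_normal_eq_distr:
  assumes "\<sigma> \<ge> 0"
  shows "centered_normal \<sigma> = distr std_normal_distribution borel (\<lambda>x. \<sigma> * x)"
proof (cases "\<sigma> = 0")
  case True
  interpret prob_space std_normal_distribution
    using prob_space_normal_density[of 1 0] by simp
  show ?thesis using True by (simp add: centered_normal_def distr_const)
next
  case False
  interpret prob_space std_normal_distribution
    using prob_space_normal_density[of 1 0] by simp
  have "distributed std_normal_distribution lborel (\<lambda>x. x) std_normal_density"
    by (auto simp: distributed_def distr_id2)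
  from normal_density_affine[OF this, of \<sigma> 0] False assms
  have "distributed std_normal_distribution lborel (\<lambda>x. \<sigma> * x) (normal_density 0 \<sigma>)" by simp
  then have "distr std_normal_distribution lborel (\<lambda>x. \<sigma> * x) = density lborel (normal_density 0 \<sigma>)"
    by (simp add: distributed_def)
  moreover have "distr std_normal_distribution lborel (\<lambda>x. \<sigma> * x) =
      distr std_normal_distribution borel (\<lambda>x. \<sigma> * x)"
    by (rule distr_cong) auto
  ultimately show ?thesis using False by (simp add: centered_normal_def)
qed

lemma real_distribution_centered_normal:
  "\<sigma> \<ge> 0 \<Longrightarrow> real_distribution (centered_normal \<sigma>)"
  unfolding centered_normal_eq_distr
  using prob_space.prob_space_distr[OF prob_space_normal_density[of 1 0], of "\<lambda>x. \<sigma> * x" borel]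
  by (simp add: real_distribution_def real_distribution_axioms_def)

lemma char_centered_normal:
  assumes "\<sigma> \<ge> 0"
  shows "char (centered_normal \<sigma>) t = complex_of_real (exp (- (\<sigma>\<^sup>2 * t\<^sup>2) / 2))"
proof -
  have "char (centered_normal \<sigma>) t = char std_normal_distribution (\<sigma> * t)"
    unfolding char_def centered_normal_eq_distr[OF assms]
    by (subst integral_distr) (auto simp: mult_ac)
  then show ?thesis by (simp add: char_std_normal_distribution power_mult_distrib)
qed

lemma std_normal_moment:
  "integrable std_normal_distribution (\<lambda>x. x ^ n)"
  "integrable std_normal_distribution (\<lambda>x. \<bar>x\<bar> ^ n)"
  "(LINT x|std_normal_distribution. x ^ n) = gmom 1 n"
proof -
  show 1: "integrable std_normal_distribution (\<lambda>x. x ^ n)"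
    by (rule integrable_std_normal_distribution_moment)
  show "integrable std_normal_distribution (\<lambda>x. \<bar>x\<bar> ^ n)"
    using integrable_abs[OF 1] by (simp add: power_abs)
  show "(LINT x|std_normal_distribution. x ^ n) = gmom 1 n"
  proof (cases "even n")
    case True
    then obtain k where "n = 2 * k" by (elim evenE)
    then show ?thesis using gmom_even[of 1 k] std_normal_distribution_even_moments(1)[of k] by simp
  qed (simp add: gmom_odd integral_std_normal_distribution_moment_odd)
qed

text \<open>Degenerate laws are included, since the class has to be closed under multiplication by 0
  and under mean-square limits.\<close>

definition gauss :: "'w measure \<Rightarrow> ('w \<Rightarrow> real) \<Rightarrow> bool" where
  "gauss M X \<longleftrightarrow> X \<in> borel_measurable M \<and> (\<exists>\<sigma>\<ge>0. distr M borel X = centered_normal \<sigma>)"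

lemma (in prob_space) gauss_moments:
  assumes "gauss M X"
  shows "all_moments M X" "expectation (\<lambda>w. X w ^ n) = gmom (expectation (\<lambda>w. (X w)\<^sup>2)) n"
    "distr M borel X = centered_normal (sqrt (expectation (\<lambda>w. (X w)\<^sup>2)))"
proof -
  from assms obtain \<sigma> where [measurable]: "X \<in> borel_measurable M" and "\<sigma> \<ge> 0"
    and D: "distr M borel X = centered_normal \<sigma>"
    unfolding gauss_def by blast
  note D' = D[unfolded centered_normal_eq_distr[OF \<open>\<sigma> \<ge> 0\<close>]]
  have "integrable M (\<lambda>w. \<bar>X w\<bar> ^ p)" for p
  proof -
    have "integrable (distr M borel X) (\<lambda>x. \<bar>x\<bar> ^ p)"
      unfolding D' by (subst integrable_distr_eq)
        (auto simp: abs_mult power_mult_distrib std_normal_moment(2))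
    then show ?thesis by (subst (asm) integrable_distr_eq) auto
  qed
  then show "all_moments M X" by (simp add: all_moments_def)
  have eq: "expectation (\<lambda>w. X w ^ n) = gmom (\<sigma>\<^sup>2) n" for n
  proof -
    have "expectation (\<lambda>w. X w ^ n) = (LINT x|distr M borel X. x ^ n)"
      by (subst integral_distr) auto
    also have "\<dots> = \<sigma> ^ n * gmom 1 n"
      unfolding D' by (subst integral_distr) (auto simp: power_mult_distrib std_normal_moment)
    finally show ?thesis using gmom_scale[of \<sigma> 1 n] by simp
  qed
  have "expectation (\<lambda>w. (X w)\<^sup>2) = \<sigma>\<^sup>2" unfolding eq by (simp add: numeral_2_eq_2)
  with eq D \<open>\<sigma> \<ge> 0\<close> show "expectation (\<lambda>w. X w ^ n) = gmom (expectation (\<lambda>w. (X w)\<^sup>2)) n"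
    "distr M borel X = centered_normal (sqrt (expectation (\<lambda>w. (X w)\<^sup>2)))" by simp_all
qed

section \<open>Square-integrable functions and mean-square limits\<close>

lemma square_integrable_mult:
  fixes f g :: "'w \<Rightarrow> real"
  assumes [measurable]: "f \<in> borel_measurable M" "g \<in> borel_measurable M"
    and "integrable M (\<lambda>x. (f x)\<^sup>2)" "integrable M (\<lambda>x. (g x)\<^sup>2)"
  shows "integrable M (\<lambda>x. f x * g x)"
proof (rule Bochner_Integration.integrable_bound)
  show "integrable M (\<lambda>x. (f x)\<^sup>2 + (g x)\<^sup>2)" using assms by simp
  show "AE x in M. norm (f x * g x) \<le> norm ((f x)\<^sup>2 + (g x)\<^sup>2)"
  proof (rule AE_I2)
    fix x
    show "norm (f x * g x) \<le> norm ((f x)\<^sup>2 + (g x)\<^sup>2)"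
      using abs_mult_le_sum_squares[of "f x" "g x"] by simp
  qed
qed measurable

lemma square_integrable_add:
  fixes f g :: "'w \<Rightarrow> real"
  assumes [measurable]: "f \<in> borel_measurable M" "g \<in> borel_measurable M"
    and "integrable M (\<lambda>x. (f x)\<^sup>2)" "integrable M (\<lambda>x. (g x)\<^sup>2)"
  shows "integrable M (\<lambda>x. (f x + g x)\<^sup>2)"
  using assms square_integrable_mult[OF assms] by (simp add: power2_sum mult.assoc)

lemma square_integrable_diff:
  fixes f g :: "'w \<Rightarrow> real"
  assumes [measurable]: "f \<in> borel_measurable M" "g \<in> borel_measurable M"
    and "integrable M (\<lambda>x. (f x)\<^sup>2)" "integrable M (\<lambda>x. (g x)\<^sup>2)"
  shows "integrable M (\<lambda>x. (f x - g x)\<^sup>2)"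
  using assms square_integrable_mult[OF assms] by (simp add: power2_diff mult.assoc)

lemma Cauchy_Schwarz_integral:
  fixes f g :: "'w \<Rightarrow> real"
  assumes [measurable]: "f \<in> borel_measurable M" "g \<in> borel_measurable M"
    and f: "integrable M (\<lambda>x. (f x)\<^sup>2)" and g: "integrable M (\<lambda>x. (g x)\<^sup>2)"
  shows "\<bar>LINT x|M. f x * g x\<bar> \<le> sqrt (LINT x|M. (f x)\<^sup>2) * sqrt (LINT x|M. (g x)\<^sup>2)"
proof -
  let ?a = "LINT x|M. (f x)\<^sup>2" and ?b = "LINT x|M. f x * g x" and ?c = "LINT x|M. (g x)\<^sup>2"
  note fg = square_integrable_mult[OF assms]
  have pos: "0 \<le> ?a + 2 * s * ?b + s\<^sup>2 * ?c" for s
  proof -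
    have "0 \<le> (LINT x|M. (f x + s * g x)\<^sup>2)" by simp
    also have "(\<lambda>x. (f x + s * g x)\<^sup>2) = (\<lambda>x. (f x)\<^sup>2 + 2 * s * (f x * g x) + s\<^sup>2 * (g x)\<^sup>2)"
      by (simp add: power2_eq_square algebra_simps)
    also have "(LINT x|M. (f x)\<^sup>2 + 2 * s * (f x * g x) + s\<^sup>2 * (g x)\<^sup>2) = ?a + 2 * s * ?b + s\<^sup>2 * ?c"
      using f g fg by simp
    finally show ?thesis .
  qed
  have "?b\<^sup>2 \<le> ?a * ?c"
  proof (cases "?c = 0")
    case True
    have "?b = 0"
    proof (rule ccontr)
      assume b: "?b \<noteq> 0"
      \<comment> \<open>Without its square term the quadratic is affine in \<open>s\<close>, and
        this \<open>s\<close> gives it the value -1.\<close>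
      from pos[of "- (?a + 1) / (2 * ?b)"] b True show False by (simp add: field_simps)
    qed
    then show ?thesis using True by simp
  next
    case False
    then have c: "?c > 0" by (simp add: less_le)
    have "0 \<le> ?c * (?a + 2 * (- ?b / ?c) * ?b + (- ?b / ?c)\<^sup>2 * ?c)"
      using pos[of "- ?b / ?c"] c by (intro mult_nonneg_nonneg) auto
    also have "\<dots> = ?a * ?c - ?b\<^sup>2" using c by (simp add: power2_eq_square field_simps)
    finally show ?thesis by simp
  qed
  then have "sqrt (?b\<^sup>2) \<le> sqrt (?a * ?c)" by (rule real_sqrt_le_mono)
  then show ?thesis by (simp add: real_sqrt_mult)
qed

lemma L2_product_limit:
  fixes f g :: "nat \<Rightarrow> 'w \<Rightarrow> real"
  assumes [measurable]: "\<And>n. f n \<in> borel_measurable M" "\<And>n. g n \<in> borel_measurable M"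
      "F \<in> borel_measurable M" "G \<in> borel_measurable M"
    and f: "\<And>n. integrable M (\<lambda>x. (f n x)\<^sup>2)" and g: "\<And>n. integrable M (\<lambda>x. (g n x)\<^sup>2)"
    and F: "integrable M (\<lambda>x. (F x)\<^sup>2)" and G: "integrable M (\<lambda>x. (G x)\<^sup>2)"
    and limf: "(\<lambda>n. LINT x|M. (f n x - F x)\<^sup>2) \<longlonglongrightarrow> 0"
    and limg: "(\<lambda>n. LINT x|M. (g n x - G x)\<^sup>2) \<longlonglongrightarrow> 0"
  shows "(\<lambda>n. LINT x|M. f n x * g n x) \<longlonglongrightarrow> (LINT x|M. F x * G x)"
proof -
  note fF = square_integrable_diff[OF _ _ f F] and gG = square_integrable_diff[OF _ _ g G]
  let ?A = "\<lambda>n. LINT x|M. (f n x - F x)\<^sup>2" and ?B = "\<lambda>n. LINT x|M. (g n x - G x)\<^sup>2"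
  have eq: "(LINT x|M. f n x * g n x) = (LINT x|M. (f n x - F x) * (g n x - G x)) +
      (LINT x|M. (f n x - F x) * G x) + (LINT x|M. F x * (g n x - G x)) + (LINT x|M. F x * G x)" for n
  proof -
    have "integrable M (\<lambda>x. (f n x - F x) * (g n x - G x))" "integrable M (\<lambda>x. (f n x - F x) * G x)"
      "integrable M (\<lambda>x. F x * (g n x - G x))" "integrable M (\<lambda>x. F x * G x)"
      by (intro square_integrable_mult fF gG F G; measurable)+
    then show ?thesis
      by (simp flip: Bochner_Integration.integral_add) (simp add: algebra_simps)
  qed
  have lims: "(\<lambda>n. sqrt (?A n) * sqrt (?B n)) \<longlonglongrightarrow> sqrt 0 * sqrt 0"
    "(\<lambda>n. sqrt (?A n) * sqrt (LINT x|M. (G x)\<^sup>2)) \<longlonglongrightarrow> sqrt 0 * sqrt (LINT x|M. (G x)\<^sup>2)"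
    "(\<lambda>n. sqrt (LINT x|M. (F x)\<^sup>2) * sqrt (?B n)) \<longlonglongrightarrow> sqrt (LINT x|M. (F x)\<^sup>2) * sqrt 0"
    by (intro tendsto_intros limf limg)+
  have "(\<lambda>n. LINT x|M. (f n x - F x) * (g n x - G x)) \<longlonglongrightarrow> 0"
    using lims(1) by (intro tendsto_zero_sandwich[OF Cauchy_Schwarz_integral] fF gG) auto
  moreover have "(\<lambda>n. LINT x|M. (f n x - F x) * G x) \<longlonglongrightarrow> 0"
    using lims(2) by (intro tendsto_zero_sandwich[OF Cauchy_Schwarz_integral] fF G) auto
  moreover have "(\<lambda>n. LINT x|M. F x * (g n x - G x)) \<longlonglongrightarrow> 0"
    using lims(3) by (intro tendsto_zero_sandwich[OF Cauchy_Schwarz_integral] gG F) auto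
  ultimately have "(\<lambda>n. LINT x|M. f n x * g n x) \<longlonglongrightarrow> 0 + 0 + 0 + (LINT x|M. F x * G x)"
    unfolding eq by (intro tendsto_intros)
  then show ?thesis by simp
qed

lemma (in prob_space) expectation_abs_le_sqrt:
  assumes [measurable]: "X \<in> borel_measurable M" and "integrable M (\<lambda>w. (X w)\<^sup>2)"
  shows "integrable M X" "expectation (\<lambda>w. \<bar>X w\<bar>) \<le> sqrt (expectation (\<lambda>w. (X w)\<^sup>2))"
proof -
  have 1: "integrable M (\<lambda>w. \<bar>X w\<bar>)"
    by (rule square_integrable_imp_integrable) (use assms in auto)
  then show "integrable M X" by (rule integrable_abs_cancel) simp
  have "0 \<le> variance (\<lambda>w. \<bar>X w\<bar>)" by simp
  also have "\<dots> = expectation (\<lambda>w. (X w)\<^sup>2) - (expectation (\<lambda>w. \<bar>X w\<bar>))\<^sup>2"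
    using 1 assms by (subst variance_eq) auto
  finally show "expectation (\<lambda>w. \<bar>X w\<bar>) \<le> sqrt (expectation (\<lambda>w. (X w)\<^sup>2))"
    by (intro real_le_rsqrt) simp
qed

lemma cmod_iexp_diff_le: "cmod (iexp a - iexp b) \<le> \<bar>a - b\<bar>"
proof -
  have "iexp a - iexp b = iexp b * (iexp (a - b) - 1)"
    by (simp add: exp_diff right_diff_distrib)
  then have "cmod (iexp a - iexp b) = cmod (iexp (a - b) - 1)" by (simp add: norm_mult)
  also have "\<dots> \<le> \<bar>a - b\<bar>" using iexp_approx1[of "a - b" 0] by simp
  finally show ?thesis .
qed

lemma (in prob_space) integrable_iexp_rv:
  assumes [measurable]: "Z \<in> borel_measurable M" shows "integrable M (\<lambda>w. iexp (t * Z w))"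
proof (rule integrable_const_bound)
  show "AE w in M. cmod (iexp (t * Z w)) \<le> 1" by (simp del: of_real_mult)
qed measurable

lemma (in prob_space) char_distr_eq:
  assumes [measurable]: "Z \<in> borel_measurable M"
  shows "char (distr M borel Z) t = (CLINT w|M. iexp (t * Z w))"
  unfolding char_def by (rule integral_distr) measurable

lemma (in prob_space) char_distr_L2_limit:
  assumes [measurable]: "\<And>n. X n \<in> borel_measurable M" "Y \<in> borel_measurable M"
    and int: "\<And>n. integrable M (\<lambda>w. (X n w - Y w)\<^sup>2)"
    and lim: "(\<lambda>n. expectation (\<lambda>w. (X n w - Y w)\<^sup>2)) \<longlonglongrightarrow> 0"
  shows "(\<lambda>n. char (distr M borel (X n)) t) \<longlonglongrightarrow> char (distr M borel Y) t"
proof -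
  have bd: "dist (char (distr M borel (X n)) t) (char (distr M borel Y) t)
      \<le> \<bar>t\<bar> * sqrt (expectation (\<lambda>w. (X n w - Y w)\<^sup>2))" for n
  proof -
    note i = integrable_iexp_rv[OF assms(1)[of n], of t] integrable_iexp_rv[OF assms(2), of t]
    have "dist (char (distr M borel (X n)) t) (char (distr M borel Y) t) =
       cmod (CLINT w|M. iexp (t * X n w) - iexp (t * Y w))"
      unfolding dist_norm char_distr_eq[OF assms(1)] char_distr_eq[OF assms(2)]
        Bochner_Integration.integral_diff[OF i] ..
    also have "\<dots> \<le> expectation (\<lambda>w. \<bar>t\<bar> * \<bar>X n w - Y w\<bar>)"
    proof (rule norm_integral_le)
      show "integrable M (\<lambda>w. \<bar>t\<bar> * \<bar>X n w - Y w\<bar>)"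
        by (intro integrable_mult_right integrable_abs) (rule expectation_abs_le_sqrt(1)[OF _ int], simp)
      show "cmod (iexp (t * X n w) - iexp (t * Y w)) \<le> \<bar>t\<bar> * \<bar>X n w - Y w\<bar>" for w
        using cmod_iexp_diff_le[of "t * X n w" "t * Y w"]
        unfolding right_diff_distrib[symmetric] abs_mult .
      show "integrable M (\<lambda>w. iexp (t * X n w) - iexp (t * Y w))"
        by (rule Bochner_Integration.integrable_diff[OF i])
    qed
    also have "\<dots> \<le> \<bar>t\<bar> * sqrt (expectation (\<lambda>w. (X n w - Y w)\<^sup>2))"
      unfolding integral_mult_right_zero
      by (rule mult_left_mono[OF expectation_abs_le_sqrt(2)[OF _ int]]) simp_all
    finally show ?thesis .
  qed
  have "(\<lambda>n. \<bar>t\<bar> * sqrt (expectation (\<lambda>w. (X n w - Y w)\<^sup>2))) \<longlonglongrightarrow> \<bar>t\<bar> * sqrt 0"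
    by (intro tendsto_intros lim)
  then have "(\<lambda>n. dist (char (distr M borel (X n)) t) (char (distr M borel Y) t)) \<longlonglongrightarrow> 0"
    using bd by (intro tendsto_zero_sandwich[where f = "\<lambda>n. dist (char (distr M borel (X n)) t) (char (distr M borel Y) t)"])
      (simp_all only: abs_of_nonneg[OF zero_le_dist] real_sqrt_zero mult_zero_right)
  then show ?thesis by (rule tendsto_dist_iff[THEN iffD2])
qed

text \<open>Mean-square convergence carries over to characteristic functions and to second moments.
  The characteristic functions of the approximants depend on the second moment alone, so the limit
  has the characteristic function of a normal law.\<close>

lemma (in prob_space) gauss_L2_limit:
  assumes X: "\<And>n. gauss M (X n)" and Y[measurable]: "Y \<in> borel_measurable M"
    and int: "\<And>n. integrable M (\<lambda>w. (X n w - Y w)\<^sup>2)"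
    and lim: "(\<lambda>n. expectation (\<lambda>w. (X n w - Y w)\<^sup>2)) \<longlonglongrightarrow> 0"
  shows "gauss M Y"
proof -
  have [measurable]: "X n \<in> borel_measurable M" for n using X by (simp add: gauss_def)
  have X2: "integrable M (\<lambda>w. (X n w)\<^sup>2)" for n
    using gauss_moments(1)[OF X] by (intro all_moments_integrable all_moments_power)
  have Y2: "integrable M (\<lambda>w. (Y w)\<^sup>2)"
  proof (rule Bochner_Integration.integrable_bound)
    show "integrable M (\<lambda>w. 2 * (X 0 w)\<^sup>2 + 2 * (X 0 w - Y w)\<^sup>2)" using X2 int by simp
    show "AE w in M. norm ((Y w)\<^sup>2) \<le> norm (2 * (X 0 w)\<^sup>2 + 2 * (X 0 w - Y w)\<^sup>2)"
    proof (rule AE_I2)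
      fix w
      \<comment> \<open>The difference of the two sides of the bound,
        \<open>2 X^2 + 2 (X - Y)^2 - Y^2\<close>, is this square.\<close>
      have "0 \<le> (2 * X 0 w - Y w)\<^sup>2" by simp
      then show "norm ((Y w)\<^sup>2) \<le> norm (2 * (X 0 w)\<^sup>2 + 2 * (X 0 w - Y w)\<^sup>2)"
        by (simp add: power2_eq_square algebra_simps)
    qed
  qed measurable
  define v where "v n = expectation (\<lambda>w. (X n w)\<^sup>2)" for n
  let ?u = "expectation (\<lambda>w. (Y w)\<^sup>2)"
  have cX: "char (distr M borel (X n)) t = complex_of_real (exp (- (v n * t\<^sup>2) / 2))" for n t
    unfolding gauss_moments(3)[OF X] v_def by (simp add: char_centered_normal)
  have conv: "(\<lambda>n. char (distr M borel (X n)) t) \<longlonglongrightarrow> char (distr M borel Y) t" for t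
    by (rule char_distr_L2_limit) (use int lim in auto)
  have vlim: "v \<longlonglongrightarrow> ?u"
    using L2_product_limit[where f = X and g = X, OF _ _ _ _ X2 X2 Y2 Y2 lim lim]
    unfolding v_def power2_eq_square by simp
  have "char (distr M borel Y) t = complex_of_real (exp (- (?u * t\<^sup>2) / 2))" for t
  proof (rule LIMSEQ_unique[OF conv])
    show "(\<lambda>n. char (distr M borel (X n)) t) \<longlonglongrightarrow> complex_of_real (exp (- (?u * t\<^sup>2) / 2))"
      unfolding cX by (intro tendsto_intros vlim) auto
  qed
  then have "char (distr M borel Y) = char (centered_normal (sqrt ?u))"
    by (auto simp: char_centered_normal)
  then have "distr M borel Y = centered_normal (sqrt ?u)"
    by (rule Levy_uniqueness[rotated 2])
      (simp_all add: real_distribution_centered_normal real_distribution_distr)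
  then show ?thesis unfolding gauss_def by (auto intro!: exI[of _ "sqrt ?u"])
qed

section \<open>Quadratic forms in Gaussian variables\<close>

text \<open>A linear space all of whose members are Gaussian. Closure under linear combinations
  encodes joint Gaussianity of finite families, so that no multivariate law has to be
  mentioned.\<close>

locale gaussian_space = prob_space M for M :: "'w measure" +
  fixes G :: "('w \<Rightarrow> real) set"
  assumes gauss_mem: "X \<in> G \<Longrightarrow> gauss M X"
    and add_mem: "X \<in> G \<Longrightarrow> Y \<in> G \<Longrightarrow> (\<lambda>w. X w + Y w) \<in> G"
    and scale_mem: "X \<in> G \<Longrightarrow> (\<lambda>w. c * X w) \<in> G"
begin

abbreviation cov :: "('w \<Rightarrow> real) \<Rightarrow> ('w \<Rightarrow> real) \<Rightarrow> real" where
  "cov X Y \<equiv> expectation (\<lambda>w. X w * Y w)"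

lemma am_mem: "X \<in> G \<Longrightarrow> all_moments M X"
  by (intro gauss_moments(1) gauss_mem)

text \<open>The derivative of \<open>E (Y + s X)^(n+1)\<close> at \<open>s = 0\<close> is computed
  twice: under the expectation, and through the variance of the Gaussian variable
  \<open>Y + s X\<close>, whose derivative at 0 is twice the covariance.\<close>

lemma expectation_mult_power:
  assumes X: "X \<in> G" and Y: "Y \<in> G"
  shows "expectation (\<lambda>w. X w * Y w ^ n) = real n * cov X Y * expectation (\<lambda>w. Y w ^ (n - 1))"
proof -
  note am = am_mem[OF X] am_mem[OF Y]
  have mem: "(\<lambda>w. Y w + s * X w) \<in> G" for s by (intro add_mem scale_mem X Y)
  define V where "V s = expectation (\<lambda>w. (Y w + s * X w) ^ 2)" for s
  have "((\<lambda>s. expectation (\<lambda>w. (Y w + s * X w) ^ Suc n * 1)) has_real_derivative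
      real (Suc n) * expectation (\<lambda>w. Y w ^ (Suc n - 1) * X w * 1)) (at 0)"
    by (intro DERIV_expectation_power am all_moments_const)
  moreover have "expectation (\<lambda>w. (Y w + s * X w) ^ Suc n * 1) = gmom (V s) (Suc n)" for s
    using gauss_moments(2)[OF gauss_mem[OF mem[of s]], of "Suc n"] by (simp add: V_def)
  ultimately have d1: "((\<lambda>s. gmom (V s) (Suc n)) has_real_derivative
      real (Suc n) * expectation (\<lambda>w. X w * Y w ^ n)) (at 0)"
    by (simp add: mult.commute)
  have "((\<lambda>s. expectation (\<lambda>w. (Y w + s * X w) ^ 2 * 1)) has_real_derivative
      real 2 * expectation (\<lambda>w. Y w ^ (2 - 1) * X w * 1)) (at 0)"
    by (intro DERIV_expectation_power am all_moments_const)
  then have "(V has_real_derivative 2 * cov X Y) (at 0)"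
    unfolding V_def by (simp add: mult.commute)
  from DERIV_chain2[OF DERIV_gmom this]
  have d2: "((\<lambda>s. gmom (V s) (Suc n)) has_real_derivative
      real (Suc n) * real n / 2 * gmom (V 0) (n - 1) * (2 * cov X Y)) (at 0)" .
  have "gmom (V 0) (n - 1) = expectation (\<lambda>w. Y w ^ (n - 1))"
    unfolding V_def mult_zero_left add_0_right by (rule gauss_moments(2)[OF gauss_mem[OF Y], symmetric])
  with DERIV_unique[OF d1 d2] show ?thesis by simp
qed

text \<open>\<^term>\<open>wick X F F'\<close>: \<open>F\<close> is a polynomial in elements of the space and \<open>F'\<close> is its derivative
  in the direction of \<open>X\<close>, i.e. the derivation with \<open>Y' = cov X Y\<close> for \<open>Y \<in> G\<close>.\<close>

inductive wick :: "('w \<Rightarrow> real) \<Rightarrow> ('w \<Rightarrow> real) \<Rightarrow> ('w \<Rightarrow> real) \<Rightarrow> bool" for X where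
  wick_const: "wick X (\<lambda>_. c) (\<lambda>_. 0)"
| wick_mult: "wick X F F' \<Longrightarrow> Z \<in> G \<Longrightarrow>
    wick X (\<lambda>w. F w * Z w) (\<lambda>w. F' w * Z w + F w * cov X Z)"
| wick_add: "wick X F F' \<Longrightarrow> wick X H H' \<Longrightarrow> wick X (\<lambda>w. F w + H w) (\<lambda>w. F' w + H' w)"

lemma wick_all_moments:
  assumes "wick X F F'" shows "all_moments M F" "all_moments M F'"
proof -
  from assms have "all_moments M F \<and> all_moments M F'"
  proof induction
    case (wick_mult F F' Z)
    moreover from this have "all_moments M Z" by (simp add: am_mem)
    ultimately show ?case by (auto intro!: all_moments_add all_moments_mult all_moments_const)
  qed (auto intro: all_moments_const all_moments_add)
  then show "all_moments M F" "all_moments M F'" by auto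
qed

text \<open>The rules of \<open>wick\<close> multiply only by single members of the space. The
  Leibniz rule for two polynomials follows by induction on the second factor; when that factor is
  constant, a further induction on the first one is needed.\<close>

lemma wick_times:
  assumes "wick X H H'" "wick X F F'"
  shows "wick X (\<lambda>w. F w * H w) (\<lambda>w. F' w * H w + F w * H' w)"
  using assms(1)
proof induction
  case (wick_const c)
  from assms(2) show ?case
  proof induction
    case (wick_const d)
    then show ?case using wick.wick_const[of X "d * c"] by simp
  next
    case (wick_mult F F' Z)
    from wick.wick_mult[OF wick_mult(3,2)] show ?case by (simp add: algebra_simps)
  next
    case (wick_add F F' H H')
    from wick.wick_add[OF wick_add(3,4)] show ?case by (simp add: algebra_simps)
  qed
next
  case (wick_mult H H' Z)
  from wick.wick_mult[OF wick_mult(3,2)] show ?case by (simp add: algebra_simps)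
next
  case (wick_add H H' K K')
  from wick.wick_add[OF wick_add(3,4)] show ?case by (simp add: algebra_simps)
qed

lemma wick_mem: "Z \<in> G \<Longrightarrow> wick X Z (\<lambda>_. cov X Z)"
  using wick_mult[OF wick_const[of X 1], of Z] by simp

lemma wick_scale: "wick X F F' \<Longrightarrow> wick X (\<lambda>w. c * F w) (\<lambda>w. c * F' w)"
  using wick_times[OF _ wick_const[of X c], of F F'] by simp

lemma wick_sum:
  "(\<And>i. i \<in> I \<Longrightarrow> wick X (F i) (F' i)) \<Longrightarrow> wick X (\<lambda>w. \<Sum>i\<in>I. F i w) (\<lambda>w. \<Sum>i\<in>I. F' i w)"
  by (induction I rule: infinite_finite_induct) (auto intro: wick_const wick_add)

lemma wick_prod_list:
  assumes "\<And>B. B \<in> set Bs \<Longrightarrow> wick X (F B) (F' B)"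
  shows "wick X (\<lambda>w. \<Prod>B\<leftarrow>Bs. F B w)
    (\<lambda>w. \<Sum>i<length Bs. F' (Bs ! i) w * (\<Prod>B\<leftarrow>take i Bs @ drop (Suc i) Bs. F B w))"
  using assms
proof (induction Bs)
  case Nil then show ?case using wick_const[of X 1] by simp
next
  case (Cons B Bs)
  then have 1: "wick X (\<lambda>w. \<Prod>B\<leftarrow>Bs. F B w)
    (\<lambda>w. \<Sum>i<length Bs. F' (Bs ! i) w * (\<Prod>B\<leftarrow>take i Bs @ drop (Suc i) Bs. F B w))" by simp
  have 2: "wick X (F B) (F' B)" using Cons by simp
  from wick_times[OF 1 2] show ?case
    by (simp add: sum.lessThan_Suc_shift sum_distrib_left mult_ac del: sum.lessThan_Suc)
qed

text \<open>The factor \<open>Y ^ n\<close> makes the induction over \<^const>\<open>wick\<close> work: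
  replacing \<open>Y\<close> by \<open>Y + s Z\<close> and differentiating at \<open>s = 0\<close> produces the new factor \<open>Z\<close>.\<close>

lemma wick_expectation_power:
  assumes "wick X F F'" and X: "X \<in> G" and "Y \<in> G"
  shows "expectation (\<lambda>w. Y w ^ n * (X w * F w)) =
    real n * cov X Y * expectation (\<lambda>w. Y w ^ (n - 1) * F w) + expectation (\<lambda>w. Y w ^ n * F' w)"
  using assms(1,3)
proof (induction arbitrary: Y n)
  case (wick_const c)
  have eq: "(\<lambda>w. Y w ^ n * (X w * c)) = (\<lambda>w. c * (X w * Y w ^ n))" by (simp add: mult_ac)
  show ?case unfolding eq integral_mult_right_zero expectation_mult_power[OF X wick_const] by simp
next
  case (wick_mult F F' Z)
  note am = am_mem[OF X] am_mem[OF wick_mult(2)] am_mem[OF wick_mult(4)] wick_all_moments[OF wick_mult(1)]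
  have mem: "(\<lambda>w. Y w + s * Z w) \<in> G" for s by (intro add_mem scale_mem wick_mult)
  have covs: "cov X (\<lambda>w. Y w + s * Z w) = cov X Y + s * cov X Z" for s
  proof -
    have "integrable M (\<lambda>w. X w * Y w)" "integrable M (\<lambda>w. X w * Z w)"
      by (intro all_moments_integrable all_moments_mult am)+
    then show ?thesis by (simp add: distrib_left mult.left_commute[of _ s])
  qed
  have d1: "((\<lambda>s. expectation (\<lambda>w. (Y w + s * Z w) ^ Suc n * (X w * F w))) has_real_derivative
      real (Suc n) * expectation (\<lambda>w. Y w ^ (Suc n - 1) * Z w * (X w * F w))) (at 0)"
    by (intro DERIV_expectation_power am all_moments_mult)
  have d2: "((\<lambda>s. expectation (\<lambda>w. (Y w + s * Z w) ^ n * F w)) has_real_derivative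
      real n * expectation (\<lambda>w. Y w ^ (n - 1) * Z w * F w)) (at 0)"
    by (intro DERIV_expectation_power am)
  have d3: "((\<lambda>s. expectation (\<lambda>w. (Y w + s * Z w) ^ Suc n * F' w)) has_real_derivative
      real (Suc n) * expectation (\<lambda>w. Y w ^ (Suc n - 1) * Z w * F' w)) (at 0)"
    by (intro DERIV_expectation_power am)
  have d4: "((\<lambda>s. real (Suc n) * (cov X Y + s * cov X Z)) has_real_derivative real (Suc n) * cov X Z) (at 0)"
    by (auto intro!: derivative_eq_intros)
  have eq: "(\<lambda>s. expectation (\<lambda>w. (Y w + s * Z w) ^ Suc n * (X w * F w))) =
     (\<lambda>s. real (Suc n) * (cov X Y + s * cov X Z) * expectation (\<lambda>w. (Y w + s * Z w) ^ n * F w) +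
       expectation (\<lambda>w. (Y w + s * Z w) ^ Suc n * F' w))"
  proof
    fix s
    show "expectation (\<lambda>w. (Y w + s * Z w) ^ Suc n * (X w * F w)) =
       real (Suc n) * (cov X Y + s * cov X Z) * expectation (\<lambda>w. (Y w + s * Z w) ^ n * F w) +
       expectation (\<lambda>w. (Y w + s * Z w) ^ Suc n * F' w)"
      using wick_mult(3)[OF mem[of s], of "Suc n"] unfolding covs diff_Suc_1 .
  qed
  note d5 = DERIV_add[OF DERIV_mult[OF d4 d2] d3, folded eq]
  from DERIV_unique[OF d1 d5]
  have "real (Suc n) * expectation (\<lambda>w. Y w ^ n * (X w * (F w * Z w))) = real (Suc n) *
     (cov X Z * expectation (\<lambda>w. Y w ^ n * F w) +
      real n * cov X Y * expectation (\<lambda>w. Y w ^ (n - 1) * (F w * Z w)) +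
      expectation (\<lambda>w. Y w ^ n * (F' w * Z w)))"
    by (simp add: mult_ac) (simp add: algebra_simps)
  then have "expectation (\<lambda>w. Y w ^ n * (X w * (F w * Z w))) =
      cov X Z * expectation (\<lambda>w. Y w ^ n * F w) +
      real n * cov X Y * expectation (\<lambda>w. Y w ^ (n - 1) * (F w * Z w)) +
      expectation (\<lambda>w. Y w ^ n * (F' w * Z w))"
    by (subst (asm) mult_left_cancel) auto
  moreover have "expectation (\<lambda>w. Y w ^ n * (F' w * Z w + F w * cov X Z)) =
      expectation (\<lambda>w. Y w ^ n * (F' w * Z w)) + cov X Z * expectation (\<lambda>w. Y w ^ n * F w)"
  proof -
    have "integrable M (\<lambda>w. Y w ^ n * (F' w * Z w))" "integrable M (\<lambda>w. Y w ^ n * F w)"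
      by (intro all_moments_integrable all_moments_mult all_moments_power am)+
    note int = this
    have "expectation (\<lambda>w. Y w ^ n * (F' w * Z w + F w * cov X Z)) =
        expectation (\<lambda>w. Y w ^ n * (F' w * Z w) + cov X Z * (Y w ^ n * F w))"
      by (rule Bochner_Integration.integral_cong) (auto simp: algebra_simps)
    then show ?thesis using int by simp
  qed
  ultimately show ?case by simp
next
  case (wick_add F F' H H')
  note am = am_mem[OF X] am_mem[OF wick_add(5)] wick_all_moments[OF wick_add(1)] wick_all_moments[OF wick_add(2)]
  have int: "integrable M (\<lambda>w. Y w ^ k * (X w * F w))" "integrable M (\<lambda>w. Y w ^ k * (X w * H w))"
    "integrable M (\<lambda>w. Y w ^ k * F w)" "integrable M (\<lambda>w. Y w ^ k * H w)"
    "integrable M (\<lambda>w. Y w ^ k * F' w)" "integrable M (\<lambda>w. Y w ^ k * H' w)" for k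
    by (intro all_moments_integrable all_moments_mult all_moments_power am)+
  show ?case
    using wick_add(3,4)[OF wick_add(5), of n] int by (simp add: distrib_left)
qed

text \<open>Gaussian integration by parts; taking the exponent 0 removes the auxiliary power of
  \<open>Y\<close>.\<close>

lemma wick_expectation:
  assumes "wick X F F'" "X \<in> G"
  shows "expectation (\<lambda>w. X w * F w) = expectation F'"
  using wick_expectation_power[OF assms(1,2,2), of 0] by simp

end

text \<open>Matrices are functions restricted to a finite index set rather than elements of a vector
  type, because the number of variables grows along the sequence.\<close>

definition mm :: "'i set \<Rightarrow> ('i \<Rightarrow> 'i \<Rightarrow> real) \<Rightarrow> ('i \<Rightarrow> 'i \<Rightarrow> real) \<Rightarrow> 'i \<Rightarrow> 'i \<Rightarrow> real" where
  "mm I A B p q = (\<Sum>r\<in>I. A p r * B r q)"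

definition tp :: "('i \<Rightarrow> 'i \<Rightarrow> real) \<Rightarrow> 'i \<Rightarrow> 'i \<Rightarrow> real" where
  "tp A p q = A q p"

text \<open>A bound for the operator norm with respect to the maximum norm. It is submultiplicative
  and is controlled directly by summable decay of covariances.\<close>

definition row_bound :: "'i set \<Rightarrow> ('i \<Rightarrow> 'i \<Rightarrow> real) \<Rightarrow> real \<Rightarrow> bool" where
  "row_bound I A a \<longleftrightarrow> (\<forall>p\<in>I. (\<Sum>q\<in>I. \<bar>A p q\<bar>) \<le> a)"

lemma tp_tp [simp]: "tp (tp A) = A"
  by (simp add: tp_def fun_eq_iff)

lemma tp_mm: "tp (mm I A B) = mm I (tp B) (tp A)"
  by (simp add: tp_def mm_def fun_eq_iff mult.commute)

lemma mm_assoc: "mm I (mm I A B) D = mm I A (mm I B D)"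
proof (intro ext)
  fix p q
  show "mm I (mm I A B) D p q = mm I A (mm I B D) p q"
    unfolding mm_def sum_distrib_left sum_distrib_right
    by (subst sum.swap) (simp add: mult.assoc)
qed

lemma row_bound_mm:
  assumes "row_bound I A a" "row_bound I B b" "0 \<le> b"
  shows "row_bound I (mm I A B) (a * b)"
  unfolding row_bound_def
proof
  fix p assume p: "p \<in> I"
  have "(\<Sum>q\<in>I. \<bar>mm I A B p q\<bar>) \<le> (\<Sum>q\<in>I. \<Sum>r\<in>I. \<bar>A p r\<bar> * \<bar>B r q\<bar>)"
    unfolding mm_def by (intro sum_mono order_trans[OF sum_abs]) (simp add: abs_mult)
  also have "\<dots> = (\<Sum>r\<in>I. \<bar>A p r\<bar> * (\<Sum>q\<in>I. \<bar>B r q\<bar>))"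
    by (subst sum.swap) (simp add: sum_distrib_left)
  also have "\<dots> \<le> (\<Sum>r\<in>I. \<bar>A p r\<bar> * b)"
    using assms by (intro sum_mono mult_left_mono) (auto simp: row_bound_def)
  also have "\<dots> \<le> a * b"
    unfolding sum_distrib_right[symmetric] using assms p by (intro mult_right_mono) (auto simp: row_bound_def)
  finally show "(\<Sum>q\<in>I. \<bar>mm I A B p q\<bar>) \<le> a * b" .
qed

lemma sum_swap4:
  "(\<Sum>p\<in>I. \<Sum>q\<in>I. \<Sum>r\<in>I. \<Sum>s\<in>I. t p q r s) = (\<Sum>q\<in>I. \<Sum>s\<in>I. \<Sum>r\<in>I. \<Sum>p\<in>I. (t p q r s :: real))"
proof -
  have "(\<Sum>p\<in>I. \<Sum>q\<in>I. \<Sum>r\<in>I. \<Sum>s\<in>I. t p q r s) = (\<Sum>q\<in>I. \<Sum>p\<in>I. \<Sum>r\<in>I. \<Sum>s\<in>I. t p q r s)"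
    by (rule sum.swap)
  also have "\<dots> = (\<Sum>q\<in>I. \<Sum>r\<in>I. \<Sum>p\<in>I. \<Sum>s\<in>I. t p q r s)"
    by (rule sum.cong[OF refl]) (rule sum.swap)
  also have "\<dots> = (\<Sum>q\<in>I. \<Sum>r\<in>I. \<Sum>s\<in>I. \<Sum>p\<in>I. t p q r s)"
    by (rule sum.cong[OF refl], rule sum.cong[OF refl]) (rule sum.swap)
  also have "\<dots> = (\<Sum>q\<in>I. \<Sum>s\<in>I. \<Sum>r\<in>I. \<Sum>p\<in>I. t p q r s)"
    by (rule sum.cong[OF refl]) (rule sum.swap)
  finally show ?thesis .
qed

text \<open>Counts the terms of the expansion of a product of k + 2 forms: the first form is
  contracted with each of the k + 1 others, in two ways, and each contraction leaves a new form and
  a trace.\<close>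

fun wick_bound :: "nat \<Rightarrow> real" where
  "wick_bound 0 = 1"
| "wick_bound (Suc 0) = 0"
| "wick_bound (Suc (Suc k)) = 2 * real (Suc k) * (wick_bound (Suc k) + wick_bound k)"

lemma wick_bound_nonneg: "0 \<le> wick_bound k"
  by (induction k rule: wick_bound.induct) auto

lemma prod_list_remove_nth:
  fixes bs :: "real list"
  assumes "i < length bs"
  shows "bs ! i * prod_list (take i bs @ drop (Suc i) bs) = prod_list bs"
proof -
  have "prod_list bs = prod_list (take i bs @ bs ! i # drop (Suc i) bs)"
    using id_take_nth_drop[OF assms] by simp
  then show ?thesis by (simp add: mult_ac)
qed

locale gaussian_family = gaussian_space M G for M :: "'w measure" and G +
  fixes I :: "'i set" and X :: "'i \<Rightarrow> 'w \<Rightarrow> real"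
  assumes finite_I: "finite I" and X_mem: "p \<in> I \<Longrightarrow> X p \<in> G"
begin

abbreviation C :: "'i \<Rightarrow> 'i \<Rightarrow> real" where "C p q \<equiv> cov (X p) (X q)"

definition qf :: "('i \<Rightarrow> 'i \<Rightarrow> real) \<Rightarrow> 'w \<Rightarrow> real" where
  "qf A w = (\<Sum>p\<in>I. \<Sum>q\<in>I. A p q * (X p w * X q w - C p q))"

definition tr :: "('i \<Rightarrow> 'i \<Rightarrow> real) \<Rightarrow> real" where
  "tr A = (\<Sum>p\<in>I. \<Sum>q\<in>I. A p q * C p q)"

text \<open>The matrix of the form that remains when the first variable of \<open>A\<close> is
  paired with the first variable of \<open>B\<close>. Pairing with the second variable of
  \<open>B\<close> gives \<open>M1 A (tp B)\<close>.\<close>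

definition M1 where "M1 A B = mm I (mm I (tp A) C) B"

text \<open>Since \<open>A\<close> need not be symmetric, \<open>A C\<close> and the product of its
  transpose with \<open>C\<close> are both bounded. This pair is preserved by contraction, because
  \<open>M1 A B\<close> times \<open>C\<close> is the product of two such matrices.\<close>

definition mat_bd :: "('i \<Rightarrow> 'i \<Rightarrow> real) \<Rightarrow> real \<Rightarrow> bool" where
  "mat_bd A a \<longleftrightarrow> 0 \<le> a \<and> row_bound I (mm I A C) a \<and> row_bound I (mm I (tp A) C) a"

lemma tp_C: "tp C = C"
  by (simp add: tp_def fun_eq_iff mult.commute)

lemma mat_bd_M1:
  assumes "mat_bd A a" "mat_bd B b"
  shows "mat_bd (M1 A B) (a * b)"
proof -
  have "mm I (M1 A B) C = mm I (mm I (tp A) C) (mm I B C)"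
    by (simp add: M1_def mm_assoc)
  moreover have "mm I (tp (M1 A B)) C = mm I (mm I (tp B) C) (mm I A C)"
    by (simp add: M1_def tp_mm tp_C mm_assoc)
  moreover have "row_bound I (mm I (mm I (tp A) C) (mm I B C)) (a * b)"
    "row_bound I (mm I (mm I (tp B) C) (mm I A C)) (b * a)"
    using assms by (auto simp: mat_bd_def intro!: row_bound_mm)
  ultimately show ?thesis using assms by (simp add: mat_bd_def mult.commute)
qed

lemma mat_bd_tp: "mat_bd A a \<Longrightarrow> mat_bd (tp A) a"
  by (simp add: mat_bd_def)

lemma tr_bound:
  assumes "mat_bd A a" shows "\<bar>tr A\<bar> \<le> real (card I) * a"
proof -
  have "tr A = (\<Sum>p\<in>I. mm I A C p p)"
    by (simp add: tr_def mm_def mult.commute)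
  also have "\<bar>\<dots>\<bar> \<le> (\<Sum>p\<in>I. \<bar>mm I A C p p\<bar>)" by (rule sum_abs)
  also have "\<dots> \<le> (\<Sum>p\<in>I. a)"
  proof (rule sum_mono)
    fix p assume p: "p \<in> I"
    then have "\<bar>mm I A C p p\<bar> \<le> (\<Sum>q\<in>I. \<bar>mm I A C p q\<bar>)"
      using finite_I by (intro member_le_sum) auto
    also have "\<dots> \<le> a" using assms p by (auto simp: mat_bd_def row_bound_def)
    finally show "\<bar>mm I A C p p\<bar> \<le> a" .
  qed
  finally show ?thesis by simp
qed

lemma all_moments_X: "p \<in> I \<Longrightarrow> all_moments M (X p)"
  by (intro am_mem X_mem)

lemma all_moments_qf: "all_moments M (qf A)"
  unfolding qf_def[abs_def]
  by (intro all_moments_sum all_moments_cmult all_moments_diff all_moments_mult all_moments_const all_moments_X)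

lemma wick_qf:
  "wick Y (qf B) (\<lambda>w. \<Sum>r\<in>I. \<Sum>s\<in>I. B r s * (cov Y (X r) * X s w + X r w * cov Y (X s)))"
proof -
  have "wick Y (\<lambda>w. X r w * X s w + - C r s) (\<lambda>w. (cov Y (X r) * X s w + X r w * cov Y (X s)) + 0)"
    if "r \<in> I" "s \<in> I" for r s
    by (intro wick_add wick_times wick_mem wick_const X_mem that)
  then show ?thesis unfolding qf_def[abs_def] by (intro wick_sum wick_scale) simp
qed

text \<open>Integration by parts in the first variable of every term. The part in which the
  derivative falls on the second variable is \<open>C p q\<close> times the expectation of
  \<open>F\<close>, and the centering of the form cancels it.\<close>

lemma expectation_qf_mult:
  assumes F: "\<And>p. p \<in> I \<Longrightarrow> wick (X p) F (F' p)"
  shows "expectation (\<lambda>w. qf A w * F w) = (\<Sum>p\<in>I. \<Sum>q\<in>I. A p q * expectation (\<lambda>w. X q w * F' p w))"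
proof -
  have amF: "all_moments M F" "all_moments M (F' p)" if "p \<in> I" for p
    using wick_all_moments[OF F[OF that]] .
  have 1: "expectation (\<lambda>w. (X p w * X q w - C p q) * F w) = expectation (\<lambda>w. X q w * F' p w)"
    if p: "p \<in> I" and q: "q \<in> I" for p q
  proof -
    note am = amF[OF p] all_moments_X[OF p] all_moments_X[OF q]
    have int: "integrable M (\<lambda>w. X p w * (X q w * F w))" "integrable M F" "integrable M (\<lambda>w. X q w * F' p w)"
      by (intro all_moments_integrable all_moments_mult am)+
    have "expectation (\<lambda>w. (X p w * X q w - C p q) * F w) =
        expectation (\<lambda>w. X p w * (X q w * F w) - C p q * F w)"
      by (rule Bochner_Integration.integral_cong) (simp_all add: algebra_simps)
    also have "\<dots> = expectation (\<lambda>w. X p w * (X q w * F w)) - C p q * expectation F"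
      using int by simp
    also have "expectation (\<lambda>w. X p w * (X q w * F w)) = expectation (\<lambda>w. C p q * F w + X q w * F' p w)"
      by (intro wick_expectation wick_times wick_mem F X_mem p q)
    also have "\<dots> = C p q * expectation F + expectation (\<lambda>w. X q w * F' p w)" using int by simp
    finally show ?thesis by simp
  qed
  have int: "integrable M (\<lambda>w. (X p w * X q w - C p q) * F w)" if "p \<in> I" "q \<in> I" for p q
    by (intro all_moments_integrable all_moments_mult all_moments_diff all_moments_const all_moments_X
        amF(1)[OF that(1)] that)
  have "expectation (\<lambda>w. qf A w * F w) =
      expectation (\<lambda>w. \<Sum>p\<in>I. \<Sum>q\<in>I. A p q * ((X p w * X q w - C p q) * F w))"
    by (simp add: qf_def sum_distrib_right mult.assoc)
  also have "\<dots> = (\<Sum>p\<in>I. \<Sum>q\<in>I. A p q * expectation (\<lambda>w. (X p w * X q w - C p q) * F w))"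
    using int by (simp add: Bochner_Integration.integral_sum)
  also have "\<dots> = (\<Sum>p\<in>I. \<Sum>q\<in>I. A p q * expectation (\<lambda>w. X q w * F' p w))"
    by (intro sum.cong refl) (simp add: 1)
  finally show ?thesis .
qed

text \<open>The contraction yields uncentered forms; centering them again produces the traces. The
  two summands come from differentiating either of the two variables of \<open>B\<close>.\<close>

lemma contract_derivative:
  "(\<Sum>p\<in>I. \<Sum>q\<in>I. A p q * (X q w * (\<Sum>r\<in>I. \<Sum>s\<in>I. B r s * (C p r * X s w + X r w * C p s)))) =
   qf (M1 A B) w + qf (M1 A (tp B)) w + (tr (M1 A B) + tr (M1 A (tp B)))"
proof -
  have eq: "qf D w + tr D = (\<Sum>q\<in>I. \<Sum>s\<in>I. D q s * (X q w * X s w))" for D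
    unfolding qf_def tr_def sum.distrib[symmetric]
    by (intro sum.cong refl) (simp add: right_diff_distrib)
  have m: "(\<Sum>q\<in>I. \<Sum>s\<in>I. M1 A D q s * (X q w * X s w)) =
      (\<Sum>p\<in>I. \<Sum>q\<in>I. \<Sum>r\<in>I. \<Sum>s\<in>I. A p q * C p r * D r s * (X q w * X s w))" for D
    by (subst sum_swap4) (simp add: M1_def mm_def tp_def sum_distrib_right sum_distrib_left mult.assoc)
  have "(\<Sum>p\<in>I. \<Sum>q\<in>I. A p q * (X q w * (\<Sum>r\<in>I. \<Sum>s\<in>I. B r s * (C p r * X s w + X r w * C p s)))) =
     (\<Sum>p\<in>I. \<Sum>q\<in>I. \<Sum>r\<in>I. \<Sum>s\<in>I. A p q * C p r * B r s * (X q w * X s w)) +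
     (\<Sum>p\<in>I. \<Sum>q\<in>I. \<Sum>r\<in>I. \<Sum>s\<in>I. A p q * C p s * B r s * (X q w * X r w))"
    unfolding sum_distrib_left sum.distrib[symmetric]
    by (intro sum.cong refl) (simp add: algebra_simps)
  also have "(\<Sum>p\<in>I. \<Sum>q\<in>I. \<Sum>r\<in>I. \<Sum>s\<in>I. A p q * C p s * B r s * (X q w * X r w)) =
     (\<Sum>p\<in>I. \<Sum>q\<in>I. \<Sum>r\<in>I. \<Sum>s\<in>I. A p q * C p r * tp B r s * (X q w * X s w))"
    unfolding tp_def by (rule sum.cong[OF refl], rule sum.cong[OF refl]) (rule sum.swap)
  finally show ?thesis unfolding m[symmetric] using eq[of "M1 A B"] eq[of "M1 A (tp B)"] by simp
qed

text \<open>The derivation acts on one form of the product at a time. A product is thereby reduced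
  to products with one form less, in which a contracted form appears, and to products with two forms
  less, multiplied by a trace.\<close>

lemma expectation_qf_prod_list:
  fixes Bs defines "rest i \<equiv> take i Bs @ drop (Suc i) Bs"
  shows "expectation (\<lambda>w. qf A w * (\<Prod>B\<leftarrow>Bs. qf B w)) =
    (\<Sum>i<length Bs. expectation (\<lambda>w. qf (M1 A (Bs ! i)) w * (\<Prod>B\<leftarrow>rest i. qf B w)) +
       expectation (\<lambda>w. qf (M1 A (tp (Bs ! i))) w * (\<Prod>B\<leftarrow>rest i. qf B w)) +
       (tr (M1 A (Bs ! i)) + tr (M1 A (tp (Bs ! i)))) * expectation (\<lambda>w. \<Prod>B\<leftarrow>rest i. qf B w))"
proof -
  define D where "D p B w = (\<Sum>r\<in>I. \<Sum>s\<in>I. B r s * (C p r * X s w + X r w * C p s))" for p B w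
  define P where "P i w = (\<Prod>B\<leftarrow>rest i. qf B w)" for i w
  have amP: "all_moments M (P i)" for i
    unfolding P_def[abs_def] by (intro all_moments_prod_list all_moments_qf)
  have amD: "all_moments M (D p B)" for p B
    unfolding D_def[abs_def]
    by (intro all_moments_sum all_moments_cmult all_moments_add all_moments_mult all_moments_X all_moments_const)
  have "wick (X p) (\<lambda>w. \<Prod>B\<leftarrow>Bs. qf B w) (\<lambda>w. \<Sum>i<length Bs. D p (Bs ! i) w * P i w)" for p
    unfolding D_def P_def rest_def by (rule wick_prod_list) (rule wick_qf)
  from expectation_qf_mult[OF this]
  have "expectation (\<lambda>w. qf A w * (\<Prod>B\<leftarrow>Bs. qf B w)) =
      (\<Sum>p\<in>I. \<Sum>q\<in>I. A p q * expectation (\<lambda>w. X q w * (\<Sum>i<length Bs. D p (Bs ! i) w * P i w)))" .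
  also have "\<dots> = (\<Sum>p\<in>I. \<Sum>q\<in>I. \<Sum>i<length Bs. A p q * expectation (\<lambda>w. X q w * D p (Bs ! i) w * P i w))"
  proof (intro sum.cong refl)
    fix p q assume "p \<in> I" "q \<in> I"
    then have "integrable M (\<lambda>w. X q w * D p (Bs ! i) w * P i w)" for i
      by (intro all_moments_integrable all_moments_mult amP amD all_moments_X)
    then show "A p q * expectation (\<lambda>w. X q w * (\<Sum>i<length Bs. D p (Bs ! i) w * P i w)) =
        (\<Sum>i<length Bs. A p q * expectation (\<lambda>w. X q w * D p (Bs ! i) w * P i w))"
      unfolding sum_distrib_left[symmetric] by (simp add: sum_distrib_left mult.assoc[symmetric])
  qed
  also have "\<dots> = (\<Sum>i<length Bs. \<Sum>p\<in>I. \<Sum>q\<in>I. A p q * expectation (\<lambda>w. X q w * D p (Bs ! i) w * P i w))"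
  proof -
    have "(\<Sum>p\<in>I. \<Sum>q\<in>I. \<Sum>i<length Bs. f p q i) = (\<Sum>p\<in>I. \<Sum>i<length Bs. \<Sum>q\<in>I. f p q i)" for f :: "'i \<Rightarrow> 'i \<Rightarrow> nat \<Rightarrow> real"
      by (rule sum.cong[OF refl]) (rule sum.swap)
    note this[of "\<lambda>p q i. A p q * expectation (\<lambda>w. X q w * D p (Bs ! i) w * P i w)"]
    also note sum.swap
    finally show ?thesis .
  qed
  also have "\<dots> = (\<Sum>i<length Bs. expectation (\<lambda>w. (\<Sum>p\<in>I. \<Sum>q\<in>I. A p q * (X q w * D p (Bs ! i) w)) * P i w))"
  proof (intro sum.cong refl)
    fix i
    have "integrable M (\<lambda>w. X q w * D p (Bs ! i) w * P i w)" if "q \<in> I" for p q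
      using that by (intro all_moments_integrable all_moments_mult amP amD all_moments_X)
    then show "(\<Sum>p\<in>I. \<Sum>q\<in>I. A p q * expectation (\<lambda>w. X q w * D p (Bs ! i) w * P i w)) =
      expectation (\<lambda>w. (\<Sum>p\<in>I. \<Sum>q\<in>I. A p q * (X q w * D p (Bs ! i) w)) * P i w)"
      by (simp add: sum_distrib_right mult.assoc[symmetric] Bochner_Integration.integral_sum)
        (simp add: mult.assoc Bochner_Integration.integral_sum)
  qed
  also have "\<dots> = (\<Sum>i<length Bs. expectation (\<lambda>w. qf (M1 A (Bs ! i)) w * P i w) +
       expectation (\<lambda>w. qf (M1 A (tp (Bs ! i))) w * P i w) +
       (tr (M1 A (Bs ! i)) + tr (M1 A (tp (Bs ! i)))) * expectation (P i))"
  proof (intro sum.cong refl)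
    fix i
    have "integrable M (\<lambda>w. qf B w * P i w)" "integrable M (P i)" for B
      by (intro all_moments_integrable all_moments_mult amP all_moments_qf)+
    then show "expectation (\<lambda>w. (\<Sum>p\<in>I. \<Sum>q\<in>I. A p q * (X q w * D p (Bs ! i) w)) * P i w) =
       expectation (\<lambda>w. qf (M1 A (Bs ! i)) w * P i w) +
       expectation (\<lambda>w. qf (M1 A (tp (Bs ! i))) w * P i w) +
       (tr (M1 A (Bs ! i)) + tr (M1 A (tp (Bs ! i)))) * expectation (P i)"
      unfolding D_def contract_derivative by (simp add: distrib_right)
  qed
  finally show ?thesis unfolding P_def .
qed

end

context gaussian_family
begin

text \<open>The normalisation \<open>s\<close> stands for the square root of the number of variables: then a trace is
  at most a product of two normalised bounds, and contracting two forms does not increase the bound.\<close>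

lemma expectation_prod_qf_bound:
  assumes s: "1 \<le> s" "real (card I) \<le> s\<^sup>2"
  shows "length As = k \<Longrightarrow> list_all2 mat_bd As as \<Longrightarrow>
    \<bar>expectation (\<lambda>w. \<Prod>A\<leftarrow>As. qf A w)\<bar> \<le> wick_bound k * (\<Prod>a\<leftarrow>as. s * a)"
proof (induction k arbitrary: As as rule: wick_bound.induct)
  case 1
  then show ?case by (simp add: prob_space)
next
  case 2
  then obtain A where "As = [A]" by (auto simp: length_Suc_conv)
  then show ?case using expectation_qf_prod_list[of A "[]"] by simp
next
  case (3 k)
  from 3(3) obtain A Bs where As: "As = A # Bs" and len: "length Bs = Suc k"
    by (auto simp: length_Suc_conv)
  with 3(4) obtain a bs where as: "as = a # bs" and A: "mat_bd A a" and Bs: "list_all2 mat_bd Bs bs"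
    by (auto simp: list_all2_Cons1)
  have len': "length bs = Suc k" using len list_all2_lengthD[OF Bs] by simp
  have a0: "0 \<le> a" using A by (simp add: mat_bd_def)
  define total where "total = (\<Prod>a\<leftarrow>as. s * a)"
  define rest where "rest i = take i Bs @ drop (Suc i) Bs" for i
  define R where "R i = (\<Prod>b\<leftarrow>take i bs @ drop (Suc i) bs. s * b)" for i
  have step: "\<bar>expectation (\<lambda>w. qf (M1 A (Bs ! i)) w * (\<Prod>B\<leftarrow>rest i. qf B w)) +
       expectation (\<lambda>w. qf (M1 A (tp (Bs ! i))) w * (\<Prod>B\<leftarrow>rest i. qf B w)) +
       (tr (M1 A (Bs ! i)) + tr (M1 A (tp (Bs ! i)))) * expectation (\<lambda>w. \<Prod>B\<leftarrow>rest i. qf B w)\<bar>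
      \<le> 2 * (wick_bound (Suc k) + wick_bound k) * total" if i: "i < Suc k" for i
  proof -
    let ?b = "bs ! i"
    have B: "mat_bd (Bs ! i) ?b" using Bs i len by (simp add: list_all2_nthD)
    then have b0: "0 \<le> ?b" by (simp add: mat_bd_def)
    have rest: "list_all2 mat_bd (rest i) (take i bs @ drop (Suc i) bs)"
      unfolding rest_def using Bs by (intro list_all2_appendI list_all2_takeI list_all2_dropI)
    have lrest: "length (rest i) = k" using i len by (simp add: rest_def)
    have R0: "0 \<le> R i" unfolding R_def
    proof (rule prod_list_nonneg)
      have "\<forall>b\<in>set bs. 0 \<le> b" using Bs by (auto simp: list_all2_conv_all_nth mat_bd_def in_set_conv_nth)
      then show "0 \<le> x" if "x \<in> set (map (times s) (take i bs @ drop (Suc i) bs))" for x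
        using that s(1) by (auto dest: in_set_takeD in_set_dropD)
    qed
    have total: "total = (s * a) * (s * ?b) * R i"
      using prod_list_remove_nth[of i "map (times s) bs"] i len'
      by (simp add: total_def as R_def take_map drop_map)
    \<comment> \<open>A contracted form carries one factor \<open>s\<close> less than the two forms
      that it replaces. This spare factor is given away here and exploited in
      \<open>expectation_qf_power\<close>.\<close>
    have ab: "s * (a * ?b) \<le> (s * a) * (s * ?b)"
      using s(1) a0 b0 mult_right_mono[of 1 s "s * (a * ?b)"] by (simp add: mult_ac)
    have q: "\<bar>expectation (\<lambda>w. qf D w * (\<Prod>B\<leftarrow>rest i. qf B w))\<bar> \<le> wick_bound (Suc k) * total"
      if "mat_bd D (a * ?b)" for D
    proof -
      have "\<bar>expectation (\<lambda>w. \<Prod>B\<leftarrow>D # rest i. qf B w)\<bar> \<le>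
          wick_bound (Suc k) * (\<Prod>b\<leftarrow>a * ?b # take i bs @ drop (Suc i) bs. s * b)"
        using 3(1)[of "D # rest i" "a * ?b # take i bs @ drop (Suc i) bs"] that rest lrest by simp
      also have "\<dots> = wick_bound (Suc k) * (s * (a * ?b) * R i)" by (simp add: R_def)
      also have "\<dots> \<le> wick_bound (Suc k) * total"
        unfolding total using ab R0 by (intro mult_left_mono mult_right_mono wick_bound_nonneg)
      finally show ?thesis by simp
    qed
    have t: "\<bar>tr D * expectation (\<lambda>w. \<Prod>B\<leftarrow>rest i. qf B w)\<bar> \<le> wick_bound k * total"
      if "mat_bd D (a * ?b)" for D
    proof -
      have "\<bar>tr D\<bar> \<le> real (card I) * (a * ?b)" by (rule tr_bound) fact
      also have "\<dots> \<le> s\<^sup>2 * (a * ?b)" using a0 b0 by (intro mult_right_mono s) auto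
      finally have 1: "\<bar>tr D\<bar> \<le> (s * a) * (s * ?b)" by (simp add: power2_eq_square mult_ac)
      have 2: "\<bar>expectation (\<lambda>w. \<Prod>B\<leftarrow>rest i. qf B w)\<bar> \<le> wick_bound k * R i"
        using 3(2)[OF lrest rest] by (simp add: R_def)
      have "\<bar>tr D * expectation (\<lambda>w. \<Prod>B\<leftarrow>rest i. qf B w)\<bar> \<le> ((s * a) * (s * ?b)) * (wick_bound k * R i)"
        unfolding abs_mult by (intro mult_mono 1 2) (use s a0 b0 in auto)
      then show ?thesis by (simp add: total mult_ac)
    qed
    note bds = mat_bd_M1[OF A B] mat_bd_M1[OF A mat_bd_tp[OF B]]
    show ?thesis
      using q[OF bds(1)] q[OF bds(2)] t[OF bds(1)] t[OF bds(2)]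
      unfolding distrib_right distrib_left by linarith
  qed
  have "expectation (\<lambda>w. \<Prod>A\<leftarrow>As. qf A w) = expectation (\<lambda>w. qf A w * (\<Prod>B\<leftarrow>Bs. qf B w))"
    by (simp add: As)
  note eq = trans[OF this expectation_qf_prod_list]
  have "\<bar>expectation (\<lambda>w. \<Prod>A\<leftarrow>As. qf A w)\<bar> \<le> (\<Sum>i<length Bs. 2 * (wick_bound (Suc k) + wick_bound k) * total)"
    unfolding eq
    by (rule order_trans[OF sum_abs], rule sum_mono, rule step[unfolded rest_def]) (simp add: len)
  then show ?case by (simp add: len total_def algebra_simps)
qed

text \<open>The traces add up to the second moment and so reproduce the recursion of the normal
  moments. The terms with a contracted form have one factor \<open>s\<close> less, which leaves an
  error of order \<open>1 / s\<close>.\<close>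

lemma expectation_qf_power:
  assumes s: "1 \<le> s" "real (card I) \<le> s\<^sup>2" and A: "mat_bd A a"
  shows "\<bar>expectation (\<lambda>w. qf A w ^ Suc (Suc k)) -
      real (Suc k) * expectation (\<lambda>w. qf A w ^ 2) * expectation (\<lambda>w. qf A w ^ k)\<bar>
    \<le> 2 * real (Suc k) * wick_bound (Suc k) * (s * a) ^ Suc (Suc k) / s"
proof -
  \<comment> \<open>This turns out to be the second moment of the form: for \<open>k = 0\<close> the
    remaining terms are expectations of single centered forms and vanish.\<close>
  define \<tau> where "\<tau> = tr (M1 A A) + tr (M1 A (tp A))"
  define e where "e k = expectation (\<lambda>w. qf (M1 A A) w * qf A w ^ k) +
      expectation (\<lambda>w. qf (M1 A (tp A)) w * qf A w ^ k)" for k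
  have a0: "0 \<le> a" using A by (simp add: mat_bd_def)
  have rep: "take i (replicate (Suc k) A) @ drop (Suc i) (replicate (Suc k) A) = replicate k A"
    if "i < Suc k" for i k
    using that by (simp add: replicate_add[symmetric] del: replicate_Suc)
  have plr: "prod_list (replicate n x) = x ^ n" for n and x :: real
    by (induction n) auto
  have 1: "expectation (\<lambda>w. qf A w ^ Suc (Suc k)) = real (Suc k) * (e k + \<tau> * expectation (\<lambda>w. qf A w ^ k))" for k
  proof -
    have "expectation (\<lambda>w. qf A w * (\<Prod>B\<leftarrow>replicate (Suc k) A. qf B w)) =
      (\<Sum>i<Suc k. e k + \<tau> * expectation (\<lambda>w. qf A w ^ k))"
      unfolding e_def \<tau>_def
      by (rule trans[OF expectation_qf_prod_list], unfold length_replicate, rule sum.cong[OF refl])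
        (simp only: rep lessThan_iff nth_replicate map_replicate plr)
    then show ?thesis by (simp add: map_replicate plr del: replicate_Suc)
  qed
  have 2: "expectation (\<lambda>w. qf D w) = 0" for D
    using expectation_qf_prod_list[of D "[]"] by simp
  have "e 0 = 0" by (simp add: e_def 2)
  then have 3: "expectation (\<lambda>w. qf A w ^ 2) = \<tau>"
    using 1[of 0] by (simp add: prob_space numeral_2_eq_2)
  have q: "\<bar>expectation (\<lambda>w. qf D w * qf A w ^ k)\<bar> \<le> wick_bound (Suc k) * (s * a) ^ Suc (Suc k) / s"
    if D: "mat_bd D (a * a)" for D
  proof -
    have "list_all2 mat_bd (D # replicate k A) (a * a # replicate k a)"
      using D A by (simp add: list_all2_conv_all_nth nth_Cons')
    from expectation_prod_qf_bound[OF s _ this, of "Suc k"]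
    have "\<bar>expectation (\<lambda>w. qf D w * qf A w ^ k)\<bar> \<le> wick_bound (Suc k) * (s * (a * a) * (s * a) ^ k)"
      by (simp add: map_replicate plr)
    also have "s * (a * a) * (s * a) ^ k = (s * a) ^ Suc (Suc k) / s" using s by simp
    finally show ?thesis by (simp only: times_divide_eq_right)
  qed
  have "\<bar>e k\<bar> \<le> 2 * (wick_bound (Suc k) * (s * a) ^ Suc (Suc k) / s)"
    using q[OF mat_bd_M1[OF A A]] q[OF mat_bd_M1[OF A mat_bd_tp[OF A]]] unfolding e_def by linarith
  then have "real (Suc k) * \<bar>e k\<bar> \<le> real (Suc k) * (2 * (wick_bound (Suc k) * (s * a) ^ Suc (Suc k) / s))"
    by (rule mult_left_mono) simp
  moreover have "expectation (\<lambda>w. qf A w ^ Suc (Suc k)) -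
      real (Suc k) * expectation (\<lambda>w. qf A w ^ 2) * expectation (\<lambda>w. qf A w ^ k) = real (Suc k) * e k"
    unfolding 1 3 by (simp only: distrib_left mult.assoc add_diff_cancel_right')
  ultimately show ?thesis by (simp only: abs_mult abs_of_nat mult_ac times_divide_eq_right)
qed

end

text \<open>Boundedness of \<open>s * a\<close> says that no single variable dominates the form. The
  moments then satisfy the recursion of \<open>gmom\<close> up to an error of order
  \<open>1 / s\<close>, and the limit is propagated by induction in steps of two.\<close>

lemma (in gaussian_space) qf_moments_tendsto:
  fixes I :: "nat \<Rightarrow> 'i set" and X :: "nat \<Rightarrow> 'i \<Rightarrow> 'w \<Rightarrow> real"
  assumes fam: "\<And>n. gaussian_family M G (I n) (X n)"
    and s: "\<And>n. 1 \<le> s n" "\<And>n. real (card (I n)) \<le> (s n)\<^sup>2" "filterlim s at_top sequentially"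
    and A: "\<And>n. gaussian_family.mat_bd M (I n) (X n) (A n) (a n)" "\<And>n. s n * a n \<le> b"
    and var: "(\<lambda>n. expectation (\<lambda>w. (gaussian_family.qf M (I n) (X n) (A n) w)\<^sup>2)) \<longlonglongrightarrow> v"
  shows "(\<lambda>n. expectation (\<lambda>w. gaussian_family.qf M (I n) (X n) (A n) w ^ k)) \<longlonglongrightarrow> gmom v k"
proof -
  define Q where "Q n = gaussian_family.qf M (I n) (X n) (A n)" for n
  define m where "m k n = expectation (\<lambda>w. Q n w ^ k)" for k n
  have a0: "0 \<le> a n" for n
    using A(1)[of n] gaussian_family.mat_bd_def[OF fam] by blast
  have b0: "0 \<le> b" using A(2)[of 0] a0[of 0] s(1)[of 0] by (meson mult_nonneg_nonneg order_trans zero_le_one)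
  have rec: "\<bar>m (Suc (Suc k)) n - real (Suc k) * m 2 n * m k n\<bar> \<le>
      2 * real (Suc k) * wick_bound (Suc k) * b ^ Suc (Suc k) * inverse (s n)" for k n
  proof -
    have "2 * real (Suc k) * wick_bound (Suc k) * (s n * a n) ^ Suc (Suc k) / s n \<le>
        2 * real (Suc k) * wick_bound (Suc k) * b ^ Suc (Suc k) * inverse (s n)"
      unfolding divide_inverse
      by (intro mult_right_mono mult_left_mono power_mono A(2) mult_nonneg_nonneg)
        (use s(1)[of n] a0[of n] wick_bound_nonneg in auto)
    with gaussian_family.expectation_qf_power[OF fam s(1,2) A(1), of n k] show ?thesis
      unfolding m_def Q_def by linarith
  qed
  have "m k \<longlonglongrightarrow> gmom v k"
  proof (induction k rule: induct_nat_012)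
    case 0
    then show ?case by (simp add: m_def[abs_def] prob_space)
  next
    case 1
    have "expectation (Q n) = 0" for n
      using gaussian_family.expectation_qf_prod_list[OF fam, of n "A n" "[]"] by (simp add: Q_def)
    then show ?case by (simp add: m_def[abs_def])
  next
    case (ge2 k)
    have "(\<lambda>n. inverse (s n)) \<longlonglongrightarrow> 0"
      by (rule tendsto_inverse_0_at_top[OF s(3)])
    then have "(\<lambda>n. 2 * real (Suc k) * wick_bound (Suc k) * b ^ Suc (Suc k) * inverse (s n)) \<longlonglongrightarrow> 0"
      by (rule tendsto_mult_right_zero)
    then have "(\<lambda>n. m (Suc (Suc k)) n - real (Suc k) * m 2 n * m k n) \<longlonglongrightarrow> 0"
      by (rule tendsto_zero_sandwich[OF rec])
    moreover have "(\<lambda>n. real (Suc k) * m 2 n * m k n) \<longlonglongrightarrow> real (Suc k) * v * gmom v k"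
      using var by (intro tendsto_mult tendsto_const ge2.IH) (simp add: m_def Q_def)
    ultimately have "(\<lambda>n. (m (Suc (Suc k)) n - real (Suc k) * m 2 n * m k n) +
        real (Suc k) * m 2 n * m k n) \<longlonglongrightarrow> 0 + real (Suc k) * v * gmom v k"
      by (rule tendsto_add)
    then show ?case by simp
  qed
  then show ?thesis by (simp add: m_def[abs_def] Q_def)
qed

text \<open>The exponential is replaced by its Taylor polynomial of degree 2N, whose remainder is
  controlled by the moment of order 2N; the even order makes the absolute moment a moment. The
  degree is fixed by means of the limit law, and only then the index tends to infinity.\<close>

lemma (in prob_space) char_tendsto_of_moments:
  assumes am: "\<And>n. all_moments M (Q n)" and v: "0 \<le> v"
    and mom: "\<And>k. (\<lambda>n. expectation (\<lambda>w. Q n w ^ k)) \<longlonglongrightarrow> gmom v k"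
  shows "(\<lambda>n. CLINT w|M. iexp (t * Q n w)) \<longlonglongrightarrow> complex_of_real (exp (- (v * t\<^sup>2) / 2))"
proof (rule LIMSEQ_I)
  fix r :: real assume r: "0 < r"
  note [measurable] = all_moments_measurable[OF am]
  define c where "c n = (CLINT w|M. iexp (t * Q n w))" for n
  define \<phi> where "\<phi> = complex_of_real (exp (- (v * t\<^sup>2) / 2))"
  define P where "P N n = (\<Sum>k\<le>N. ((\<i> * t) ^ k / fact k) * expectation (\<lambda>w. Q n w ^ k))" for N n
  define P' where "P' N = (\<Sum>k\<le>N. ((\<i> * t) ^ k / fact k) * complex_of_real (gmom v k))" for N
  have 1: "cmod (c n - P (2 * N) n) \<le> 2 * \<bar>t\<bar> ^ (2 * N) / fact (2 * N) * expectation (\<lambda>w. Q n w ^ (2 * N))" for n N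
  proof -
    have int: "integrable M (\<lambda>w. Q n w ^ k)" for k
      by (intro all_moments_integrable all_moments_power am)
    show ?thesis
      using char_approx1'[of "2 * N" "Q n" "distr M borel (Q n)" t, OF int _ refl]
      unfolding c_def P_def char_distr_eq[OF all_moments_measurable[OF am]]
      by (simp add: power_even_abs)
  qed
  have 2: "cmod (\<phi> - P' (2 * N)) \<le> 2 * \<bar>t\<bar> ^ (2 * N) / fact (2 * N) * gmom v (2 * N)" for N
  proof -
    interpret S: prob_space std_normal_distribution
      using prob_space_normal_density[of 1 0] by simp
    define \<sigma> where "\<sigma> = sqrt v"
    have \<sigma>: "0 \<le> \<sigma>" "\<sigma>\<^sup>2 = v" using v by (auto simp: \<sigma>_def)
    have e: "(LINT x|std_normal_distribution. (\<sigma> * x) ^ k) = gmom v k" for k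
      using gmom_scale[of \<sigma> 1 k] by (simp add: power_mult_distrib std_normal_moment \<sigma>)
    have "cmod (char (centered_normal \<sigma>) t - (\<Sum>k \<le> 2 * N. ((\<i> * t)^k / fact k) * S.expectation (\<lambda>x. (\<sigma> * x)^k))) \<le>
      (2 * \<bar>t\<bar>^(2 * N) / fact (2 * N)) * S.expectation (\<lambda>x. \<bar>\<sigma> * x\<bar>^(2 * N))"
      by (rule S.char_approx1') (simp_all add: power_mult_distrib std_normal_moment centered_normal_eq_distr \<sigma>)
    then show ?thesis by (simp add: e power_even_abs P'_def \<phi>_def char_centered_normal \<sigma>)
  qed
  \<comment> \<open>Inserting the even moments turns the remainder into twice the general term of
    the exponential series at \<open>t^2 v / 2\<close>, which tends to 0.\<close>
  have err: "2 * \<bar>t\<bar> ^ (2 * N) / fact (2 * N) * gmom v (2 * N) = 2 * ((t\<^sup>2 * v / 2) ^ N / fact N)" for N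
  proof -
    have "\<bar>t\<bar> ^ (2 * N) = (t\<^sup>2) ^ N" by (simp only: power_mult power2_abs)
    then show ?thesis by (simp only: gmom_even power_divide power_mult_distrib) simp
  qed
  have "(\<lambda>N. 2 * ((t\<^sup>2 * v / 2) ^ N / fact N)) \<longlonglongrightarrow> 2 * 0"
  proof (rule tendsto_mult_left)
    have "(\<lambda>N. inverse (fact N) * (t\<^sup>2 * v / 2) ^ N) \<longlonglongrightarrow> 0"
      by (rule summable_LIMSEQ_zero[OF summable_exp])
    then show "(\<lambda>N. (t\<^sup>2 * v / 2) ^ N / fact N) \<longlonglongrightarrow> 0"
      by (simp only: divide_inverse mult.commute)
  qed
  then have "eventually (\<lambda>N. 2 * ((t\<^sup>2 * v / 2) ^ N / fact N) < r / 4) sequentially"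
    by (rule order_tendstoD(2)) (use r in simp)
  then obtain N where N: "2 * \<bar>t\<bar> ^ (2 * N) / fact (2 * N) * gmom v (2 * N) < r / 4"
    unfolding eventually_sequentially err by blast
  have "(\<lambda>n. 2 * \<bar>t\<bar> ^ (2 * N) / fact (2 * N) * expectation (\<lambda>w. Q n w ^ (2 * N)))
      \<longlonglongrightarrow> 2 * \<bar>t\<bar> ^ (2 * N) / fact (2 * N) * gmom v (2 * N)"
    by (intro tendsto_mult tendsto_const mom)
  then have ev1: "eventually (\<lambda>n. 2 * \<bar>t\<bar> ^ (2 * N) / fact (2 * N) * expectation (\<lambda>w. Q n w ^ (2 * N)) < r / 4) sequentially"
    using N by (rule order_tendstoD(2))
  have "P (2 * N) \<longlonglongrightarrow> P' (2 * N)"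
    unfolding P_def[abs_def] P'_def by (intro tendsto_sum tendsto_mult tendsto_const tendsto_of_real mom)
  then have ev2: "eventually (\<lambda>n. dist (P (2 * N) n) (P' (2 * N)) < r / 4) sequentially"
    using r by (intro tendstoD) auto
  have "eventually (\<lambda>n. norm (c n - \<phi>) < r) sequentially"
    using ev1 ev2
  proof eventually_elim
    case (elim n)
    have "norm (c n - \<phi>) \<le> norm (c n - P (2 * N) n) + norm (P (2 * N) n - P' (2 * N)) + norm (\<phi> - P' (2 * N))"
      using norm_triangle_ineq[of "c n - P (2 * N) n" "P (2 * N) n - P' (2 * N)"]
        norm_triangle_ineq4[of "c n - P' (2 * N)" "\<phi> - P' (2 * N)"] by simp
    with 1[of n N] 2[of N] N elim r show ?case unfolding dist_norm by linarith
  qed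
  then show "\<exists>no. \<forall>n\<ge>no. norm ((CLINT w|M. iexp (t * Q n w)) - complex_of_real (exp (- (v * t\<^sup>2) / 2))) < r"
    unfolding eventually_sequentially c_def \<phi>_def .
qed

section \<open>Convergence in distribution of random vectors\<close>

text \<open>Generated as a linear span, so that expectations are determined by characteristic
  functions. It is nevertheless an algebra, by the product formulas for sine and cosine.\<close>

inductive trig_poly :: "(real^'n \<Rightarrow> real) \<Rightarrow> bool" where
  cos: "trig_poly (\<lambda>x. cos (u \<bullet> x))"
| sin: "trig_poly (\<lambda>x. sin (u \<bullet> x))"
| add: "trig_poly f \<Longrightarrow> trig_poly g \<Longrightarrow> trig_poly (\<lambda>x. f x + g x)"
| scale: "trig_poly f \<Longrightarrow> trig_poly (\<lambda>x. c * f x)"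

lemma trig_poly_const: "trig_poly (\<lambda>_. c)"
  using trig_poly.scale[OF trig_poly.cos[of 0], of c] by simp

lemma trig_poly_sum: "(\<And>i. i \<in> I \<Longrightarrow> trig_poly (f i)) \<Longrightarrow> trig_poly (\<lambda>x. \<Sum>i\<in>I. f i x)"
  by (induction I rule: infinite_finite_induct) (auto intro: trig_poly_const trig_poly.add)

lemma trig_poly_mult_cos_sin:
  assumes "trig_poly g"
  shows "trig_poly (\<lambda>x. cos (u \<bullet> x) * g x)" "trig_poly (\<lambda>x. sin (u \<bullet> x) * g x)"
proof -
  from assms have "trig_poly (\<lambda>x. cos (u \<bullet> x) * g x) \<and> trig_poly (\<lambda>x. sin (u \<bullet> x) * g x)"
  proof induction
    case (cos v)
    have "trig_poly (\<lambda>x. (1/2) * (cos ((u - v) \<bullet> x) + cos ((u + v) \<bullet> x)))"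
      "trig_poly (\<lambda>x. (1/2) * (sin ((u + v) \<bullet> x) + sin ((u - v) \<bullet> x)))"
      by (intro trig_poly.intros)+
    moreover have "(1/2) * (cos ((u - v) \<bullet> x) + cos ((u + v) \<bullet> x)) = cos (u \<bullet> x) * cos (v \<bullet> x)"
      "(1/2) * (sin ((u + v) \<bullet> x) + sin ((u - v) \<bullet> x)) = sin (u \<bullet> x) * cos (v \<bullet> x)" for x
      by (simp_all add: inner_diff_left inner_add_left cos_diff cos_add sin_add sin_diff)
    ultimately show ?case by simp
  next
    case (sin v)
    have "trig_poly (\<lambda>x. (1/2) * (sin ((u + v) \<bullet> x) + (-1) * sin ((u - v) \<bullet> x)))"
      "trig_poly (\<lambda>x. (1/2) * (cos ((u - v) \<bullet> x) + (-1) * cos ((u + v) \<bullet> x)))"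
      by (intro trig_poly.intros)+
    moreover have "(1/2) * (sin ((u + v) \<bullet> x) + (-1) * sin ((u - v) \<bullet> x)) = cos (u \<bullet> x) * sin (v \<bullet> x)"
      "(1/2) * (cos ((u - v) \<bullet> x) + (-1) * cos ((u + v) \<bullet> x)) = sin (u \<bullet> x) * sin (v \<bullet> x)" for x
      by (simp_all add: inner_diff_left inner_add_left cos_diff cos_add sin_add sin_diff)
    ultimately show ?case by simp
  next
    case (add f g)
    then show ?case unfolding distrib_left
      using trig_poly.add[of "\<lambda>x. cos (u \<bullet> x) * f x" "\<lambda>x. cos (u \<bullet> x) * g x"]
        trig_poly.add[of "\<lambda>x. sin (u \<bullet> x) * f x" "\<lambda>x. sin (u \<bullet> x) * g x"] by simp
  next
    case (scale f c)
    then show ?case unfolding mult.left_commute[of _ c]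
      using trig_poly.scale[of "\<lambda>x. cos (u \<bullet> x) * f x" c]
        trig_poly.scale[of "\<lambda>x. sin (u \<bullet> x) * f x" c] by simp
  qed
  then show "trig_poly (\<lambda>x. cos (u \<bullet> x) * g x)" "trig_poly (\<lambda>x. sin (u \<bullet> x) * g x)" by auto
qed

lemma trig_poly_mult:
  assumes "trig_poly f" "trig_poly g" shows "trig_poly (\<lambda>x. f x * g x)"
  using assms(1)
proof induction
  case (add f f')
  then show ?case unfolding distrib_right
    using trig_poly.add[of "\<lambda>x. f x * g x" "\<lambda>x. f' x * g x"] by simp
next
  case (scale f c)
  then show ?case unfolding mult.assoc using trig_poly.scale[of "\<lambda>x. f x * g x" c] by simp
qed (rule trig_poly_mult_cos_sin[OF assms(2)])+

lemma trig_poly_continuous: "trig_poly f \<Longrightarrow> continuous_on UNIV f"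
  by (induction rule: trig_poly.induct) (auto intro!: continuous_intros)

lemma trig_poly_bounded: "trig_poly f \<Longrightarrow> \<exists>B. \<forall>x. \<bar>f x\<bar> \<le> B"
proof (induction rule: trig_poly.induct)
  case (add f g)
  then obtain B C where "\<And>x. \<bar>f x\<bar> \<le> B" "\<And>x. \<bar>g x\<bar> \<le> C" by blast
  then have "\<bar>f x + g x\<bar> \<le> B + C" for x by (rule order_trans[OF abs_triangle_ineq add_mono])
  then show ?case by blast
next
  case (scale f c)
  then obtain B where "\<And>x. \<bar>f x\<bar> \<le> B" by blast
  then have "\<bar>c * f x\<bar> \<le> \<bar>c\<bar> * B" for x by (simp add: abs_mult mult_left_mono)
  then show ?case by blast
next
  case (cos u) show ?case by (intro exI[of _ 1]) simp
next
  case (sin u) show ?case by (intro exI[of _ 1]) simp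
qed

lemma trig_poly_expectation_tendsto:
  fixes X :: "nat \<Rightarrow> 'w \<Rightarrow> real^'n" and \<mu> :: "(real^'n) measure"
  assumes M: "prob_space M" and \<mu>: "prob_space \<mu>" "sets \<mu> = sets borel"
    and X[measurable]: "\<And>n. X n \<in> borel_measurable M"
    and char: "\<And>u. (\<lambda>n. CLINT w|M. iexp (u \<bullet> X n w)) \<longlonglongrightarrow> (CLINT x|\<mu>. iexp (u \<bullet> x))"
    and "trig_poly f"
  shows "(\<lambda>n. LINT w|M. f (X n w)) \<longlonglongrightarrow> (LINT x|\<mu>. f x)"
  using \<open>trig_poly f\<close>
proof induction
  interpret M: prob_space M by fact
  interpret \<mu>: prob_space \<mu> by fact
  note [measurable_cong] = \<mu>(2)
  have i: "integrable M (\<lambda>w. iexp (u \<bullet> X n w))" "integrable \<mu> (\<lambda>x. iexp (u \<bullet> x))" for u n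
    using M.integrable_iexp_rv[of "\<lambda>w. u \<bullet> X n w" 1] \<mu>.integrable_iexp_rv[of "\<lambda>x. u \<bullet> x" 1] by simp_all
  {
    case (cos u)
    from tendsto_Re[OF char[of u]] show ?case by (simp add: integral_Re[OF i(1), symmetric] integral_Re[OF i(2), symmetric] Re_exp)
  next
    case (sin u)
    from tendsto_Im[OF char[of u]] show ?case by (simp add: integral_Im[OF i(1), symmetric] integral_Im[OF i(2), symmetric] Im_exp)
  next
    case (add f g)
    have int: "integrable M (\<lambda>w. f (X n w))" "integrable \<mu> f" if "trig_poly f" for f n
    proof -
      from trig_poly_bounded[OF that] obtain B where "\<And>x. \<bar>f x\<bar> \<le> B" by blast
      moreover have [measurable]: "f \<in> borel_measurable borel"
        by (rule borel_measurable_continuous_onI[OF trig_poly_continuous[OF that]])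
      ultimately show "integrable M (\<lambda>w. f (X n w))" "integrable \<mu> f"
        by (auto intro!: M.integrable_const_bound[of _ B] \<mu>.integrable_const_bound[of _ B])
    qed
    from add tendsto_add[OF add(3,4)] show ?case by (simp add: int)
  next
    case (scale f c)
    then show ?case by (simp add: tendsto_mult_left)
  }
qed

text \<open>Embeds the torus into a compact subset of Euclidean space, where polynomials in the
  coordinates are dense; pulled back, they are trigonometric polynomials.\<close>

definition torus_map :: "real \<Rightarrow> real^'n \<Rightarrow> (real^'n) \<times> (real^'n)" where
  "torus_map \<kappa> x = (\<chi> i. cos (\<kappa> * x $ i), \<chi> i. sin (\<kappa> * x $ i))"

text \<open>A periodic substitute for \<open>f\<close>. Where
  \<open>|\<kappa> x_i| <= pi / 2\<close> the arcsine recovers \<open>x\<close> from the sines, and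
  the product is a weight in [0,1] that tends to 1 as \<open>\<kappa>\<close> tends to 0.\<close>

definition torus_fun :: "real \<Rightarrow> (real^'n \<Rightarrow> real) \<Rightarrow> (real^'n) \<times> (real^'n) \<Rightarrow> real" where
  "torus_fun \<kappa> f p = f (\<chi> i. arcsin (snd p $ i) / \<kappa>) * (\<Prod>i\<in>UNIV. max 0 (fst p $ i))"

lemma real_polynomial_torus_map:
  fixes g :: "(real^'n) \<times> (real^'n) \<Rightarrow> real"
  assumes "real_polynomial_function g"
  shows "trig_poly (\<lambda>x. g (torus_map \<kappa> x))"
  using assms
proof induction
  case (linear f)
  interpret bounded_linear f by fact
  have "f (torus_map \<kappa> x) = (\<Sum>i\<in>UNIV. f (axis i 1, 0) * cos (axis i \<kappa> \<bullet> x)) +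
      (\<Sum>i\<in>UNIV. f (0, axis i 1) * sin (axis i \<kappa> \<bullet> x))" for x
  proof -
    have v: "v = (\<Sum>i\<in>UNIV. v $ i *\<^sub>R axis i 1)" for v :: "real^'n"
      using basis_expansion[of v] by (simp add: scalar_mult_eq_scaleR)
    have s: "sum (\<lambda>i. (h i, 0)) A = (sum h A, 0)" "sum (\<lambda>i. (0, h i)) A = (0, sum h A)"
      if "finite A" for h :: "'n \<Rightarrow> real^'n" and A
      using that by (induction A) (auto simp: zero_prod_def)
    have "torus_map \<kappa> x = (\<chi> i. cos (\<kappa> * x $ i), 0) + (0, \<chi> i. sin (\<kappa> * x $ i))"
      by (simp add: torus_map_def)
    also have "\<dots> = (\<Sum>i\<in>UNIV. cos (\<kappa> * x $ i) *\<^sub>R (axis i 1, 0)) + (\<Sum>i\<in>UNIV. sin (\<kappa> * x $ i) *\<^sub>R (0, axis i 1))"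
      by (subst v, subst (2) v) (simp add: s)
    finally show ?thesis
      by (simp add: add sum scaleR inner_axis' mult_ac del: scaleR_Pair)
  qed
  then show ?case by (simp add: trig_poly.intros trig_poly_sum)
next
  case (add f g)
  then show ?case using trig_poly.add[of "\<lambda>x. f (torus_map \<kappa> x)" "\<lambda>x. g (torus_map \<kappa> x)"] by simp
next
  case (mult f g)
  then show ?case using trig_poly_mult[of "\<lambda>x. f (torus_map \<kappa> x)" "\<lambda>x. g (torus_map \<kappa> x)"] by simp
qed (rule trig_poly_const)

lemma torus_approx:
  fixes f :: "real^'n \<Rightarrow> real"
  assumes f: "continuous_on UNIV f" and "\<kappa> \<noteq> 0" "e > 0"
  obtains g where "trig_poly g" "\<And>x. \<bar>torus_fun \<kappa> f (torus_map \<kappa> x) - g x\<bar> < e"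
proof -
  define S :: "((real^'n) \<times> (real^'n)) set" where
    "S = cbox (\<chi> i. -1) (\<chi> i. 1) \<times> cbox (\<chi> i. -1) (\<chi> i. 1)"
  have "compact S" unfolding S_def by (intro compact_Times compact_cbox)
  moreover have "continuous_on S (torus_fun \<kappa> f)"
  proof -
    have "continuous_on S (\<lambda>p. \<chi> i. arcsin (snd p $ i) / \<kappa>)"
      by (intro continuous_intros) (auto simp: S_def mem_box_cart \<open>\<kappa> \<noteq> 0\<close>)
    then have "continuous_on S (\<lambda>p. f (\<chi> i. arcsin (snd p $ i) / \<kappa>))"
      by (rule continuous_on_compose2[OF f]) auto
    then show ?thesis unfolding torus_fun_def[abs_def]
      by (intro continuous_on_mult continuous_on_prod continuous_on_max continuous_intros)
  qed
  ultimately obtain h where h: "real_polynomial_function h" "\<And>p. p \<in> S \<Longrightarrow> \<bar>torus_fun \<kappa> f p - h p\<bar> < e"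
    using Stone_Weierstrass_real_polynomial_function[of S "torus_fun \<kappa> f" e] \<open>e > 0\<close> by metis
  have "torus_map \<kappa> x \<in> S" for x
    by (auto simp: S_def torus_map_def mem_box_cart)
  with h show ?thesis by (intro that[of "\<lambda>x. h (torus_map \<kappa> x)"] real_polynomial_torus_map) auto
qed

lemma torus_fun_bound:
  fixes x :: "real^'n"
  assumes "\<And>x. \<bar>f x\<bar> \<le> B"
  shows "\<bar>torus_fun \<kappa> f (torus_map \<kappa> x)\<bar> \<le> B"
proof -
  have "(\<Prod>i\<in>UNIV. max 0 (cos (\<kappa> * x $ i))) \<le> (\<Prod>i\<in>(UNIV :: 'n set). 1)"
    by (intro prod_mono) auto
  moreover have "0 \<le> (\<Prod>i\<in>UNIV. max 0 (cos (\<kappa> * x $ i)))" by (intro prod_nonneg) auto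
  ultimately have "\<bar>\<Prod>i\<in>UNIV. max 0 (cos (\<kappa> * x $ i))\<bar> \<le> 1" by simp
  then have "\<bar>f y\<bar> * \<bar>\<Prod>i\<in>UNIV. max 0 (cos (\<kappa> * x $ i))\<bar> \<le> B * 1" for y
    by (intro mult_mono assms) (use assms[of 0] in auto)
  then show ?thesis by (simp add: torus_fun_def torus_map_def abs_mult)
qed

text \<open>On the ball the arcsine inverts the sine, so the only error is the weight, each factor
  of which is at least \<open>cos (\<kappa> * r)\<close>.\<close>

lemma torus_fun_close:
  fixes x :: "real^'n"
  assumes B: "\<And>x. \<bar>f x\<bar> \<le> B" and x: "norm x \<le> r" and \<kappa>: "0 < \<kappa>" "\<kappa> * r \<le> pi / 2"
  shows "\<bar>f x - torus_fun \<kappa> f (torus_map \<kappa> x)\<bar> \<le> B * (1 - cos (\<kappa> * r) ^ CARD('n))"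
proof -
  have xi: "\<bar>\<kappa> * x $ i\<bar> \<le> \<kappa> * r" for i
    using component_le_norm_cart[of x i] x \<kappa> by (simp add: abs_mult)
  have arc: "arcsin (sin (\<kappa> * x $ i)) / \<kappa> = x $ i" for i
  proof -
    have "- (pi / 2) \<le> \<kappa> * x $ i" "\<kappa> * x $ i \<le> pi / 2" using xi[of i] \<kappa>(2) by linarith+
    then show ?thesis using \<kappa>(1) by (subst arcsin_sin) auto
  qed
  have c: "cos (\<kappa> * r) \<le> cos (\<kappa> * x $ i)" for i
  proof -
    have "cos (\<kappa> * r) \<le> cos \<bar>\<kappa> * x $ i\<bar>"
      using xi[of i] \<kappa> by (intro cos_monotone_0_pi_le) auto
    then show ?thesis by simp
  qed
  have c0: "0 \<le> cos (\<kappa> * r)"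
  proof -
    have "0 \<le> \<kappa> * r" using xi[of undefined] by (rule order_trans[OF abs_ge_zero])
    then show ?thesis using \<kappa> by (intro cos_ge_zero) auto
  qed
  define p where "p = (\<Prod>i\<in>UNIV. max 0 (cos (\<kappa> * x $ i)))"
  have "(\<Prod>i\<in>(UNIV :: 'n set). cos (\<kappa> * r)) \<le> p"
    unfolding p_def using c c0 by (intro prod_mono) (auto simp: le_max_iff_disj)
  then have p1: "cos (\<kappa> * r) ^ CARD('n) \<le> p" by simp
  have p2: "p \<le> (\<Prod>i\<in>(UNIV :: 'n set). 1)"
    unfolding p_def by (intro prod_mono) auto
  have "f x - torus_fun \<kappa> f (torus_map \<kappa> x) = f x * (1 - p)"
    by (simp add: torus_fun_def torus_map_def arc p_def algebra_simps)
  also have "\<bar>\<dots>\<bar> = \<bar>f x\<bar> * (1 - p)" using p2 by (simp add: abs_mult)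
  also have "\<dots> \<le> B * (1 - cos (\<kappa> * r) ^ CARD('n))"
    using p1 p2 B[of x] by (intro mult_mono) (auto intro: order_trans[OF abs_ge_zero])
  finally show ?thesis .
qed

text \<open>A trigonometric polynomial is
  close to \<open>f\<close> on a large ball and bounded by the bound of \<open>f\<close> everywhere; it comes from the
  Stone-Weierstrass theorem on the torus.\<close>

theorem levy_continuity_multi:
  fixes X :: "nat \<Rightarrow> 'w \<Rightarrow> real^'n" and \<mu> :: "(real^'n) measure"
  assumes M: "prob_space M" and \<mu>: "prob_space \<mu>" "sets \<mu> = sets borel"
    and X[measurable]: "\<And>n. X n \<in> borel_measurable M"
    and char: "\<And>u. (\<lambda>n. CLINT w|M. iexp (u \<bullet> X n w)) \<longlonglongrightarrow> (CLINT x|\<mu>. iexp (u \<bullet> x))"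
    and tight: "\<And>e. e > 0 \<Longrightarrow> \<exists>r>0. eventually (\<lambda>n. measure M {w \<in> space M. r < norm (X n w)} < e) sequentially"
    and f: "continuous_on UNIV f" "bounded (range f)"
  shows "(\<lambda>n. LINT w|M. f (X n w)) \<longlonglongrightarrow> (LINT x|\<mu>. (f x :: real))"
proof (rule LIMSEQ_I)
  interpret M: prob_space M by fact
  interpret \<mu>: prob_space \<mu> by fact
  note [measurable_cong] = \<mu>(2)
  fix e0 :: real assume e0: "0 < e0"
  from f(2) obtain B' where B': "\<And>x. \<bar>f x\<bar> \<le> B'" by (auto simp: bounded_iff)
  define B where "B = max 1 B'"
  have B: "\<bar>f x\<bar> \<le> B" "B > 0" for x using B'[of x] by (auto simp: B_def)
  \<comment> \<open>Five errors of size \<open>e\<close> will be added, together with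
    \<open>2 B\<close> times the probability of a large value, which is below \<open>e\<close>;
    \<open>5 e + 2 B e\<close> is at most \<open>e0\<close>.\<close>
  define e where "e = e0 / (8 * (B + 1))"
  have e: "e > 0" using e0 B by (simp add: e_def)
  have f_m[measurable]: "f \<in> borel_measurable borel" using f(1) by (rule borel_measurable_continuous_onI)
  define F where "F \<kappa> x = torus_fun \<kappa> f (torus_map \<kappa> x)" for \<kappa> x
  have Fb: "\<bar>F \<kappa> x\<bar> \<le> B" for \<kappa> x unfolding F_def by (rule torus_fun_bound) (rule B)
  have F_m[measurable]: "F \<kappa> \<in> borel_measurable borel" for \<kappa>
  proof -
    have [measurable]: "(\<lambda>x. \<chi> i. arcsin (sin (\<kappa> * x $ i)) / \<kappa>) \<in> borel_measurable borel"
      unfolding divide_inverse by (intro borel_measurable_continuous_onI continuous_intros) auto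
    show ?thesis unfolding F_def torus_fun_def torus_map_def by simp
  qed
  from tight[OF e] obtain r where r: "r > 0"
    and tight_r: "eventually (\<lambda>n. measure M {w \<in> space M. r < norm (X n w)} < e) sequentially" by blast
  have lim0: "(\<lambda>m. inverse (real (Suc m))) \<longlonglongrightarrow> 0" by (rule LIMSEQ_inverse_real_of_nat)
  have lim_r: "(\<lambda>m. inverse (real (Suc m)) * s) \<longlonglongrightarrow> 0 * s" for s by (intro tendsto_intros lim0)
  have close: "(\<lambda>m. B * (1 - cos (inverse (real (Suc m)) * s) ^ CARD('n))) \<longlonglongrightarrow> B * (1 - cos (0 * s) ^ CARD('n))" for s
    by (intro tendsto_intros lim_r)
  have ev_pi: "eventually (\<lambda>m. inverse (real (Suc m)) * s \<le> pi / 2) sequentially" for s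
    using order_tendstoD(2)[OF lim_r, of s "pi / 2"] by (auto elim: eventually_mono)
  have "eventually (\<lambda>m. B * (1 - cos (inverse (real (Suc m)) * r) ^ CARD('n)) < e) sequentially"
    by (rule order_tendstoD(2)[OF close]) (simp add: e)
  moreover have "eventually (\<lambda>m. \<bar>(LINT x|\<mu>. F (inverse (real (Suc m))) x) - (LINT x|\<mu>. f x)\<bar> < e) sequentially"
  proof -
    have "(\<lambda>m. LINT x|\<mu>. F (inverse (real (Suc m))) x) \<longlonglongrightarrow> (LINT x|\<mu>. f x)"
    proof (rule integral_dominated_convergence[where w = "\<lambda>_. B"])
      show "AE x in \<mu>. (\<lambda>m. F (inverse (real (Suc m))) x) \<longlonglongrightarrow> f x"
      proof (rule AE_I2)
        fix x
        have "(\<lambda>m. f x - F (inverse (real (Suc m))) x) \<longlonglongrightarrow> 0"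
        proof (rule Lim_null_comparison)
          show "eventually (\<lambda>m. norm (f x - F (inverse (real (Suc m))) x) \<le>
              B * (1 - cos (inverse (real (Suc m)) * norm x) ^ CARD('n))) sequentially"
            using ev_pi[of "norm x"]
            by eventually_elim (auto simp: F_def intro!: torus_fun_close B)
          show "(\<lambda>m. B * (1 - cos (inverse (real (Suc m)) * norm x) ^ CARD('n))) \<longlonglongrightarrow> 0"
            using close[of "norm x"] by simp
        qed
        from tendsto_diff[OF tendsto_const[of "f x"] this]
        show "(\<lambda>m. F (inverse (real (Suc m))) x) \<longlonglongrightarrow> f x" by simp
      qed
    qed (auto simp: Fb)
    from tendstoD[OF this e] show ?thesis by (simp add: dist_real_def)
  qed
  ultimately have "eventually (\<lambda>m. B * (1 - cos (inverse (real (Suc m)) * r) ^ CARD('n)) < e \<and>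
      \<bar>(LINT x|\<mu>. F (inverse (real (Suc m))) x) - (LINT x|\<mu>. f x)\<bar> < e \<and> inverse (real (Suc m)) * r \<le> pi / 2) sequentially"
    using ev_pi[of r] by eventually_elim simp
  then obtain m where m: "B * (1 - cos (inverse (real (Suc m)) * r) ^ CARD('n)) < e"
    "\<bar>(LINT x|\<mu>. F (inverse (real (Suc m))) x) - (LINT x|\<mu>. f x)\<bar> < e" "inverse (real (Suc m)) * r \<le> pi / 2"
    unfolding eventually_sequentially by blast
  \<comment> \<open>The frequency is determined by the tightness radius and the limit law, hence is
    the same for all \<open>n\<close>; a single trigonometric polynomial then serves the whole
    sequence.\<close>
  define \<kappa> where "\<kappa> = inverse (real (Suc m))"
  have \<kappa>: "0 < \<kappa>" by (simp add: \<kappa>_def)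
  from torus_approx[OF f(1) _ e, of \<kappa>] \<kappa> obtain g where g: "trig_poly g" "\<And>x. \<bar>F \<kappa> x - g x\<bar> < e"
    unfolding F_def by (metis less_irrefl)
  have g_m[measurable]: "g \<in> borel_measurable borel"
    by (rule borel_measurable_continuous_onI[OF trig_poly_continuous[OF g(1)]])
  from trig_poly_bounded[OF g(1)] obtain Bg where Bg: "\<And>x. \<bar>g x\<bar> \<le> Bg" by blast
  have int: "integrable M (\<lambda>w. f (X n w))" "integrable M (\<lambda>w. F \<kappa> (X n w))" "integrable M (\<lambda>w. g (X n w))"
    "integrable \<mu> (F \<kappa>)" "integrable \<mu> g" for n
    by (rule M.integrable_const_bound[of _ B] M.integrable_const_bound[of _ Bg]
        \<mu>.integrable_const_bound[of _ B] \<mu>.integrable_const_bound[of _ Bg]; simp add: B Fb Bg; fail)+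
  have g_lim: "(\<lambda>n. LINT w|M. g (X n w)) \<longlonglongrightarrow> (LINT x|\<mu>. g x)"
    by (rule trig_poly_expectation_tendsto[OF M \<mu> X char g(1)])
  have d\<mu>: "\<bar>(LINT x|\<mu>. F \<kappa> x) - (LINT x|\<mu>. g x)\<bar> \<le> e"
  proof -
    have "\<bar>LINT x|\<mu>. F \<kappa> x - g x\<bar> \<le> (LINT x|\<mu>. e)"
      using norm_integral_le[of \<mu> "\<lambda>x. F \<kappa> x - g x" "\<lambda>_. e"] int g(2) by (simp add: less_imp_le)
    then show ?thesis using int by (simp add: \<mu>.prob_space)
  qed
  have dM: "\<bar>(LINT w|M. F \<kappa> (X n w)) - (LINT w|M. g (X n w))\<bar> \<le> e" for n
  proof -
    have "\<bar>LINT w|M. F \<kappa> (X n w) - g (X n w)\<bar> \<le> (LINT w|M. e)"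
      using norm_integral_le[of M "\<lambda>w. F \<kappa> (X n w) - g (X n w)" "\<lambda>_. e"] int g(2) by (simp add: less_imp_le)
    then show ?thesis using int by (simp add: M.prob_space)
  qed
  have dF: "\<bar>(LINT w|M. f (X n w)) - (LINT w|M. F \<kappa> (X n w))\<bar> \<le>
      e + 2 * B * measure M {w \<in> space M. r < norm (X n w)}" for n
  proof -
    let ?A = "{w \<in> space M. r < norm (X n w)}"
    have [measurable]: "?A \<in> sets M" by measurable
    have iA: "integrable M (\<lambda>w. indicat_real ?A w)"
      by (rule M.integrable_const_bound[of _ 1]) (auto split: split_indicator)
    have "\<bar>LINT w|M. f (X n w) - F \<kappa> (X n w)\<bar> \<le> (LINT w|M. e + 2 * B * indicator ?A w)"
    proof -
      have "AE w in M. \<bar>f (X n w) - F \<kappa> (X n w)\<bar> \<le> e + 2 * B * indicator ?A w"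
      proof (rule AE_I2)
        fix w assume w: "w \<in> space M"
        show "\<bar>f (X n w) - F \<kappa> (X n w)\<bar> \<le> e + 2 * B * indicator ?A w"
        proof (cases "norm (X n w) \<le> r")
          case True
          have "\<bar>f (X n w) - F \<kappa> (X n w)\<bar> \<le> B * (1 - cos (\<kappa> * r) ^ CARD('n))"
            unfolding F_def by (rule torus_fun_close[OF B(1) True \<kappa>]) (use m(3) in \<open>simp add: \<kappa>_def\<close>)
          also have "\<dots> \<le> e" using m(1) by (simp add: \<kappa>_def)
          finally show ?thesis using True by (simp add: indicator_def)
        next
          case False
          have "\<bar>f (X n w) - F \<kappa> (X n w)\<bar> \<le> 2 * B"
            using B(1)[of "X n w"] Fb[of \<kappa> "X n w"] by linarith
          then show ?thesis using False w e by (simp add: indicator_def)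
        qed
      qed
      moreover have "integrable M (\<lambda>w. f (X n w) - F \<kappa> (X n w))" using int by simp
      ultimately show ?thesis
        using iA by (intro order_trans[OF integral_abs_bound] integral_mono_AE) auto
    qed
    also have "\<dots> = e + 2 * B * measure M ?A"
      using iA by (simp add: M.prob_space)
    finally show ?thesis using int by simp
  qed
  have "eventually (\<lambda>n. norm ((LINT w|M. f (X n w)) - (LINT x|\<mu>. f x)) < e0) sequentially"
    using tight_r tendstoD[OF g_lim e]
  proof eventually_elim
    case (elim n)
    have "2 * B * measure M {w \<in> space M. r < norm (X n w)} \<le> 2 * B * e"
      using elim(1) B by (intro mult_left_mono) auto
    then have "norm ((LINT w|M. f (X n w)) - (LINT x|\<mu>. f x)) < 5 * e + 2 * B * e"
      using dF[of n] dM[of n] d\<mu> m(2) elim(2) unfolding \<kappa>_def[symmetric] dist_real_def real_norm_def by linarith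
    also have "\<dots> \<le> e0"
    proof -
      have "e0 = 8 * (B + 1) * e" using B by (simp add: e_def)
      then show ?thesis using B(2) e by (simp add: algebra_simps)
    qed
    finally show ?case .
  qed
  then show "\<exists>no. \<forall>n\<ge>no. norm ((LINT w|M. f (X n w)) - (LINT x|\<mu>. f x)) < e0"
    unfolding eventually_sequentially .
qed

section \<open>Positive semidefinite matrices and the existence of normal laws\<close>

lemma psd_row_zero:
  fixes S :: "real^'n^'n"
  assumes sym: "transpose S = S" and psd: "\<And>u. 0 \<le> u \<bullet> (S *v u)" and "S $ i $ i = 0"
  shows "S $ i $ j = 0"
proof (rule ccontr)
  assume ij: "S $ i $ j \<noteq> 0"
  have sij: "S $ j $ i = S $ i $ j" using sym by (metis transpose_def vec_lambda_beta)
  \<comment> \<open>With a zero diagonal entry the form along \<open>e_j + t e_i\<close> is affine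
    in \<open>t\<close> with slope \<open>2 S_ij\<close>; this \<open>t\<close> gives it the value
    -1.\<close>
  define t where "t = - (S $ j $ j + 1) / (2 * S $ i $ j)"
  have "0 \<le> (axis j 1 + t *\<^sub>R axis i 1) \<bullet> (S *v (axis j 1 + t *\<^sub>R axis i 1))" by (rule psd)
  also have "\<dots> = S $ j $ j + 2 * t * S $ i $ j + t\<^sup>2 * S $ i $ i"
    by (simp add: matrix_vector_right_distrib matrix_vector_mult_scaleR matrix_vector_mult_basis
        inner_add_left inner_add_right inner_axis' column_def sij power2_eq_square algebra_simps)
  also have "\<dots> = - 1" using ij assms(3) by (simp add: t_def field_simps)
  finally show False by simp
qed

text \<open>A Cholesky decomposition, one row at a time.\<close>

lemma psd_sum_of_squares:
  fixes S :: "real^'n^'n"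
  assumes "transpose S = S" "\<And>u. 0 \<le> u \<bullet> (S *v u)"
  shows "\<exists>ls. \<forall>u. u \<bullet> (S *v u) = (\<Sum>l\<leftarrow>ls. (l \<bullet> u)\<^sup>2)"
  using assms
proof (induction "card {i. row i S \<noteq> 0}" arbitrary: S rule: less_induct)
  case less
  have sym: "S $ a $ b = S $ b $ a" for a b using less(2) by (metis transpose_def vec_lambda_beta)
  show ?case
  proof (cases "\<forall>i. S $ i $ i = 0")
    case True
    then have "S $ i $ j = 0" for i j using psd_row_zero[OF less(2,3)] by blast
    then have "S = 0" by (simp add: vec_eq_iff)
    then show ?thesis by (intro exI[of _ "[]"]) simp
  next
    case False
    then obtain i where i: "S $ i $ i \<noteq> 0" by blast
    have "0 \<le> axis i 1 \<bullet> (S *v axis i 1)" by (rule less(3))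
    then have ii: "S $ i $ i > 0" using i by (simp add: matrix_vector_mult_basis inner_axis' column_def)
    \<comment> \<open>The Schur complement: subtracting the square that belongs to row
      \<open>i\<close> clears row and column \<open>i\<close>.\<close>
    define T where "T = (\<chi> a b. S $ a $ b - S $ i $ a * S $ i $ b / S $ i $ i)"
    have T: "u \<bullet> (T *v u) = u \<bullet> (S *v u) - (row i S \<bullet> u)\<^sup>2 / S $ i $ i" for u
    proof -
      have "(T *v u) $ a = (S *v u) $ a - S $ i $ a * (row i S \<bullet> u) / S $ i $ i" for a
        unfolding T_def matrix_vector_mult_def inner_vec_def row_def
        by (simp add: left_diff_distrib right_diff_distrib sum_subtractf sum_distrib_left sum_divide_distrib mult_ac)
      then have "u \<bullet> (T *v u) = u \<bullet> (S *v u) - (\<Sum>a\<in>UNIV. u $ a * (S $ i $ a * (row i S \<bullet> u) / S $ i $ i))"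
        unfolding inner_vec_def[of u] by (simp add: right_diff_distrib sum_subtractf)
      also have "(\<Sum>a\<in>UNIV. u $ a * (S $ i $ a * (row i S \<bullet> u) / S $ i $ i)) =
          (row i S \<bullet> u) * (row i S \<bullet> u) / S $ i $ i"
        by (subst (2) inner_vec_def)
          (simp add: row_def sum_distrib_left sum_divide_distrib mult_ac)
      finally show ?thesis by (simp add: power2_eq_square)
    qed
    have "transpose T = T"
      unfolding T_def transpose_def by (simp add: vec_eq_iff sym mult.commute)
    moreover have "0 \<le> u \<bullet> (T *v u)" for u
    proof -
      \<comment> \<open>The minimiser of the form of \<open>S\<close> along
        \<open>u - t e_i\<close>; its minimal value is the form of \<open>T\<close> at
        \<open>u\<close>, which is therefore nonnegative.\<close>
      define t where "t = (row i S \<bullet> u) / S $ i $ i"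
      have Si: "(S *v u) $ i = row i S \<bullet> u" by (simp add: matrix_vector_mul_component row_def)
      have Sa: "u \<bullet> (S *v axis i 1) = row i S \<bullet> u"
        unfolding matrix_vector_mult_basis column_def row_def inner_vec_def
        by (rule sum.cong[OF refl]) (metis mult.commute sym vec_lambda_beta inner_real_def)
      have "0 \<le> (u - t *\<^sub>R axis i 1) \<bullet> (S *v (u - t *\<^sub>R axis i 1))" by (rule less(3))
      also have "\<dots> = u \<bullet> (S *v u) - 2 * t * (row i S \<bullet> u) + t\<^sup>2 * S $ i $ i"
        using Si Sa
        by (simp add: matrix_vector_mult_diff_distrib matrix_vector_mult_scaleR inner_diff_left inner_diff_right
          inner_axis' power2_eq_square algebra_simps)
          (simp add: matrix_vector_mult_basis column_def)
      also have "\<dots> = u \<bullet> (T *v u)"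
        unfolding T using ii by (simp add: t_def power2_eq_square field_simps)
      finally show ?thesis .
    qed
    moreover have "card {a. row a T \<noteq> 0} < card {a. row a S \<noteq> 0}"
    proof (rule psubset_card_mono)
      have "row a T = 0" if "row a S = 0" for a
      proof -
        have "S $ a $ b = 0" for b using that by (simp add: row_def vec_eq_iff)
        moreover from this[of i] have "S $ i $ a = 0" unfolding sym[of i a] .
        ultimately show ?thesis by (simp add: row_def T_def vec_eq_iff)
      qed
      moreover have "row i T = 0" using ii by (simp add: row_def T_def vec_eq_iff)
      moreover have "row i S \<noteq> 0" using i by (auto simp: row_def vec_eq_iff)
      ultimately show "{a. row a T \<noteq> 0} \<subset> {a. row a S \<noteq> 0}" by blast
    qed simp
    ultimately obtain ls where ls: "\<And>u. u \<bullet> (T *v u) = (\<Sum>l\<leftarrow>ls. (l \<bullet> u)\<^sup>2)"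
      using less(1)[of T] by blast
    have "u \<bullet> (S *v u) = (\<Sum>l\<leftarrow>(1 / sqrt (S $ i $ i)) *\<^sub>R row i S # ls. (l \<bullet> u)\<^sup>2)" for u
      using T[of u] ls[of u] ii by (simp add: power_divide)
    then show ?thesis by blast
  qed
qed

text \<open>The law of a sum of the vectors \<open>l\<close> multiplied by independent standard
  normal variables, built by adding one independent summand at a time.\<close>

lemma exists_gaussian_law:
  fixes ls :: "(real^'n) list"
  shows "\<exists>\<mu>. prob_space \<mu> \<and> sets \<mu> = sets borel \<and>
    (\<forall>u. (CLINT x|\<mu>. iexp (u \<bullet> x)) = complex_of_real (exp (- (\<Sum>l\<leftarrow>ls. (l \<bullet> u)\<^sup>2) / 2)))"
proof (induction ls)
  case Nil
  have "prob_space (return borel (0 :: real^'n))" by (rule prob_space_return) simp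
  moreover have "(CLINT x|return borel (0 :: real^'n). iexp (u \<bullet> x)) = 1" for u
    by (subst integral_return) auto
  ultimately show ?case by (intro exI[of _ "return borel 0"]) simp
next
  case (Cons l ls)
  then obtain \<mu> where \<mu>: "prob_space \<mu>" "sets \<mu> = sets borel"
    "\<And>u. (CLINT x|\<mu>. iexp (u \<bullet> x)) = complex_of_real (exp (- (\<Sum>l\<leftarrow>ls. (l \<bullet> u)\<^sup>2) / 2))" by blast
  let ?S = "std_normal_distribution"
  interpret \<mu>: prob_space \<mu> by fact
  interpret S: prob_space ?S using prob_space_normal_density[of 1 0] by simp
  interpret P: pair_prob_space ?S \<mu> ..
  note [measurable_cong] = \<mu>(2)
  define \<nu> where "\<nu> = distr (?S \<Otimes>\<^sub>M \<mu>) borel (\<lambda>(z, x). z *\<^sub>R l + x)"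
  have "prob_space \<nu>" unfolding \<nu>_def by (rule P.prob_space_distr) measurable
  moreover have "(CLINT x|\<nu>. iexp (u \<bullet> x)) = complex_of_real (exp (- (\<Sum>l\<leftarrow>l # ls. (l \<bullet> u)\<^sup>2) / 2))" for u
  proof -
    have int: "integrable (?S \<Otimes>\<^sub>M \<mu>) (\<lambda>p. iexp (u \<bullet> (fst p *\<^sub>R l + snd p)))"
      using P.integrable_iexp_rv[of "\<lambda>p. u \<bullet> (fst p *\<^sub>R l + snd p)" 1] by simp
    have "(CLINT x|\<nu>. iexp (u \<bullet> x)) = (CLINT p|(?S \<Otimes>\<^sub>M \<mu>). iexp (u \<bullet> (fst p *\<^sub>R l + snd p)))"
      unfolding \<nu>_def by (subst integral_distr) (auto simp: case_prod_beta)
    also have "\<dots> = (CLINT z|?S. CLINT x|\<mu>. iexp (u \<bullet> (z *\<^sub>R l + x)))"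
      using P.integral_fst'[OF int] by simp
    also have "\<dots> = (CLINT z|?S. iexp ((l \<bullet> u) * z) * (CLINT x|\<mu>. iexp (u \<bullet> x)))"
    proof (intro Bochner_Integration.integral_cong refl)
      fix z
      have "iexp (u \<bullet> (z *\<^sub>R l + x)) = iexp ((l \<bullet> u) * z) * iexp (u \<bullet> x)" for x
        by (simp add: inner_add_right exp_add[symmetric] algebra_simps inner_commute)
      then show "(CLINT x|\<mu>. iexp (u \<bullet> (z *\<^sub>R l + x))) = iexp ((l \<bullet> u) * z) * (CLINT x|\<mu>. iexp (u \<bullet> x))"
        by simp
    qed
    also have "\<dots> = char ?S (l \<bullet> u) * (CLINT x|\<mu>. iexp (u \<bullet> x))"
      unfolding char_def by simp
    finally show ?thesis
      by (simp add: char_std_normal_distribution \<mu>(3) exp_add[symmetric] add_divide_distrib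
          flip: of_real_mult)
  qed
  ultimately show ?case by (intro exI[of _ \<nu>]) (simp add: \<nu>_def)
qed

text \<open>Only the quadratic form of \<open>S\<close> matters for the law, so the decomposition
  into squares is applied to the symmetric part of \<open>S\<close>.\<close>

lemma exists_mvnormal:
  fixes S :: "real^'n^'n"
  assumes psd: "\<And>u. 0 \<le> u \<bullet> (S *v u)"
  shows "\<exists>\<mu>. is_mvnormal \<mu> S \<and> (\<forall>u. (CLINT x|\<mu>. iexp (u \<bullet> x)) = complex_of_real (exp (- (u \<bullet> (S *v u)) / 2)))"
proof -
  define T where "T = (1/2) *\<^sub>R (S + transpose S)"
  have T: "u \<bullet> (T *v u) = u \<bullet> (S *v u)" for u
  proof -
    have "u \<bullet> (transpose S *v u) = u \<bullet> (S *v u)"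
      by (metis dot_lmul_matrix inner_commute vector_transpose_matrix)
    then show ?thesis
      by (simp add: T_def scaleR_matrix_vector_assoc[symmetric] matrix_vector_mult_add_rdistrib inner_add_right)
  qed
  have "transpose T = T" by (simp add: T_def transpose_def vec_eq_iff)
  then obtain ls where ls: "\<And>u. u \<bullet> (T *v u) = (\<Sum>l\<leftarrow>ls. (l \<bullet> u)\<^sup>2)"
    using psd_sum_of_squares[of T] psd T by auto
  from exists_gaussian_law[of ls] obtain \<mu> where \<mu>: "prob_space \<mu>" "sets \<mu> = sets borel"
    "\<And>u. (CLINT x|\<mu>. iexp (u \<bullet> x)) = complex_of_real (exp (- (\<Sum>l\<leftarrow>ls. (l \<bullet> u)\<^sup>2) / 2))" by blast
  interpret \<mu>: prob_space \<mu> by fact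
  note [measurable_cong] = \<mu>(2)
  have ch: "(CLINT x|\<mu>. iexp (u \<bullet> x)) = complex_of_real (exp (- (u \<bullet> (S *v u)) / 2))" for u
    using \<mu>(3)[of u] ls[of u] T[of u] by simp
  have "distr \<mu> borel (\<lambda>x. u \<bullet> x) = centered_normal (sqrt (u \<bullet> (S *v u)))" for u
  proof (rule Levy_uniqueness)
    show "real_distribution (distr \<mu> borel (\<lambda>x. u \<bullet> x))" by (rule \<mu>.real_distribution_distr) measurable
    show "real_distribution (centered_normal (sqrt (u \<bullet> (S *v u))))"
      by (rule real_distribution_centered_normal) (simp add: psd)
    show "char (distr \<mu> borel (\<lambda>x. u \<bullet> x)) = char (centered_normal (sqrt (u \<bullet> (S *v u))))"
    proof
      fix t
      have "char (distr \<mu> borel (\<lambda>x. u \<bullet> x)) t = (CLINT x|\<mu>. iexp ((t *\<^sub>R u) \<bullet> x))"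
        by (subst \<mu>.char_distr_eq) auto
      also have "\<dots> = complex_of_real (exp (- ((t *\<^sub>R u) \<bullet> (S *v (t *\<^sub>R u))) / 2))" by (rule ch)
      also have "\<dots> = char (centered_normal (sqrt (u \<bullet> (S *v u)))) t"
        by (subst char_centered_normal)
          (simp_all add: psd matrix_vector_mult_scaleR power2_eq_square mult_ac)
      finally show "char (distr \<mu> borel (\<lambda>x. u \<bullet> x)) t = char (centered_normal (sqrt (u \<bullet> (S *v u)))) t" .
    qed
  qed
  then have "is_mvnormal \<mu> S" using \<mu> psd by (simp add: is_mvnormal_def)
  with ch show ?thesis by blast
qed

section \<open>The process in the eigenbasis\<close>

lemma sq_integrableD:
  assumes "sq_integrable M f"
  shows "f \<in> borel_measurable M" "integrable M (\<lambda>w. (norm (f w))\<^sup>2)"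
  using assms by (auto simp: sq_integrable_def)

lemma sq_integrable_bounded_linear:
  fixes T :: "'a::euclidean_space \<Rightarrow> 'b::euclidean_space"
  assumes T: "bounded_linear T" and f: "sq_integrable M f"
  shows "sq_integrable M (\<lambda>w. T (f w))"
  unfolding sq_integrable_def
proof
  note [measurable] = sq_integrableD(1)[OF f]
  have [measurable]: "T \<in> borel_measurable borel"
    by (intro borel_measurable_continuous_onI linear_continuous_on T)
  show m: "(\<lambda>w. T (f w)) \<in> borel_measurable M" by measurable
  from bounded_linear.bounded[OF T] obtain K where K: "\<And>x. norm (T x) \<le> norm x * K" by blast
  have "norm ((norm (T (f w)))\<^sup>2) \<le> norm (K\<^sup>2 * (norm (f w))\<^sup>2)" for w
    using power_mono[OF K[of "f w"], of 2] by (simp add: power_mult_distrib mult.commute)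
  then show "integrable M (\<lambda>w. (norm (T (f w)))\<^sup>2)"
    by (intro Bochner_Integration.integrable_bound[OF integrable_mult_right[OF sq_integrableD(2)[OF f], of "K\<^sup>2"]])
      auto
qed

lemma sq_integrable_add:
  fixes f g :: "'w \<Rightarrow> 'a::euclidean_space"
  assumes "sq_integrable M f" "sq_integrable M g"
  shows "sq_integrable M (\<lambda>w. f w + g w)"
  unfolding sq_integrable_def
proof
  note [measurable] = sq_integrableD(1)[OF assms(1)] sq_integrableD(1)[OF assms(2)]
  show "(\<lambda>w. f w + g w) \<in> borel_measurable M" by measurable
  have "norm ((norm (f w + g w))\<^sup>2) \<le> norm (2 * (norm (f w))\<^sup>2 + 2 * (norm (g w))\<^sup>2)" for w
  proof -
    have "(norm (f w + g w))\<^sup>2 \<le> (norm (f w) + norm (g w))\<^sup>2"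
      by (intro power_mono norm_triangle_ineq) simp
    also have "\<dots> \<le> 2 * (norm (f w))\<^sup>2 + 2 * (norm (g w))\<^sup>2"
      using sum_squares_bound[of "norm (f w)" "norm (g w)"] unfolding power2_sum by linarith
    finally show ?thesis by simp
  qed
  then have "AE w in M. norm ((norm (f w + g w))\<^sup>2) \<le> norm (2 * (norm (f w))\<^sup>2 + 2 * (norm (g w))\<^sup>2)"
    by (intro AE_I2)
  moreover have "integrable M (\<lambda>w. 2 * (norm (f w))\<^sup>2 + 2 * (norm (g w))\<^sup>2)"
    by (intro Bochner_Integration.integrable_add integrable_mult_right sq_integrableD(2) assms)
  moreover have "(\<lambda>w. (norm (f w + g w))\<^sup>2) \<in> borel_measurable M" by measurable
  ultimately show "integrable M (\<lambda>w. (norm (f w + g w))\<^sup>2)"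
    using Bochner_Integration.integrable_bound by blast
qed

lemma sq_integrable_scaleR:
  fixes f :: "'w \<Rightarrow> 'a::euclidean_space"
  shows "sq_integrable M f \<Longrightarrow> sq_integrable M (\<lambda>w. c *\<^sub>R f w)"
  by (rule sq_integrable_bounded_linear[OF bounded_linear_scaleR_right])

lemma sq_integrable_diff:
  fixes f g :: "'w \<Rightarrow> 'a::euclidean_space"
  assumes "sq_integrable M f" "sq_integrable M g"
  shows "sq_integrable M (\<lambda>w. f w - g w)"
  using sq_integrable_add[OF assms(1) sq_integrable_scaleR[OF assms(2), of "-1"]] by simp

lemma sq_integrable_sum:
  fixes f :: "'i \<Rightarrow> 'w \<Rightarrow> 'a::euclidean_space"
  shows "(\<And>i. i \<in> I \<Longrightarrow> sq_integrable M (f i)) \<Longrightarrow> sq_integrable M (\<lambda>w. \<Sum>i\<in>I. f i w)"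
proof (induction I rule: infinite_finite_induct)
  case (insert i I)
  then show ?case using sq_integrable_add[of M "f i" "\<lambda>w. \<Sum>i\<in>I. f i w"] by simp
qed (simp_all add: sq_integrable_def)

lemma sq_integrable_inner:
  fixes f :: "'w \<Rightarrow> 'a::euclidean_space"
  assumes "sq_integrable M f"
  shows "(\<lambda>w. f w \<bullet> b) \<in> borel_measurable M" "integrable M (\<lambda>w. (f w \<bullet> b)\<^sup>2)"
  using sq_integrable_bounded_linear[OF bounded_linear_inner_left assms, of b]
  by (auto simp: sq_integrable_def)

lemma integrable_inner_sq:
  fixes f g :: "'w \<Rightarrow> 'a::euclidean_space"
  assumes "sq_integrable M f" "sq_integrable M g"
  shows "integrable M (\<lambda>w. f w \<bullet> g w)"
proof -
  have "integrable M (\<lambda>w. \<Sum>b\<in>Basis. (f w \<bullet> b) * (g w \<bullet> b))"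
    by (intro Bochner_Integration.integrable_sum square_integrable_mult sq_integrable_inner assms)
  then show ?thesis by (simp only: euclidean_inner[symmetric])
qed

lemma L2_norm_inner_tendsto:
  fixes f :: "nat \<Rightarrow> 'w \<Rightarrow> 'a::euclidean_space"
  assumes f: "\<And>n. sq_integrable M (f n)" and F: "sq_integrable M F"
    and lim: "(\<lambda>n. L2_norm M (\<lambda>w. F w - f n w)) \<longlonglongrightarrow> 0"
  shows "(\<lambda>n. LINT w|M. (f n w \<bullet> b - F w \<bullet> b)\<^sup>2) \<longlonglongrightarrow> 0"
proof (rule tendsto_zero_sandwich[where g = "\<lambda>n. (norm b)\<^sup>2 * (L2_norm M (\<lambda>w. F w - f n w))\<^sup>2"])
  fix n
  note d = sq_integrable_diff[OF F f[of n]]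
  have "(LINT w|M. (f n w \<bullet> b - F w \<bullet> b)\<^sup>2) \<le> (LINT w|M. (norm b)\<^sup>2 * (norm (F w - f n w))\<^sup>2)"
  proof (rule integral_mono)
    show "integrable M (\<lambda>w. (f n w \<bullet> b - F w \<bullet> b)\<^sup>2)"
      using sq_integrable_inner(2)[OF sq_integrable_diff[OF f[of n] F], of b] by (simp add: inner_diff_left)
    show "integrable M (\<lambda>w. (norm b)\<^sup>2 * (norm (F w - f n w))\<^sup>2)"
      using sq_integrableD(2)[OF d] by simp
    fix w
    have "\<bar>(F w - f n w) \<bullet> b\<bar>\<^sup>2 \<le> (norm (F w - f n w) * norm b)\<^sup>2"
      by (intro power_mono Cauchy_Schwarz_ineq2) simp
    then show "(f n w \<bullet> b - F w \<bullet> b)\<^sup>2 \<le> (norm b)\<^sup>2 * (norm (F w - f n w))\<^sup>2"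
      by (simp add: inner_diff_left power_mult_distrib mult.commute power2_commute)
  qed
  also have "\<dots> = (norm b)\<^sup>2 * (L2_norm M (\<lambda>w. F w - f n w))\<^sup>2"
    by (simp add: L2_norm_def)
  finally show "\<bar>LINT w|M. (f n w \<bullet> b - F w \<bullet> b)\<^sup>2\<bar> \<le> (norm b)\<^sup>2 * (L2_norm M (\<lambda>w. F w - f n w))\<^sup>2"
    by simp
next
  show "(\<lambda>n. (norm b)\<^sup>2 * (L2_norm M (\<lambda>w. F w - f n w))\<^sup>2) \<longlonglongrightarrow> 0"
    using tendsto_mult[OF tendsto_const[of "(norm b)\<^sup>2"] tendsto_power[OF lim, of 2]] by simp
qed

lemma L2_inner_limit:
  fixes f g :: "nat \<Rightarrow> 'w \<Rightarrow> 'a::euclidean_space"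
  assumes "\<And>n. sq_integrable M (f n)" "\<And>n. sq_integrable M (g n)" "sq_integrable M F" "sq_integrable M G"
    and "(\<lambda>n. L2_norm M (\<lambda>w. F w - f n w)) \<longlonglongrightarrow> 0" "(\<lambda>n. L2_norm M (\<lambda>w. G w - g n w)) \<longlonglongrightarrow> 0"
  shows "(\<lambda>n. LINT w|M. f n w \<bullet> g n w) \<longlonglongrightarrow> (LINT w|M. F w \<bullet> G w)"
proof -
  have eq: "(LINT w|M. f w \<bullet> g w) = (\<Sum>b\<in>Basis. LINT w|M. (f w \<bullet> b) * (g w \<bullet> b))"
    if "sq_integrable M f" "sq_integrable M g" for f g :: "'w \<Rightarrow> 'a"
  proof -
    have "(LINT w|M. f w \<bullet> g w) = (LINT w|M. (\<Sum>b\<in>Basis. (f w \<bullet> b) * (g w \<bullet> b)))"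
      by (simp only: euclidean_inner[symmetric])
    also have "\<dots> = (\<Sum>b\<in>Basis. LINT w|M. (f w \<bullet> b) * (g w \<bullet> b))"
      by (intro Bochner_Integration.integral_sum square_integrable_mult sq_integrable_inner that)
    finally show ?thesis .
  qed
  have "(\<lambda>n. \<Sum>b\<in>Basis. LINT w|M. (f n w \<bullet> b) * (g n w \<bullet> b)) \<longlonglongrightarrow>
      (\<Sum>b\<in>Basis. LINT w|M. (F w \<bullet> b) * (G w \<bullet> b))"
    by (intro tendsto_sum L2_product_limit sq_integrable_inner L2_norm_inner_tendsto assms)
  then show ?thesis unfolding eq[OF assms(1,2)] eq[OF assms(3,4)] .
qed

lemma L2_norm_bounded_linear_tendsto:
  fixes T :: "'a::euclidean_space \<Rightarrow> 'b::euclidean_space"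
  assumes T: "bounded_linear T" and f: "\<And>n. sq_integrable M (f n)" and F: "sq_integrable M F"
    and lim: "(\<lambda>n. L2_norm M (\<lambda>w. F w - f n w)) \<longlonglongrightarrow> 0"
  shows "(\<lambda>n. L2_norm M (\<lambda>w. T (F w) - T (f n w))) \<longlonglongrightarrow> 0"
proof -
  from bounded_linear.nonneg_bounded[OF T] obtain K where K: "0 \<le> K" "\<And>x. norm (T x) \<le> norm x * K" by blast
  show ?thesis
  proof (rule tendsto_zero_sandwich[where g = "\<lambda>n. K * L2_norm M (\<lambda>w. F w - f n w)"])
    fix n
    note d = sq_integrable_diff[OF F f[of n]]
    have "(LINT w|M. (norm (T (F w) - T (f n w)))\<^sup>2) \<le> (LINT w|M. K\<^sup>2 * (norm (F w - f n w))\<^sup>2)"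
    proof (rule integral_mono)
      show "integrable M (\<lambda>w. (norm (T (F w) - T (f n w)))\<^sup>2)"
        using sq_integrableD(2)[OF sq_integrable_bounded_linear[OF T d]]
        by (simp add: linear_diff[OF bounded_linear.linear[OF T]])
      show "integrable M (\<lambda>w. K\<^sup>2 * (norm (F w - f n w))\<^sup>2)"
        using sq_integrableD(2)[OF d] by simp
      show "(norm (T (F w) - T (f n w)))\<^sup>2 \<le> K\<^sup>2 * (norm (F w - f n w))\<^sup>2" for w
        using power_mono[OF K(2)[of "F w - f n w"], of 2]
        by (simp add: linear_diff[OF bounded_linear.linear[OF T]] power_mult_distrib mult.commute)
    qed
    then have "sqrt (LINT w|M. (norm (T (F w) - T (f n w)))\<^sup>2) \<le> sqrt (K\<^sup>2 * (LINT w|M. (norm (F w - f n w))\<^sup>2))"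
      by simp
    then show "\<bar>L2_norm M (\<lambda>w. T (F w) - T (f n w))\<bar> \<le> K * L2_norm M (\<lambda>w. F w - f n w)"
      using K(1) by (simp add: L2_norm_def real_sqrt_mult)
  qed (use tendsto_mult_right_zero[OF lim] in simp)
qed

section \<open>The Wiener integral: isometry\<close>

lemma gaussian_random_measure_gauss:
  assumes R: "gaussian_random_measure N R" and "finite \<E>" "\<E> \<subseteq> fin_borel"
  shows "gauss N (\<lambda>w. Re (\<Sum>E\<in>\<E>. \<Sum>i\<in>UNIV. c E $ i * R E w $ i))"
  unfolding gauss_def
proof
  have [measurable]: "R E \<in> borel_measurable N" if "E \<in> \<E>" for E
    using R assms(3) that by (auto simp: gaussian_random_measure_def)
  have [measurable]: "(\<lambda>w. R E w $ i) \<in> borel_measurable N" if "E \<in> \<E>" for E i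
    using borel_measurable_continuous_on[of "\<lambda>x. x $ i", OF _ \<open>E \<in> \<E> \<Longrightarrow> R E \<in> borel_measurable N\<close>] that
    by (simp add: continuous_on_component)
  show "(\<lambda>w. Re (\<Sum>E\<in>\<E>. \<Sum>i\<in>UNIV. c E $ i * R E w $ i)) \<in> borel_measurable N" by measurable
  show "\<exists>\<sigma>\<ge>0. distr N borel (\<lambda>w. Re (\<Sum>E\<in>\<E>. \<Sum>i\<in>UNIV. c E $ i * R E w $ i)) = centered_normal \<sigma>"
    using R assms(2,3) by (simp add: gaussian_random_measure_def)
qed

lemma norm_vec_squared: "(norm x)\<^sup>2 = (\<Sum>i\<in>UNIV. (norm (x $ i))\<^sup>2)" for x :: "'a::real_inner^'n"
  unfolding power2_norm_eq_inner by (simp add: inner_vec_def)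

lemma sq_integrable_random_measure:
  fixes R :: "real set \<Rightarrow> 'v \<Rightarrow> complex^'n"
  assumes R: "gaussian_random_measure N R" and E: "E \<in> fin_borel"
  shows "sq_integrable N (R E)"
  unfolding sq_integrable_def
proof
  interpret prob_space N using R by (simp add: gaussian_random_measure_def)
  show "R E \<in> borel_measurable N" using R E by (auto simp: gaussian_random_measure_def)
  \<comment> \<open>The coefficient 1 extracts the real part of a component and the coefficient
    \<open>- \<i>\<close> its imaginary part.\<close>
  have "gauss N (\<lambda>w. Re (\<Sum>F\<in>{E}. \<Sum>k\<in>UNIV. (axis i 1 :: complex^'n) $ k * R F w $ k))"
    "gauss N (\<lambda>w. Re (\<Sum>F\<in>{E}. \<Sum>k\<in>UNIV. (axis i (- \<i>) :: complex^'n) $ k * R F w $ k))" for i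
    by (rule gaussian_random_measure_gauss[OF R]; simp add: E)+
  moreover have "(\<Sum>k\<in>UNIV. (axis i z :: complex^'n) $ k * v $ k) = z * v $ i" for i z v
    by (simp add: axis_def if_distrib[where f = "\<lambda>x. x * _"] cong: if_cong)
  ultimately have "gauss N (\<lambda>w. Re (R E w $ i))" "gauss N (\<lambda>w. Im (R E w $ i))" for i
    by simp_all
  then have "integrable N (\<lambda>w. (Re (R E w $ i))\<^sup>2)" "integrable N (\<lambda>w. (Im (R E w $ i))\<^sup>2)" for i
    by (intro all_moments_integrable all_moments_power gauss_moments(1); simp)+
  then show "integrable N (\<lambda>w. (norm (R E w))\<^sup>2)"
    unfolding norm_vec_squared cmod_power2 by simp
qed

text \<open>For complex scalars and vectors the inner product is \<open>x \<bullet> y = Re (\<Sum>\<^sub>i x\<^sub>i cnj y\<^sub>i)\<close>.\<close>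

lemma inner_complex_Re: "x \<bullet> y = Re (x * cnj y)" for x y :: complex
  by (simp add: inner_complex_def)

text \<open>Real linear functionals of the vector integrals, applied to the integrand and, as
  \<open>comb\<close>, to the integral. They reduce matrix-valued integrals to scalar ones.\<close>

definition row_comb :: "real^'m \<Rightarrow> complex^'n^'m \<Rightarrow> complex^'n" where
  "row_comb a C = (\<chi> l. \<Sum>i\<in>UNIV. complex_of_real (a $ i) * C $ i $ l)"

definition comb :: "real^'m \<Rightarrow> complex^'m \<Rightarrow> complex" where
  "comb a y = (\<Sum>i\<in>UNIV. complex_of_real (a $ i) * y $ i)"

lemma bounded_linear_row_comb: "bounded_linear (row_comb a :: complex^'n^'m \<Rightarrow> complex^'n)"
  by (intro linear_conv_bounded_linear[THEN iffD1] linearI)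
    (simp_all add: row_comb_def vec_eq_iff distrib_left sum.distrib scaleR_sum_right)

lemma bounded_linear_comb: "bounded_linear (comb a)"
  by (intro linear_conv_bounded_linear[THEN iffD1] linearI)
    (simp_all add: comb_def distrib_left sum.distrib scaleR_sum_right)

lemma comb_matrix_vector: "comb a (C *v y) = (\<Sum>l\<in>UNIV. row_comb a C $ l * y $ l)"
proof -
  have "comb a (C *v y) = (\<Sum>i\<in>UNIV. \<Sum>l\<in>UNIV. complex_of_real (a $ i) * C $ i $ l * y $ l)"
    by (simp add: comb_def matrix_vector_mult_def sum_distrib_left mult.assoc)
  also have "\<dots> = (\<Sum>l\<in>UNIV. \<Sum>i\<in>UNIV. complex_of_real (a $ i) * C $ i $ l * y $ l)"
    by (rule sum.swap)
  finally show ?thesis by (simp add: row_comb_def sum_distrib_right)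
qed

text \<open>The covariance of the random measure puts the length of \<open>E \<inter> F\<close> on
  equal components. Since overlaps are measured, the two families may be unrelated and their sets
  need not be disjoint.\<close>

lemma random_measure_isometry:
  fixes R :: "real set \<Rightarrow> 'v \<Rightarrow> complex^'n" and C C' :: "real set \<Rightarrow> complex^'n^'m"
  assumes R: "gaussian_random_measure N R"
    and E: "finite \<E>" "\<E> \<subseteq> fin_borel" and E': "finite \<E>'" "\<E>' \<subseteq> fin_borel"
  shows "(LINT w|N. comb a (\<Sum>E\<in>\<E>. C E *v R E w) \<bullet> comb b (\<Sum>E\<in>\<E>'. C' E *v R E w)) =
    (LINT x|lborel. row_comb a (\<Sum>E\<in>\<E>. indicator E x *\<^sub>R C E) \<bullet> row_comb b (\<Sum>E\<in>\<E>'. indicator E x *\<^sub>R C' E))"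
proof -
  note comb_sum = linear_sum[OF bounded_linear.linear[OF bounded_linear_comb]]
  note row_comb_sum = linear_sum[OF bounded_linear.linear[OF bounded_linear_row_comb]]
  note row_comb_scaleR = linear_scale[OF bounded_linear.linear[OF bounded_linear_row_comb]]
  have cov: "(LINT w|N. R E w $ l * cnj (R F w $ k)) = (if l = k then complex_of_real (measure lborel (E \<inter> F)) else 0)"
    if "E \<in> fin_borel" "F \<in> fin_borel" for E F l k
    using R that by (simp add: gaussian_random_measure_def)
  have comp: "sq_integrable N (\<lambda>w. R E w $ l)" if "E \<in> fin_borel" for E l
    by (rule sq_integrable_bounded_linear[OF bounded_linear_vec_nth sq_integrable_random_measure[OF R that]])
  have int: "integrable N (\<lambda>w. R E w $ l * cnj (R F w $ k))" if "E \<in> fin_borel" "F \<in> fin_borel" for E F l k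
  proof -
    note [measurable] = sq_integrableD(1)[OF comp[OF that(1), of l]] sq_integrableD(1)[OF comp[OF that(2), of k]]
    have [measurable]: "cnj \<in> borel_measurable borel"
      by (intro borel_measurable_continuous_onI continuous_intros)
    have "integrable N (\<lambda>w. (cmod (R E w $ l))\<^sup>2 + (cmod (R F w $ k))\<^sup>2)"
      by (intro Bochner_Integration.integrable_add sq_integrableD(2) comp that)
    then show ?thesis
    proof (rule Bochner_Integration.integrable_bound)
      show "(\<lambda>w. R E w $ l * cnj (R F w $ k)) \<in> borel_measurable N" by measurable
      show "AE w in N. norm (R E w $ l * cnj (R F w $ k)) \<le> norm ((cmod (R E w $ l))\<^sup>2 + (cmod (R F w $ k))\<^sup>2)"
        using abs_mult_le_sum_squares[of "cmod (R E _ $ l)" "cmod (R F _ $ k)"]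
        by (intro AE_I2) (simp add: norm_mult)
    qed
  qed
  have E_ii: "E \<in> fin_borel" if "E \<in> \<E>" for E using that E by auto
  have E'_ii: "E \<in> fin_borel" if "E \<in> \<E>'" for E using that E' by auto
  let ?c = "\<lambda>E l. row_comb a (C E) $ l" and ?d = "\<lambda>F k. row_comb b (C' F) $ k"
  have L: "comb a (\<Sum>E\<in>\<E>. C E *v R E w) \<bullet> comb b (\<Sum>E\<in>\<E>'. C' E *v R E w) =
    Re (\<Sum>E\<in>\<E>. \<Sum>F\<in>\<E>'. \<Sum>l\<in>UNIV. \<Sum>k\<in>UNIV. ?c E l * cnj (?d F k) * (R E w $ l * cnj (R F w $ k)))" for w
    unfolding comb_sum comb_matrix_vector inner_complex_Re cnj_sum complex_cnj_mult sum_product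
    by (simp add: mult_ac)
  have "(LINT w|N. comb a (\<Sum>E\<in>\<E>. C E *v R E w) \<bullet> comb b (\<Sum>E\<in>\<E>'. C' E *v R E w)) =
    Re (\<Sum>E\<in>\<E>. \<Sum>F\<in>\<E>'. \<Sum>l\<in>UNIV. \<Sum>k\<in>UNIV. ?c E l * cnj (?d F k) * (LINT w|N. R E w $ l * cnj (R F w $ k)))"
  proof -
    have i: "integrable N (\<lambda>w. ?c E l * cnj (?d F k) * (R E w $ l * cnj (R F w $ k)))" if "E \<in> \<E>" "F \<in> \<E>'" for E F l k
      by (intro integrable_mult_right int E_ii E'_ii that)
    show ?thesis unfolding L
      by (subst integral_Re, (intro Bochner_Integration.integrable_sum i; simp; fail))
        (simp add: i Bochner_Integration.integral_sum)
  qed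
  also have "\<dots> = (\<Sum>E\<in>\<E>. \<Sum>F\<in>\<E>'. \<Sum>l\<in>UNIV. Re (?c E l * cnj (?d F l)) * measure lborel (E \<inter> F))"
    by (simp add: cov E_ii E'_ii if_distrib[where f = "\<lambda>x. _ * x"] cong: if_cong sum.cong)
  also have "\<dots> = (\<Sum>E\<in>\<E>. \<Sum>F\<in>\<E>'. (row_comb a (C E) \<bullet> row_comb b (C' F)) * measure lborel (E \<inter> F))"
    by (simp add: inner_vec_def inner_complex_Re sum_distrib_right)
  also have "\<dots> = (LINT x|lborel. (\<Sum>E\<in>\<E>. \<Sum>F\<in>\<E>'. (row_comb a (C E) \<bullet> row_comb b (C' F)) * indicator (E \<inter> F) x))"
  proof -
    have "integrable lborel (\<lambda>x. indicator (E \<inter> F) x :: real)" if "E \<in> \<E>" "F \<in> \<E>'" for E F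
    proof -
      have s: "E \<in> sets lborel" "F \<in> sets lborel" "emeasure lborel E < \<infinity>"
        using E_ii[OF that(1)] E'_ii[OF that(2)] by (auto simp: fin_borel_def)
      have "emeasure lborel (E \<inter> F) \<le> emeasure lborel E" by (rule emeasure_mono) (use s in auto)
      then show ?thesis using s by (intro integrable_real_indicator) auto
    qed
    then show ?thesis by (simp add: Bochner_Integration.integral_sum)
  qed
  also have "\<dots> = (LINT x|lborel. row_comb a (\<Sum>E\<in>\<E>. indicator E x *\<^sub>R C E) \<bullet> row_comb b (\<Sum>E\<in>\<E>'. indicator E x *\<^sub>R C' E))"
    unfolding row_comb_sum row_comb_scaleR inner_sum_left inner_sum_right
    by (subst sum.swap) (simp add: indicator_inter_arith mult_ac)
  finally show ?thesis .
qed

lemma sq_integrable_indicator_scaleR: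
  fixes C :: "'a::euclidean_space"
  assumes "E \<in> fin_borel" shows "sq_integrable lborel (\<lambda>x. indicator E x *\<^sub>R C)"
proof -
  have [measurable]: "E \<in> sets borel" using assms by (simp add: fin_borel_def)
  have "integrable lborel (\<lambda>x. (norm C)\<^sup>2 * indicator E x :: real)"
    using assms by (intro integrable_mult_right integrable_real_indicator) (auto simp: fin_borel_def)
  moreover have "(norm (indicator E x *\<^sub>R C))\<^sup>2 = (norm C)\<^sup>2 * indicator E x" for x
    by (simp add: indicator_def)
  ultimately show ?thesis by (simp add: sq_integrable_def)
qed

text \<open>Both sides are inner products of mean-square limits, hence limits of the identity for
  simple integrands. The polarised form with two integrands is the one that yields
  covariances.\<close>

theorem wiener_integral_isometry:
  fixes R :: "real set \<Rightarrow> 'v \<Rightarrow> complex^'n" and f g :: "real \<Rightarrow> complex^'n^'m"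
  assumes R: "gaussian_random_measure N R"
    and f: "wiener_integral N R f Y" and g: "wiener_integral N R g Z"
  shows "(LINT w|N. comb a (Y w) \<bullet> comb b (Z w)) = (LINT x|lborel. row_comb a (f x) \<bullet> row_comb b (g x))"
proof -
  from f obtain \<E> C where f': "sq_integrable lborel f" "sq_integrable N Y"
    and E: "\<And>n. finite (\<E> n)" "\<And>n. \<E> n \<subseteq> fin_borel"
    and fl: "(\<lambda>n. L2_norm lborel (\<lambda>x. f x - (\<Sum>E\<in>\<E> n. indicator E x *\<^sub>R C n E))) \<longlonglongrightarrow> 0"
    and Yl: "(\<lambda>n. L2_norm N (\<lambda>w. Y w - (\<Sum>E\<in>\<E> n. C n E *v R E w))) \<longlonglongrightarrow> 0"
    unfolding wiener_integral_def by blast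
  from g obtain \<E>' C' where g': "sq_integrable lborel g" "sq_integrable N Z"
    and E': "\<And>n. finite (\<E>' n)" "\<And>n. \<E>' n \<subseteq> fin_borel"
    and gl: "(\<lambda>n. L2_norm lborel (\<lambda>x. g x - (\<Sum>E\<in>\<E>' n. indicator E x *\<^sub>R C' n E))) \<longlonglongrightarrow> 0"
    and Zl: "(\<lambda>n. L2_norm N (\<lambda>w. Z w - (\<Sum>E\<in>\<E>' n. C' n E *v R E w))) \<longlonglongrightarrow> 0"
    unfolding wiener_integral_def by blast
  have bl: "bounded_linear (\<lambda>y. A *v y :: complex^'m)" for A :: "complex^'n^'m"
    by (intro linear_conv_bounded_linear[THEN iffD1] linearI)
      (simp_all add: matrix_vector_mult_def vec_eq_iff distrib_left sum.distrib scaleR_sum_right)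
  have sN: "sq_integrable N (\<lambda>w. \<Sum>E\<in>\<E>. C E *v R E w)" if "\<E> \<subseteq> fin_borel" for \<E> and C :: "real set \<Rightarrow> complex^'n^'m"
    by (intro sq_integrable_sum sq_integrable_bounded_linear[OF bl] sq_integrable_random_measure[OF R])
      (use that in auto)
  have sl: "sq_integrable lborel (\<lambda>x. \<Sum>E\<in>\<E>. indicator E x *\<^sub>R C E)" if "\<E> \<subseteq> fin_borel"
    for \<E> and C :: "real set \<Rightarrow> complex^'n^'m"
    by (intro sq_integrable_sum sq_integrable_indicator_scaleR) (use that in auto)
  note lin = sq_integrable_bounded_linear[OF bounded_linear_comb] sq_integrable_bounded_linear[OF bounded_linear_row_comb]
    L2_norm_bounded_linear_tendsto[OF bounded_linear_comb] L2_norm_bounded_linear_tendsto[OF bounded_linear_row_comb]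
  have 1: "(\<lambda>n. LINT w|N. comb a (\<Sum>E\<in>\<E> n. C n E *v R E w) \<bullet> comb b (\<Sum>E\<in>\<E>' n. C' n E *v R E w))
      \<longlonglongrightarrow> (LINT w|N. comb a (Y w) \<bullet> comb b (Z w))"
    by (rule L2_inner_limit) (intro lin sN f' g' E E' Yl Zl)+
  have 2: "(\<lambda>n. LINT x|lborel. row_comb a (\<Sum>E\<in>\<E> n. indicator E x *\<^sub>R C n E) \<bullet> row_comb b (\<Sum>E\<in>\<E>' n. indicator E x *\<^sub>R C' n E))
      \<longlonglongrightarrow> (LINT x|lborel. row_comb a (f x) \<bullet> row_comb b (g x))"
    by (rule L2_inner_limit) (intro lin sl f' g' E E' fl gl)+
  show ?thesis
    using 1 2 unfolding random_measure_isometry[OF R E E'] by (rule LIMSEQ_unique)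
qed

section \<open>Matrix powers in an eigenbasis\<close>

lemma diag2_nth: "diag2 x y $ i $ k = (if i = k then (if i = 1 then x else y) else 0)"
  using exhaust_2[of i] exhaust_2[of k] by (auto simp: diag2_def vector_2)

lemma diag2_mult: "diag2 x y ** diag2 x' y' = diag2 (x * x') (y * y')"
  by (simp add: vec_eq_iff matrix_matrix_mult_def sum_2 forall_2 diag2_nth)

lemma diag2_1: "diag2 1 1 = mat 1"
  by (simp add: vec_eq_iff diag2_nth mat_def)

text \<open>Conjugation commutes with powers, and the conjugated diagonal matrix depends linearly on
  its two entries, so the exponential series is summed entry by entry. The inverse is a separate
  argument in order to cover transposed bases too.\<close>

lemma mat_exp_diag2:
  assumes Q: "Q ** Q' = mat 1" "Q' ** Q = mat 1"
  shows "mat_exp (Q ** diag2 x y ** Q') = Q ** diag2 (exp x) (exp y) ** Q'"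
proof -
  have pow: "(matrix_matrix_mult (Q ** diag2 x y ** Q') ^^ k) (mat 1) = Q ** diag2 (x ^ k) (y ^ k) ** Q'" for k
  proof (induction k)
    case 0
    show ?case by (simp add: diag2_1 Q)
  next
    case (Suc k)
    have "(Q ** diag2 x y ** Q') ** (Q ** diag2 (x ^ k) (y ^ k) ** Q') =
        Q ** (diag2 x y ** ((Q' ** Q) ** (diag2 (x ^ k) (y ^ k) ** Q')))"
      by (simp only: matrix_mul_assoc)
    also have "\<dots> = Q ** ((diag2 x y ** diag2 (x ^ k) (y ^ k)) ** Q')"
      by (simp add: Q matrix_mul_assoc)
    also have "\<dots> = Q ** diag2 (x ^ Suc k) (y ^ Suc k) ** Q'"
      by (simp add: diag2_mult matrix_mul_assoc)
    finally show ?case using Suc by simp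
  qed
  have lin: "Q ** diag2 a b ** Q' = a *\<^sub>R (Q ** diag2 1 0 ** Q') + b *\<^sub>R (Q ** diag2 0 1 ** Q')" for a b
    by (simp add: vec_eq_iff matrix_matrix_mult_def sum_2 diag2_nth algebra_simps)
  have e: "(\<lambda>k. z ^ k / fact k) sums exp z" for z :: real
    using exp_converges[of z] by (simp add: divide_inverse mult.commute)
  have "(\<lambda>k. (x ^ k / fact k) *\<^sub>R (Q ** diag2 1 0 ** Q') + (y ^ k / fact k) *\<^sub>R (Q ** diag2 0 1 ** Q')) sums
      (exp x *\<^sub>R (Q ** diag2 1 0 ** Q') + exp y *\<^sub>R (Q ** diag2 0 1 ** Q'))"
    by (intro sums_add sums_scaleR_left e)
  moreover have "(1 / fact k) *\<^sub>R (Q ** diag2 (x ^ k) (y ^ k) ** Q') =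
      (x ^ k / fact k) *\<^sub>R (Q ** diag2 1 0 ** Q') + (y ^ k / fact k) *\<^sub>R (Q ** diag2 0 1 ** Q')" for k
    by (subst lin) (simp add: scaleR_add_right)
  ultimately show ?thesis
    unfolding mat_exp_def pow by (subst lin) (simp add: sums_iff)
qed

text \<open>The case \<open>c = 0\<close> agrees with \<open>0 powr x = 0\<close>.\<close>

lemma mat_powr_diag2:
  assumes Q: "Q ** Q' = mat 1" "Q' ** Q = mat 1" and c: "0 \<le> c"
  shows "mat_powr c (Q ** diag2 x y ** Q') = Q ** diag2 (c powr x) (c powr y) ** Q'"
proof (cases "c = 0")
  case True
  have "diag2 0 0 = (0 :: real^2^2)" by (simp add: vec_eq_iff diag2_nth)
  then show ?thesis using True by (simp add: mat_powr_def)
next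
  case False
  then have c: "c > 0" using c by simp
  have "ln c *\<^sub>R (Q ** diag2 x y ** Q') = Q ** diag2 (ln c * x) (ln c * y) ** Q'"
    by (simp add: vec_eq_iff matrix_matrix_mult_def sum_2 diag2_nth algebra_simps)
  then show ?thesis using c by (simp add: mat_powr_def mat_exp_diag2[OF Q] powr_def mult.commute)
qed

text \<open>Its integral is the constant in the spectral representation of \<open>|t|\<close> to the
  power \<open>\<eta>\<close> as an integral of
  \<open>(1 - cos (t x)) |x|^(-1-\<eta>)\<close>.\<close>

definition fbm_integrand :: "real \<Rightarrow> real \<Rightarrow> real" where
  "fbm_integrand \<eta> x = (1 - cos x) * \<bar>x\<bar> powr (- 1 - \<eta>)"

lemma fbm_integrand_scale:
  assumes "t \<noteq> 0"
  shows "fbm_integrand \<eta> (t * x) = \<bar>t\<bar> powr (- 1 - \<eta>) * ((1 - cos (t * x)) * \<bar>x\<bar> powr (- 1 - \<eta>))"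
  by (simp add: fbm_integrand_def abs_mult powr_mult)

lemma fbm_integral_scale:
  assumes int: "integrable lborel (fbm_integrand \<eta>)" and \<eta>: "0 < \<eta>"
  shows "integrable lborel (\<lambda>x. (1 - cos (t * x)) * \<bar>x\<bar> powr (- 1 - \<eta>))"
    "(LINT x|lborel. (1 - cos (t * x)) * \<bar>x\<bar> powr (- 1 - \<eta>)) = \<bar>t\<bar> powr \<eta> * (LINT x|lborel. fbm_integrand \<eta> x)"
proof -
  have "integrable lborel (\<lambda>x. (1 - cos (t * x)) * \<bar>x\<bar> powr (- 1 - \<eta>)) \<and>
    (LINT x|lborel. (1 - cos (t * x)) * \<bar>x\<bar> powr (- 1 - \<eta>)) = \<bar>t\<bar> powr \<eta> * (LINT x|lborel. fbm_integrand \<eta> x)"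
  proof (cases "t = 0")
    case True
    then show ?thesis by simp
  next
    case False
    let ?g = "\<lambda>x. (1 - cos (t * x)) * \<bar>x\<bar> powr (- 1 - \<eta>)"
    have g: "?g = (\<lambda>x. \<bar>t\<bar> powr (1 + \<eta>) * fbm_integrand \<eta> (0 + t * x))"
    proof
      fix x
      have "\<bar>t\<bar> powr (1 + \<eta>) * \<bar>t\<bar> powr (- 1 - \<eta>) = 1"
        using False by (simp flip: powr_add)
      then show "?g x = \<bar>t\<bar> powr (1 + \<eta>) * fbm_integrand \<eta> (0 + t * x)"
        unfolding add_0_left fbm_integrand_scale[OF False] mult.assoc[symmetric] by simp
    qed
    have "integrable lborel ?g"
      unfolding g using lborel_integrable_real_affine[OF int False, of 0] by simp
    moreover have "integral\<^sup>L lborel ?g = \<bar>t\<bar> powr \<eta> * (LINT x|lborel. fbm_integrand \<eta> x)"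
    proof -
      have "(LINT x|lborel. fbm_integrand \<eta> x) = \<bar>t\<bar> * (LINT x|lborel. fbm_integrand \<eta> (0 + t * x))"
        using lborel_integral_real_affine[OF False, of "fbm_integrand \<eta>" 0] by simp
      moreover have "\<bar>t\<bar> powr (1 + \<eta>) = \<bar>t\<bar> powr \<eta> * \<bar>t\<bar>" using False by (simp add: powr_add)
      ultimately show ?thesis unfolding g by simp
    qed
    ultimately show ?thesis by blast
  qed
  then show "integrable lborel (\<lambda>x. (1 - cos (t * x)) * \<bar>x\<bar> powr (- 1 - \<eta>))"
    "(LINT x|lborel. (1 - cos (t * x)) * \<bar>x\<bar> powr (- 1 - \<eta>)) = \<bar>t\<bar> powr \<eta> * (LINT x|lborel. fbm_integrand \<eta> x)"
    by auto
qed

section \<open>Spectral form of the process in the eigenbasis\<close>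

locale ofbm_process =
  fixes N :: "'v measure" and R :: "real set \<Rightarrow> 'v \<Rightarrow> complex^2"
    and M :: "'w measure" and B :: "real \<Rightarrow> 'w \<Rightarrow> real^2"
    and P H :: "real^2^2" and A :: "complex^2^2" and h\<^sub>1 h\<^sub>2 :: real
  assumes h: "0 < h\<^sub>1" "h\<^sub>1 < h\<^sub>2" "h\<^sub>2 < 1"
    and P: "invertible P"
    and H: "H = P ** diag2 h\<^sub>1 h\<^sub>2 ** matrix_inv P"
    and rank: "rank (Re_mat (A ** hermitian A)) = 2"
    and reversible: "Im_mat (A ** hermitian A) = 0"
    and ofbm: "ofbm N R M H A B"
begin

definition \<eta> :: "2 \<Rightarrow> 2 \<Rightarrow> real" where
  "\<eta> i k = (if i = 1 then h\<^sub>1 else h\<^sub>2) + (if k = 1 then h\<^sub>1 else h\<^sub>2)"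

definition Pinv :: "real^2^2" where "Pinv = matrix_inv P"

definition X :: "real \<Rightarrow> 'w \<Rightarrow> real^2" where "X t w = Pinv *v B t w"

definition \<Gamma> :: "real^2^2" where "\<Gamma> = Pinv ** Re_mat (A ** hermitian A) ** transpose Pinv"

lemma P_Pinv: "P ** Pinv = mat 1" "Pinv ** P = mat 1"
  using someI_ex[OF P[unfolded invertible_def]] by (auto simp: Pinv_def matrix_inv_def)

lemma \<eta>_bounds: "0 < \<eta> i k" "\<eta> i k < 2"
  using h by (auto simp: \<eta>_def)

sublocale prob_space M
  using ofbm by (simp add: ofbm_def)

lemma random_measure: "gaussian_random_measure N R"
  using ofbm by (simp add: ofbm_def)

lemma B_measurable[measurable]: "B t \<in> borel_measurable M"
  using ofbm by (simp add: ofbm_def)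

lemma Re_mat_hermitian: "Re_mat (A ** hermitian A) $ i $ k = (\<Sum>l\<in>UNIV. A $ i $ l \<bullet> A $ k $ l)"
  by (simp add: Re_mat_def matrix_matrix_mult_def hermitian_def transpose_def cnj_mat_def inner_complex_Re)

text \<open>Here time reversibility enters: the matrix is real, so the conjugated factor on the
  negative half-line gives the same products as the factor on the positive one.\<close>

lemma AA_eq: "(\<Sum>l\<in>UNIV. A $ i $ l * cnj (A $ k $ l)) = complex_of_real (Re_mat (A ** hermitian A) $ i $ k)"
proof -
  have "Im_mat (A ** hermitian A) $ i $ k = 0" by (simp add: reversible)
  then have "Im (\<Sum>l\<in>UNIV. A $ i $ l * cnj (A $ k $ l)) = 0"
    by (simp add: Im_mat_def matrix_matrix_mult_def hermitian_def transpose_def cnj_mat_def)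
  moreover have "Re (\<Sum>l\<in>UNIV. A $ i $ l * cnj (A $ k $ l)) = Re_mat (A ** hermitian A) $ i $ k"
    by (simp add: Re_mat_def matrix_matrix_mult_def hermitian_def transpose_def cnj_mat_def)
  ultimately show ?thesis by (simp add: complex_eq_iff)
qed

text \<open>The matrix is the Gram matrix of the rows of \<open>A\<close> for the real inner
  product, hence semidefinite; a vector with vanishing form lies in its kernel, which full rank
  makes trivial.\<close>

lemma Re_mat_posdef:
  assumes "v \<noteq> 0" shows "0 < v \<bullet> (Re_mat (A ** hermitian A) *v v)"
proof -
  let ?S = "Re_mat (A ** hermitian A)"
  let ?a = "\<lambda>l. \<Sum>i\<in>UNIV. v $ i *\<^sub>R A $ i $ l"
  have Sv: "(?S *v v) $ i = (\<Sum>l\<in>UNIV. A $ i $ l \<bullet> ?a l)" for i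
    unfolding matrix_vector_mult_def Re_mat_hermitian
    by (simp add: sum_2 inner_add_right algebra_simps)
  have q: "v \<bullet> (?S *v v) = (\<Sum>l\<in>UNIV. ?a l \<bullet> ?a l)"
    unfolding inner_vec_def[of v] Sv by (simp add: sum_2 inner_add_left inner_add_right algebra_simps)
  have "v \<bullet> (?S *v v) \<noteq> 0"
  proof
    assume "v \<bullet> (?S *v v) = 0"
    then have "?a l = 0" for l
      unfolding q by (subst (asm) sum_nonneg_eq_0_iff) auto
    then have "?S *v v = 0" by (simp add: vec_eq_iff Sv)
    moreover have "inj (matrix_vector_mult ?S)"
      using rank full_rank_injective[of ?S] by simp
    ultimately show False using assms by (metis injD matrix_vector_mult_0_right)
  qed
  moreover have "0 \<le> v \<bullet> (?S *v v)" unfolding q by (intro sum_nonneg) auto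
  ultimately show ?thesis by simp
qed

lemma \<Gamma>_posdef: "u \<noteq> 0 \<Longrightarrow> 0 < u \<bullet> (\<Gamma> *v u)"
proof -
  assume u: "u \<noteq> 0"
  have "u \<bullet> (\<Gamma> *v u) = (transpose Pinv *v u) \<bullet> (Re_mat (A ** hermitian A) *v (transpose Pinv *v u))"
    unfolding \<Gamma>_def matrix_vector_mul_assoc[symmetric]
    by (metis dot_lmul_matrix vector_transpose_matrix transpose_transpose)
  moreover have "transpose Pinv *v u \<noteq> 0"
  proof
    assume "transpose Pinv *v u = 0"
    then have "transpose P *v (transpose Pinv *v u) = 0" by simp
    then show False using u by (simp add: vector_matrix_mul_assoc P_Pinv)
  qed
  ultimately show ?thesis using Re_mat_posdef by simp
qed

lemma \<Gamma>_diag_pos: "0 < \<Gamma> $ i $ i"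
  using \<Gamma>_posdef[of "axis i 1"] by (simp add: matrix_vector_mult_basis inner_axis' column_def)

definition et :: "real \<Rightarrow> real \<Rightarrow> complex" where
  "et t x = (exp (\<i> * complex_of_real (t * x)) - 1) / (\<i> * complex_of_real x)"

lemma neg_D: "- (H - (1/2) *\<^sub>R mat 1) = P ** diag2 (1/2 - h\<^sub>1) (1/2 - h\<^sub>2) ** Pinv"
proof -
  have "P ** diag2 (1/2 - h\<^sub>1) (1/2 - h\<^sub>2) ** Pinv = (1/2) *\<^sub>R (P ** Pinv) - P ** diag2 h\<^sub>1 h\<^sub>2 ** Pinv"
    by (simp add: vec_eq_iff matrix_matrix_mult_def sum_2 diag2_nth algebra_simps)
  then have "P ** diag2 (1/2 - h\<^sub>1) (1/2 - h\<^sub>2) ** Pinv = (1/2) *\<^sub>R mat 1 - P ** diag2 h\<^sub>1 h\<^sub>2 ** Pinv"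
    by (simp add: P_Pinv)
  then show ?thesis by (simp add: H Pinv_def)
qed

text \<open>Testing with the transposed inverse of \<open>P\<close> removes the change of basis and
  leaves scalar powers of \<open>|x|\<close>. For each \<open>x\<close> at most one of the two
  summands of the kernel is present, because the power of 0 is the zero matrix.\<close>

lemma row_kernel:
  "row_comb (transpose Pinv *v u) (ofbm_kernel H A t x) $ l =
    et t x * (\<Sum>i\<in>UNIV. complex_of_real (u $ i * \<bar>x\<bar> powr (1/2 - (if i = 1 then h\<^sub>1 else h\<^sub>2))) *
      (\<Sum>k\<in>UNIV. complex_of_real (Pinv $ i $ k) * (if 0 \<le> x then A $ k $ l else cnj (A $ k $ l))))"
proof -
  define p where "p i = (if i = (1::2) then h\<^sub>1 else h\<^sub>2)" for i
  have mp: "mat_powr c (- (H - (1/2) *\<^sub>R mat 1)) = P ** diag2 (c powr (1/2 - h\<^sub>1)) (c powr (1/2 - h\<^sub>2)) ** Pinv"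
    if "0 \<le> c" for c
    unfolding neg_D by (rule mat_powr_diag2[OF P_Pinv that])
  define L where "L c = diag2 (c powr (1/2 - h\<^sub>1)) (c powr (1/2 - h\<^sub>2)) ** Pinv" for c
  have L: "L c $ i $ k = c powr (1/2 - p i) * Pinv $ i $ k" for c i k
    by (simp add: L_def matrix_matrix_mult_def diag2_nth p_def if_distrib[where f = "\<lambda>x. x * _"] cong: if_cong)
  have PL: "mat_powr c (- (H - (1/2) *\<^sub>R mat 1)) $ a $ b = (\<Sum>i\<in>UNIV. P $ a $ i * L c $ i $ b)" if "0 \<le> c" for c a b
    unfolding mp[OF that] L_def matrix_mul_assoc[symmetric] by (simp add: matrix_matrix_mult_def)
  have k: "ofbm_kernel H A t x $ a $ l = et t x * (\<Sum>i\<in>UNIV. complex_of_real (P $ a $ i) *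
      (\<Sum>b\<in>UNIV. complex_of_real (L \<bar>x\<bar> $ i $ b) * (if 0 \<le> x then A $ b $ l else cnj (A $ b $ l))))" for a
  proof -
    have "ofbm_kernel H A t x $ a $ l = et t x *
      ((\<Sum>b\<in>UNIV. complex_of_real (mat_powr (max x 0) (- (H - (1/2) *\<^sub>R mat 1)) $ a $ b) * A $ b $ l) +
       (\<Sum>b\<in>UNIV. complex_of_real (mat_powr (max (- x) 0) (- (H - (1/2) *\<^sub>R mat 1)) $ a $ b) * cnj (A $ b $ l)))"
      by (simp only: ofbm_kernel_def Let_def et_def matrix_matrix_mult_def cmat_def cnj_mat_def vec_lambda_beta
          vector_add_component)
    also have "\<dots> = et t x * (\<Sum>b\<in>UNIV. complex_of_real (mat_powr \<bar>x\<bar> (- (H - (1/2) *\<^sub>R mat 1)) $ a $ b) *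
        (if 0 \<le> x then A $ b $ l else cnj (A $ b $ l)))"
    proof (cases "0 \<le> x")
      case True
      have "mat_powr (max (- x) 0) (- (H - (1/2) *\<^sub>R mat 1)) = 0" using True by (simp add: mat_powr_def)
      then show ?thesis using True by (simp del: minus_diff_eq)
    next
      case False
      have "mat_powr (max x 0) (- (H - (1/2) *\<^sub>R mat 1)) = 0" using False by (simp add: mat_powr_def)
      then show ?thesis using False by (simp del: minus_diff_eq)
    qed
    also have "(\<Sum>b\<in>UNIV. complex_of_real (mat_powr \<bar>x\<bar> (- (H - (1/2) *\<^sub>R mat 1)) $ a $ b) *
        (if 0 \<le> x then A $ b $ l else cnj (A $ b $ l))) = (\<Sum>i\<in>UNIV. complex_of_real (P $ a $ i) *
      (\<Sum>b\<in>UNIV. complex_of_real (L \<bar>x\<bar> $ i $ b) * (if 0 \<le> x then A $ b $ l else cnj (A $ b $ l))))"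
      unfolding PL[OF abs_ge_zero] by (simp only: sum_2 of_real_add of_real_mult) (simp add: algebra_simps)
    finally show ?thesis .
  qed
  have PiP: "(\<Sum>a\<in>UNIV. (transpose Pinv *v u) $ a * P $ a $ i) = u $ i" for i
  proof -
    have "transpose P *v (transpose Pinv *v u) = u"
      by (simp add: vector_matrix_mul_assoc P_Pinv)
    then have "(transpose P *v (transpose Pinv *v u)) $ i = u $ i" by simp
    then show ?thesis by (simp add: matrix_vector_mult_def transpose_def mult.commute)
  qed
  let ?a = "transpose Pinv *v u"
  define Z where "Z i = (\<Sum>b\<in>UNIV. complex_of_real (L \<bar>x\<bar> $ i $ b) * (if 0 \<le> x then A $ b $ l else cnj (A $ b $ l)))" for i
  have "row_comb ?a (ofbm_kernel H A t x) $ l =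
      et t x * (\<Sum>a\<in>UNIV. \<Sum>i\<in>UNIV. complex_of_real (?a $ a * P $ a $ i) * Z i)"
    by (simp add: row_comb_def k Z_def[symmetric] sum_distrib_left mult_ac)
  also have "(\<Sum>a\<in>UNIV. \<Sum>i\<in>UNIV. complex_of_real (?a $ a * P $ a $ i) * Z i) = (\<Sum>i\<in>UNIV. complex_of_real (u $ i) * Z i)"
    unfolding PiP[symmetric] of_real_sum sum_distrib_right by (rule sum.swap)
  finally show ?thesis
    by (simp add: Z_def L p_def sum_distrib_left mult_ac)
qed

text \<open>The matrix factor is real and equal for both signs of \<open>x\<close>, so only the real
  part of the product of the two exponential factors remains, a combination of three terms
  \<open>1 - cos\<close>. At \<open>x = 0\<close> both sides are 0 by the conventions for division
  and \<open>powr\<close>.\<close>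

lemma kernel_inner:
  "row_comb (transpose Pinv *v u) (ofbm_kernel H A t x) \<bullet> row_comb (transpose Pinv *v v) (ofbm_kernel H A s x) =
   (\<Sum>i\<in>UNIV. \<Sum>k\<in>UNIV. u $ i * v $ k * \<Gamma> $ i $ k *
     ((1 - cos (t * x) + (1 - cos (s * x)) - (1 - cos ((t - s) * x))) * \<bar>x\<bar> powr (- 1 - \<eta> i k)))"
proof (cases "x = 0")
  case True
  then show ?thesis unfolding inner_vec_def row_kernel by (simp add: et_def)
next
  case False
  define p where "p i = (if i = (1::2) then h\<^sub>1 else h\<^sub>2)" for i
  define a where "a b l = (if 0 \<le> x then A $ b $ l else cnj (A $ b $ l))" for b l
  define g where "g i l = (\<Sum>b\<in>UNIV. complex_of_real (Pinv $ i $ b) * a b l)" for i l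
  have aa: "(\<Sum>l\<in>UNIV. a b l * cnj (a c l)) = complex_of_real (Re_mat (A ** hermitian A) $ b $ c)" for b c
  proof (cases "0 \<le> x")
    case False
    have "(\<Sum>l\<in>UNIV. a b l * cnj (a c l)) = cnj (\<Sum>l\<in>UNIV. A $ b $ l * cnj (A $ c $ l))"
      using False by (simp add: a_def)
    then show ?thesis by (simp add: AA_eq)
  qed (simp add: a_def AA_eq)
  have gg: "(\<Sum>l\<in>UNIV. g i l * cnj (g k l)) = complex_of_real (\<Gamma> $ i $ k)" for i k
  proof -
    have "(\<Sum>l\<in>UNIV. g i l * cnj (g k l)) =
       (\<Sum>b\<in>UNIV. \<Sum>c\<in>UNIV. complex_of_real (Pinv $ i $ b * Pinv $ k $ c) * (\<Sum>l\<in>UNIV. a b l * cnj (a c l)))"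
      by (simp add: g_def sum_2 algebra_simps)
    then show ?thesis
      unfolding aa by (simp add: \<Gamma>_def matrix_matrix_mult_def transpose_def sum_2 algebra_simps)
  qed
  have et: "et t x * cnj (et s x) = (exp (\<i> * complex_of_real (t * x)) - 1) * cnj (exp (\<i> * complex_of_real (s * x)) - 1) / complex_of_real (x\<^sup>2)"
  proof -
    have d: "\<i> * complex_of_real x * (- \<i> * complex_of_real x) = complex_of_real (x\<^sup>2)"
      by (simp add: power2_eq_square complex_eq_iff)
    show ?thesis
      unfolding et_def complex_cnj_divide complex_cnj_mult complex_cnj_i complex_cnj_complex_of_real
        times_divide_times_eq d ..
  qed
  have "Re ((exp (\<i> * complex_of_real (t * x)) - 1) * cnj (exp (\<i> * complex_of_real (s * x)) - 1)) =
      1 - cos (t * x) + (1 - cos (s * x)) - (1 - cos ((t - s) * x))"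
    by (simp add: exp_eq_polar[symmetric] cis.ctr cos_diff left_diff_distrib Re_exp Im_exp algebra_simps
        del: of_real_mult)
  then have Re_et: "Re (et t x * cnj (et s x)) =
      (1 - cos (t * x) + (1 - cos (s * x)) - (1 - cos ((t - s) * x))) / x\<^sup>2"
    unfolding et by (simp add: Re_divide_of_real del: complex_cnj_diff)
  have pw: "\<bar>x\<bar> powr (1/2 - p i) * \<bar>x\<bar> powr (1/2 - p k) = \<bar>x\<bar> powr (- 1 - \<eta> i k) * x\<^sup>2" for i k
  proof -
    have "\<bar>x\<bar> powr (1/2 - p i) * \<bar>x\<bar> powr (1/2 - p k) = \<bar>x\<bar> powr ((- 1 - \<eta> i k) + 2)"
      unfolding powr_add[symmetric] by (rule arg_cong[where f = "(powr) \<bar>x\<bar>"]) (simp add: p_def \<eta>_def)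
    also have "\<dots> = \<bar>x\<bar> powr (- 1 - \<eta> i k) * \<bar>x\<bar> powr 2" by (rule powr_add)
    also have "\<bar>x\<bar> powr 2 = x\<^sup>2" using False by simp
    finally show ?thesis .
  qed
  have "row_comb (transpose Pinv *v u) (ofbm_kernel H A t x) \<bullet> row_comb (transpose Pinv *v v) (ofbm_kernel H A s x) =
    Re (\<Sum>l\<in>UNIV. (et t x * (\<Sum>i\<in>UNIV. complex_of_real (u $ i * \<bar>x\<bar> powr (1/2 - p i)) * g i l)) *
      cnj (et s x * (\<Sum>k\<in>UNIV. complex_of_real (v $ k * \<bar>x\<bar> powr (1/2 - p k)) * g k l)))"
    by (simp only: inner_vec_def inner_complex_Re row_kernel p_def g_def a_def Re_sum)
  also have "\<dots> = Re ((et t x * cnj (et s x)) * (\<Sum>i\<in>UNIV. \<Sum>k\<in>UNIV.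
      complex_of_real (u $ i * v $ k * (\<bar>x\<bar> powr (1/2 - p i) * \<bar>x\<bar> powr (1/2 - p k))) * (\<Sum>l\<in>UNIV. g i l * cnj (g k l))))"
    by (rule arg_cong[where f = Re]) (simp add: sum_2 algebra_simps)
  also have "\<dots> = Re (et t x * cnj (et s x)) * (\<Sum>i\<in>UNIV. \<Sum>k\<in>UNIV.
      (u $ i * v $ k * (\<bar>x\<bar> powr (- 1 - \<eta> i k) * x\<^sup>2)) * \<Gamma> $ i $ k)"
  proof -
    have "(\<Sum>i\<in>UNIV. \<Sum>k\<in>UNIV. complex_of_real (u $ i * v $ k * (\<bar>x\<bar> powr (1/2 - p i) * \<bar>x\<bar> powr (1/2 - p k))) *
        (\<Sum>l\<in>UNIV. g i l * cnj (g k l))) = complex_of_real (\<Sum>i\<in>UNIV. \<Sum>k\<in>UNIV.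
      (u $ i * v $ k * (\<bar>x\<bar> powr (- 1 - \<eta> i k) * x\<^sup>2)) * \<Gamma> $ i $ k)"
      unfolding gg pw by simp
    then show ?thesis by (simp only: Re_complex_of_real times_complex.sel Im_complex_of_real mult_zero_right diff_zero)
  qed
  also have "\<dots> = (\<Sum>i\<in>UNIV. \<Sum>k\<in>UNIV. u $ i * v $ k * \<Gamma> $ i $ k *
     ((1 - cos (t * x) + (1 - cos (s * x)) - (1 - cos ((t - s) * x))) * \<bar>x\<bar> powr (- 1 - \<eta> i k)))"
    unfolding Re_et sum_distrib_left using False by (intro sum.cong refl) (simp add: field_simps)
  finally show ?thesis .
qed

end

section \<open>Joint law and covariance of the process\<close>

lemma comb_cvec: "comb a (cvec v) = complex_of_real (a \<bullet> v)"
  by (simp add: comb_def cvec_def inner_vec_def)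

lemma cvec_measurable[measurable]: "cvec \<in> borel_measurable borel"
  unfolding cvec_def by (intro borel_measurable_continuous_onI continuous_intros)

lemma comb_measurable[measurable]: "comb a \<in> borel_measurable borel"
  by (intro borel_measurable_continuous_onI linear_continuous_on bounded_linear_comb)

lemma L2_sum_tendsto:
  fixes f :: "'j \<Rightarrow> nat \<Rightarrow> 'w \<Rightarrow> real"
  assumes "finite J"
    and "\<And>j n. j \<in> J \<Longrightarrow> f j n \<in> borel_measurable M" "\<And>j. j \<in> J \<Longrightarrow> F j \<in> borel_measurable M"
    and "\<And>j n. j \<in> J \<Longrightarrow> integrable M (\<lambda>w. (f j n w - F j w)\<^sup>2)"
    and "\<And>j. j \<in> J \<Longrightarrow> (\<lambda>n. LINT w|M. (f j n w - F j w)\<^sup>2) \<longlonglongrightarrow> 0"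
  shows "(\<forall>n. integrable M (\<lambda>w. ((\<Sum>j\<in>J. f j n w) - (\<Sum>j\<in>J. F j w))\<^sup>2)) \<and>
    (\<lambda>n. LINT w|M. ((\<Sum>j\<in>J. f j n w) - (\<Sum>j\<in>J. F j w))\<^sup>2) \<longlonglongrightarrow> 0"
  using assms
proof (induction J rule: finite_induct)
  case empty
  then show ?case by simp
next
  case (insert i J)
  let ?a = "\<lambda>n w. f i n w - F i w" and ?b = "\<lambda>n w. (\<Sum>j\<in>J. f j n w) - (\<Sum>j\<in>J. F j w)"
  have IH: "\<And>n. integrable M (\<lambda>w. (?b n w)\<^sup>2)" "(\<lambda>n. LINT w|M. (?b n w)\<^sup>2) \<longlonglongrightarrow> 0"
    using insert.IH insert.prems by simp_all
  have [measurable]: "?a n \<in> borel_measurable M" "?b n \<in> borel_measurable M" for n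
    using insert.prems by simp_all
  have ia: "integrable M (\<lambda>w. (?a n w)\<^sup>2)" for n using insert.prems by simp
  have eq: "(\<Sum>j\<in>insert i J. f j n w) - (\<Sum>j\<in>insert i J. F j w) = ?a n w + ?b n w" for n w
    using insert.hyps by simp
  have int: "integrable M (\<lambda>w. (?a n w + ?b n w)\<^sup>2)" for n
    by (rule square_integrable_add[OF _ _ ia IH(1)]) measurable
  have "(\<lambda>n. LINT w|M. (?a n w + ?b n w)\<^sup>2) \<longlonglongrightarrow> 0"
  proof (rule tendsto_zero_sandwich)
    show "\<bar>LINT w|M. (?a n w + ?b n w)\<^sup>2\<bar> \<le> 2 * (LINT w|M. (?a n w)\<^sup>2) + 2 * (LINT w|M. (?b n w)\<^sup>2)" for n
    proof -
      have "(LINT w|M. (?a n w + ?b n w)\<^sup>2) \<le> (LINT w|M. 2 * (?a n w)\<^sup>2 + 2 * (?b n w)\<^sup>2)"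
      proof (rule integral_mono[OF int])
        show "integrable M (\<lambda>w. 2 * (?a n w)\<^sup>2 + 2 * (?b n w)\<^sup>2)" using ia IH(1) by simp
        show "(?a n w + ?b n w)\<^sup>2 \<le> 2 * (?a n w)\<^sup>2 + 2 * (?b n w)\<^sup>2" for w
          using sum_squares_bound[of "?a n w" "?b n w"] unfolding power2_sum by linarith
      qed
      also have "\<dots> = 2 * (LINT w|M. (?a n w)\<^sup>2) + 2 * (LINT w|M. (?b n w)\<^sup>2)"
        using ia IH(1) by simp
      finally show ?thesis by simp
    qed
    have "(\<lambda>n. 2 * (LINT w|M. (?a n w)\<^sup>2) + 2 * (LINT w|M. (?b n w)\<^sup>2)) \<longlonglongrightarrow> 2 * 0 + 2 * 0"
      using insert.prems IH(2) by (intro tendsto_add tendsto_mult_left) simp_all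
    then show "(\<lambda>n. 2 * (LINT w|M. (?a n w)\<^sup>2) + 2 * (LINT w|M. (?b n w)\<^sup>2)) \<longlonglongrightarrow> 0" by simp
  qed
  then show ?case unfolding eq using int by simp
qed

text \<open>Joint Gaussianity of Wiener integrals: a real combination is the mean-square limit of
  real linear functionals of the random measure, and these are Gaussian by assumption on the
  measure.\<close>

lemma wiener_integral_gauss:
  fixes R :: "real set \<Rightarrow> 'v \<Rightarrow> complex^'n" and f :: "'j \<Rightarrow> real \<Rightarrow> complex^'n^'m"
  assumes R: "gaussian_random_measure N R" and J: "finite J"
    and f: "\<And>j. wiener_integral N R (f j) (Y j)"
  shows "gauss N (\<lambda>w. \<Sum>j\<in>J. Re (comb (a j) (Y j w)))"
proof -
  interpret prob_space N using R by (simp add: gaussian_random_measure_def)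
  have "\<forall>j. \<exists>p. (\<forall>n. finite (fst p n) \<and> fst p n \<subseteq> fin_borel) \<and>
      (\<lambda>n. L2_norm N (\<lambda>w. Y j w - (\<Sum>E\<in>fst p n. snd p n E *v R E w))) \<longlonglongrightarrow> 0"
  proof
    fix j
    from f[of j] obtain \<E> C where "\<forall>n. finite (\<E> n) \<and> \<E> n \<subseteq> fin_borel"
      "(\<lambda>n. L2_norm N (\<lambda>w. Y j w - (\<Sum>E\<in>\<E> n. C n E *v R E w))) \<longlonglongrightarrow> 0"
      unfolding wiener_integral_def by blast
    then show "\<exists>p. (\<forall>n. finite (fst p n) \<and> fst p n \<subseteq> fin_borel) \<and>
      (\<lambda>n. L2_norm N (\<lambda>w. Y j w - (\<Sum>E\<in>fst p n. snd p n E *v R E w))) \<longlonglongrightarrow> 0"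
      by (intro exI[of _ "(\<E>, C)"]) simp
  qed
  from choice[OF this] obtain p where p: "\<forall>j. (\<forall>n. finite (fst (p j) n) \<and> fst (p j) n \<subseteq> fin_borel) \<and>
      (\<lambda>n. L2_norm N (\<lambda>w. Y j w - (\<Sum>E\<in>fst (p j) n. snd (p j) n E *v R E w))) \<longlonglongrightarrow> 0" ..
  define \<E> C where "\<E> j = fst (p j)" and "C j = snd (p j)" for j
  have E: "\<And>j n. finite (\<E> j n)" "\<And>j n. \<E> j n \<subseteq> fin_borel"
    and lim: "\<And>j. (\<lambda>n. L2_norm N (\<lambda>w. Y j w - (\<Sum>E\<in>\<E> j n. C j n E *v R E w))) \<longlonglongrightarrow> 0"
    using p by (simp_all add: \<E>_def C_def)
  have Y: "sq_integrable N (Y j)" for j using f[of j] by (simp add: wiener_integral_def)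
  define S where "S j n w = (\<Sum>E\<in>\<E> j n. C j n E *v R E w)" for j n w
  have bl: "bounded_linear (\<lambda>y. A *v y :: complex^'m)" for A :: "complex^'n^'m"
    by (intro linear_conv_bounded_linear[THEN iffD1] linearI)
      (simp_all add: matrix_vector_mult_def vec_eq_iff distrib_left sum.distrib scaleR_sum_right)
  have S: "sq_integrable N (S j n)" for j n
    unfolding S_def[abs_def]
    by (intro sq_integrable_sum sq_integrable_bounded_linear[OF bl] sq_integrable_random_measure[OF R])
      (use E(2)[of j n] in auto)
  have blc: "bounded_linear (\<lambda>y. Re (comb a y))" for a :: "real^'m"
    by (rule bounded_linear_compose[OF bounded_linear_Re bounded_linear_comb])
  have lim': "(\<lambda>n. LINT w|N. (Re (comb (a j) (S j n w)) - Re (comb (a j) (Y j w)))\<^sup>2) \<longlonglongrightarrow> 0" for j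
    using L2_norm_inner_tendsto[OF sq_integrable_bounded_linear[OF blc[of "a j"] S]
        sq_integrable_bounded_linear[OF blc[of "a j"] Y]
        L2_norm_bounded_linear_tendsto[OF blc[of "a j"] S Y lim[of j, folded S_def]], where b = 1] by simp
  have int': "integrable N (\<lambda>w. (Re (comb (a j) (S j n w)) - Re (comb (a j) (Y j w)))\<^sup>2)" for j n
    using sq_integrableD(2)[OF sq_integrable_diff[OF sq_integrable_bounded_linear[OF blc[of "a j"] S[of j n]]
        sq_integrable_bounded_linear[OF blc[of "a j"] Y[of j]]]] by simp
  have meas: "(\<lambda>w. Re (comb (a j) (S j n w))) \<in> borel_measurable N" "(\<lambda>w. Re (comb (a j) (Y j w))) \<in> borel_measurable N" for j n
    by (rule sq_integrableD(1)[OF sq_integrable_bounded_linear[OF blc S]],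
        rule sq_integrableD(1)[OF sq_integrable_bounded_linear[OF blc Y]])
  note L2 = L2_sum_tendsto[of J "\<lambda>j n w. Re (comb (a j) (S j n w))" N "\<lambda>j w. Re (comb (a j) (Y j w))",
      OF J meas int' lim']
  show ?thesis
  proof (rule gauss_L2_limit)
    fix n
    define \<F> where "\<F> = (\<Union>j\<in>J. \<E> j n)"
    \<comment> \<open>The simple approximations for different \<open>j\<close> use different
      families of sets. They are merged into one family, with coefficient 0 where a set does not
      occur.\<close>
    define c where "c E = (\<Sum>j\<in>J. if E \<in> \<E> j n then row_comb (a j) (C j n E) else 0)" for E
    have F: "finite \<F>" "\<F> \<subseteq> fin_borel"
      unfolding \<F>_def using J E(1) by (blast, intro UN_least E(2))
    have "gauss N (\<lambda>w. Re (\<Sum>E\<in>\<F>. \<Sum>i\<in>UNIV. c E $ i * R E w $ i))"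
      by (rule gaussian_random_measure_gauss[OF R F])
    moreover have "Re (\<Sum>E\<in>\<F>. \<Sum>i\<in>UNIV. c E $ i * R E w $ i) = (\<Sum>j\<in>J. Re (comb (a j) (S j n w)))" for w
    proof -
      have "(\<Sum>j\<in>J. comb (a j) (S j n w)) = (\<Sum>j\<in>J. \<Sum>E\<in>\<E> j n. \<Sum>i\<in>UNIV. row_comb (a j) (C j n E) $ i * R E w $ i)"
        unfolding S_def linear_sum[OF bounded_linear.linear[OF bounded_linear_comb]] comb_matrix_vector ..
      also have "\<dots> = (\<Sum>j\<in>J. \<Sum>E\<in>\<F>. \<Sum>i\<in>UNIV. (if E \<in> \<E> j n then row_comb (a j) (C j n E) else 0) $ i * R E w $ i)"
        by (intro sum.cong[OF refl] sum.mono_neutral_cong_left F) (auto simp: \<F>_def)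
      also have "\<dots> = (\<Sum>E\<in>\<F>. \<Sum>i\<in>UNIV. c E $ i * R E w $ i)"
        unfolding c_def sum_component sum_distrib_right
        by (subst sum.swap, rule sum.cong[OF refl]) (rule sum.swap)
      finally show ?thesis by (simp flip: Re_sum)
    qed
    ultimately show "gauss N (\<lambda>w. \<Sum>j\<in>J. Re (comb (a j) (S j n w)))" by simp
  next
    show "(\<lambda>w. \<Sum>j\<in>J. Re (comb (a j) (Y j w))) \<in> borel_measurable N"
      using meas(2) by (rule borel_measurable_sum)
  qed (use L2 in auto)
qed

context ofbm_process
begin

lemma law_B:
  "\<exists>Y. (\<forall>t. wiener_integral N R (ofbm_kernel H A t) (Y t)) \<and>
    (\<forall>T. finite T \<longrightarrow> distr M (PiM T (\<lambda>_. borel)) (\<lambda>\<omega>. \<lambda>t\<in>T. cvec (B t \<omega>))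
               = distr N (PiM T (\<lambda>_. borel)) (\<lambda>\<omega>. \<lambda>t\<in>T. Y t \<omega>))"
  using ofbm unfolding ofbm_def by blast

lemma kernel_sq_integrable: "sq_integrable lborel (ofbm_kernel H A t)"
  using law_B by (auto simp: wiener_integral_def)

text \<open>Only finite-dimensional laws of \<open>B\<close> and of the Wiener integrals agree,
  possibly on different spaces; the mixed moment is a function of the pair of times and is
  transferred through that law.\<close>

lemma cov_B:
  "integrable M (\<lambda>w. (a \<bullet> B t w) * (b \<bullet> B s w))"
  "expectation (\<lambda>w. (a \<bullet> B t w) * (b \<bullet> B s w)) =
    (LINT x|lborel. row_comb a (ofbm_kernel H A t x) \<bullet> row_comb b (ofbm_kernel H A s x))"
proof -
  obtain Y where Y: "\<And>t. wiener_integral N R (ofbm_kernel H A t) (Y t)"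
    and law: "\<And>T. finite T \<Longrightarrow> distr M (PiM T (\<lambda>_. borel)) (\<lambda>\<omega>. \<lambda>t\<in>T. cvec (B t \<omega>))
               = distr N (PiM T (\<lambda>_. borel)) (\<lambda>\<omega>. \<lambda>t\<in>T. Y t \<omega>)"
    using law_B by metis
  have sY: "sq_integrable N (Y t)" for t using Y[of t] by (simp add: wiener_integral_def)
  have [measurable]: "Y t \<in> borel_measurable N" for t by (rule sq_integrableD(1)[OF sY])
  let ?T = "{t, s}"
  define \<phi> where "\<phi> \<omega> = comb a (\<omega> t) \<bullet> comb b (\<omega> s)" for \<omega>
  have \<phi>[measurable]: "\<phi> \<in> borel_measurable (PiM ?T (\<lambda>_. borel))"
    unfolding \<phi>_def by measurable
  have mB: "(\<lambda>\<omega>. \<lambda>t\<in>?T. cvec (B t \<omega>)) \<in> measurable M (PiM ?T (\<lambda>_. borel))" by measurable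
  have mY: "(\<lambda>\<omega>. \<lambda>t\<in>?T. Y t \<omega>) \<in> measurable N (PiM ?T (\<lambda>_. borel))" by measurable
  have eqB: "\<phi> (\<lambda>t\<in>?T. cvec (B t w)) = (a \<bullet> B t w) * (b \<bullet> B s w)" for w
    by (simp add: \<phi>_def comb_cvec inner_complex_def)
  have eqY: "\<phi> (\<lambda>t\<in>?T. Y t w) = comb a (Y t w) \<bullet> comb b (Y s w)" for w
    by (simp add: \<phi>_def)
  have "integrable N (\<lambda>w. comb a (Y t w) \<bullet> comb b (Y s w))"
    by (intro integrable_inner_sq sq_integrable_bounded_linear[OF bounded_linear_comb] sY)
  then have "integrable (distr N (PiM ?T (\<lambda>_. borel)) (\<lambda>\<omega>. \<lambda>t\<in>?T. Y t \<omega>)) \<phi>"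
    by (simp only: integrable_distr_eq[OF mY \<phi>] eqY)
  then have "integrable (distr M (PiM ?T (\<lambda>_. borel)) (\<lambda>\<omega>. \<lambda>t\<in>?T. cvec (B t \<omega>))) \<phi>"
    by (simp only: law[OF finite.insertI[OF finite.insertI[OF finite.emptyI]]])
  then show "integrable M (\<lambda>w. (a \<bullet> B t w) * (b \<bullet> B s w))"
    by (simp only: integrable_distr_eq[OF mB \<phi>] eqB)
  have "expectation (\<lambda>w. (a \<bullet> B t w) * (b \<bullet> B s w)) =
      integral\<^sup>L (distr M (PiM ?T (\<lambda>_. borel)) (\<lambda>\<omega>. \<lambda>t\<in>?T. cvec (B t \<omega>))) \<phi>"
    by (simp only: integral_distr[OF mB \<phi>] eqB)
  also have "\<dots> = integral\<^sup>L (distr N (PiM ?T (\<lambda>_. borel)) (\<lambda>\<omega>. \<lambda>t\<in>?T. Y t \<omega>)) \<phi>"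
    by (simp only: law[OF finite.insertI[OF finite.insertI[OF finite.emptyI]]])
  also have "\<dots> = (LINT w|N. comb a (Y t w) \<bullet> comb b (Y s w))"
    by (simp only: integral_distr[OF mY \<phi>] eqY)
  also have "\<dots> = (LINT x|lborel. row_comb a (ofbm_kernel H A t x) \<bullet> row_comb b (ofbm_kernel H A s x))"
    by (rule wiener_integral_isometry[OF random_measure Y Y])
  finally show "expectation (\<lambda>w. (a \<bullet> B t w) * (b \<bullet> B s w)) =
    (LINT x|lborel. row_comb a (ofbm_kernel H A t x) \<bullet> row_comb b (ofbm_kernel H A s x))" .
qed

lemma gauss_B:
  fixes n :: nat
  shows "gauss M (\<lambda>w. \<Sum>j<n. a j \<bullet> B (\<tau> j) w)"
proof -
  obtain Y where Y: "\<And>t. wiener_integral N R (ofbm_kernel H A t) (Y t)"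
    and law: "\<And>T. finite T \<Longrightarrow> distr M (PiM T (\<lambda>_. borel)) (\<lambda>\<omega>. \<lambda>t\<in>T. cvec (B t \<omega>))
               = distr N (PiM T (\<lambda>_. borel)) (\<lambda>\<omega>. \<lambda>t\<in>T. Y t \<omega>)"
    using law_B by metis
  have sY: "sq_integrable N (Y t)" for t using Y[of t] by (simp add: wiener_integral_def)
  have [measurable]: "Y t \<in> borel_measurable N" for t by (rule sq_integrableD(1)[OF sY])
  let ?T = "\<tau> ` {..<n}"
  define \<phi> where "\<phi> \<omega> = (\<Sum>j<n. Re (comb (a j) (\<omega> (\<tau> j))))" for \<omega>
  have \<phi>[measurable]: "\<phi> \<in> borel_measurable (PiM ?T (\<lambda>_. borel))"
    unfolding \<phi>_def by measurable
  have mB: "(\<lambda>\<omega>. \<lambda>t\<in>?T. cvec (B t \<omega>)) \<in> measurable M (PiM ?T (\<lambda>_. borel))" by measurable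
  have mY: "(\<lambda>\<omega>. \<lambda>t\<in>?T. Y t \<omega>) \<in> measurable N (PiM ?T (\<lambda>_. borel))" by measurable
  have "distr M borel (\<lambda>w. \<phi> (\<lambda>t\<in>?T. cvec (B t w))) = distr (distr M (PiM ?T (\<lambda>_. borel)) (\<lambda>\<omega>. \<lambda>t\<in>?T. cvec (B t \<omega>))) borel \<phi>"
    by (subst distr_distr[OF \<phi> mB]) (simp add: comp_def)
  also have "\<dots> = distr (distr N (PiM ?T (\<lambda>_. borel)) (\<lambda>\<omega>. \<lambda>t\<in>?T. Y t \<omega>)) borel \<phi>"
    by (simp only: law[OF finite_imageI[OF finite_lessThan]])
  also have "\<dots> = distr N borel (\<lambda>w. \<phi> (\<lambda>t\<in>?T. Y t w))"
    by (subst distr_distr[OF \<phi> mY]) (simp add: comp_def)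
  finally have d: "distr M borel (\<lambda>w. \<phi> (\<lambda>t\<in>?T. cvec (B t w))) = distr N borel (\<lambda>w. \<phi> (\<lambda>t\<in>?T. Y t w))" .
  have eqB: "\<phi> (\<lambda>t\<in>?T. cvec (B t w)) = (\<Sum>j<n. a j \<bullet> B (\<tau> j) w)" for w
    by (simp add: \<phi>_def comb_cvec)
  have eqY: "\<phi> (\<lambda>t\<in>?T. Y t w) = (\<Sum>j<n. Re (comb (a j) (Y (\<tau> j) w)))" for w
    by (simp add: \<phi>_def)
  have "gauss N (\<lambda>w. \<Sum>j<n. Re (comb (a j) (Y (\<tau> j) w)))"
    by (rule wiener_integral_gauss[OF random_measure _ Y]) simp
  then show ?thesis using d unfolding gauss_def eqB eqY by simp
qed

lemma inner_X: "u \<bullet> X t w = (transpose Pinv *v u) \<bullet> B t w"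
  by (simp add: X_def dot_lmul_matrix)

lemma X_nth: "X t w $ i = axis i 1 \<bullet> X t w"
  by (simp add: inner_axis')

definition K :: "2 \<Rightarrow> 2 \<Rightarrow> real" where "K i k = (LINT x|lborel. fbm_integrand (\<eta> i k) x)"

lemma fbm_integrand_nonneg: "0 \<le> fbm_integrand e x"
  by (simp add: fbm_integrand_def)

lemma fbm_integrand_measurable[measurable]: "fbm_integrand e \<in> borel_measurable borel"
  unfolding fbm_integrand_def by measurable

text \<open>For equal indices the integrability is contained in the square integrability of the
  kernel at time 1, divided by a positive diagonal entry of \<open>\<Gamma>\<close>. The mixed
  exponent lies between the two equal-index ones, so the mixed integrand is dominated by their
  sum.\<close>

lemma integrable_fbm_integrand: "integrable lborel (fbm_integrand (\<eta> i k))"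
proof -
  have diag: "integrable lborel (fbm_integrand (\<eta> i i))" for i
  proof -
    let ?u = "axis i 1 :: real^2"
    let ?f = "\<lambda>x. row_comb (transpose Pinv *v ?u) (ofbm_kernel H A 1 x)"
    have "integrable lborel (\<lambda>x. ?f x \<bullet> ?f x)"
      by (intro integrable_inner_sq sq_integrable_bounded_linear[OF bounded_linear_row_comb] kernel_sq_integrable)
    also have "(\<lambda>x. ?f x \<bullet> ?f x) = (\<lambda>x. (2 * \<Gamma> $ i $ i) * fbm_integrand (\<eta> i i) x)"
      unfolding kernel_inner by (rule ext) (use exhaust_2[of i] in \<open>auto simp: sum_2 axis_def fbm_integrand_def\<close>)
    finally show ?thesis using \<Gamma>_diag_pos[of i] by simp
  qed
  show ?thesis
  proof (rule Bochner_Integration.integrable_bound)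
    show "integrable lborel (\<lambda>x. fbm_integrand (\<eta> 1 1) x + fbm_integrand (\<eta> 2 2) x)"
      by (intro Bochner_Integration.integrable_add diag)
    have pw: "\<bar>x\<bar> powr (- 1 - \<eta> i k) \<le> \<bar>x\<bar> powr (- 1 - \<eta> 1 1) + \<bar>x\<bar> powr (- 1 - \<eta> 2 2)" for x
    proof -
      have e: "\<eta> 1 1 \<le> \<eta> i k" "\<eta> i k \<le> \<eta> 2 2" using h by (auto simp: \<eta>_def)
      consider "x = 0" | "1 \<le> \<bar>x\<bar>" | "x \<noteq> 0" "\<bar>x\<bar> < 1" by linarith
      then show ?thesis
      proof cases
        case 2
        have "\<bar>x\<bar> powr (- 1 - \<eta> i k) \<le> \<bar>x\<bar> powr (- 1 - \<eta> 1 1)" using 2 e by (intro powr_mono) auto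
        then show ?thesis by (simp add: add_increasing2)
      next
        case 3
        have "\<bar>x\<bar> powr (- 1 - \<eta> i k) \<le> \<bar>x\<bar> powr (- 1 - \<eta> 2 2)" using 3 e by (intro powr_mono') auto
        then show ?thesis by (simp add: add_increasing)
      qed simp
    qed
    show "AE x in lborel. norm (fbm_integrand (\<eta> i k) x) \<le> norm (fbm_integrand (\<eta> 1 1) x + fbm_integrand (\<eta> 2 2) x)"
    proof (rule AE_I2)
      fix x
      have "fbm_integrand (\<eta> i k) x \<le> fbm_integrand (\<eta> 1 1) x + fbm_integrand (\<eta> 2 2) x"
        unfolding fbm_integrand_def distrib_left[symmetric] by (intro mult_left_mono pw) simp
      then show "norm (fbm_integrand (\<eta> i k) x) \<le> norm (fbm_integrand (\<eta> 1 1) x + fbm_integrand (\<eta> 2 2) x)"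
        using fbm_integrand_nonneg[of "\<eta> i k" x] by simp
    qed
  qed measurable
qed

text \<open>The covariance of fractional Brownian motion, entry by entry, with twice the Hurst index
  replaced by \<open>\<eta> i k\<close>.\<close>

definition rr :: "2 \<Rightarrow> 2 \<Rightarrow> real \<Rightarrow> real \<Rightarrow> real" where
  "rr i k t s = \<Gamma> $ i $ k * K i k * (\<bar>t\<bar> powr \<eta> i k + \<bar>s\<bar> powr \<eta> i k - \<bar>t - s\<bar> powr \<eta> i k)"

lemma cov_uX:
  "integrable M (\<lambda>w. (u \<bullet> X t w) * (v \<bullet> X s w))"
  "expectation (\<lambda>w. (u \<bullet> X t w) * (v \<bullet> X s w)) =
    (LINT x|lborel. (\<Sum>i\<in>UNIV. \<Sum>k\<in>UNIV. u $ i * v $ k * \<Gamma> $ i $ k *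
     ((1 - cos (t * x) + (1 - cos (s * x)) - (1 - cos ((t - s) * x))) * \<bar>x\<bar> powr (- 1 - \<eta> i k))))"
  unfolding inner_X cov_B kernel_inner by (rule cov_B, rule refl)

lemma cov_X:
  "integrable M (\<lambda>w. X t w $ i * X s w $ k)"
  "expectation (\<lambda>w. X t w $ i * X s w $ k) = rr i k t s"
proof -
  show "integrable M (\<lambda>w. X t w $ i * X s w $ k)" unfolding X_nth by (rule cov_uX)
  note int = fbm_integral_scale(1)[OF integrable_fbm_integrand \<eta>_bounds(1)]
  note val = fbm_integral_scale(2)[OF integrable_fbm_integrand \<eta>_bounds(1)]
  let ?g = "\<lambda>t x. (1 - cos (t * x)) * \<bar>x\<bar> powr (- 1 - \<eta> i k)"
  have "expectation (\<lambda>w. X t w $ i * X s w $ k) =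
     (LINT x|lborel. \<Gamma> $ i $ k * (?g t x + ?g s x - ?g (t - s) x))"
    unfolding X_nth cov_uX(2)
    by (intro Bochner_Integration.integral_cong refl)
      (use exhaust_2[of i] exhaust_2[of k] in \<open>auto simp: sum_2 axis_def distrib_right left_diff_distrib\<close>)
  also have "\<dots> = \<Gamma> $ i $ k * ((LINT x|lborel. ?g t x) + (LINT x|lborel. ?g s x) - (LINT x|lborel. ?g (t - s) x))"
    using int by (simp only: integral_mult_right_zero Bochner_Integration.integral_add Bochner_Integration.integral_diff
        Bochner_Integration.integrable_add)
  also have "\<dots> = rr i k t s"
    unfolding val rr_def K_def by (simp add: algebra_simps)
  finally show "expectation (\<lambda>w. X t w $ i * X s w $ k) = rr i k t s" .
qed

text \<open>At time 1 the three powers in \<open>rr\<close> add up to 2. This expresses the spectral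
  constants by the covariance at time 1, in terms of which the asymptotic covariance is
  stated.\<close>

lemma rr_Sigma: "2 * (\<Gamma> $ i $ k * K i k) = (Pinv ** Sigma_BH M B ** transpose Pinv) $ i $ k"
proof -
  have "2 * (\<Gamma> $ i $ k * K i k) = expectation (\<lambda>w. X 1 w $ i * X 1 w $ k)"
    unfolding cov_X(2) rr_def by simp
  moreover have o: "integrable M (\<lambda>w. B 1 w $ a * B 1 w $ b)" for a b
    using cov_B(1)[of "axis a 1" 1 "axis b 1" 1] by (simp add: inner_axis')
  have S: "Sigma_BH M B $ a $ b = expectation (\<lambda>w. B 1 w $ a * B 1 w $ b)" for a b
  proof -
    have io: "integrable M (\<lambda>w. outer (B 1 w) (B 1 w))"
    proof -
      have "outer (B 1 w) (B 1 w) = (\<Sum>a\<in>UNIV. \<Sum>b\<in>UNIV. (B 1 w $ a * B 1 w $ b) *\<^sub>R axis a (axis b 1))" for w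
        by (simp add: outer_def vec_eq_iff sum_2 forall_2 axis_def)
      then show ?thesis using o by simp
    qed
    have bl: "bounded_linear (\<lambda>S :: real^2^2. S $ a $ b)"
      by (rule bounded_linear_compose[OF bounded_linear_vec_nth bounded_linear_vec_nth])
    show ?thesis
      unfolding Sigma_BH_def using integral_bounded_linear[OF bl io] by (simp add: outer_def)
  qed
  moreover have "X 1 w $ i = (\<Sum>a\<in>UNIV. Pinv $ i $ a * B 1 w $ a)" for w i
    by (simp add: X_def matrix_vector_mult_def)
  ultimately have "2 * (\<Gamma> $ i $ k * K i k) = expectation (\<lambda>w. \<Sum>a\<in>UNIV. \<Sum>b\<in>UNIV.
      (Pinv $ i $ a * Pinv $ k $ b) * (B 1 w $ a * B 1 w $ b))"
    by (simp add: sum_product mult_ac)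
  also have "\<dots> = (\<Sum>a\<in>UNIV. \<Sum>b\<in>UNIV. (Pinv $ i $ a * Pinv $ k $ b) * expectation (\<lambda>w. B 1 w $ a * B 1 w $ b))"
    using o by (simp only: Bochner_Integration.integral_sum Bochner_Integration.integrable_sum
        integrable_mult_right integral_mult_right_zero)
  also have "\<dots> = (Pinv ** Sigma_BH M B ** transpose Pinv) $ i $ k"
    unfolding S[symmetric] by (simp add: matrix_matrix_mult_def transpose_def sum_2 algebra_simps)
  finally show ?thesis .
qed

end

section \<open>Wavelet coefficients\<close>

lemma L2_inner_mult_bound:
  fixes V :: "'w \<Rightarrow> 'a::euclidean_space" and W :: "'w \<Rightarrow> real"
  assumes V: "sq_integrable M V" and W: "sq_integrable M W"
  shows "integrable M (\<lambda>w. (u \<bullet> V w) * W w)"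
    "\<bar>LINT w|M. (u \<bullet> V w) * W w\<bar> \<le> norm u * L2_norm M V * L2_norm M W"
proof -
  have uV: "sq_integrable M (\<lambda>w. u \<bullet> V w)"
    by (rule sq_integrable_bounded_linear[OF bounded_linear_inner_right V])
  note m = sq_integrableD(1)[OF uV] sq_integrableD(1)[OF W]
  have i: "integrable M (\<lambda>w. (u \<bullet> V w)\<^sup>2)" "integrable M (\<lambda>w. (W w)\<^sup>2)"
    using sq_integrableD(2)[OF uV] sq_integrableD(2)[OF W] by simp_all
  show "integrable M (\<lambda>w. (u \<bullet> V w) * W w)" by (rule square_integrable_mult[OF m i])
  have "(LINT w|M. (u \<bullet> V w)\<^sup>2) \<le> (LINT w|M. (norm u)\<^sup>2 * (norm (V w))\<^sup>2)"
  proof (rule integral_mono[OF i(1)])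
    show "integrable M (\<lambda>w. (norm u)\<^sup>2 * (norm (V w))\<^sup>2)" using sq_integrableD(2)[OF V] by simp
    show "(u \<bullet> V w)\<^sup>2 \<le> (norm u)\<^sup>2 * (norm (V w))\<^sup>2" for w
      using power_mono[OF Cauchy_Schwarz_ineq2[of u "V w"], of 2] by (simp add: power_mult_distrib)
  qed
  then have "sqrt (LINT w|M. (u \<bullet> V w)\<^sup>2) \<le> sqrt ((norm u)\<^sup>2 * (LINT w|M. (norm (V w))\<^sup>2))"
    by simp
  also have "\<dots> = norm u * L2_norm M V" by (simp add: real_sqrt_mult L2_norm_def)
  finally have "sqrt (LINT w|M. (u \<bullet> V w)\<^sup>2) * sqrt (LINT w|M. (W w)\<^sup>2) \<le> norm u * L2_norm M V * L2_norm M W"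
    unfolding L2_norm_def[of M W] real_norm_def power2_abs by (rule mult_right_mono) simp
  then show "\<bar>LINT w|M. (u \<bullet> V w) * W w\<bar> \<le> norm u * L2_norm M V * L2_norm M W"
    using Cauchy_Schwarz_integral[OF m i] by linarith
qed

text \<open>Pairing with a fixed \<open>W\<close> is a continuous functional on the
  square-integrable variables, so it commutes with the mean-square integral; the paired simple
  functions converge in the mean over the line.\<close>

lemma ms_integral_pairing:
  fixes X :: "real \<Rightarrow> 'w \<Rightarrow> real^'n"
  assumes ms: "ms_integral M X Y" and W: "sq_integrable M W"
    and meas: "(\<lambda>z. LINT w|M. (u \<bullet> X z w) * W w) \<in> borel_measurable borel"
  shows "integrable lborel (\<lambda>z. LINT w|M. (u \<bullet> X z w) * W w)"
    "(LINT w|M. (u \<bullet> Y w) * W w) = (LINT z|lborel. LINT w|M. (u \<bullet> X z w) * (W w :: real))"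
proof -
  from ms obtain \<E> Z where X: "\<And>z. sq_integrable M (X z)" and Y: "sq_integrable M Y"
    and E: "\<And>n. finite (\<E> n)" "\<And>n. \<E> n \<subseteq> fin_borel" and Z: "\<And>n E. E \<in> \<E> n \<Longrightarrow> sq_integrable M (Z n E)"
    and nm: "\<And>n. (\<lambda>z. L2_norm M (\<lambda>\<omega>. X z \<omega> - (\<Sum>E\<in>\<E> n. indicator E z *\<^sub>R Z n E \<omega>))) \<in> borel_measurable borel"
    and nl: "(\<lambda>n. \<integral>\<^sup>+z. ennreal (L2_norm M (\<lambda>\<omega>. X z \<omega> - (\<Sum>E\<in>\<E> n. indicator E z *\<^sub>R Z n E \<omega>))) \<partial>lborel) \<longlonglongrightarrow> 0"
    and Yl: "(\<lambda>n. L2_norm M (\<lambda>\<omega>. Y \<omega> - (\<Sum>E\<in>\<E> n. measure lborel E *\<^sub>R Z n E \<omega>))) \<longlonglongrightarrow> 0"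
    unfolding ms_integral_def by blast
  define q where "q z = (LINT w|M. (u \<bullet> X z w) * W w)" for z
  define e where "e n E = (LINT w|M. (u \<bullet> Z n E w) * W w)" for n E
  define qn where "qn n z = (\<Sum>E\<in>\<E> n. indicator E z * e n E)" for n z
  define \<delta> where "\<delta> n z = L2_norm M (\<lambda>\<omega>. X z \<omega> - (\<Sum>E\<in>\<E> n. indicator E z *\<^sub>R Z n E \<omega>))" for n z
  define c where "c = norm u * L2_norm M W"
  have c0: "0 \<le> c" by (simp add: c_def L2_norm_def)
  have \<delta>0: "0 \<le> \<delta> n z" for n z by (simp add: \<delta>_def L2_norm_def)
  have [measurable]: "q \<in> borel_measurable borel" unfolding q_def by (rule meas)
  have [measurable]: "\<delta> n \<in> borel_measurable borel" for n unfolding \<delta>_def by (rule nm)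
  have E_m[measurable]: "E \<in> sets borel" if "E \<in> \<E> n" for E n using E(2)[of n] that by (auto simp: fin_borel_def)
  have [measurable]: "qn n \<in> borel_measurable borel" for n unfolding qn_def by measurable
  have close: "\<bar>q z - qn n z\<bar> \<le> c * \<delta> n z" for n z
  proof -
    let ?S = "\<lambda>\<omega>. \<Sum>E\<in>\<E> n. indicator E z *\<^sub>R Z n E \<omega>"
    have S: "sq_integrable M ?S" by (intro sq_integrable_sum sq_integrable_scaleR Z)
    have "qn n z = (LINT w|M. (u \<bullet> ?S w) * W w)"
    proof -
      have "(LINT w|M. (u \<bullet> ?S w) * W w) = (LINT w|M. (\<Sum>E\<in>\<E> n. indicator E z * ((u \<bullet> Z n E w) * W w)))"
        by (simp add: inner_sum_right sum_distrib_right mult.assoc)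
      also have "\<dots> = (\<Sum>E\<in>\<E> n. indicator E z * e n E)"
        by (subst Bochner_Integration.integral_sum)
          (auto simp: e_def intro!: integrable_mult_right L2_inner_mult_bound(1)[OF Z W])
      finally show ?thesis by (simp add: qn_def)
    qed
    then have "q z - qn n z = (LINT w|M. (u \<bullet> (X z w - ?S w)) * W w)"
      using L2_inner_mult_bound(1)[OF X[of z] W, of u] L2_inner_mult_bound(1)[OF S W, of u]
      by (simp add: q_def inner_diff_right left_diff_distrib)
    with L2_inner_mult_bound(2)[OF sq_integrable_diff[OF X[of z] S] W, of u]
    show ?thesis by (simp add: c_def \<delta>_def mult_ac)
  qed
  have lim: "(\<lambda>n. \<integral>\<^sup>+z. ennreal (c * \<delta> n z) \<partial>lborel) \<longlonglongrightarrow> 0"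
  proof -
    have "(\<integral>\<^sup>+z. ennreal (c * \<delta> n z) \<partial>lborel) = ennreal c * (\<integral>\<^sup>+z. ennreal (\<delta> n z) \<partial>lborel)" for n
      by (subst nn_integral_cmult[symmetric]) (auto simp: ennreal_mult' c0)
    then show ?thesis using ennreal_tendsto_cmult[OF _ nl[folded \<delta>_def], of "ennreal c"] by simp
  qed
  have qn_int: "integrable lborel (qn n)" for n
    unfolding qn_def using E(2)[of n]
    by (intro Bochner_Integration.integrable_sum integrable_mult_left integrable_real_indicator)
      (auto simp: fin_borel_def)
  have qn_val: "integral\<^sup>L lborel (qn n) = (\<Sum>E\<in>\<E> n. measure lborel E * e n E)" for n
  proof -
    have "integrable lborel (\<lambda>z. indicator E z * e n E)" if "E \<in> \<E> n" for E
      using E(2)[of n] that by (intro integrable_mult_left integrable_real_indicator) (auto simp: fin_borel_def)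
    then show ?thesis unfolding qn_def by (subst Bochner_Integration.integral_sum) auto
  qed
  \<comment> \<open>The error integrals are only known to tend to 0 and may be infinite for small
    \<open>n\<close>; integrability is read off from one late index.\<close>
  have "eventually (\<lambda>n. (\<integral>\<^sup>+z. ennreal (c * \<delta> n z) \<partial>lborel) < 1) sequentially"
    by (rule order_tendstoD(2)[OF lim]) simp
  then obtain n0 where n0: "\<And>n. n \<ge> n0 \<Longrightarrow> (\<integral>\<^sup>+z. ennreal (c * \<delta> n z) \<partial>lborel) < 1"
    unfolding eventually_sequentially by blast
  have \<delta>_int: "integrable lborel (\<lambda>z. c * \<delta> n z)" if "n \<ge> n0" for n
  proof (rule integrableI_nonneg)
    show "(\<integral>\<^sup>+z. ennreal (c * \<delta> n z) \<partial>lborel) < \<infinity>"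
      using n0[OF that] by (rule order.strict_trans) simp
  qed (auto simp: c0 \<delta>0)
  have q_int: "integrable lborel q"
  proof (rule Bochner_Integration.integrable_bound)
    show "integrable lborel (\<lambda>z. \<bar>qn n0 z\<bar> + c * \<delta> n0 z)"
      using qn_int \<delta>_int by auto
    show "AE z in lborel. norm (q z) \<le> norm (\<bar>qn n0 z\<bar> + c * \<delta> n0 z)"
    proof (rule AE_I2)
      fix z
      show "norm (q z) \<le> norm (\<bar>qn n0 z\<bar> + c * \<delta> n0 z)"
        using close[of z n0] by simp
    qed
  qed measurable
  then show "integrable lborel (\<lambda>z. LINT w|M. (u \<bullet> X z w) * W w)" unfolding q_def .
  have "(\<lambda>n. integral\<^sup>L lborel (qn n)) \<longlonglongrightarrow> integral\<^sup>L lborel q"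
  proof (rule tendsto_L1_int[OF qn_int q_int])
    show "(\<lambda>n. \<integral>\<^sup>+z. norm (qn n z - q z) \<partial>lborel) \<longlonglongrightarrow> 0"
    proof (rule tendsto_sandwich[OF _ _ tendsto_const lim])
      have "(\<integral>\<^sup>+z. norm (qn n z - q z) \<partial>lborel) \<le> (\<integral>\<^sup>+z. ennreal (c * \<delta> n z) \<partial>lborel)" for n
        using close[of _ n] by (intro nn_integral_mono ennreal_leI) (simp add: abs_minus_commute)
      then show "eventually (\<lambda>n. (\<integral>\<^sup>+z. norm (qn n z - q z) \<partial>lborel) \<le> (\<integral>\<^sup>+z. ennreal (c * \<delta> n z) \<partial>lborel)) sequentially"
        by simp
    qed simp
  qed
  moreover have "(\<lambda>n. integral\<^sup>L lborel (qn n)) \<longlonglongrightarrow> (LINT w|M. (u \<bullet> Y w) * W w)"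
  proof -
    define S where "S n w = (\<Sum>E\<in>\<E> n. measure lborel E *\<^sub>R Z n E w)" for n w
    have S: "sq_integrable M (S n)" for n
      unfolding S_def[abs_def] by (intro sq_integrable_sum sq_integrable_scaleR Z)
    have eq: "integral\<^sup>L lborel (qn n) = (LINT w|M. (u \<bullet> S n w) * W w)" for n
    proof -
      have "(LINT w|M. (u \<bullet> S n w) * W w) = (LINT w|M. (\<Sum>E\<in>\<E> n. measure lborel E * ((u \<bullet> Z n E w) * W w)))"
        by (simp add: S_def inner_sum_right sum_distrib_right mult.assoc)
      also have "\<dots> = (\<Sum>E\<in>\<E> n. measure lborel E * e n E)"
        by (subst Bochner_Integration.integral_sum)
          (auto simp: e_def intro!: integrable_mult_right L2_inner_mult_bound(1)[OF Z W])
      finally show ?thesis by (simp add: qn_val)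
    qed
    have "(\<lambda>n. (LINT w|M. (u \<bullet> Y w) * W w) - integral\<^sup>L lborel (qn n)) \<longlonglongrightarrow> 0"
    proof (rule tendsto_zero_sandwich)
      show "\<bar>(LINT w|M. (u \<bullet> Y w) * W w) - integral\<^sup>L lborel (qn n)\<bar> \<le> norm u * L2_norm M (\<lambda>w. Y w - S n w) * L2_norm M W" for n
        using L2_inner_mult_bound(1)[OF Y W, of u] L2_inner_mult_bound(1)[OF S[of n] W, of u]
          L2_inner_mult_bound(2)[OF sq_integrable_diff[OF Y S[of n]] W, of u]
        by (simp add: eq inner_diff_right left_diff_distrib)
      have "(\<lambda>n. norm u * L2_norm M (\<lambda>w. Y w - S n w) * L2_norm M W) \<longlonglongrightarrow> norm u * 0 * L2_norm M W"
        using Yl unfolding S_def by (intro tendsto_intros)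
      then show "(\<lambda>n. norm u * L2_norm M (\<lambda>w. Y w - S n w) * L2_norm M W) \<longlonglongrightarrow> 0" by simp
    qed
    from tendsto_diff[OF tendsto_const[of "LINT w|M. (u \<bullet> Y w) * W w"] this] show ?thesis by simp
  qed
  ultimately show "(LINT w|M. (u \<bullet> Y w) * W w) = (LINT z|lborel. LINT w|M. (u \<bullet> X z w) * W w)"
    unfolding q_def by (rule LIMSEQ_unique[symmetric])
qed

section \<open>Covariances of the wavelet coefficients\<close>

locale ofbm_wavelet = ofbm_process +
  fixes \<psi> :: "real \<Rightarrow> real" and N\<^sub>\<psi> :: nat and \<alpha> :: real and D :: "nat \<Rightarrow> int \<Rightarrow> 'b \<Rightarrow> real^2"
  assumes wavelet: "wavelet \<psi> N\<^sub>\<psi> \<alpha>" and coeffs: "wavelet_coeffs M \<psi> B D"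
begin

lemma psi_integrable: "integrable lborel \<psi>"
  using wavelet by (simp add: wavelet_def)

lemma psi_measurable[measurable]: "\<psi> \<in> borel_measurable borel"
  using borel_measurable_integrable[OF psi_integrable] by simp

lemma psi_moment: "(LINT t|lborel. \<psi> t) = 0" "(LINT t|lborel. t * \<psi> t) = 0"
proof -
  have *: "\<forall>q<N\<^sub>\<psi>. (LINT t|lborel. t ^ q * \<psi> t) = 0" "2 \<le> N\<^sub>\<psi>" using wavelet by (auto simp: wavelet_def)
  then show "(LINT t|lborel. \<psi> t) = 0" "(LINT t|lborel. t * \<psi> t) = 0"
    using *(1)[rule_format, of 0] *(1)[rule_format, of 1] by auto
qed

lemma psi_support_ex: "\<exists>L>0. \<forall>t. \<psi> t \<noteq> 0 \<longrightarrow> \<bar>t\<bar> \<le> L"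
proof -
  obtain a b where ab: "closure {t. \<psi> t \<noteq> 0} = {a..b}" using wavelet by (auto simp: wavelet_def)
  have "\<bar>t\<bar> \<le> max 1 (max \<bar>a\<bar> \<bar>b\<bar>)" if "\<psi> t \<noteq> 0" for t
  proof -
    have "t \<in> {a..b}" using that closure_subset[of "{t. \<psi> t \<noteq> 0}"] unfolding ab by blast
    then show ?thesis by auto
  qed
  then show ?thesis by (intro exI[of _ "max 1 (max \<bar>a\<bar> \<bar>b\<bar>)"]) auto
qed

definition L :: real where "L = (SOME L. L > 0 \<and> (\<forall>t. \<psi> t \<noteq> 0 \<longrightarrow> \<bar>t\<bar> \<le> L))"

lemma L: "L > 0" "\<psi> t \<noteq> 0 \<Longrightarrow> \<bar>t\<bar> \<le> L"
  using someI_ex[OF psi_support_ex[unfolded Bex_def]] unfolding L_def[symmetric] by auto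

lemma psi_mult_integrable:
  assumes [measurable]: "f \<in> borel_measurable borel" and b: "\<And>t. \<bar>t\<bar> \<le> L \<Longrightarrow> \<bar>f t\<bar> \<le> C"
  shows "integrable lborel (\<lambda>t. \<psi> t * f t)"
    "\<bar>LINT t|lborel. \<psi> t * f t\<bar> \<le> (LINT t|lborel. \<bar>\<psi> t\<bar>) * C"
proof -
  have le: "\<bar>\<psi> t * f t\<bar> \<le> \<bar>\<psi> t\<bar> * C" for t
    by (cases "\<psi> t = 0") (auto simp: abs_mult intro!: mult_left_mono b L(2))
  have i: "integrable lborel (\<lambda>t. \<bar>\<psi> t\<bar> * C)" using psi_integrable by simp
  show j: "integrable lborel (\<lambda>t. \<psi> t * f t)"
  proof (rule Bochner_Integration.integrable_bound[OF i])
    show "AE t in lborel. norm (\<psi> t * f t) \<le> norm (\<bar>\<psi> t\<bar> * C)"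
      using le by (intro AE_I2) (auto intro: order_trans[OF _ abs_ge_self])
  qed measurable
  have "\<bar>LINT t|lborel. \<psi> t * f t\<bar> \<le> (LINT t|lborel. \<bar>\<psi> t\<bar> * C)"
    using norm_integral_le[OF j i] le by simp
  then show "\<bar>LINT t|lborel. \<psi> t * f t\<bar> \<le> (LINT t|lborel. \<bar>\<psi> t\<bar>) * C" by simp
qed

definition d :: "nat \<Rightarrow> int \<Rightarrow> 2 \<Rightarrow> 'b \<Rightarrow> real" where
  "d j k i w = (Pinv *v D (2 ^ j) k w) $ i"

lemma d_eq: "d j k i w = row i Pinv \<bullet> D (2 ^ j) k w"
  by (simp add: d_def matrix_vector_mul_component row_def)

lemma X_eq: "X t w $ i = row i Pinv \<bullet> B t w"
  by (simp add: X_def matrix_vector_mul_component row_def)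

lemma D_ms: "ms_integral M (\<lambda>z \<omega>. \<psi> z *\<^sub>R B (2 ^ j * z + 2 ^ j * of_int k) \<omega>) (D (2 ^ j) k)"
  using coeffs by (simp add: wavelet_coeffs_def)

lemma D_sq: "sq_integrable M (D (2 ^ j) k)"
  using D_ms[of j k] by (simp add: ms_integral_def)

lemma d_sq: "sq_integrable M (d j k i)"
  unfolding d_eq[abs_def] by (rule sq_integrable_bounded_linear[OF bounded_linear_inner_right D_sq])

lemma X_sq: "sq_integrable M (\<lambda>w. X t w $ i)"
proof -
  have "integrable M (\<lambda>w. (norm (X t w $ i))\<^sup>2)" using cov_X(1)[of t i t i] by (simp add: power2_eq_square)
  moreover have "(\<lambda>w. X t w $ i) \<in> borel_measurable M" unfolding X_eq by measurable
  ultimately show ?thesis by (simp add: sq_integrable_def)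
qed

lemma d_pairing:
  assumes W: "sq_integrable M W"
    and [measurable]: "(\<lambda>t. expectation (\<lambda>w. X t w $ i * W w)) \<in> borel_measurable borel"
  shows "integrable lborel (\<lambda>z. \<psi> z * expectation (\<lambda>w. X (2 ^ j * z + 2 ^ j * of_int k) w $ i * W w))"
    "expectation (\<lambda>w. d j k i w * W w) =
      (LINT z|lborel. \<psi> z * expectation (\<lambda>w. X (2 ^ j * z + 2 ^ j * of_int k) w $ i * W w))"
proof -
  have eq: "expectation (\<lambda>w. (row i Pinv \<bullet> (\<psi> z *\<^sub>R B t w)) * W w) = \<psi> z * expectation (\<lambda>w. X t w $ i * W w)" for z t
    by (simp add: X_eq mult.assoc)
  have m: "(\<lambda>z. expectation (\<lambda>w. (row i Pinv \<bullet> (\<psi> z *\<^sub>R B (2 ^ j * z + 2 ^ j * of_int k) w)) * W w)) \<in> borel_measurable borel"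
    unfolding eq by measurable
  from ms_integral_pairing[OF D_ms[of j k] W m]
  show "integrable lborel (\<lambda>z. \<psi> z * expectation (\<lambda>w. X (2 ^ j * z + 2 ^ j * of_int k) w $ i * W w))"
    "expectation (\<lambda>w. d j k i w * W w) =
      (LINT z|lborel. \<psi> z * expectation (\<lambda>w. X (2 ^ j * z + 2 ^ j * of_int k) w $ i * W w))"
    unfolding eq d_eq by auto
qed

lemma rr_measurable[measurable]: "(\<lambda>p. rr i k (fst p) (snd p)) \<in> borel_measurable (borel \<Otimes>\<^sub>M borel)"
  unfolding rr_def by measurable

lemma rr_measurable1[measurable]: "(\<lambda>t. rr i k t s) \<in> borel_measurable borel" "(\<lambda>s. rr i k t s) \<in> borel_measurable borel"
  unfolding rr_def by measurable

lemma cov_dX: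
  "expectation (\<lambda>w. d j k i w * X t w $ l) = (LINT z|lborel. \<psi> z * rr i l (2 ^ j * z + 2 ^ j * of_int k) t)"
  using d_pairing(2)[OF X_sq[of t l], of i j k] unfolding cov_X(2) by simp

lemma cov_Xd_measurable[measurable]:
  "(\<lambda>t. expectation (\<lambda>w. X t w $ l * d j k i w)) \<in> borel_measurable borel"
proof -
  have "(\<lambda>t. LINT z|lborel. \<psi> z * rr i l (2 ^ j * z + 2 ^ j * of_int k) t) \<in> borel_measurable borel"
    by (rule lborel.borel_measurable_lebesgue_integral) (simp add: rr_def)
  then show ?thesis unfolding cov_dX[symmetric] by (simp add: mult.commute)
qed

lemma rr_swap: "rr i l t s = rr l i s t"
  unfolding cov_X(2)[symmetric] by (simp add: mult.commute)

text \<open>The two terms of the covariance that depend on only one time drop out because \<open>\<psi>\<close> has mean 0.\<close>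

definition J :: "real \<Rightarrow> nat \<Rightarrow> nat \<Rightarrow> real \<Rightarrow> real" where
  "J e j j' y = (LINT z|lborel. \<psi> z * (LINT z'|lborel. \<psi> z' * \<bar>2 ^ j * z - 2 ^ j' * z' + y\<bar> powr e))"

definition cc :: "2 \<Rightarrow> 2 \<Rightarrow> nat \<Rightarrow> nat \<Rightarrow> real \<Rightarrow> real" where
  "cc i l j j' y = - (\<Gamma> $ i $ l * K i l * J (\<eta> i l) j j' y)"

lemma abs_powr_bound:
  fixes e x c :: real
  assumes "0 \<le> e" "\<bar>x\<bar> \<le> c" shows "\<bar>\<bar>x\<bar> powr e\<bar> \<le> c powr e"
  using assms powr_mono2[of e "\<bar>x\<bar>" c] by simp

lemma affine_bound:
  fixes a b t :: real
  assumes "\<bar>t\<bar> \<le> L" shows "\<bar>a * t + b\<bar> \<le> \<bar>a\<bar> * L + \<bar>b\<bar>"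
proof -
  have "\<bar>a * t\<bar> \<le> \<bar>a\<bar> * L" using assms by (simp add: abs_mult mult_left_mono)
  then show ?thesis by linarith
qed

lemma psi_powr_integrable:
  assumes "0 \<le> e" shows "integrable lborel (\<lambda>t. \<psi> t * \<bar>a * t + b\<bar> powr e)"
    "\<bar>LINT t|lborel. \<psi> t * \<bar>a * t + b\<bar> powr e\<bar> \<le> (LINT t|lborel. \<bar>\<psi> t\<bar>) * (\<bar>a\<bar> * L + \<bar>b\<bar>) powr e"
proof -
  have m: "(\<lambda>t. \<bar>a * t + b\<bar> powr e) \<in> borel_measurable borel" by measurable
  have bd: "\<bar>\<bar>a * t + b\<bar> powr e\<bar> \<le> (\<bar>a\<bar> * L + \<bar>b\<bar>) powr e" if "\<bar>t\<bar> \<le> L" for t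
    by (rule abs_powr_bound[OF assms affine_bound[OF that]])
  show "integrable lborel (\<lambda>t. \<psi> t * \<bar>a * t + b\<bar> powr e)"
    "\<bar>LINT t|lborel. \<psi> t * \<bar>a * t + b\<bar> powr e\<bar> \<le> (LINT t|lborel. \<bar>\<psi> t\<bar>) * (\<bar>a\<bar> * L + \<bar>b\<bar>) powr e"
    by (rule psi_mult_integrable[OF m bd]; simp)+
qed

lemma J_inner_integrable:
  assumes "0 \<le> e"
  shows "integrable lborel (\<lambda>z. \<psi> z * (LINT z'|lborel. \<psi> z' * \<bar>a * z - a' * z' + y\<bar> powr e))"
proof (rule psi_mult_integrable(1))
  show "(\<lambda>z. LINT z'|lborel. \<psi> z' * \<bar>a * z - a' * z' + y\<bar> powr e) \<in> borel_measurable borel"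
    by (rule lborel.borel_measurable_lebesgue_integral) simp
  fix z assume z: "\<bar>z\<bar> \<le> L"
  have "\<bar>LINT z'|lborel. \<psi> z' * \<bar>(- a') * z' + (a * z + y)\<bar> powr e\<bar> \<le>
      (LINT t|lborel. \<bar>\<psi> t\<bar>) * (\<bar>- a'\<bar> * L + \<bar>a * z + y\<bar>) powr e"
    by (rule psi_powr_integrable(2)[OF assms])
  also have "\<dots> \<le> (LINT t|lborel. \<bar>\<psi> t\<bar>) * (\<bar>a'\<bar> * L + (\<bar>a\<bar> * L + \<bar>y\<bar>)) powr e"
    using affine_bound[OF z, of a y] L(1) assms
    by (intro mult_left_mono powr_mono2) (auto intro!: add_nonneg_nonneg)
  finally show "\<bar>LINT z'|lborel. \<psi> z' * \<bar>a * z - a' * z' + y\<bar> powr e\<bar> \<le>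
      (LINT t|lborel. \<bar>\<psi> t\<bar>) * (\<bar>a'\<bar> * L + (\<bar>a\<bar> * L + \<bar>y\<bar>)) powr e"
    by (simp add: algebra_simps)
qed

text \<open>The pairing is used twice: the second coefficient is the test variable for the first,
  and its covariance with the process at a fixed time is already an integral of \<open>rr\<close>.
  What is left depends on the positions through their lag only.\<close>

lemma cov_d:
  "expectation (\<lambda>w. d j k i w * d j' k' l w) = cc i l j j' (2 ^ j * of_int k - 2 ^ j' * of_int k')"
proof -
  let ?e = "\<eta> i l" and ?g = "\<Gamma> $ i $ l * K i l"
  have e: "0 \<le> ?e" using \<eta>_bounds(1)[of i l] by simp
  define a b where "a = 2 ^ j * real_of_int k" and "b = 2 ^ j' * real_of_int k'"
  define c where "c = (LINT z'|lborel. \<psi> z' * \<bar>2 ^ j' * z' + b\<bar> powr ?e)"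
  have i1: "integrable lborel (\<lambda>z'. \<psi> z' * \<bar>2 ^ j' * z' + b\<bar> powr ?e)" for z
    by (rule psi_powr_integrable(1)[OF e])
  have i2: "integrable lborel (\<lambda>z'. \<psi> z' * \<bar>2 ^ j * z - 2 ^ j' * z' + (a - b)\<bar> powr ?e)" for z
    using psi_powr_integrable(1)[OF e, of "- (2 ^ j')" "2 ^ j * z + (a - b)"] by (simp add: algebra_simps)
  have inner: "expectation (\<lambda>w. X t w $ i * d j' k' l w) =
      ?g * (c - (LINT z'|lborel. \<psi> z' * \<bar>t - (2 ^ j' * z' + b)\<bar> powr ?e))" for t
  proof -
    have i3: "integrable lborel (\<lambda>z'. \<psi> z' * \<bar>t - (2 ^ j' * z' + b)\<bar> powr ?e)"
      using psi_powr_integrable(1)[OF e, of "- (2 ^ j')" "t - b"] by (simp add: algebra_simps)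
    have "expectation (\<lambda>w. X t w $ i * d j' k' l w) = (LINT z'|lborel. \<psi> z' * rr i l t (2 ^ j' * z' + b))"
      using cov_dX[of j' k' l t i] unfolding rr_swap[of l i] by (simp add: mult.commute b_def)
    also have "\<dots> = (LINT z'|lborel. ?g * (\<bar>t\<bar> powr ?e * \<psi> z' + \<psi> z' * \<bar>2 ^ j' * z' + b\<bar> powr ?e -
        \<psi> z' * \<bar>t - (2 ^ j' * z' + b)\<bar> powr ?e))"
      by (rule Bochner_Integration.integral_cong) (simp_all add: rr_def algebra_simps)
    also have "\<dots> = ?g * (c - (LINT z'|lborel. \<psi> z' * \<bar>t - (2 ^ j' * z' + b)\<bar> powr ?e))"
      using i1 i3 psi_integrable by (simp add: psi_moment c_def)
    finally show ?thesis .
  qed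
  have "expectation (\<lambda>w. d j k i w * d j' k' l w) =
      (LINT z|lborel. \<psi> z * (?g * (c - (LINT z'|lborel. \<psi> z' * \<bar>2 ^ j * z + a - (2 ^ j' * z' + b)\<bar> powr ?e))))"
    using d_pairing(2)[OF d_sq[of j' k' l], of i j k] unfolding inner a_def by simp
  also have "\<dots> = (LINT z|lborel. ?g * (c * \<psi> z - \<psi> z * (LINT z'|lborel. \<psi> z' * \<bar>2 ^ j * z - 2 ^ j' * z' + (a - b)\<bar> powr ?e)))"
    by (rule Bochner_Integration.integral_cong) (simp_all add: algebra_simps)
  also have "\<dots> = cc i l j j' (a - b)"
    using J_inner_integrable[OF e, of "2 ^ j" "2 ^ j'" "a - b"] psi_integrable
    by (simp add: psi_moment cc_def J_def)
  finally show ?thesis by (simp add: a_def b_def)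
qed

text \<open>Self-similarity: a common power of 2 can be taken out of the absolute value. This is why
  the normalised coefficients have a covariance that does not change with the scale.\<close>

lemma J_scale:
  assumes e: "0 < e" shows "J e (l + j) (l + j') (2 ^ l * y) = (2 ^ l) powr e * J e j j' y"
proof -
  have "\<bar>2 ^ (l + j) * z - 2 ^ (l + j') * z' + 2 ^ l * y\<bar> powr e = (2 ^ l) powr e * \<bar>2 ^ j * z - 2 ^ j' * z' + y\<bar> powr e" for z z'
  proof -
    have "2 ^ (l + j) * z - 2 ^ (l + j') * z' + 2 ^ l * y = 2 ^ l * (2 ^ j * z - 2 ^ j' * z' + y)"
      by (simp add: power_add algebra_simps)
    then show ?thesis by (simp add: abs_mult powr_mult)
  qed
  then show ?thesis unfolding J_def by (simp add: mult.left_commute[of "\<psi> _"])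
qed

end

lemma sum_lessThan_add: "(\<Sum>j<n + m. f j) = (\<Sum>j<n. f j) + (\<Sum>j<m. f (n + j :: nat))" for f :: "nat \<Rightarrow> real"
  by (induction m) (simp_all add: add.assoc)

text \<open>An interval of positive length is not contained in a null set.\<close>

lemma AE_lborel_open_ex:
  assumes "AE x in lborel. P (x :: real)" "a < b"
  shows "\<exists>x. a < x \<and> x < b \<and> P x"
proof (rule ccontr)
  assume n: "\<not> ?thesis"
  from AE_E[OF assms(1)] obtain S where S: "{x \<in> space lborel. \<not> P x} \<subseteq> S" "emeasure lborel S = 0" "S \<in> sets lborel"
    by blast
  have "{a<..<b} \<subseteq> S" using n S(1) by auto
  then have "emeasure lborel {a<..<b} \<le> emeasure lborel S" by (rule emeasure_mono) (rule S(3))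
  then show False using S(2) assms(2) by simp
qed

section \<open>The Gaussian space generated by the process\<close>

context ofbm_wavelet
begin

text \<open>Indexed by an initial segment of the naturals, with repeated times allowed, so that a
  sum of two members is obtained by concatenation.\<close>

definition GB :: "('b \<Rightarrow> real) set" where
  "GB = {Z. \<exists>(n::nat) a \<tau>. Z = (\<lambda>w. \<Sum>j<n. a j \<bullet> B (\<tau> j) w)}"

text \<open>The mean-square closure of \<open>GB\<close>. It is needed because the wavelet
  coefficients are limits of linear combinations of values of the process, not such combinations
  themselves.\<close>

definition G :: "('b \<Rightarrow> real) set" where
  "G = {Z. Z \<in> borel_measurable M \<and> (\<exists>S. (\<forall>n. S n \<in> GB) \<and>
     (\<forall>n. integrable M (\<lambda>w. (S n w - Z w)\<^sup>2)) \<and> (\<lambda>n::nat. expectation (\<lambda>w. (S n w - Z w)\<^sup>2)) \<longlonglongrightarrow> 0)}"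

lemma GB_I: "(\<lambda>w. \<Sum>j<n. a j \<bullet> B (\<tau> j) w) \<in> GB" for n :: nat
  unfolding GB_def by (intro CollectI exI[of _ n] exI[of _ a] exI[of _ \<tau>] refl)

lemma GB_gauss: "Z \<in> GB \<Longrightarrow> gauss M Z"
  by (auto simp: GB_def gauss_B)

lemma GB_measurable: "Z \<in> GB \<Longrightarrow> Z \<in> borel_measurable M"
  using GB_gauss by (simp add: gauss_def)

lemma GB_scale: assumes "Z \<in> GB" shows "(\<lambda>w. c * Z w) \<in> GB"
proof -
  from assms obtain n a \<tau> where "Z = (\<lambda>w. \<Sum>j<n::nat. a j \<bullet> B (\<tau> j) w)" by (auto simp: GB_def)
  then have eq: "(\<lambda>w. c * Z w) = (\<lambda>w. \<Sum>j<n::nat. (c *\<^sub>R a j) \<bullet> B (\<tau> j) w)"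
    by (simp add: sum_distrib_left)
  show ?thesis unfolding eq by (rule GB_I[where n = n and a = "\<lambda>j. c *\<^sub>R a j" and \<tau> = \<tau>])
qed

lemma GB_add: assumes "Z \<in> GB" "Z' \<in> GB" shows "(\<lambda>w. Z w + Z' w) \<in> GB"
proof -
  from assms(1) obtain n a \<tau> where Z: "Z = (\<lambda>w. \<Sum>j<n::nat. a j \<bullet> B (\<tau> j) w)" by (auto simp: GB_def)
  from assms(2) obtain m b \<sigma> where Z': "Z' = (\<lambda>w. \<Sum>j<m::nat. b j \<bullet> B (\<sigma> j) w)" by (auto simp: GB_def)
  have eq: "(\<lambda>w. Z w + Z' w) = (\<lambda>w. \<Sum>j<n + m. (if j < n then a j else b (j - n)) \<bullet> B (if j < n then \<tau> j else \<sigma> (j - n)) w)"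
    unfolding sum_lessThan_add Z Z' by simp
  show ?thesis unfolding eq
    by (rule GB_I[where n = "n + m" and a = "\<lambda>j. if j < n then a j else b (j - n)" and
        \<tau> = "\<lambda>j. if j < n then \<tau> j else \<sigma> (j - n)"])
qed

sublocale gaussian_space M G
proof unfold_locales
  show "gauss M Z" if "Z \<in> G" for Z
  proof -
    from that obtain S where Z: "Z \<in> borel_measurable M" and S: "\<And>n. S n \<in> GB"
      "\<And>n. integrable M (\<lambda>w. (S n w - Z w)\<^sup>2)" "(\<lambda>n::nat. expectation (\<lambda>w. (S n w - Z w)\<^sup>2)) \<longlonglongrightarrow> 0"
      by (auto simp: G_def)
    show ?thesis by (rule gauss_L2_limit[OF GB_gauss[OF S(1)] Z S(2,3)])
  qed
  show "(\<lambda>w. Z w + Z' w) \<in> G" if G: "Z \<in> G" "Z' \<in> G" for Z Z'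
  proof -
    from G(1) obtain S where Z[measurable]: "Z \<in> borel_measurable M" and S: "\<And>n. S n \<in> GB"
      "\<And>n. integrable M (\<lambda>w. (S n w - Z w)\<^sup>2)" "(\<lambda>n::nat. expectation (\<lambda>w. (S n w - Z w)\<^sup>2)) \<longlonglongrightarrow> 0"
      by (auto simp: G_def)
    from G(2) obtain S' where Z'[measurable]: "Z' \<in> borel_measurable M" and S': "\<And>n. S' n \<in> GB"
      "\<And>n. integrable M (\<lambda>w. (S' n w - Z' w)\<^sup>2)" "(\<lambda>n::nat. expectation (\<lambda>w. (S' n w - Z' w)\<^sup>2)) \<longlonglongrightarrow> 0"
      by (auto simp: G_def)
    note L2 = L2_sum_tendsto[of "UNIV :: bool set" "\<lambda>b. if b then S else S'" M "\<lambda>b. if b then Z else Z'"]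
    have "(\<forall>n. integrable M (\<lambda>w. ((S n w + S' n w) - (Z w + Z' w))\<^sup>2)) \<and>
      (\<lambda>n. expectation (\<lambda>w. ((S n w + S' n w) - (Z w + Z' w))\<^sup>2)) \<longlonglongrightarrow> 0"
      using L2 GB_measurable[OF S(1)] GB_measurable[OF S'(1)] S(2,3) S'(2,3) Z Z'
      by (simp add: UNIV_bool add.commute split: if_splits)
    then show ?thesis
      unfolding G_def using GB_add[OF S(1) S'(1)]
      by (intro CollectI conjI exI[of _ "\<lambda>n w. S n w + S' n w"]) (auto intro!: borel_measurable_add)
  qed
  show "(\<lambda>w. c * Z w) \<in> G" if G: "Z \<in> G" for Z c
  proof -
    from G obtain S where Z[measurable]: "Z \<in> borel_measurable M" and S: "\<And>n. S n \<in> GB"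
      "\<And>n. integrable M (\<lambda>w. (S n w - Z w)\<^sup>2)" "(\<lambda>n::nat. expectation (\<lambda>w. (S n w - Z w)\<^sup>2)) \<longlonglongrightarrow> 0"
      by (auto simp: G_def)
    have eq: "(c * x - c * y)\<^sup>2 = c\<^sup>2 * (x - y)\<^sup>2" for x y
      unfolding right_diff_distrib[symmetric] by (rule power_mult_distrib)
    show ?thesis
      unfolding G_def using GB_scale[OF S(1), where c = c] S(2) tendsto_mult_right_zero[OF S(3), of "c\<^sup>2"]
      by (intro CollectI conjI exI[of _ "\<lambda>n w. c * S n w"]) (auto simp: eq)
  qed
qed

text \<open>A grid of mesh \<open>1 / (n + 1)\<close> starting at the left end of the support;
  \<open>tau\<close> rounds down to it. The weights \<open>wt\<close> are integrals of
  \<open>\<psi>\<close> over the cells, so that the sum is exactly an integral against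
  \<open>\<psi>\<close> with rounded argument and no regularity of \<open>\<psi>\<close>
  enters.\<close>

definition tpt :: "nat \<Rightarrow> nat \<Rightarrow> real" where "tpt n p = - L + real p / real (Suc n)"
definition tau :: "nat \<Rightarrow> real \<Rightarrow> real" where "tau n z = tpt n (nat \<lfloor>real (Suc n) * (z + L)\<rfloor>)"
definition npt :: "nat \<Rightarrow> nat" where "npt n = Suc (nat \<lfloor>real (Suc n) * (2 * L)\<rfloor>)"
definition cell :: "nat \<Rightarrow> nat \<Rightarrow> real set" where "cell n p = {z. nat \<lfloor>real (Suc n) * (z + L)\<rfloor> = p}"
definition wt :: "nat \<Rightarrow> nat \<Rightarrow> real" where "wt n p = (LINT z|lborel. \<psi> z * indicator (cell n p) z)"

lemma cell_measurable[measurable]: "cell n p \<in> sets borel"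
  unfolding cell_def by measurable

lemma tau_close: assumes "\<bar>z\<bar> \<le> L" shows "\<bar>z - tau n z\<bar> \<le> 1 / real (Suc n)"
proof -
  let ?x = "real (Suc n) * (z + L)"
  have "0 \<le> ?x" using assms by (intro mult_nonneg_nonneg) auto
  then have "real (nat \<lfloor>?x\<rfloor>) = of_int \<lfloor>?x\<rfloor>" by simp
  moreover have "of_int \<lfloor>?x\<rfloor> \<le> ?x" "?x < of_int \<lfloor>?x\<rfloor> + 1" by linarith+
  ultimately have "\<bar>?x - real (nat \<lfloor>?x\<rfloor>)\<bar> \<le> 1" by linarith
  moreover have "z - tau n z = (?x - real (nat \<lfloor>?x\<rfloor>)) / real (Suc n)"
    by (simp add: tau_def tpt_def field_simps del: of_nat_Suc)
  ultimately show ?thesis by (simp add: divide_right_mono del: of_nat_Suc)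
qed

lemma riemann_sum:
  fixes f :: "real \<Rightarrow> 'c::{banach, second_countable_topology}"
  shows "integrable lborel (\<lambda>z. \<psi> z *\<^sub>R f (tau n z))"
    "(LINT z|lborel. \<psi> z *\<^sub>R f (tau n z)) = (\<Sum>p<npt n. wt n p *\<^sub>R f (tpt n p))"
proof -
  have eq: "\<psi> z *\<^sub>R f (tau n z) = (\<Sum>p<npt n. (\<psi> z * indicator (cell n p) z) *\<^sub>R f (tpt n p))" for z
  proof (cases "\<psi> z = 0")
    case False
    then have z: "\<bar>z\<bar> \<le> L" by (rule L(2))
    let ?q = "nat \<lfloor>real (Suc n) * (z + L)\<rfloor>"
    have "real (Suc n) * (z + L) \<le> real (Suc n) * (2 * L)" using z by (intro mult_left_mono) auto
    then have "?q < npt n" unfolding npt_def by (intro le_imp_less_Suc nat_mono floor_mono)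
    then have "(\<Sum>p<npt n. (\<psi> z * indicator (cell n p) z) *\<^sub>R f (tpt n p)) =
       (\<Sum>p\<in>{?q}. (\<psi> z * indicator (cell n p) z) *\<^sub>R f (tpt n p))"
      by (intro sum.mono_neutral_right) (auto simp: cell_def)
    then show ?thesis by (simp add: cell_def tau_def)
  qed simp
  have i: "integrable lborel (\<lambda>z. \<psi> z * indicator (cell n p) z)" for p
    by (rule psi_mult_integrable(1)[where C = 1]) (auto simp: indicator_def)
  show "integrable lborel (\<lambda>z. \<psi> z *\<^sub>R f (tau n z))"
    unfolding eq by (intro Bochner_Integration.integrable_sum integrable_scaleR_left i)
  show "(LINT z|lborel. \<psi> z *\<^sub>R f (tau n z)) = (\<Sum>p<npt n. wt n p *\<^sub>R f (tpt n p))"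
    unfolding eq by (subst Bochner_Integration.integral_sum) (auto simp: wt_def i)
qed

definition S :: "nat \<Rightarrow> int \<Rightarrow> 2 \<Rightarrow> nat \<Rightarrow> 'b \<Rightarrow> real" where
  "S j k i n w = (\<Sum>p<npt n. wt n p * X (2 ^ j * tpt n p + 2 ^ j * of_int k) w $ i)"

lemma S_sq: "sq_integrable M (S j k i n)"
proof -
  have "sq_integrable M (\<lambda>w. c * X t w $ i)" for c t
    using sq_integrable_scaleR[OF X_sq[of t i], where c = c] unfolding real_scaleR_def .
  then show ?thesis unfolding S_def[abs_def] by (intro sq_integrable_sum)
qed

lemma K_nonneg: "0 \<le> K i k"
  unfolding K_def by (intro integral_nonneg_AE AE_I2 fbm_integrand_nonneg)

text \<open>The increments have a variance that depends on the time difference only. This supplies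
  the modulus of continuity for the error of the Riemann sums.\<close>

lemma X_increment:
  "L2_norm M (\<lambda>w. X t w $ i - X s w $ i) = sqrt (2 * \<Gamma> $ i $ i * K i i * \<bar>t - s\<bar> powr \<eta> i i)"
proof -
  have "expectation (\<lambda>w. (X t w $ i - X s w $ i)\<^sup>2) = rr i i t t - 2 * rr i i t s + rr i i s s"
  proof -
    have "expectation (\<lambda>w. (X t w $ i - X s w $ i)\<^sup>2) =
      expectation (\<lambda>w. X t w $ i * X t w $ i - 2 * (X t w $ i * X s w $ i) + X s w $ i * X s w $ i)"
      by (rule Bochner_Integration.integral_cong) (auto simp: power2_eq_square algebra_simps)
    then show ?thesis using cov_X(1) by (simp add: cov_X(2))
  qed
  also have "\<dots> = 2 * \<Gamma> $ i $ i * K i i * \<bar>t - s\<bar> powr \<eta> i i"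
    by (simp add: rr_def algebra_simps)
  finally show ?thesis by (simp add: L2_norm_def)
qed

text \<open>The error \<open>W\<close> is tested against itself. Its squared norm is an integral of
  \<open>\<psi>\<close> against differences of \<open>q\<close>, and by the Cauchy-Schwarz
  inequality each difference is at most the norm of an increment of the process times the norm of
  \<open>W\<close>; one factor of that norm is then divided out.\<close>

lemma S_error:
  "L2_norm M (\<lambda>w. d j k i w - S j k i n w) \<le>
    (LINT t|lborel. \<bar>\<psi> t\<bar>) * sqrt (2 * \<Gamma> $ i $ i * K i i * (2 ^ j / real (Suc n)) powr \<eta> i i)"
proof -
  define b where "b = 2 ^ j * real_of_int k"
  define W where "W w = d j k i w - S j k i n w" for w
  have W: "sq_integrable M W" unfolding W_def[abs_def] by (intro sq_integrable_diff d_sq S_sq)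
  have int: "integrable M (\<lambda>w. V w * W w)" if "sq_integrable M V" for V
    using L2_inner_mult_bound(1)[OF that W, of 1] by simp
  define q where "q t = expectation (\<lambda>w. X t w $ i * W w)" for t
  have [measurable]: "q \<in> borel_measurable borel"
  proof -
    have "q t = expectation (\<lambda>w. X t w $ i * d j k i w) - (\<Sum>p<npt n. wt n p * rr i i t (2 ^ j * tpt n p + b))" for t
    proof -
      have 1: "integrable M (\<lambda>w. X t w $ i * d j k i w)"
        using L2_inner_mult_bound(1)[OF X_sq d_sq, of 1] by simp
      have "q t = expectation (\<lambda>w. X t w $ i * d j k i w - (\<Sum>p<npt n. wt n p * (X t w $ i * X (2 ^ j * tpt n p + b) w $ i)))"
        unfolding q_def W_def S_def b_def[symmetric]
        by (rule Bochner_Integration.integral_cong) (auto simp: right_diff_distrib sum_distrib_left mult_ac)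
      also have "\<dots> = expectation (\<lambda>w. X t w $ i * d j k i w) - (\<Sum>p<npt n. wt n p * rr i i t (2 ^ j * tpt n p + b))"
        using 1 cov_X(1) by (simp add: cov_X(2))
      finally show ?thesis .
    qed
    then have eq: "q = (\<lambda>t. expectation (\<lambda>w. X t w $ i * d j k i w) - (\<Sum>p<npt n. wt n p * rr i i t (2 ^ j * tpt n p + b)))"
      by (rule ext)
    show ?thesis unfolding eq by measurable
  qed
  let ?N = "L2_norm M W" and ?c = "sqrt (2 * \<Gamma> $ i $ i * K i i * (2 ^ j / real (Suc n)) powr \<eta> i i)"
  have N0: "0 \<le> ?N" by (simp add: L2_norm_def)
  have "?N\<^sup>2 = expectation (\<lambda>w. d j k i w * W w) - expectation (\<lambda>w. S j k i n w * W w)"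
  proof -
    have "?N\<^sup>2 = expectation (\<lambda>w. (W w)\<^sup>2)" by (simp add: L2_norm_def)
    also have "\<dots> = expectation (\<lambda>w. d j k i w * W w - S j k i n w * W w)"
      by (rule Bochner_Integration.integral_cong) (auto simp: W_def power2_eq_square algebra_simps)
    finally show ?thesis using int[OF d_sq] int[OF S_sq] by simp
  qed
  also have "expectation (\<lambda>w. d j k i w * W w) = (LINT z|lborel. \<psi> z * q (2 ^ j * z + b))"
    unfolding q_def b_def by (rule d_pairing(2)[OF W]) (simp flip: q_def)
  also have "expectation (\<lambda>w. S j k i n w * W w) = (LINT z|lborel. \<psi> z * q (2 ^ j * tau n z + b))"
  proof -
    have "expectation (\<lambda>w. S j k i n w * W w) = expectation (\<lambda>w. \<Sum>p<npt n. wt n p * (X (2 ^ j * tpt n p + b) w $ i * W w))"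
      by (simp add: S_def b_def sum_distrib_right mult.assoc)
    also have "\<dots> = (\<Sum>p<npt n. wt n p * q (2 ^ j * tpt n p + b))"
      using int[OF X_sq] by (simp add: q_def)
    also have "\<dots> = (LINT z|lborel. \<psi> z * q (2 ^ j * tau n z + b))"
      using riemann_sum(2)[of "\<lambda>z. q (2 ^ j * z + b)" n] by simp
    finally show ?thesis .
  qed
  also have "(LINT z|lborel. \<psi> z * q (2 ^ j * z + b)) - (LINT z|lborel. \<psi> z * q (2 ^ j * tau n z + b)) =
      (LINT z|lborel. \<psi> z * (q (2 ^ j * z + b) - q (2 ^ j * tau n z + b)))"
  proof -
    have "integrable lborel (\<lambda>z. \<psi> z * q (2 ^ j * z + b))"
      unfolding q_def b_def by (rule d_pairing(1)[OF W]) (simp flip: q_def)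
    moreover have "integrable lborel (\<lambda>z. \<psi> z * q (2 ^ j * tau n z + b))"
      using riemann_sum(1)[of "\<lambda>z. q (2 ^ j * z + b)" n] by simp
    ultimately show ?thesis by (simp add: right_diff_distrib)
  qed
  also have "\<dots> \<le> (LINT t|lborel. \<bar>\<psi> t\<bar>) * (?c * ?N)"
  proof (rule order_trans[OF abs_ge_self psi_mult_integrable(2)])
    have [measurable]: "tau n \<in> borel_measurable borel" unfolding tau_def tpt_def by measurable
    show "(\<lambda>z. q (2 ^ j * z + b) - q (2 ^ j * tau n z + b)) \<in> borel_measurable borel" by measurable
    fix z assume z: "\<bar>z\<bar> \<le> L"
    have q_eq: "q (2 ^ j * z + b) - q (2 ^ j * tau n z + b) =
        expectation (\<lambda>w. (1 \<bullet> (X (2 ^ j * z + b) w $ i - X (2 ^ j * tau n z + b) w $ i)) * W w)"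
      using int[OF X_sq] by (simp add: q_def left_diff_distrib)
    have "\<bar>q (2 ^ j * z + b) - q (2 ^ j * tau n z + b)\<bar> \<le>
        L2_norm M (\<lambda>w. X (2 ^ j * z + b) w $ i - X (2 ^ j * tau n z + b) w $ i) * ?N"
      unfolding q_eq using L2_inner_mult_bound(2)[OF sq_integrable_diff[OF X_sq X_sq] W, of 1] by simp
    also have "\<dots> \<le> ?c * ?N"
    proof (rule mult_right_mono[OF _ N0])
      have "(2 ^ j * z + b) - (2 ^ j * tau n z + b) = 2 ^ j * (z - tau n z)" by (simp add: algebra_simps)
      then have "\<bar>(2 ^ j * z + b) - (2 ^ j * tau n z + b)\<bar> = 2 ^ j * \<bar>z - tau n z\<bar>"
        by (simp only: abs_mult) simp
      also have "\<dots> \<le> 2 ^ j * (1 / real (Suc n))" by (intro mult_left_mono tau_close z) simp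
      finally have "\<bar>(2 ^ j * z + b) - (2 ^ j * tau n z + b)\<bar> \<le> 2 ^ j / real (Suc n)" by simp
      then show "L2_norm M (\<lambda>w. X (2 ^ j * z + b) w $ i - X (2 ^ j * tau n z + b) w $ i) \<le> ?c"
        unfolding X_increment using \<eta>_bounds(1)[of i i] \<Gamma>_diag_pos[of i] K_nonneg[of i i]
        by (intro real_sqrt_le_mono mult_left_mono powr_mono2) auto
    qed
    finally show "\<bar>q (2 ^ j * z + b) - q (2 ^ j * tau n z + b)\<bar> \<le> ?c * ?N" .
  qed
  finally have "?N * ?N \<le> ((LINT t|lborel. \<bar>\<psi> t\<bar>) * ?c) * ?N" by (simp add: power2_eq_square mult.assoc)
  then have "?N \<le> (LINT t|lborel. \<bar>\<psi> t\<bar>) * ?c"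
  proof (cases "?N = 0")
    case True
    have "0 \<le> (LINT t|lborel. \<bar>\<psi> t\<bar>) * ?c" using \<Gamma>_diag_pos[of i] K_nonneg[of i i] by (intro mult_nonneg_nonneg) auto
    then show ?thesis using True by simp
  next
    case False
    then show ?thesis using \<open>?N * ?N \<le> _\<close> N0 by simp
  qed
  then show ?thesis unfolding W_def .
qed

lemma S_tendsto: "(\<lambda>n. L2_norm M (\<lambda>w. d j k i w - S j k i n w)) \<longlonglongrightarrow> 0"
proof (rule tendsto_zero_sandwich)
  show "\<bar>L2_norm M (\<lambda>w. d j k i w - S j k i n w)\<bar> \<le>
    (LINT t|lborel. \<bar>\<psi> t\<bar>) * sqrt (2 * \<Gamma> $ i $ i * K i i * (2 ^ j / real (Suc n)) powr \<eta> i i)" for n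
    using S_error[of j k i n] by (simp add: L2_norm_def)
  have "(\<lambda>n. 2 ^ j / real (Suc n)) \<longlonglongrightarrow> 0"
    unfolding divide_inverse by (intro tendsto_mult_right_zero LIMSEQ_inverse_real_of_nat)
  then have "(\<lambda>n. (2 ^ j / real (Suc n)) powr \<eta> i i) \<longlonglongrightarrow> 0 powr \<eta> i i"
    using \<eta>_bounds(1)[of i i] by (intro tendsto_powr2) auto
  then have "(\<lambda>n. (LINT t|lborel. \<bar>\<psi> t\<bar>) * sqrt (2 * \<Gamma> $ i $ i * K i i * (2 ^ j / real (Suc n)) powr \<eta> i i))
     \<longlonglongrightarrow> (LINT t|lborel. \<bar>\<psi> t\<bar>) * sqrt (2 * \<Gamma> $ i $ i * K i i * 0 powr \<eta> i i)"
    by (rule tendsto_mult[OF tendsto_const tendsto_real_sqrt[OF tendsto_mult[OF tendsto_const]]])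
  then show "(\<lambda>n. (LINT t|lborel. \<bar>\<psi> t\<bar>) * sqrt (2 * \<Gamma> $ i $ i * K i i * (2 ^ j / real (Suc n)) powr \<eta> i i)) \<longlonglongrightarrow> 0"
    by simp
qed

lemma S_L2:
  "integrable M (\<lambda>w. (S j k i n w - d j k i w)\<^sup>2)"
  "(\<lambda>n. expectation (\<lambda>w. (S j k i n w - d j k i w)\<^sup>2)) \<longlonglongrightarrow> 0"
  using sq_integrableD(2)[OF sq_integrable_diff[OF S_sq d_sq]] L2_norm_inner_tendsto[OF S_sq d_sq S_tendsto, of j k i 1]
  by simp_all

lemma d_mem: "d j k i \<in> G"
proof -
  have "S j k i n \<in> GB" for n
  proof -
    have eq: "S j k i n = (\<lambda>w. \<Sum>p<npt n. (wt n p *\<^sub>R row i Pinv) \<bullet> B (2 ^ j * tpt n p + 2 ^ j * of_int k) w)"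
      by (simp add: fun_eq_iff S_def X_eq)
    show ?thesis unfolding eq
      by (rule GB_I[where n = "npt n" and a = "\<lambda>p. wt n p *\<^sub>R row i Pinv" and \<tau> = "\<lambda>p. 2 ^ j * tpt n p + 2 ^ j * of_int k"])
  qed
  then show ?thesis
    unfolding G_def using sq_integrableD(1)[OF d_sq] S_L2 by blast
qed

end

section \<open>Positive definiteness of the coefficient covariance\<close>

lemma L1_fourier_injective:
  fixes f :: "real \<Rightarrow> real"
  assumes f: "integrable lborel f" and F: "\<And>y. (CLINT z|lborel. complex_of_real (f z) * iexp (y * z)) = 0"
  shows "AE z in lborel. f z = 0"
proof -
  have [measurable]: "f \<in> borel_measurable borel" using borel_measurable_integrable[OF f] by simp
  \<comment> \<open>Positive and negative part have the same Fourier transform; at frequency 0 this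
    means equal mass \<open>c\<close>. If \<open>c > 0\<close>, division by \<open>c\<close> makes
    them probability densities with equal characteristic functions.\<close>
  define p m where "p z = max 0 (f z)" and "m z = max 0 (- f z)" for z
  have [measurable]: "p \<in> borel_measurable borel" "m \<in> borel_measurable borel" unfolding p_def m_def by measurable
  have p0: "0 \<le> p z" "0 \<le> m z" and fpm: "f z = p z - m z" for z by (auto simp: p_def m_def)
  have ip: "integrable lborel p" "integrable lborel m"
    unfolding p_def m_def by (rule Bochner_Integration.integrable_bound[OF f]; simp)+
  have ic: "integrable lborel (\<lambda>z. complex_of_real (g z) * iexp (y * z))"
    if "integrable lborel g" for g :: "real \<Rightarrow> real" and y
  proof (rule Bochner_Integration.integrable_bound[OF that])
    have [measurable]: "g \<in> borel_measurable borel" using borel_measurable_integrable[OF that] by simp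
    show "(\<lambda>z. complex_of_real (g z) * iexp (y * z)) \<in> borel_measurable lborel" by measurable
    show "AE z in lborel. norm (complex_of_real (g z) * iexp (y * z)) \<le> norm (g z)"
      by (simp add: norm_mult del: of_real_mult)
  qed
  have eq: "(CLINT z|lborel. complex_of_real (p z) * iexp (y * z)) = (CLINT z|lborel. complex_of_real (m z) * iexp (y * z))" for y
  proof -
    have "(CLINT z|lborel. complex_of_real (p z) * iexp (y * z)) - (CLINT z|lborel. complex_of_real (m z) * iexp (y * z)) =
        (CLINT z|lborel. complex_of_real (f z) * iexp (y * z))"
      by (subst Bochner_Integration.integral_diff[OF ic[OF ip(1)] ic[OF ip(2)], symmetric])
        (simp add: fpm left_diff_distrib)
    then show ?thesis using F by simp
  qed
  define c where "c = (LINT z|lborel. p z)"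
  have cm: "c = (LINT z|lborel. m z)"
  proof -
    have "complex_of_real (LINT z|lborel. p z) = complex_of_real (LINT z|lborel. m z)"
      using eq[of 0] by (simp flip: integral_complex_of_real)
    then show ?thesis unfolding c_def by (simp only: of_real_eq_iff)
  qed
  show ?thesis
  proof (cases "c = 0")
    case True
    then have "AE z in lborel. p z = 0" "AE z in lborel. m z = 0"
      using integral_nonneg_eq_0_iff_AE[OF ip(1)] integral_nonneg_eq_0_iff_AE[OF ip(2)] p0 c_def cm by simp_all
    then show ?thesis by eventually_elim (simp add: fpm)
  next
    case False
    have c: "c > 0" using False p0 by (simp add: c_def less_le)
    define \<mu> where "\<mu> g = density lborel (\<lambda>z. ennreal (g z / c))" for g :: "real \<Rightarrow> real"
    have rd: "real_distribution (\<mu> g)" if [measurable]: "g \<in> borel_measurable borel"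
      and g: "\<And>z. 0 \<le> g z" "integrable lborel g" "(LINT z|lborel. g z) = c" for g
    proof -
      have "prob_space (\<mu> g)"
      proof
        have "emeasure (\<mu> g) (space (\<mu> g)) = (\<integral>\<^sup>+z. ennreal (g z / c) \<partial>lborel)"
          unfolding \<mu>_def by (subst emeasure_density) auto
        also have "\<dots> = ennreal (LINT z|lborel. g z / c)"
          using g c by (intro nn_integral_eq_integral) auto
        also have "\<dots> = 1" using g c by simp
        finally show "emeasure (\<mu> g) (space (\<mu> g)) = 1" .
      qed
      then show ?thesis by (simp add: real_distribution_def real_distribution_axioms_def \<mu>_def)
    qed
    have ch: "char (\<mu> g) y = (CLINT z|lborel. complex_of_real (g z) * iexp (y * z)) / complex_of_real c"
      if [measurable]: "g \<in> borel_measurable borel" and g: "\<And>z. 0 \<le> g z" for g y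
    proof -
      have "char (\<mu> g) y = (CLINT z|lborel. (g z / c) *\<^sub>R iexp (y * z))"
        unfolding char_def \<mu>_def using g c by (subst integral_density) auto
      also have "\<dots> = (CLINT z|lborel. complex_of_real (g z) * iexp (y * z) / complex_of_real c)"
        by (rule Bochner_Integration.integral_cong) (auto simp: scaleR_conv_of_real)
      finally show ?thesis by simp
    qed
    have "\<mu> p = \<mu> m"
    proof (rule Levy_uniqueness)
      show "real_distribution (\<mu> p)" "real_distribution (\<mu> m)" by (rule rd; simp add: p0 ip c_def cm[symmetric])+
      show "char (\<mu> p) = char (\<mu> m)" by (rule ext) (simp add: ch p0 eq del: of_real_mult)
    qed
    then have "AE z in lborel. ennreal (p z / c) = ennreal (m z / c)"
      unfolding \<mu>_def by (rule sigma_finite_measure.density_unique[OF sigma_finite_lborel, rotated 2]) simp_all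
    then show ?thesis
      by eventually_elim (use c p0 in \<open>simp add: fpm\<close>)
  qed
qed

context ofbm_wavelet
begin

definition phi :: "real \<Rightarrow> complex" where "phi y = (CLINT z|lborel. complex_of_real (\<psi> z) * iexp (y * z))"

lemma phi_integrable: "integrable lborel (\<lambda>z. complex_of_real (\<psi> z) * iexp (y * z))"
proof (rule Bochner_Integration.integrable_bound[OF psi_integrable])
  show "AE z in lborel. norm (complex_of_real (\<psi> z) * iexp (y * z)) \<le> norm (\<psi> z)"
    by (simp add: norm_mult del: of_real_mult)
qed measurable

lemma phi_continuous: "isCont phi y"
  unfolding continuous_at_sequentially
proof safe
  fix Y assume Y: "Y \<longlonglongrightarrow> y"
  show "(phi \<circ> Y) \<longlonglongrightarrow> phi y"
    unfolding comp_def phi_def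
  proof (rule integral_dominated_convergence[where w = "\<lambda>z. \<bar>\<psi> z\<bar>"])
    show "AE z in lborel. (\<lambda>n. complex_of_real (\<psi> z) * iexp (Y n * z)) \<longlonglongrightarrow> complex_of_real (\<psi> z) * iexp (y * z)"
      by (intro AE_I2 tendsto_intros Y)
    show "AE z in lborel. norm (complex_of_real (\<psi> z) * iexp (Y n * z)) \<le> \<bar>\<psi> z\<bar>" for n
      by (simp add: norm_mult del: of_real_mult)
  qed (use psi_integrable in auto)
qed

text \<open>The transform is continuous, so vanishing almost everywhere would make it vanish
  everywhere. Then \<open>\<psi>\<close> would be 0 almost everywhere, against the normalisation of
  its square.\<close>

lemma phi_not_AE_zero:
  assumes s: "s > 0" shows "\<not> (AE x in lborel. phi (s * x) = 0)"
proof
  assume AE: "AE x in lborel. phi (s * x) = 0"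
  have "phi y = 0" for y
  proof (rule ccontr)
    assume n: "phi y \<noteq> 0"
    have "eventually (\<lambda>z. phi z \<noteq> 0) (nhds y)"
      using phi_continuous[of y] n tendsto_imp_eventually_ne[of phi "phi y" "at y" 0]
      by (simp add: isCont_def eventually_nhds_conv_at)
    then obtain e where e: "e > 0" "\<And>z. dist z y < e \<Longrightarrow> phi z \<noteq> 0"
      unfolding eventually_nhds_metric by blast
    obtain x where x: "(y - e) / s < x" "x < (y + e) / s" "phi (s * x) = 0"
      using AE_lborel_open_ex[OF AE, of "(y - e) / s" "(y + e) / s"] e(1) s by (auto simp: divide_strict_right_mono)
    have "dist (s * x) y < e" using x(1,2) s by (simp add: dist_real_def abs_less_iff field_simps)
    then show False using e(2) x(3) by blast
  qed
  then have "AE z in lborel. \<psi> z = 0"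
    by (intro L1_fourier_injective psi_integrable) (simp add: phi_def)
  then have "AE z in lborel. (\<psi> z)\<^sup>2 = 0" by eventually_elim simp
  then have "(LINT z|lborel. (\<psi> z)\<^sup>2) = 0" by (rule integral_eq_zero_AE)
  then show False using wavelet by (simp add: wavelet_def)
qed

text \<open>The density with which the frequency \<open>x\<close> contributes to the scalar process
  \<open>u \<bullet> X\<close>, apart from the factors \<open>iexp (t * x) - 1\<close>.\<close>

definition Wu :: "real^2 \<Rightarrow> real \<Rightarrow> real" where
  "Wu u x = (\<Sum>i\<in>UNIV. \<Sum>k\<in>UNIV. u $ i * u $ k * \<Gamma> $ i $ k * \<bar>x\<bar> powr (- 1 - \<eta> i k))"

lemma Wu_pos: assumes "u \<noteq> 0" "x \<noteq> 0" shows "0 < Wu u x"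
proof -
  define p where "p i = (if i = (1::2) then h\<^sub>1 else h\<^sub>2)" for i
  define v :: "real^2" where "v = (\<chi> i. u $ i * \<bar>x\<bar> powr (- p i))"
  have pw: "\<bar>x\<bar> powr (- 1 - \<eta> i k) = \<bar>x\<bar> powr (- 1) * (\<bar>x\<bar> powr (- p i) * \<bar>x\<bar> powr (- p k))" for i k
    unfolding powr_add[symmetric] by (rule arg_cong[where f = "(powr) \<bar>x\<bar>"]) (simp add: p_def \<eta>_def)
  have "v \<bullet> (\<Gamma> *v v) = (\<Sum>i\<in>UNIV. \<Sum>k\<in>UNIV. v $ i * (\<Gamma> $ i $ k * v $ k))"
    by (simp add: inner_vec_def matrix_vector_mult_def sum_distrib_left)
  then have "Wu u x = \<bar>x\<bar> powr (- 1) * (v \<bullet> (\<Gamma> *v v))"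
    unfolding Wu_def pw v_def by (simp add: sum_distrib_left mult_ac)
  moreover have "v \<noteq> 0"
  proof
    assume "v = 0"
    have "u $ i * \<bar>x\<bar> powr (- p i) = 0" for i
    proof -
      from \<open>v = 0\<close> have "v $ i = 0" by simp
      then show ?thesis by (simp add: v_def)
    qed
    then have "u = 0" using assms(2) by (simp add: vec_eq_iff)
    then show False using assms(1) by simp
  qed
  ultimately show ?thesis using \<Gamma>_posdef[of v] assms(2) by simp
qed

lemma Wu_nonneg: "0 \<le> Wu u x"
proof (cases "u = 0 \<or> x = 0")
  case False
  then show ?thesis using Wu_pos[of u x] by simp
qed (auto simp: Wu_def)

lemma cov_u_spectral:
  "expectation (\<lambda>w. (u \<bullet> X t w) * (u \<bullet> X s w)) = (LINT x|lborel. ((iexp (t * x) - 1) \<bullet> (iexp (s * x) - 1)) * Wu u x)"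
  "integrable lborel (\<lambda>x. ((iexp (t * x) - 1) \<bullet> (iexp (s * x) - 1)) * Wu u x)"
proof -
  have eq: "((iexp (t * x) - 1) \<bullet> (iexp (s * x) - 1)) * Wu u x =
    row_comb (transpose Pinv *v u) (ofbm_kernel H A t x) \<bullet> row_comb (transpose Pinv *v u) (ofbm_kernel H A s x)" for x
  proof -
    have "(iexp (t * x) - 1) \<bullet> (iexp (s * x) - 1) = 1 - cos (t * x) + (1 - cos (s * x)) - (1 - cos ((t - s) * x))"
      by (simp add: inner_complex_def Re_exp Im_exp cos_diff left_diff_distrib algebra_simps del: of_real_mult)
    then show ?thesis unfolding kernel_inner Wu_def by (simp add: sum_distrib_left mult_ac)
  qed
  show "expectation (\<lambda>w. (u \<bullet> X t w) * (u \<bullet> X s w)) = (LINT x|lborel. ((iexp (t * x) - 1) \<bullet> (iexp (s * x) - 1)) * Wu u x)"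
    unfolding eq inner_X by (rule cov_B)
  show "integrable lborel (\<lambda>x. ((iexp (t * x) - 1) \<bullet> (iexp (s * x) - 1)) * Wu u x)"
    unfolding eq by (intro integrable_inner_sq sq_integrable_bounded_linear[OF bounded_linear_row_comb] kernel_sq_integrable)
qed

text \<open>For Riemann sums the second moment is an integral of \<open>|F n|^2\<close> against the
  spectral density \<open>Wu\<close>. If the variance of the limit were 0, Fatou's lemma would make
  the integral of \<open>|F'|^2\<close> against this positive density vanish. But \<open>F'\<close>
  is the Fourier transform of \<open>\<psi>\<close> at the rescaled frequency, because
  \<open>\<psi>\<close> has mean 0.\<close>

theorem cov_d_posdef:
  assumes u: "u \<noteq> 0"
  shows "0 < expectation (\<lambda>w. (\<Sum>i\<in>UNIV. u $ i * d j 0 i w)\<^sup>2)"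
proof -
  define s where "s = (2 ^ j :: real)"
  define V where "V w = (\<Sum>i\<in>UNIV. u $ i * d j 0 i w)" for w
  define T where "T n w = (\<Sum>i\<in>UNIV. u $ i * S j 0 i n w)" for n w
  define F where "F n x = (\<Sum>p<npt n. wt n p *\<^sub>R (iexp (s * tpt n p * x) - 1))" for n x
  define F' where "F' x = (CLINT z|lborel. \<psi> z *\<^sub>R (iexp (s * z * x) - 1))" for x
  have F'phi: "F' x = phi (s * x)" for x
  proof -
    have "F' x = (CLINT z|lborel. complex_of_real (\<psi> z) * iexp ((s * x) * z) - complex_of_real (\<psi> z))"
      unfolding F'_def by (rule Bochner_Integration.integral_cong) (auto simp: scaleR_conv_of_real algebra_simps)
    also have "\<dots> = phi (s * x) - (CLINT z|lborel. complex_of_real (\<psi> z))"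
      unfolding phi_def by (rule Bochner_Integration.integral_diff[OF phi_integrable]) (use psi_integrable in simp)
    finally show ?thesis using psi_moment(1) by simp
  qed
  have lim: "(\<lambda>n. F n x) \<longlonglongrightarrow> F' x" for x
  proof -
    have "F n x = (CLINT z|lborel. \<psi> z *\<^sub>R (iexp (s * tau n z * x) - 1))" for n
      unfolding F_def using riemann_sum(2)[of "\<lambda>z. iexp (s * z * x) - 1" n] by simp
    moreover have "(\<lambda>n. CLINT z|lborel. \<psi> z *\<^sub>R (iexp (s * tau n z * x) - 1)) \<longlonglongrightarrow> F' x"
      unfolding F'_def
    proof (rule integral_dominated_convergence[where w = "\<lambda>z. 2 * \<bar>\<psi> z\<bar>"])
      have [measurable]: "tau n \<in> borel_measurable borel" for n unfolding tau_def tpt_def by measurable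
      show "(\<lambda>z. \<psi> z *\<^sub>R (iexp (s * tau n z * x) - 1)) \<in> borel_measurable lborel" for n by measurable
      show "AE z in lborel. (\<lambda>n. \<psi> z *\<^sub>R (iexp (s * tau n z * x) - 1)) \<longlonglongrightarrow> \<psi> z *\<^sub>R (iexp (s * z * x) - 1)"
      proof (rule AE_I2)
        fix z
        show "(\<lambda>n. \<psi> z *\<^sub>R (iexp (s * tau n z * x) - 1)) \<longlonglongrightarrow> \<psi> z *\<^sub>R (iexp (s * z * x) - 1)"
        proof (cases "\<psi> z = 0")
          case False
          have "(\<lambda>n. z - tau n z) \<longlonglongrightarrow> 0"
          proof (rule tendsto_zero_sandwich)
            show "\<bar>z - tau n z\<bar> \<le> inverse (real (Suc n))" for n
              using tau_close[OF L(2)[OF False], of n] by (simp add: divide_inverse)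
          qed (rule LIMSEQ_inverse_real_of_nat)
          from tendsto_diff[OF tendsto_const[of z] this] have "(\<lambda>n. tau n z) \<longlonglongrightarrow> z" by simp
          then show ?thesis by (intro tendsto_intros)
        qed simp
      qed
      show "AE z in lborel. norm (\<psi> z *\<^sub>R (iexp (s * tau n z * x) - 1)) \<le> 2 * \<bar>\<psi> z\<bar>" for n
      proof (rule AE_I2)
        fix z
        have "norm (iexp (s * tau n z * x) - 1) \<le> 2"
          using norm_triangle_ineq4[of "iexp (s * tau n z * x)" 1] by (simp del: of_real_mult)
        from mult_left_mono[OF this abs_ge_zero[of "\<psi> z"]]
        show "norm (\<psi> z *\<^sub>R (iexp (s * tau n z * x) - 1)) \<le> 2 * \<bar>\<psi> z\<bar>"
          unfolding norm_scaleR by (simp only: mult.commute)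
      qed
    qed (use psi_integrable in auto)
    ultimately show ?thesis by simp
  qed
  have T: "T n w = (\<Sum>p<npt n. wt n p * (u \<bullet> X (s * tpt n p) w))" for n w
  proof -
    have "T n w = (\<Sum>i\<in>UNIV. \<Sum>p<npt n. wt n p * (u $ i * X (s * tpt n p) w $ i))"
      by (simp add: T_def S_def s_def sum_distrib_left mult_ac)
    also have "\<dots> = (\<Sum>p<npt n. \<Sum>i\<in>UNIV. wt n p * (u $ i * X (s * tpt n p) w $ i))" by (rule sum.swap)
    finally show ?thesis by (simp add: inner_vec_def sum_distrib_left)
  qed
  have sq: "(norm (F n x))\<^sup>2 * Wu u x = (\<Sum>p<npt n. \<Sum>q<npt n. wt n p * wt n q *
      (((iexp (s * tpt n p * x) - 1) \<bullet> (iexp (s * tpt n q * x) - 1)) * Wu u x))" for n x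
  proof -
    have "norm (\<Sum>p<m. b p *\<^sub>R E p) ^ 2 = (\<Sum>p<m. \<Sum>q<m. b p * b q * (E p \<bullet> E q))"
      for m :: nat and b :: "nat \<Rightarrow> real" and E :: "nat \<Rightarrow> complex"
      unfolding power2_norm_eq_inner inner_sum_left
      by (intro sum.cong refl) (simp only: inner_sum_right inner_scaleR_left inner_scaleR_right sum_distrib_left mult.assoc mult.left_commute inner_commute)
    then show ?thesis unfolding F_def by (simp only: sum_distrib_right mult.assoc)
  qed
  have int: "integrable lborel (\<lambda>x. (norm (F n x))\<^sup>2 * Wu u x)" for n
    unfolding sq by (intro Bochner_Integration.integrable_sum integrable_mult_right cov_u_spectral)
  have ET: "expectation (\<lambda>w. (T n w)\<^sup>2) = (LINT x|lborel. (norm (F n x))\<^sup>2 * Wu u x)" for n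
  proof -
    have "(T n w)\<^sup>2 = (\<Sum>p<npt n. \<Sum>q<npt n. wt n p * wt n q * ((u \<bullet> X (s * tpt n p) w) * (u \<bullet> X (s * tpt n q) w)))" for w
      unfolding T power2_eq_square sum_product by (intro sum.cong refl) (simp add: mult_ac)
    then have "expectation (\<lambda>w. (T n w)\<^sup>2) = (\<Sum>p<npt n. \<Sum>q<npt n. wt n p * wt n q *
        expectation (\<lambda>w. (u \<bullet> X (s * tpt n p) w) * (u \<bullet> X (s * tpt n q) w)))"
      using cov_uX(1)[of u _ u] by simp
    also have "\<dots> = (LINT x|lborel. (norm (F n x))\<^sup>2 * Wu u x)"
      unfolding sq cov_u_spectral(1)
      by (simp only: Bochner_Integration.integral_sum Bochner_Integration.integrable_sum
          integrable_mult_right integral_mult_right_zero cov_u_spectral(2))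
    finally show ?thesis .
  qed
  have "(\<forall>n. integrable M (\<lambda>w. (T n w - V w)\<^sup>2)) \<and> (\<lambda>n. expectation (\<lambda>w. (T n w - V w)\<^sup>2)) \<longlonglongrightarrow> 0"
    unfolding T_def V_def
  proof (rule L2_sum_tendsto)
    have eq: "(u $ i * S j 0 i n w - u $ i * d j 0 i w)\<^sup>2 = (u $ i)\<^sup>2 * (S j 0 i n w - d j 0 i w)\<^sup>2" for i n w
      unfolding right_diff_distrib[symmetric] by (rule power_mult_distrib)
    show "integrable M (\<lambda>w. (u $ i * S j 0 i n w - u $ i * d j 0 i w)\<^sup>2)" for i n
      unfolding eq using S_L2(1) by simp
    show "(\<lambda>n. expectation (\<lambda>w. (u $ i * S j 0 i n w - u $ i * d j 0 i w)\<^sup>2)) \<longlonglongrightarrow> 0" for i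
      unfolding eq using tendsto_mult_right_zero[OF S_L2(2)] by simp
    show "(\<lambda>w. u $ i * S j 0 i n w) \<in> borel_measurable M" "(\<lambda>w. u $ i * d j 0 i w) \<in> borel_measurable M" for i n
      using sq_integrableD(1)[OF S_sq] sq_integrableD(1)[OF d_sq] by (auto intro!: borel_measurable_times)
  qed simp
  then have TV: "\<And>n. integrable M (\<lambda>w. (T n w - V w)\<^sup>2)" "(\<lambda>n. expectation (\<lambda>w. (T n w - V w)\<^sup>2)) \<longlonglongrightarrow> 0" by auto
  have Tsq: "sq_integrable M (T n)" for n
    unfolding T_def[abs_def]
    using sq_integrable_scaleR[OF S_sq, unfolded real_scaleR_def] by (intro sq_integrable_sum)
  have Vsq: "sq_integrable M V"
    unfolding V_def[abs_def]
    using sq_integrable_scaleR[OF d_sq, unfolded real_scaleR_def] by (intro sq_integrable_sum)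
  have conv: "(\<lambda>n. expectation (\<lambda>w. T n w * T n w)) \<longlonglongrightarrow> expectation (\<lambda>w. V w * V w)"
    using sq_integrableD[OF Tsq] sq_integrableD[OF Vsq] by (intro L2_product_limit TV) auto
  have "expectation (\<lambda>w. (V w)\<^sup>2) \<noteq> 0"
  proof
    assume V0: "expectation (\<lambda>w. (V w)\<^sup>2) = 0"
    have [measurable]: "(\<lambda>x. F n x) \<in> borel_measurable borel" for n unfolding F_def by measurable
    have [measurable]: "Wu u \<in> borel_measurable borel" unfolding Wu_def by measurable
    have "(\<integral>\<^sup>+x. liminf (\<lambda>n. ennreal ((norm (F n x))\<^sup>2 * Wu u x)) \<partial>lborel) \<le>
        liminf (\<lambda>n. \<integral>\<^sup>+x. ennreal ((norm (F n x))\<^sup>2 * Wu u x) \<partial>lborel)"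
      by (rule nn_integral_liminf) simp
    also have "(\<lambda>n. \<integral>\<^sup>+x. ennreal ((norm (F n x))\<^sup>2 * Wu u x) \<partial>lborel) = (\<lambda>n. ennreal (expectation (\<lambda>w. T n w * T n w)))"
      unfolding power2_eq_square[symmetric] ET
      by (rule ext, rule nn_integral_eq_integral[OF int]) (simp add: Wu_nonneg)
    also have "liminf \<dots> = 0"
    proof (rule lim_imp_Liminf)
      show "(\<lambda>n. ennreal (expectation (\<lambda>w. T n w * T n w))) \<longlonglongrightarrow> 0"
      proof -
        have "(\<lambda>n. expectation (\<lambda>w. T n w * T n w)) \<longlonglongrightarrow> 0"
          using conv V0 by (simp only: power2_eq_square)
        from tendsto_ennrealI[OF this] show ?thesis by (simp only: ennreal_0)
      qed
    qed simp
    also have "(\<lambda>x. liminf (\<lambda>n. ennreal ((norm (F n x))\<^sup>2 * Wu u x))) = (\<lambda>x. ennreal ((norm (F' x))\<^sup>2 * Wu u x))"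
      by (rule ext, rule lim_imp_Liminf) (auto intro!: tendsto_intros lim)
    finally have "(\<integral>\<^sup>+x. ennreal ((norm (F' x))\<^sup>2 * Wu u x) \<partial>lborel) = 0" by simp
    moreover have "F' \<in> borel_measurable borel"
      by (rule borel_measurable_LIMSEQ_metric[OF _ lim]) simp
    ultimately have "AE x in lborel. ennreal ((norm (F' x))\<^sup>2 * Wu u x) = 0"
      by (subst (asm) nn_integral_0_iff_AE) auto
    moreover have "AE x in lborel. x \<noteq> (0::real)" by (rule AE_lborel_singleton)
    ultimately have "AE x in lborel. phi (s * x) = 0"
    proof eventually_elim
      case (elim x)
      have "(norm (F' x))\<^sup>2 * Wu u x \<le> 0" using elim(1) by (simp add: ennreal_eq_0_iff)
      then have "(norm (F' x))\<^sup>2 \<le> 0" using Wu_pos[OF u elim(2)] by (simp add: mult_le_0_iff)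
      then show ?case by (simp add: F'phi)
    qed
    then show False using phi_not_AE_zero[of s] by (simp add: s_def)
  qed
  then show ?thesis unfolding V_def by (simp add: less_le)
qed

section \<open>Quadratic decay of the covariances\<close>

lemma powr_taylor4:
  fixes e y u :: real
  assumes e: "0 < e" "e < 2" and y: "2 \<le> y" "\<bar>u\<bar> \<le> y / 2"
  defines "c m \<equiv> (\<Prod>i<m. e - real i)"
  shows "\<bar>(y + u) powr e - (\<Sum>m<4. c m * y powr (e - real m) / fact m * u ^ m)\<bar> \<le> \<bar>c 4\<bar> * (4 / y\<^sup>2) * u ^ 4"
proof (cases "u = 0")
  case True
  then show ?thesis using y by (simp add: c_def numeral_eq_Suc)
next
  case False
  define diff where "diff m t = c m * t powr (e - real m)" for m t
  have "\<exists>t. (if y + u < y then y + u < t \<and> t < y else y < t \<and> t < y + u) \<and>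
      (y + u) powr e = (\<Sum>m<4. diff m y / fact m * (y + u - y) ^ m) + diff 4 t / fact 4 * (y + u - y) ^ 4"
  proof (rule Taylor[where a = "y / 2" and b = "2 * y" and c = y])
    show "diff 0 = (\<lambda>x. x powr e)" by (rule ext) (simp add: diff_def c_def)
    show "\<forall>m t. m < 4 \<and> y / 2 \<le> t \<and> t \<le> 2 * y \<longrightarrow> DERIV (diff m) t :> diff (Suc m) t"
    proof (intro allI impI)
      fix m :: nat and t :: real assume "m < 4 \<and> y / 2 \<le> t \<and> t \<le> 2 * y"
      then have t: "t > 0" using y by simp
      have "((\<lambda>t. c m * t powr (e - real m)) has_real_derivative c m * ((e - real m) * t powr (e - real m - 1))) (at t)"
        by (rule DERIV_cmult[OF has_real_derivative_powr[OF t]])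
      then show "DERIV (diff m) t :> diff (Suc m) t"
        unfolding diff_def by (simp add: c_def mult.assoc diff_diff_eq add.commute)
    qed
  qed (use y False in auto)
  then obtain t where t: "if u < 0 then y + u < t \<and> t < y else y < t \<and> t < y + u"
    and eq: "(y + u) powr e = (\<Sum>m<4. diff m y / fact m * u ^ m) + diff 4 t / fact 4 * u ^ 4"
    by auto
  have t2: "y / 2 \<le> t" using t y by (auto split: if_splits)
  \<comment> \<open>The intermediate point is at least \<open>y / 2\<close>, which is at least 1.
    Since \<open>e < 2\<close>, the exponent \<open>e - 4\<close> can be raised to -2, whence the
    quadratic decay.\<close>
  have "t powr (e - 4) \<le> (y / 2) powr (e - 4)" using t2 y e by (intro powr_mono2') auto
  also have "\<dots> \<le> (y / 2) powr (- 2)" using y e by (intro powr_mono) auto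
  also have "\<dots> = 4 / y\<^sup>2"
  proof -
    have "(y / 2) powr (- 2) = inverse ((y / 2) powr 2)" by (rule powr_minus)
    also have "(y / 2) powr 2 = (y / 2)\<^sup>2" using y by (intro powr_numeral) simp
    finally show ?thesis by (simp add: power_divide)
  qed
  finally have tp: "t powr (e - 4) \<le> 4 / y\<^sup>2" .
  have "(y + u) powr e - (\<Sum>m<4. c m * y powr (e - real m) / fact m * u ^ m) = c 4 * t powr (e - 4) / fact 4 * u ^ 4"
    unfolding eq by (simp add: diff_def)
  also have "\<bar>\<dots>\<bar> = \<bar>c 4\<bar> * t powr (e - 4) * u ^ 4 / fact 4" by (simp add: abs_mult)
  also have "\<dots> \<le> \<bar>c 4\<bar> * t powr (e - 4) * u ^ 4 / 1"
    by (intro divide_left_mono) (auto intro!: mult_nonneg_nonneg simp: fact_numeral)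
  also have "\<dots> \<le> \<bar>c 4\<bar> * (4 / y\<^sup>2) * u ^ 4"
    unfolding div_by_1 by (intro mult_right_mono mult_left_mono tp) auto
  finally show ?thesis .
qed

text \<open>With four vanishing terms in the Taylor expansion the decay is quadratic. A monomial of degree at
  most 3 in two variables has degree at most 1 in one of them, so two vanishing moments suffice.\<close>

theorem J_decay:
  assumes e: "0 < e" "e < 2"
  shows "\<exists>C\<ge>0. \<forall>y. \<bar>J e j j' y\<bar> \<le> C / (1 + y\<^sup>2)"
proof -
  define U where "U = (2 ^ j + 2 ^ j') * L"
  define \<Psi> where "\<Psi> = (LINT t|lborel. \<bar>\<psi> t\<bar>)"
  \<comment> \<open>Beyond this radius the hypotheses of the Taylor estimate hold:
    \<open>|y|\<close> is at least 2, and the shift, which is at most \<open>U\<close> on the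
    support, is at most \<open>|y| / 2\<close>.\<close>
  define R where "R = max 2 (2 * U)"
  have U0: "0 \<le> U" using L(1) by (simp add: U_def)
  have P0: "0 \<le> \<Psi>" by (simp add: \<Psi>_def)
  define c where "c m = (\<Prod>i<m. e - real i)" for m
  have Ub: "\<bar>2 ^ j * z - 2 ^ j' * z'\<bar> \<le> U" if "\<bar>z\<bar> \<le> L" "\<bar>z'\<bar> \<le> L" for z z'
  proof -
    have "\<bar>2 ^ j * z\<bar> \<le> 2 ^ j * L" "\<bar>2 ^ j' * z'\<bar> \<le> 2 ^ j' * L"
      using that by (auto simp: abs_mult intro!: mult_left_mono)
    then show ?thesis unfolding U_def distrib_right by linarith
  qed
  have dbl: "\<bar>LINT z|lborel. \<psi> z * (LINT z'|lborel. \<psi> z' * f z z')\<bar> \<le> \<Psi> * (\<Psi> * C)"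
    if m: "(\<lambda>p. f (fst p) (snd p)) \<in> borel_measurable (borel \<Otimes>\<^sub>M borel)"
      and b: "\<And>z z'. \<bar>z\<bar> \<le> L \<Longrightarrow> \<bar>z'\<bar> \<le> L \<Longrightarrow> \<bar>f z z'\<bar> \<le> C" for f :: "real \<Rightarrow> real \<Rightarrow> real" and C
    unfolding \<Psi>_def
  proof (rule psi_mult_integrable(2))
    have m': "(\<lambda>(z, z'). \<psi> z' * f z z') \<in> borel_measurable (borel \<Otimes>\<^sub>M lborel)"
      using m by (simp add: case_prod_beta)
    show "(\<lambda>z. LINT z'|lborel. \<psi> z' * f z z') \<in> borel_measurable borel"
      by (rule lborel.borel_measurable_lebesgue_integral[OF m'])
    have [measurable]: "f z \<in> borel_measurable borel" for z
      using measurable_compose[OF measurable_Pair1'[of z borel borel] m] by simp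
    show "\<bar>LINT z'|lborel. \<psi> z' * f z z'\<bar> \<le> (LINT t|lborel. \<bar>\<psi> t\<bar>) * C" if "\<bar>z\<bar> \<le> L" for z
      by (rule psi_mult_integrable(2)) (use b that in auto)
  qed
  have poly0: "(LINT z|lborel. \<psi> z * (LINT z'|lborel. \<psi> z' * (\<Sum>m<4. b m * (s * (2 ^ j * z - 2 ^ j' * z')) ^ m))) = 0"
    for b :: "nat \<Rightarrow> real" and s
  proof -
    define p q where "p = s * 2 ^ j" and "q = s * 2 ^ j'"
    have pw: "integrable lborel (\<lambda>z. \<psi> z * z ^ m)" for m
      by (rule psi_mult_integrable(1)[where C = "L ^ m"]) (auto simp: power_abs intro!: power_mono)
    define \<mu> where "\<mu> m = (LINT z|lborel. \<psi> z * z ^ m)" for m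
    have \<mu>: "\<mu> 0 = 0" "\<mu> (Suc 0) = 0" using psi_moment by (simp_all add: \<mu>_def mult.commute)
    have i0: "integrable lborel \<psi>" "(LINT z|lborel. \<psi> z) = 0" by (rule psi_integrable, rule psi_moment)
    have i1: "integrable lborel (\<lambda>z. \<psi> z * z)" "(LINT z|lborel. \<psi> z * z) = 0"
      using pw[of 1] \<mu>(2) by (simp_all add: \<mu>_def)
    have inner: "(LINT z'|lborel. \<psi> z' * (\<Sum>m<4. b m * (s * (2 ^ j * z - 2 ^ j' * z')) ^ m)) =
        (b 2 * q\<^sup>2 * \<mu> 2 - b 3 * q ^ 3 * \<mu> 3) + 3 * b 3 * p * q\<^sup>2 * \<mu> 2 * z" for z
    proof -
      have "\<psi> z' * (\<Sum>m<4. b m * (s * (2 ^ j * z - 2 ^ j' * z')) ^ m) =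
        (b 0 + b 1 * p * z + b 2 * p\<^sup>2 * z\<^sup>2 + b 3 * p ^ 3 * z ^ 3) * \<psi> z' +
        (- b 1 * q - 2 * b 2 * p * q * z - 3 * b 3 * p\<^sup>2 * q * z\<^sup>2) * (\<psi> z' * z') +
        (b 2 * q\<^sup>2 + 3 * b 3 * p * q\<^sup>2 * z) * (\<psi> z' * z' ^ 2) + (- b 3 * q ^ 3) * (\<psi> z' * z' ^ 3)" for z'
      proof -
        have "s * (2 ^ j * z - 2 ^ j' * z') = p * z - q * z'" by (simp add: p_def q_def algebra_simps)
        show ?thesis
          unfolding \<open>s * (2 ^ j * z - 2 ^ j' * z') = p * z - q * z'\<close>
          by (simp add: numeral_eq_Suc algebra_simps)
      qed
      note eq = this
      have "(LINT z'|lborel. A * \<psi> z' + B * (\<psi> z' * z') + C * (\<psi> z' * z' ^ 2) + E * (\<psi> z' * z' ^ 3)) = C * \<mu> 2 + E * \<mu> 3" for A B C E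
        using i0 i1 pw[of 2] pw[of 3] by (simp add: \<mu>_def[symmetric])
      note eq2 = this
      show ?thesis unfolding eq eq2 by (simp add: algebra_simps)
    qed
    have "(LINT z|lborel. \<psi> z * ((b 2 * q\<^sup>2 * \<mu> 2 - b 3 * q ^ 3 * \<mu> 3) + 3 * b 3 * p * q\<^sup>2 * \<mu> 2 * z)) =
        (LINT z|lborel. (b 2 * q\<^sup>2 * \<mu> 2 - b 3 * q ^ 3 * \<mu> 3) * \<psi> z + (3 * b 3 * p * q\<^sup>2 * \<mu> 2) * (\<psi> z * z))"
      by (rule Bochner_Integration.integral_cong) (auto simp: algebra_simps)
    also have "\<dots> = 0" using i0 i1 by simp
    finally show ?thesis unfolding inner .
  qed
  have small: "\<bar>J e j j' y\<bar> \<le> \<Psi> * (\<Psi> * (U + R) powr e)" if "\<bar>y\<bar> \<le> R" for y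
    unfolding J_def
  proof (rule dbl)
    fix z z' assume z: "\<bar>z\<bar> \<le> L" "\<bar>z'\<bar> \<le> L"
    have "\<bar>2 ^ j * z - 2 ^ j' * z' + y\<bar> \<le> U + R" using Ub[OF z] that by linarith
    then show "\<bar>\<bar>2 ^ j * z - 2 ^ j' * z' + y\<bar> powr e\<bar> \<le> (U + R) powr e"
      using e by (intro abs_powr_bound) auto
  qed measurable
  have large: "\<bar>J e j j' y\<bar> \<le> \<Psi> * (\<Psi> * (\<bar>c 4\<bar> * (4 / y\<^sup>2) * U ^ 4))" if y: "R \<le> \<bar>y\<bar>" for y
  proof -
    \<comment> \<open>Multiplication by the sign reduces negative lags to positive ones: the
      absolute value of the shifted lag becomes \<open>|y|\<close> plus the signed shift.\<close>
    define s where "s = sgn y"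
    have yne: "y \<noteq> 0" "2 \<le> \<bar>y\<bar>" "2 * U \<le> \<bar>y\<bar>" using y by (auto simp: R_def)
    define b where "b m = c m * \<bar>y\<bar> powr (e - real m) / fact m" for m
    let ?u = "\<lambda>z z'. s * (2 ^ j * z - 2 ^ j' * z')"
    let ?p = "\<lambda>z z'. \<Sum>m<4. b m * ?u z z' ^ m"
    have bnd: "\<bar>\<bar>2 ^ j * z - 2 ^ j' * z' + y\<bar> powr e - ?p z z'\<bar> \<le> \<bar>c 4\<bar> * (4 / y\<^sup>2) * U ^ 4"
      if z: "\<bar>z\<bar> \<le> L" "\<bar>z'\<bar> \<le> L" for z z'
    proof -
      have ab: "\<bar>?u z z'\<bar> = \<bar>2 ^ j * z - 2 ^ j' * z'\<bar>" using yne by (simp add: s_def abs_mult abs_sgn_eq)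
      then have uU: "\<bar>?u z z'\<bar> \<le> U" using Ub[OF z] by simp
      then have u2: "\<bar>?u z z'\<bar> \<le> \<bar>y\<bar> / 2" using yne by linarith
      have "\<bar>y\<bar> + ?u z z' = s * (2 ^ j * z - 2 ^ j' * z' + y)"
        by (simp add: s_def distrib_left abs_sgn mult.commute)
      then have "\<bar>2 ^ j * z - 2 ^ j' * z' + y\<bar> = \<bar>\<bar>y\<bar> + ?u z z'\<bar>"
        using yne by (simp add: s_def abs_mult abs_sgn_eq)
      also have "\<dots> = \<bar>y\<bar> + ?u z z'" using u2 yne by linarith
      finally have "\<bar>\<bar>2 ^ j * z - 2 ^ j' * z' + y\<bar> powr e - ?p z z'\<bar> \<le> \<bar>c 4\<bar> * (4 / \<bar>y\<bar>\<^sup>2) * ?u z z' ^ 4"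
        using powr_taylor4[OF e yne(2) u2] unfolding b_def c_def by simp
      also have "\<dots> \<le> \<bar>c 4\<bar> * (4 / \<bar>y\<bar>\<^sup>2) * U ^ 4"
      proof (rule mult_left_mono)
        have "?u z z' ^ 4 = \<bar>?u z z'\<bar> ^ 4" by (rule power_even_abs[symmetric]) simp
        also have "\<dots> \<le> U ^ 4" by (intro power_mono uU) simp
        finally show "?u z z' ^ 4 \<le> U ^ 4" .
      qed simp
      finally show ?thesis by simp
    qed
    have "J e j j' y = (LINT z|lborel. \<psi> z * (LINT z'|lborel. \<psi> z' * (\<bar>2 ^ j * z - 2 ^ j' * z' + y\<bar> powr e - ?p z z')))"
    proof -
      have pi: "integrable lborel (\<lambda>z'. \<psi> z' * ?p z z')" for z
      proof -
        have "continuous_on {-L..L} (\<lambda>z'. ?p z z')" by (intro continuous_intros)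
        then have "bounded ((\<lambda>z'. ?p z z') ` {-L..L})"
          by (intro compact_imp_bounded compact_continuous_image compact_Icc)
        then obtain C where "\<forall>t \<in> (\<lambda>z'. ?p z z') ` {-L..L}. norm t \<le> C" unfolding bounded_iff by blast
        then have C: "\<bar>?p z z'\<bar> \<le> C" if "\<bar>z'\<bar> \<le> L" for z'
          using that unfolding real_norm_def abs_le_iff by (force simp: abs_le_iff)
        show ?thesis
          by (rule psi_mult_integrable(1)[where C = C, OF _ C]) measurable
      qed
      have ai: "integrable lborel (\<lambda>z'. \<psi> z' * \<bar>2 ^ j * z - 2 ^ j' * z' + y\<bar> powr e)" for z
        using psi_powr_integrable(1)[of e "- (2 ^ j')" "2 ^ j * z + y"] e by (simp add: algebra_simps)
      have "(LINT z'|lborel. \<psi> z' * (\<bar>2 ^ j * z - 2 ^ j' * z' + y\<bar> powr e - ?p z z')) =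
        (LINT z'|lborel. \<psi> z' * \<bar>2 ^ j * z - 2 ^ j' * z' + y\<bar> powr e) - (LINT z'|lborel. \<psi> z' * ?p z z')" for z
        using ai[of z] pi[of z] by (simp add: right_diff_distrib)
      moreover have "integrable lborel (\<lambda>z. \<psi> z * (LINT z'|lborel. \<psi> z' * ?p z z'))"
      proof -
        have m': "(\<lambda>(z, z'). \<psi> z' * ?p z z') \<in> borel_measurable (borel \<Otimes>\<^sub>M lborel)" by measurable
        show ?thesis
        proof (rule psi_mult_integrable(1))
          show "(\<lambda>z. LINT z'|lborel. \<psi> z' * ?p z z') \<in> borel_measurable borel"
            by (rule lborel.borel_measurable_lebesgue_integral[OF m'])
          fix z assume z: "\<bar>z\<bar> \<le> L"
          show "\<bar>LINT z'|lborel. \<psi> z' * ?p z z'\<bar> \<le> (LINT t|lborel. \<bar>\<psi> t\<bar>) * (\<Sum>m<4. \<bar>b m\<bar> * U ^ m)"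
          proof (rule psi_mult_integrable(2))
            fix z' assume z': "\<bar>z'\<bar> \<le> L"
            have "\<bar>?u z z'\<bar> \<le> U" using Ub[OF z z'] yne by (simp add: s_def abs_mult abs_sgn_eq)
            then have "\<bar>b m * ?u z z' ^ m\<bar> \<le> \<bar>b m\<bar> * U ^ m" for m
              unfolding abs_mult power_abs by (intro mult_left_mono power_mono) auto
            then show "\<bar>?p z z'\<bar> \<le> (\<Sum>m<4. \<bar>b m\<bar> * U ^ m)"
              by (intro order_trans[OF sum_abs] sum_mono)
          qed measurable
        qed
      qed
      ultimately show ?thesis
        using J_inner_integrable[of e "2 ^ j" "2 ^ j'" y] e poly0[of b s] by (simp add: J_def right_diff_distrib)
    qed
    also have "\<bar>\<dots>\<bar> \<le> \<Psi> * (\<Psi> * (\<bar>c 4\<bar> * (4 / y\<^sup>2) * U ^ 4))"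
      by (rule dbl[OF _ bnd]) measurable
    finally show ?thesis .
  qed
  \<comment> \<open>Inside the radius \<open>1 + y^2\<close> is at most \<open>1 + R^2\<close>;
    outside it is at most \<open>2 y^2\<close>, because \<open>|y|\<close> is then at least 1.
    Adding the two constants covers both cases.\<close>
  define C1 where "C1 = \<Psi> * (\<Psi> * (U + R) powr e) * (1 + R\<^sup>2)"
  define C2 where "C2 = \<Psi> * (\<Psi> * (\<bar>c 4\<bar> * 8 * U ^ 4))"
  have C0: "0 \<le> C1" "0 \<le> C2" using P0 U0 by (simp_all add: C1_def C2_def)
  have "\<bar>J e j j' y\<bar> \<le> (C1 + C2) / (1 + y\<^sup>2)" for y
  proof (cases "\<bar>y\<bar> \<le> R")
    case True
    then have "y\<^sup>2 \<le> R\<^sup>2" using abs_le_square_iff[of y R] by (simp add: R_def)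
    have "\<bar>J e j j' y\<bar> * (1 + y\<^sup>2) \<le> (\<Psi> * (\<Psi> * (U + R) powr e)) * (1 + R\<^sup>2)"
      using \<open>y\<^sup>2 \<le> R\<^sup>2\<close> P0 by (intro mult_mono small True) auto
    then have "\<bar>J e j j' y\<bar> * (1 + y\<^sup>2) \<le> C1 + C2" using C0 by (simp add: C1_def)
    moreover have "0 < 1 + y\<^sup>2" by (simp add: add_pos_nonneg)
    ultimately show ?thesis by (simp add: pos_le_divide_eq)
  next
    case False
    then have "R \<le> \<bar>y\<bar>" by simp
    have "1 \<le> \<bar>y\<bar>" using False by (simp add: R_def)
    then have y1: "1 \<le> y\<^sup>2" using abs_le_square_iff[of 1 y] by simp
    then have "y \<noteq> 0" by auto
    have "1 + y\<^sup>2 \<le> 2 * y\<^sup>2" using y1 by simp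
    have "\<bar>J e j j' y\<bar> * (1 + y\<^sup>2) \<le> (\<Psi> * (\<Psi> * (\<bar>c 4\<bar> * (4 / y\<^sup>2) * U ^ 4))) * (2 * y\<^sup>2)"
      using \<open>1 + y\<^sup>2 \<le> 2 * y\<^sup>2\<close> P0 U0 by (intro mult_mono large \<open>R \<le> \<bar>y\<bar>\<close>) auto
    also have "\<dots> = C2" using \<open>y \<noteq> 0\<close> by (simp add: C2_def field_simps)
    finally have "\<bar>J e j j' y\<bar> * (1 + y\<^sup>2) \<le> C1 + C2" using C0 by simp
    moreover have "0 < 1 + y\<^sup>2" by (simp add: add_pos_nonneg)
    ultimately show ?thesis by (simp add: pos_le_divide_eq)
  qed
  then show ?thesis using C0 by (intro exI[of _ "C1 + C2"]) auto
qed

end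

section \<open>Averages over two scales\<close>

text \<open>Writes finite sums over windows as integrals over the integers, so that dominated
  convergence can be used for sums.\<close>

lemma count_integral_window:
  fixes \<phi> :: "int \<Rightarrow> real" and a b :: int
  shows "integrable (count_space UNIV) (\<lambda>z. \<phi> z * indicator {a..b} z)"
    "(LINT z|count_space UNIV. \<phi> z * indicator {a..b} z) = (\<Sum>z\<in>{a..b}. \<phi> z)"
proof -
  have s: "{z. \<phi> z * indicator {a..b} z \<noteq> 0} \<subseteq> {a..b}" by (auto simp: indicator_def)
  then have f: "finite {z. \<phi> z * indicator {a..b} z \<noteq> 0}" by (rule finite_subset) simp
  show "integrable (count_space UNIV) (\<lambda>z. \<phi> z * indicator {a..b} z)"
  proof -
    have "Infinite_Set_Sum.abs_summable_on (\<lambda>z. \<phi> z * indicator {a..b} z) UNIV \<longleftrightarrow> Infinite_Set_Sum.abs_summable_on \<phi> {a..b}"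
      by (rule abs_summable_on_cong_neutral) auto
    then show ?thesis by (simp add: Infinite_Set_Sum.abs_summable_on_def integrable_count_space)
  qed
  have "(LINT z|count_space UNIV. \<phi> z * indicator {a..b} z) = (\<Sum>z | \<phi> z * indicator {a..b} z \<noteq> 0. \<phi> z * indicator {a..b} z)"
    using f by (subst lebesgue_integral_count_space_finite_support) simp_all
  also have "\<dots> = (\<Sum>z\<in>{a..b}. \<phi> z * indicator {a..b} z)"
    by (intro sum.mono_neutral_left s) auto
  also have "\<dots> = (\<Sum>z\<in>{a..b}. \<phi> z)" by (rule sum.cong) auto
  finally show "(LINT z|count_space UNIV. \<phi> z * indicator {a..b} z) = (\<Sum>z\<in>{a..b}. \<phi> z)" .
qed

text \<open>In terms of the lag \<open>z = k - r k'\<close> every row is a window of the same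
  sequence. The proportion of rows whose window contains a given lag is at most 1 and tends to 1, so
  dominated convergence with the summable bound \<open>|\<phi>|\<close> applies.\<close>

lemma toeplitz_average:
  fixes \<phi> :: "int \<Rightarrow> real" and L :: "nat \<Rightarrow> nat" and r :: nat
  assumes \<phi>: "(\<lambda>z. norm (\<phi> z)) summable_on UNIV" and r: "0 < r" and L: "filterlim L at_top sequentially"
  shows "(\<lambda>n. (\<Sum>k'=1..L n. \<Sum>k=1..r * L n. \<phi> (int k - int r * int k')) / real (L n)) \<longlonglongrightarrow> infsum \<phi> UNIV"
proof -
  have int: "integrable (count_space UNIV) \<phi>"
    using \<phi> by (simp only: abs_summable_equivalent abs_summable_on_def)
  have inf: "infsum \<phi> UNIV = (LINT z|count_space UNIV. \<phi> z)"
    using infsetsum_infsum[OF \<phi>[unfolded abs_summable_equivalent]] by (simp add: infsetsum_def)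
  define win where "win n k' = {1 - int r * int k'..int r * int (L n) - int r * int k'}" for n k'
  have row: "(\<Sum>k=1..r * L n. \<phi> (int k - int r * int k')) = (\<Sum>z\<in>win n k'. \<phi> z)" for n k'
    by (rule sum.reindex_bij_witness[where i = "\<lambda>z. nat (z + int r * int k')" and j = "\<lambda>k. int k - int r * int k'"])
      (auto simp: win_def nat_le_iff simp flip: of_nat_mult)
  have eq: "(\<Sum>k'=1..L n. \<Sum>k=1..r * L n. \<phi> (int k - int r * int k')) / real (L n) =
      (LINT z|count_space UNIV. \<phi> z * ((\<Sum>k'=1..L n. indicator (win n k') z) / real (L n)))" for n
  proof -
    have "(\<Sum>k'=1..L n. \<Sum>k=1..r * L n. \<phi> (int k - int r * int k')) =
        (\<Sum>k'=1..L n. (LINT z|count_space UNIV. \<phi> z * indicator (win n k') z))"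
      unfolding row win_def count_integral_window(2) ..
    also have "\<dots> = (LINT z|count_space UNIV. (\<Sum>k'=1..L n. \<phi> z * indicator (win n k') z))"
      unfolding win_def by (rule Bochner_Integration.integral_sum[symmetric]) (rule count_integral_window)
    finally show ?thesis by (simp add: sum_distrib_left[symmetric])
  qed
  have ratio: "(\<Sum>k'=1..L n. indicator (win n k') z :: real) \<le> real (L n)" for n z
  proof -
    have "(\<Sum>k'=1..L n. indicator (win n k') z :: real) \<le> (\<Sum>k'=1..L n. 1)" by (intro sum_mono) (simp add: indicator_def)
    then show ?thesis by simp
  qed
  have r0: "0 \<le> (\<Sum>k'=1..L n. indicator (win n k') z :: real)" for n z by (intro sum_nonneg) auto
  \<comment> \<open>Every \<open>k'\<close> with \<open>|z| < k' <= L - |z|\<close> has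
    \<open>z\<close> in its window, so at most \<open>2 |z|\<close> rows miss it.\<close>
  have lower: "real (L n) - 2 * of_int \<bar>z\<bar> \<le> (\<Sum>k'=1..L n. indicator (win n k') z :: real)" for n z
  proof -
    have sub: "{nat \<bar>z\<bar> + 1..L n - nat \<bar>z\<bar>} \<subseteq> {k'\<in>{1..L n}. z \<in> win n k'}"
    proof
      fix k' assume k': "k' \<in> {nat \<bar>z\<bar> + 1..L n - nat \<bar>z\<bar>}"
      have 1: "\<bar>z\<bar> + 1 \<le> int k'" "int k' + \<bar>z\<bar> \<le> int (L n)" using k' by auto
      have "int k' \<le> int r * int k'" using r mult_right_mono[of 1 "int r" "int k'"] by simp
      then have "1 - int r * int k' \<le> z" using 1(1) by linarith
      moreover have "1 * (int (L n) - int k') \<le> int r * (int (L n) - int k')"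
        using r 1 by (intro mult_right_mono) auto
      then have "z \<le> int r * int (L n) - int r * int k'" using 1(2) by (simp add: right_diff_distrib)
      ultimately show "k' \<in> {k'\<in>{1..L n}. z \<in> win n k'}" using k' by (auto simp: win_def)
    qed
    have "real (L n) - 2 * of_int \<bar>z\<bar> \<le> real (card {nat \<bar>z\<bar> + 1..L n - nat \<bar>z\<bar>})"
      by (cases "nat \<bar>z\<bar> \<le> L n") auto
    also have "\<dots> \<le> real (card {k'\<in>{1..L n}. z \<in> win n k'})"
      using sub by (intro of_nat_mono card_mono) auto
    also have "\<dots> = (\<Sum>k'=1..L n. indicator (win n k') z)"
      by (simp add: indicator_def sum.If_cases Int_def)
    finally show ?thesis .
  qed
  have Linf: "filterlim (\<lambda>n. real (L n)) at_top sequentially"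
    by (rule filterlim_compose[OF filterlim_real_sequentially L])
  show ?thesis
    unfolding eq inf
  proof (rule integral_dominated_convergence[where w = "\<lambda>z. \<bar>\<phi> z\<bar>"])
    show "AE z in count_space UNIV. (\<lambda>n. \<phi> z * ((\<Sum>k'=1..L n. indicator (win n k') z) / real (L n))) \<longlonglongrightarrow> \<phi> z"
    proof (rule AE_I2)
      fix z
      have "(\<lambda>n. (\<Sum>k'=1..L n. indicator (win n k') z :: real) / real (L n)) \<longlonglongrightarrow> 1"
      proof (rule tendsto_sandwich[OF _ _ _ tendsto_const])
        have "(\<lambda>n. 1 - 2 * of_int \<bar>z\<bar> * inverse (real (L n))) \<longlonglongrightarrow> 1 - 2 * of_int \<bar>z\<bar> * 0"
          by (intro tendsto_intros tendsto_inverse_0_at_top Linf)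
        then show "(\<lambda>n. 1 - 2 * of_int \<bar>z\<bar> * inverse (real (L n))) \<longlonglongrightarrow> 1" by simp
        have ev: "eventually (\<lambda>n. 0 < real (L n)) sequentially"
          using Linf[unfolded filterlim_at_top_dense] by (rule spec)
        show "eventually (\<lambda>n. 1 - 2 * of_int \<bar>z\<bar> * inverse (real (L n)) \<le> (\<Sum>k'=1..L n. indicator (win n k') z :: real) / real (L n)) sequentially"
          using ev
        proof eventually_elim
          case (elim n)
          have "(real (L n) - 2 * of_int \<bar>z\<bar>) / real (L n) \<le> (\<Sum>k'=1..L n. indicator (win n k') z :: real) / real (L n)"
            using elim by (intro divide_right_mono lower) simp
          then show ?case using elim by (simp add: diff_divide_distrib divide_inverse[of "2 * _"])
        qed
        show "eventually (\<lambda>n. (\<Sum>k'=1..L n. indicator (win n k') z :: real) / real (L n) \<le> 1) sequentially"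
          using ev by eventually_elim (use ratio in \<open>simp add: divide_le_eq\<close>)
      qed
      from tendsto_mult[OF tendsto_const[of "\<phi> z"] this]
      show "(\<lambda>n. \<phi> z * ((\<Sum>k'=1..L n. indicator (win n k') z) / real (L n))) \<longlonglongrightarrow> \<phi> z" by simp
    qed
    show "AE z in count_space UNIV. norm (\<phi> z * ((\<Sum>k'=1..L n. indicator (win n k') z) / real (L n))) \<le> \<bar>\<phi> z\<bar>" for n
    proof (rule AE_I2)
      fix z
      have "\<bar>(\<Sum>k'=1..L n. indicator (win n k') z :: real) / real (L n)\<bar> \<le> 1"
        using ratio[of n z] r0[of n z] by (cases "L n = 0") (auto simp: divide_le_eq)
      then show "norm (\<phi> z * ((\<Sum>k'=1..L n. indicator (win n k') z) / real (L n))) \<le> \<bar>\<phi> z\<bar>"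
        unfolding real_norm_def abs_mult by (rule mult_left_le) simp
    qed
  qed (use int in auto)
qed

text \<open>When \<open>j <= j'\<close> the coarse grid is contained in the fine one: all lags are
  multiples of \<open>2 ^ j\<close>, which is the gcd, and there are \<open>r\<close> times as many
  fine coefficients as coarse ones. Hence the normalisation is \<open>sqrt r\<close> times the
  number of coarse ones.\<close>

lemma two_scale_average_le:
  fixes c :: "real \<Rightarrow> real" and K K' :: "nat \<Rightarrow> nat" and j j' :: nat
  assumes c: "(\<lambda>z. norm (c (of_int z))) summable_on (UNIV :: int set)"
    and K: "eventually (\<lambda>n. K n * 2 ^ j = K' n * 2 ^ j') sequentially" and jj: "j \<le> j'"
    and K': "filterlim K' at_top sequentially"
  shows "(\<lambda>n. (\<Sum>k=1..K n. \<Sum>k'=1..K' n. c (2 ^ j * real k - 2 ^ j' * real k')) / sqrt (real (K n) * real (K' n)))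
    \<longlonglongrightarrow> 2 powr (- real (j + j') / 2) * real (gcd (2 ^ j) (2 ^ j')) * infsum (\<lambda>z::int. c (of_int z * real (gcd (2 ^ j) (2 ^ j')))) UNIV"
proof -
  define r where "r = (2 ^ (j' - j) :: nat)"
  have r: "0 < r" by (simp add: r_def)
  have p: "(2::nat) ^ j' = 2 ^ j * r" using jj by (simp add: r_def flip: power_add)
  have pr: "(2::real) ^ j' = 2 ^ j * real r" using jj by (simp add: r_def flip: power_add)
  have g: "gcd (2 ^ j) (2 ^ j') = (2 ^ j :: nat)" using jj by (simp add: p)
  define \<phi> where "\<phi> z = c (2 ^ j * of_int z)" for z :: int
  have \<phi>: "(\<lambda>z. norm (\<phi> z)) summable_on UNIV"
  proof -
    have "(\<lambda>z. norm (c (of_int z))) summable_on range (\<lambda>z::int. 2 ^ j * z)"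
      using c by (rule summable_on_subset_banach) simp
    then have "(\<lambda>z. norm (c (of_int z))) \<circ> (\<lambda>z::int. 2 ^ j * z) summable_on UNIV"
      by (subst (asm) summable_on_reindex) (auto simp: inj_on_def)
    then show ?thesis by (simp add: \<phi>_def comp_def)
  qed
  have lim: "(\<lambda>n. (1 / sqrt (real r)) * ((\<Sum>k'=1..K' n. \<Sum>k=1..r * K' n. \<phi> (int k - int r * int k')) / real (K' n)))
      \<longlonglongrightarrow> (1 / sqrt (real r)) * infsum \<phi> UNIV"
    by (rule tendsto_mult[OF tendsto_const toeplitz_average[OF \<phi> r K']])
  have "eventually (\<lambda>n. (1 / sqrt (real r)) * ((\<Sum>k'=1..K' n. \<Sum>k=1..r * K' n. \<phi> (int k - int r * int k')) / real (K' n)) =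
      (\<Sum>k=1..K n. \<Sum>k'=1..K' n. c (2 ^ j * real k - 2 ^ j' * real k')) / sqrt (real (K n) * real (K' n))) sequentially"
    using K
  proof eventually_elim
    case (elim n)
    then have Kn: "K n = r * K' n" by (simp add: p)
    have "(\<Sum>k=1..K n. \<Sum>k'=1..K' n. c (2 ^ j * real k - 2 ^ j' * real k')) =
        (\<Sum>k'=1..K' n. \<Sum>k=1..r * K' n. \<phi> (int k - int r * int k'))"
      unfolding Kn by (subst sum.swap) (simp add: \<phi>_def pr right_diff_distrib mult.assoc)
    moreover have "sqrt (real (K n) * real (K' n)) = sqrt (real r) * real (K' n)"
      unfolding Kn by (simp add: real_sqrt_mult mult.assoc)
    ultimately show ?case by simp
  qed
  from Lim_transform_eventually[OF lim this]
  have "(\<lambda>n. (\<Sum>k=1..K n. \<Sum>k'=1..K' n. c (2 ^ j * real k - 2 ^ j' * real k')) / sqrt (real (K n) * real (K' n)))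
    \<longlonglongrightarrow> (1 / sqrt (real r)) * infsum \<phi> UNIV" .
  note lim2 = this
  \<comment> \<open>Both sides are 2 to the power \<open>- (j' - j) / 2\<close>.\<close>
  have pow: "2 powr (- real (j + j') / 2) * real (2 ^ j) = 1 / sqrt (real r)"
  proof -
    have "sqrt (real r) = 2 powr (real (j' - j) / 2)"
      by (simp add: r_def powr_half_sqrt[symmetric] powr_realpow[symmetric] powr_powr)
    then have "1 / sqrt (real r) = 2 powr (- (real (j' - j) / 2))" by (simp only: powr_minus_divide)
    also have "\<dots> = 2 powr (- real (j + j') / 2 + real j)"
      by (rule arg_cong[where f = "(powr) 2"]) (use jj in \<open>simp add: of_nat_diff field_simps\<close>)
    finally show ?thesis by (simp add: powr_add powr_realpow)
  qed
  have inf: "infsum (\<lambda>z::int. c (of_int z * real (gcd (2 ^ j) (2 ^ j')))) UNIV = infsum \<phi> UNIV"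
    unfolding g \<phi>_def by (simp add: mult.commute)
  show ?thesis unfolding inf unfolding g pow by (rule lim2)
qed

lemma two_scale_average:
  fixes c :: "real \<Rightarrow> real" and K K' :: "nat \<Rightarrow> nat" and j j' :: nat
  assumes c: "(\<lambda>z. norm (c (of_int z))) summable_on (UNIV :: int set)"
    and K: "eventually (\<lambda>n. K n * 2 ^ j = K' n * 2 ^ j') sequentially"
    and KK: "filterlim K at_top sequentially" "filterlim K' at_top sequentially"
  shows "(\<lambda>n. (\<Sum>k=1..K n. \<Sum>k'=1..K' n. c (2 ^ j * real k - 2 ^ j' * real k')) / sqrt (real (K n) * real (K' n)))
    \<longlonglongrightarrow> 2 powr (- real (j + j') / 2) * real (gcd (2 ^ j) (2 ^ j')) * infsum (\<lambda>z::int. c (of_int z * real (gcd (2 ^ j) (2 ^ j')))) UNIV"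
proof (cases "j \<le> j'")
  case True
  then show ?thesis by (rule two_scale_average_le[OF c K _ KK(2)])
next
  case False
  \<comment> \<open>Exchanging the two scales changes the sign of every lag, and the sum over all
    integers is invariant under \<open>z -> -z\<close>.\<close>
  define c' where "c' x = c (- x)" for x
  have c': "(\<lambda>z. norm (c' (of_int z))) summable_on (UNIV :: int set)"
  proof -
    have "(\<lambda>z. norm (c (of_int z))) summable_on (uminus ` (UNIV :: int set))" using c by simp
    then show ?thesis by (subst (asm) summable_on_reindex) (auto simp: c'_def comp_def)
  qed
  have K2: "eventually (\<lambda>n. K' n * 2 ^ j' = K n * 2 ^ j) sequentially" using K by eventually_elim simp
  have inf: "infsum (\<lambda>z::int. c' (of_int z * real (gcd (2 ^ j') (2 ^ j)))) UNIV =
      infsum (\<lambda>z::int. c (of_int z * real (gcd (2 ^ j) (2 ^ j')))) UNIV"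
    using infsum_reindex[of uminus "UNIV :: int set" "\<lambda>z::int. c (of_int z * real (gcd (2 ^ j) (2 ^ j')))"]
    by (simp add: c'_def comp_def gcd.commute)
  have "(\<Sum>k'=1..K' n. \<Sum>k=1..K n. c' (2 ^ j' * real k' - 2 ^ j * real k)) =
      (\<Sum>k=1..K n. \<Sum>k'=1..K' n. c (2 ^ j * real k - 2 ^ j' * real k'))" for n
    by (subst sum.swap) (simp add: c'_def)
  then show ?thesis
    using two_scale_average_le[OF c' K2 _ KK(1)] False unfolding inf
    by (simp add: mult.commute gcd.commute add.commute)
qed

section \<open>Eigenvalues of scaled matrices\<close>

lemma eigenvals_eq_det: "eigenvals (S :: real^'n^'n) = {x. det (S - x *\<^sub>R mat 1) = 0}"
proof -
  have "S *v v = x *\<^sub>R v \<longleftrightarrow> (S - x *\<^sub>R mat 1) *v v = 0" for v x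
    by (simp add: matrix_vector_mult_diff_rdistrib scaleR_matrix_vector_assoc[symmetric])
  moreover have "det A = 0 \<longleftrightarrow> (\<exists>v. v \<noteq> 0 \<and> A *v v = 0)" for A :: "real^'n^'n"
    unfolding matrix_nonfull_linear_equations_eq det_eq_0_rank using rank_bound[of A] by auto
  ultimately show ?thesis unfolding eigenvals_def by simp
qed

lemma ord_eigenval_symmetric:
  fixes S :: "real^2^2"
  assumes "S $ 1 $ 2 = S $ 2 $ 1"
  shows "ord_eigenval S 1 = (trace S - sqrt ((trace S)\<^sup>2 - 4 * det S)) / 2"
    and "ord_eigenval S 2 = (trace S + sqrt ((trace S)\<^sup>2 - 4 * det S)) / 2"
    and "ord_eigenval S 1 * ord_eigenval S 2 = det S"
proof -
  define d where "d = sqrt ((trace S)\<^sup>2 - 4 * det S)"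
  have "(trace S)\<^sup>2 - 4 * det S = (S $ 1 $ 1 - S $ 2 $ 2)\<^sup>2 + 4 * (S $ 1 $ 2)\<^sup>2"
    using assms by (simp add: trace_def sum_2 det_2 power2_eq_square algebra_simps)
  then have nn: "0 \<le> (trace S)\<^sup>2 - 4 * det S" by simp
  then have d: "0 \<le> d" "d\<^sup>2 = (trace S)\<^sup>2 - 4 * det S" by (simp_all add: d_def)
  have "det (S - x *\<^sub>R mat 1) = (x - (trace S - d) / 2) * (x - (trace S + d) / 2)" for x
  proof -
    have "det (S - x *\<^sub>R mat 1) = x\<^sup>2 - trace S * x + det S"
      by (simp add: trace_def sum_2 det_2 mat_def power2_eq_square algebra_simps)
    also have "\<dots> = (x - (trace S - d) / 2) * (x - (trace S + d) / 2)"
      using d(2) by (simp add: field_simps power2_eq_square)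
    finally show ?thesis .
  qed
  then have "eigenvals S = {(trace S - d) / 2, (trace S + d) / 2}"
    unfolding eigenvals_eq_det by auto
  then have *: "ord_eigenval S 1 = (trace S - d) / 2" "ord_eigenval S 2 = (trace S + d) / 2"
    using d(1) by (simp_all add: ord_eigenval_def min_def max_def)
  then show "ord_eigenval S 1 = (trace S - sqrt ((trace S)\<^sup>2 - 4 * det S)) / 2"
    "ord_eigenval S 2 = (trace S + sqrt ((trace S)\<^sup>2 - 4 * det S)) / 2" by (simp_all add: d_def)
  show "ord_eigenval S 1 * ord_eigenval S 2 = det S"
    unfolding * using d(2) by (simp add: field_simps power2_eq_square)
qed

text \<open>The inverse of vec_S.\<close>

definition smat :: "real^3 \<Rightarrow> real^2^2" where
  "smat t = vector [vector [t $ 1, t $ 2], vector [t $ 2, t $ 3]]"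

lemma smat_nth [simp]: "smat t $ 1 $ 1 = t $ 1" "smat t $ 1 $ 2 = t $ 2" "smat t $ 2 $ 1 = t $ 2" "smat t $ 2 $ 2 = t $ 3"
  by (simp_all add: smat_def)

definition scaled :: "real^2^2 \<Rightarrow> real \<Rightarrow> real \<Rightarrow> real^2^2 \<Rightarrow> real^2^2" where
  "scaled P x y V = P ** diag2 x y ** V ** diag2 x y ** transpose P"

lemma scaled_symmetric:
  assumes "V $ 1 $ 2 = V $ 2 $ 1" shows "scaled P x y V $ 1 $ 2 = scaled P x y V $ 2 $ 1"
  using assms by (simp add: scaled_def matrix_matrix_mult_def transpose_def diag2_def sum_2 algebra_simps)

lemma det_scaled: "det (scaled P x y V) = (det P)\<^sup>2 * (x * y)\<^sup>2 * det V"
proof -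
  have "det (diag2 x y) = x * y" by (simp add: det_2 diag2_def)
  then show ?thesis by (simp add: scaled_def det_mul power2_eq_square mult_ac)
qed

text \<open>The unit columns make the coefficients of the diagonal entries equal to 1; the angle
  between the columns survives only in the mixed term.\<close>

lemma trace_scaled:
  assumes "V $ 1 $ 2 = V $ 2 $ 1" "norm (column 1 P) = 1" "norm (column 2 P) = 1"
  shows "trace (scaled P x y V) = x\<^sup>2 * V $ 1 $ 1 + 2 * (column 1 P \<bullet> column 2 P) * x * y * V $ 1 $ 2 + y\<^sup>2 * V $ 2 $ 2"
proof -
  have c: "(P $ 1 $ i)\<^sup>2 + (P $ 2 $ i)\<^sup>2 = 1" if "norm (column i P) = 1" for i
    using that by (simp add: norm_eq_1 column_def inner_vec_def sum_2 power2_eq_square)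
  have "trace (scaled P x y V) = ((P $ 1 $ 1)\<^sup>2 + (P $ 2 $ 1)\<^sup>2) * (x\<^sup>2 * V $ 1 $ 1) +
      2 * (column 1 P \<bullet> column 2 P) * x * y * V $ 1 $ 2 + ((P $ 1 $ 2)\<^sup>2 + (P $ 2 $ 2)\<^sup>2) * (y\<^sup>2 * V $ 2 $ 2)"
    using assms(1) by (simp add: trace_def scaled_def matrix_matrix_mult_def transpose_def diag2_def sum_2
        column_def inner_vec_def power2_eq_square algebra_simps)
  then show ?thesis using c assms by simp
qed

text \<open>The larger eigenvalue of the scaled matrix divided by the square of the larger scale, as
  a function of \<open>e = x / y\<close>; here \<open>\<rho>\<close> is the inner product of the
  columns of \<open>P\<close> and \<open>\<kappa>\<close> the square of its determinant. Squares are
  written as products, the form to which the rules for \<open>approx\<close> apply.\<close>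

definition top_eig :: "real \<Rightarrow> real \<Rightarrow> real \<Rightarrow> real^2^2 \<Rightarrow> real" where
  "top_eig \<rho> \<kappa> e V = (let \<tau> = V $ 2 $ 2 + 2 * \<rho> * (e * V $ 1 $ 2) + e * e * V $ 1 $ 1
     in (\<tau> + sqrt (\<tau> * \<tau> - 4 * \<kappa> * (e * e * det V))) * (1 / 2))"

text \<open>The smaller eigenvalue is obtained as determinant over larger eigenvalue. Its logarithm
  then splits into a scale term and quantities that stay regular as \<open>x / y\<close> tends to 0,
  with no cancellation between the trace and the root.\<close>

lemma ord_eigenval_scaled:
  assumes V: "V $ 1 $ 2 = V $ 2 $ 1" "0 < det V" and P: "det P \<noteq> 0" "norm (column 1 P) = 1" "norm (column 2 P) = 1"
    and xy: "0 < x" "0 < y"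
  defines "f \<equiv> top_eig (column 1 P \<bullet> column 2 P) ((det P)\<^sup>2) (x / y) V"
  assumes f: "0 < f"
  shows "0 < ord_eigenval (scaled P x y V) i"
    and "ln (ord_eigenval (scaled P x y V) 2) = 2 * ln y + ln f"
    and "ln (ord_eigenval (scaled P x y V) 1) = 2 * ln x + (ln ((det P)\<^sup>2) + ln (det V) - ln f)"
proof -
  define \<tau> where "\<tau> = V $ 2 $ 2 + 2 * (column 1 P \<bullet> column 2 P) * ((x / y) * V $ 1 $ 2) + (x / y) * (x / y) * V $ 1 $ 1"
  define \<Delta> where "\<Delta> = \<tau> * \<tau> - 4 * (det P)\<^sup>2 * ((x / y) * (x / y) * det V)"
  have f': "f = (\<tau> + sqrt \<Delta>) / 2" by (simp add: f_def top_eig_def Let_def \<tau>_def \<Delta>_def)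
  let ?W = "scaled P x y V"
  have tr: "trace ?W = y\<^sup>2 * \<tau>"
    unfolding trace_scaled[OF V(1) P(2,3)] \<tau>_def using xy by (simp add: field_simps power2_eq_square)
  have "(trace ?W)\<^sup>2 - 4 * det ?W = (y\<^sup>2)\<^sup>2 * \<Delta>"
    unfolding tr det_scaled \<Delta>_def using xy by (simp add: field_simps power2_eq_square)
  then have "sqrt ((trace ?W)\<^sup>2 - 4 * det ?W) = y\<^sup>2 * sqrt \<Delta>" by (simp only: real_sqrt_mult real_sqrt_abs abs_power2)
  then have o2: "ord_eigenval ?W 2 = y\<^sup>2 * f"
    unfolding ord_eigenval_symmetric(2)[OF scaled_symmetric[OF V(1)]] tr f' by (simp add: field_simps)
  then have p2: "0 < ord_eigenval ?W 2" using f xy by simp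
  have prod: "ord_eigenval ?W 1 * ord_eigenval ?W 2 = det ?W"
    by (rule ord_eigenval_symmetric(3)[OF scaled_symmetric[OF V(1)]])
  have "0 < det ?W" unfolding det_scaled using xy P V by simp
  then have p1: "0 < ord_eigenval ?W 1" using prod p2 by (metis zero_less_mult_pos2)
  show "0 < ord_eigenval ?W i" using p1 p2 exhaust_2[of i] by auto
  show l2: "ln (ord_eigenval ?W 2) = 2 * ln y + ln f"
    unfolding o2 using xy f by (simp add: ln_mult ln_realpow)
  have "ln (ord_eigenval ?W 1) + ln (ord_eigenval ?W 2) = ln (det ?W)"
    unfolding prod[symmetric] using p1 p2 by (simp add: ln_mult)
  also have "\<dots> = ln ((det P)\<^sup>2) + (2 * ln x + 2 * ln y) + ln (det V)"
    unfolding det_scaled using xy P V by (simp add: ln_mult ln_realpow)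
  finally show "ln (ord_eigenval ?W 1) = 2 * ln x + (ln ((det P)\<^sup>2) + ln (det V) - ln f)"
    using l2 by simp
qed

section \<open>First-order calculus for convergent sequences\<close>

lemma Bseq_plus:
  fixes f g :: "nat \<Rightarrow> real"
  assumes "Bseq f" "Bseq g" shows "Bseq (\<lambda>n. f n + g n)"
proof -
  obtain a b where "\<And>n. norm (f n) \<le> a" "\<And>n. norm (g n) \<le> b" using assms unfolding Bseq_def by blast
  then show ?thesis by (intro BseqI'[of _ "a + b"] order_trans[OF norm_triangle_ineq] add_mono)
qed

lemma null_times_Bseq:
  fixes u l :: "nat \<Rightarrow> real"
  assumes "u \<longlonglongrightarrow> 0" "Bseq l" shows "(\<lambda>n. u n * l n) \<longlonglongrightarrow> 0"
proof -
  obtain K where K: "\<And>n. norm (l n) \<le> K" using assms(2) unfolding Bseq_def by blast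
  show ?thesis
  proof (rule tendsto_zero_sandwich)
    show "\<bar>u n * l n\<bar> \<le> \<bar>u n\<bar> * K" for n
      unfolding abs_mult using K[of n] by (intro mult_left_mono) auto
    show "(\<lambda>n. \<bar>u n\<bar> * K) \<longlonglongrightarrow> 0"
      by (intro tendsto_mult_left_zero tendsto_rabs_zero assms(1))
  qed
qed

text \<open>\<open>x' n = x n + (l n + o(1)) / r n\<close>, where \<open>x\<close> and \<open>x'\<close> have the limit \<open>c\<close>.\<close>

definition approx :: "(nat \<Rightarrow> real) \<Rightarrow> (nat \<Rightarrow> real) \<Rightarrow> (nat \<Rightarrow> real) \<Rightarrow> real \<Rightarrow> (nat \<Rightarrow> real) \<Rightarrow> bool" where
  "approx r x x' c l \<longleftrightarrow> x \<longlonglongrightarrow> c \<and> x' \<longlonglongrightarrow> c \<and> (\<lambda>n. r n * (x' n - x n) - l n) \<longlonglongrightarrow> 0 \<and> Bseq l"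

lemma approx_refl: "x \<longlonglongrightarrow> c \<Longrightarrow> approx r x x c (\<lambda>_. 0)"
  by (simp add: approx_def)

lemma approx_const: "approx r (\<lambda>_. c) (\<lambda>_. c) c (\<lambda>_. 0)"
  by (rule approx_refl) simp

lemma approx_perturb:
  assumes r: "filterlim r at_top sequentially" and y: "Bseq y"
  shows "approx r (\<lambda>_. c) (\<lambda>n. c + y n / r n) c y"
proof -
  have "(\<lambda>n. inverse (r n)) \<longlonglongrightarrow> 0" using r by (rule tendsto_inverse_0_at_top)
  from null_times_Bseq[OF this y] have "(\<lambda>n. y n / r n) \<longlonglongrightarrow> 0" by (simp add: field_simps)
  then have "(\<lambda>n. c + y n / r n) \<longlonglongrightarrow> c" using tendsto_add[of "\<lambda>_. c" c] by fastforce
  moreover have "(\<lambda>n. r n * (c + y n / r n - c) - y n) \<longlonglongrightarrow> 0"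
  proof (rule tendsto_eventually)
    have "eventually (\<lambda>n. r n > 0) sequentially" using r by (simp add: filterlim_at_top_dense)
    then show "eventually (\<lambda>n. r n * (c + y n / r n - c) - y n = 0) sequentially"
      by eventually_elim simp
  qed
  ultimately show ?thesis using y by (simp add: approx_def)
qed

lemma approx_add:
  assumes "approx r x x' c l" "approx r u u' d m"
  shows "approx r (\<lambda>n. x n + u n) (\<lambda>n. x' n + u' n) (c + d) (\<lambda>n. l n + m n)"
proof -
  have "(\<lambda>n. (r n * (x' n - x n) - l n) + (r n * (u' n - u n) - m n)) \<longlonglongrightarrow> 0 + 0"
    using assms unfolding approx_def by (intro tendsto_add) auto
  moreover have "(r n * (x' n - x n) - l n) + (r n * (u' n - u n) - m n) = r n * (x' n + u' n - (x n + u n)) - (l n + m n)" for n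
    by (simp add: algebra_simps)
  ultimately show ?thesis using assms unfolding approx_def by (auto intro: tendsto_add Bseq_plus)
qed

lemma approx_mult:
  assumes "approx r x x' c l" "approx r u u' d m"
  shows "approx r (\<lambda>n. x n * u n) (\<lambda>n. x' n * u' n) (c * d) (\<lambda>n. c * m n + d * l n)"
proof -
  note a = assms[unfolded approx_def]
  have "(\<lambda>n. x' n - c) \<longlonglongrightarrow> 0" "(\<lambda>n. u n - d) \<longlonglongrightarrow> 0" using a by (auto simp: LIM_zero)
  then have "(\<lambda>n. (x' n - c) * m n) \<longlonglongrightarrow> 0" "(\<lambda>n. (u n - d) * l n) \<longlonglongrightarrow> 0"
    using a by (auto intro: null_times_Bseq)
  moreover have "(\<lambda>n. x' n * (r n * (u' n - u n) - m n)) \<longlonglongrightarrow> c * 0" "(\<lambda>n. u n * (r n * (x' n - x n) - l n)) \<longlonglongrightarrow> d * 0"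
    by (intro tendsto_mult; use a in blast)+
  ultimately have "(\<lambda>n. x' n * (r n * (u' n - u n) - m n) + (x' n - c) * m n +
      (u n * (r n * (x' n - x n) - l n) + (u n - d) * l n)) \<longlonglongrightarrow> c * 0 + 0 + (d * 0 + 0)"
    by (intro tendsto_add)
  moreover have "x' n * (r n * (u' n - u n) - m n) + (x' n - c) * m n +
      (u n * (r n * (x' n - x n) - l n) + (u n - d) * l n) = r n * (x' n * u' n - x n * u n) - (c * m n + d * l n)" for n
    by (simp add: algebra_simps)
  moreover have "Bseq (\<lambda>n. c * m n + d * l n)" using a by (intro Bseq_plus Bseq_mult) auto
  ultimately show ?thesis using a unfolding approx_def by (auto intro: tendsto_mult)
qed

lemma approx_diff:
  assumes "approx r x x' c l" "approx r u u' d m"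
  shows "approx r (\<lambda>n. x n - u n) (\<lambda>n. x' n - u' n) (c - d) (\<lambda>n. l n - m n)"
  using approx_add[OF assms(1) approx_mult[OF approx_const[of r "-1"] assms(2)]] by simp

lemma mean_value_between:
  fixes \<phi> :: "real \<Rightarrow> real"
  assumes "\<And>z. \<bar>z - c\<bar> \<le> max \<bar>x - c\<bar> \<bar>y - c\<bar> \<Longrightarrow> DERIV \<phi> z :> \<phi>' z"
  shows "\<exists>z. \<bar>z - c\<bar> \<le> max \<bar>x - c\<bar> \<bar>y - c\<bar> \<and> \<phi> y - \<phi> x = (y - x) * \<phi>' z"
proof -
  consider "x < y" | "x = y" | "y < x" by linarith
  then show ?thesis
  proof cases
    case 1
    have "\<exists>z. x < z \<and> z < y \<and> \<phi> y - \<phi> x = (y - x) * \<phi>' z"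
      by (rule MVT2[OF 1]) (rule assms, linarith)
    then obtain z where z: "x < z" "z < y" "\<phi> y - \<phi> x = (y - x) * \<phi>' z" by blast
    moreover have "\<bar>z - c\<bar> \<le> max \<bar>x - c\<bar> \<bar>y - c\<bar>" using z by linarith
    ultimately show ?thesis by blast
  next
    case 2
    then show ?thesis by (intro exI[of _ x]) simp
  next
    case 3
    have "\<exists>z. y < z \<and> z < x \<and> \<phi> x - \<phi> y = (x - y) * \<phi>' z"
      by (rule MVT2[OF 3]) (rule assms, linarith)
    then obtain z where z: "y < z" "z < x" "\<phi> x - \<phi> y = (x - y) * \<phi>' z" by blast
    then have "\<phi> y - \<phi> x = (y - x) * \<phi>' z" by (simp add: algebra_simps)
    moreover have "\<bar>z - c\<bar> \<le> max \<bar>x - c\<bar> \<bar>y - c\<bar>" using z by linarith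
    ultimately show ?thesis by blast
  qed
qed

text \<open>The mean value theorem at each index; the intermediate points are squeezed to
  \<open>c\<close>, so continuity of the derivative lets it be evaluated at the limit instead of at
  \<open>x n\<close>.\<close>

lemma approx_chain:
  fixes \<phi> \<phi>' :: "real \<Rightarrow> real"
  assumes a: "approx r x x' c l" and \<delta>: "0 < \<delta>" "\<And>z. \<bar>z - c\<bar> < \<delta> \<Longrightarrow> DERIV \<phi> z :> \<phi>' z"
    and \<phi>': "isCont \<phi>' c"
  shows "approx r (\<lambda>n. \<phi> (x n)) (\<lambda>n. \<phi> (x' n)) (\<phi> c) (\<lambda>n. \<phi>' c * l n)"
proof -
  note a' = a[unfolded approx_def]
  define m where "m n = max \<bar>x n - c\<bar> \<bar>x' n - c\<bar>" for n
  have "(\<lambda>n. \<bar>x n - c\<bar>) \<longlonglongrightarrow> 0" "(\<lambda>n. \<bar>x' n - c\<bar>) \<longlonglongrightarrow> 0" using a' by (auto simp: LIM_zero tendsto_rabs_zero)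
  then have m0: "m \<longlonglongrightarrow> 0" unfolding m_def[abs_def] using tendsto_max[of _ "0::real" _ _ 0] by fastforce
  then have ev: "eventually (\<lambda>n. m n < \<delta>) sequentially" using \<delta>(1) by (rule order_tendstoD)
  \<comment> \<open>For the finitely many indices at which the points leave the interval, the
    default value \<open>c\<close> keeps \<open>|z n - c| <= m n\<close> true.\<close>
  define z where "z n = (if m n < \<delta> then (SOME z. \<bar>z - c\<bar> \<le> m n \<and> \<phi> (x' n) - \<phi> (x n) = (x' n - x n) * \<phi>' z) else c)" for n
  have z: "\<bar>z n - c\<bar> \<le> m n \<and> \<phi> (x' n) - \<phi> (x n) = (x' n - x n) * \<phi>' (z n)" if "m n < \<delta>" for n
  proof -
    have "\<exists>z. \<bar>z - c\<bar> \<le> m n \<and> \<phi> (x' n) - \<phi> (x n) = (x' n - x n) * \<phi>' z"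
      unfolding m_def
    proof (rule mean_value_between)
      fix z assume "\<bar>z - c\<bar> \<le> max \<bar>x n - c\<bar> \<bar>x' n - c\<bar>"
      then have "\<bar>z - c\<bar> < \<delta>" using that unfolding m_def by (rule le_less_trans)
      then show "DERIV \<phi> z :> \<phi>' z" by (rule \<delta>(2))
    qed
    from someI_ex[OF this] show ?thesis unfolding z_def using that by simp
  qed
  have "\<bar>z n - c\<bar> \<le> m n" for n using z[of n] by (cases "m n < \<delta>") (auto simp: z_def m_def)
  then have "(\<lambda>n. z n - c) \<longlonglongrightarrow> 0" using m0 by (rule tendsto_zero_sandwich)
  then have "z \<longlonglongrightarrow> c" by (rule LIM_zero_cancel)
  then have \<phi>z: "(\<lambda>n. \<phi>' (z n)) \<longlonglongrightarrow> \<phi>' c" by (rule isCont_tendsto_compose[OF \<phi>'])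
  have cont: "isCont \<phi> c" using \<delta> DERIV_isCont[of \<phi> "\<phi>' c" c] by simp
  have "(\<lambda>n. (\<phi>' (z n) - \<phi>' c) * l n) \<longlonglongrightarrow> 0"
    using \<phi>z a' by (intro null_times_Bseq) (auto simp: LIM_zero)
  moreover have "(\<lambda>n. \<phi>' (z n) * (r n * (x' n - x n) - l n)) \<longlonglongrightarrow> \<phi>' c * 0"
    using \<phi>z a' by (intro tendsto_mult) auto
  ultimately have "(\<lambda>n. \<phi>' (z n) * (r n * (x' n - x n) - l n) + (\<phi>' (z n) - \<phi>' c) * l n) \<longlonglongrightarrow> \<phi>' c * 0 + 0"
    by (intro tendsto_add)
  then have "(\<lambda>n. \<phi>' (z n) * (r n * (x' n - x n) - l n) + (\<phi>' (z n) - \<phi>' c) * l n) \<longlonglongrightarrow> 0" by simp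
  moreover have "eventually (\<lambda>n. \<phi>' (z n) * (r n * (x' n - x n) - l n) + (\<phi>' (z n) - \<phi>' c) * l n =
      r n * (\<phi> (x' n) - \<phi> (x n)) - \<phi>' c * l n) sequentially"
    using ev
  proof eventually_elim
    case (elim n)
    show ?case unfolding conjunct2[OF z[OF elim]] by (simp add: algebra_simps)
  qed
  ultimately have "(\<lambda>n. r n * (\<phi> (x' n) - \<phi> (x n)) - \<phi>' c * l n) \<longlonglongrightarrow> 0" by (rule Lim_transform_eventually)
  moreover have "Bseq (\<lambda>n. \<phi>' c * l n)" using a' by (intro Bseq_mult) auto
  ultimately show ?thesis
    using a' isCont_tendsto_compose[OF cont] unfolding approx_def by auto
qed

lemma approx_ln:
  assumes "approx r x x' c l" "0 < c"
  shows "approx r (\<lambda>n. ln (x n)) (\<lambda>n. ln (x' n)) (ln c) (\<lambda>n. inverse c * l n)"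
  by (rule approx_chain[OF assms(1,2), where \<phi>' = inverse])
     (use assms(2) in \<open>auto intro!: DERIV_ln continuous_intros\<close>)

lemma approx_sqrt:
  assumes "approx r x x' c l" "0 < c"
  shows "approx r (\<lambda>n. sqrt (x n)) (\<lambda>n. sqrt (x' n)) (sqrt c) (\<lambda>n. inverse (sqrt c) / 2 * l n)"
  by (rule approx_chain[OF assms(1,2), where \<phi>' = "\<lambda>z. inverse (sqrt z) / 2"])
     (use assms(2) in \<open>auto intro!: DERIV_real_sqrt continuous_intros\<close>)

text \<open>The sequence \<open>e\<close> is the same on both sides, so its own first-order term is
  0, and its limit is 0 as well. Every summand containing \<open>e\<close> therefore drops out of
  the linear part, and only the change of \<open>v_22\<close> is left in the first claim.\<close>

lemma approx_top_eig:
  fixes B :: "real^2^2" and t :: "nat \<Rightarrow> real^3"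
  assumes r: "filterlim r at_top sequentially" and t: "\<And>i. Bseq (\<lambda>n. t n $ i)" and e: "e \<longlonglongrightarrow> 0"
    and B: "B $ 1 $ 2 = B $ 2 $ 1" "0 < B $ 2 $ 2"
  defines "V \<equiv> \<lambda>n. B + (1 / r n) *\<^sub>R smat (t n)"
  shows "approx r (\<lambda>n. top_eig \<rho> \<kappa> (e n) B) (\<lambda>n. top_eig \<rho> \<kappa> (e n) (V n)) (B $ 2 $ 2) (\<lambda>n. t n $ 3)"
    and "approx r (\<lambda>n. det B) (\<lambda>n. det (V n)) (det B) (\<lambda>n. B $ 1 $ 1 * t n $ 3 + B $ 2 $ 2 * t n $ 1 - 2 * (B $ 1 $ 2 * t n $ 2))"
proof -
  have A: "approx r (\<lambda>n. B $ 1 $ 1) (\<lambda>n. V n $ 1 $ 1) (B $ 1 $ 1) (\<lambda>n. t n $ 1)"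
    "approx r (\<lambda>n. B $ 1 $ 2) (\<lambda>n. V n $ 1 $ 2) (B $ 1 $ 2) (\<lambda>n. t n $ 2)"
    "approx r (\<lambda>n. B $ 1 $ 2) (\<lambda>n. V n $ 2 $ 1) (B $ 1 $ 2) (\<lambda>n. t n $ 2)"
    "approx r (\<lambda>n. B $ 2 $ 2) (\<lambda>n. V n $ 2 $ 2) (B $ 2 $ 2) (\<lambda>n. t n $ 3)"
    using approx_perturb[OF r t] B(1) by (simp_all add: V_def)
  have Ae: "approx r e e 0 (\<lambda>_. 0)" by (rule approx_refl[OF e])
  have dB: "det B = B $ 1 $ 1 * B $ 2 $ 2 - B $ 1 $ 2 * B $ 1 $ 2" using B(1) by (simp add: det_2)
  have dV: "det (V n) = V n $ 1 $ 1 * V n $ 2 $ 2 - V n $ 1 $ 2 * V n $ 2 $ 1" for n by (rule det_2)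
  have l: "B $ 1 $ 1 * t n $ 3 + B $ 2 $ 2 * t n $ 1 - 2 * (B $ 1 $ 2 * t n $ 2) =
    B $ 1 $ 1 * t n $ 3 + B $ 2 $ 2 * t n $ 1 - (B $ 1 $ 2 * t n $ 2 + B $ 1 $ 2 * t n $ 2)" for n by simp
  show Adet: "approx r (\<lambda>n. det B) (\<lambda>n. det (V n)) (det B) (\<lambda>n. B $ 1 $ 1 * t n $ 3 + B $ 2 $ 2 * t n $ 1 - 2 * (B $ 1 $ 2 * t n $ 2))"
    unfolding dB dV l by (rule approx_diff[OF approx_mult[OF A(1,4)] approx_mult[OF A(2,3)]])
  define \<tau> where "\<tau> e V = V $ 2 $ 2 + 2 * \<rho> * (e * V $ 1 $ 2) + e * e * V $ 1 $ 1" for e and V :: "real^2^2"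
  have A\<tau>: "approx r (\<lambda>n. \<tau> (e n) B) (\<lambda>n. \<tau> (e n) (V n)) (B $ 2 $ 2) (\<lambda>n. t n $ 3)"
    using approx_add[OF approx_add[OF A(4) approx_mult[OF approx_const[of r "2 * \<rho>"] approx_mult[OF Ae A(2)]]]
        approx_mult[OF approx_mult[OF Ae Ae] A(1)]]
    by (simp add: \<tau>_def)
  have "approx r (\<lambda>n. \<tau> (e n) B * \<tau> (e n) B - 4 * \<kappa> * (e n * e n * det B))
      (\<lambda>n. \<tau> (e n) (V n) * \<tau> (e n) (V n) - 4 * \<kappa> * (e n * e n * det (V n))) (B $ 2 $ 2 * B $ 2 $ 2)
      (\<lambda>n. B $ 2 $ 2 * t n $ 3 + B $ 2 $ 2 * t n $ 3)"
    using approx_diff[OF approx_mult[OF A\<tau> A\<tau>] approx_mult[OF approx_const[of r "4 * \<kappa>"] approx_mult[OF approx_mult[OF Ae Ae] Adet]]]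
    by simp
  \<comment> \<open>At the limit \<open>b_22^2\<close> the root has derivative
    \<open>1 / (2 b_22)\<close>, which turns the linear part \<open>2 b_22 t_3\<close> of the
    discriminant into \<open>t_3\<close>.\<close>
  from approx_sqrt[OF this] B(2)
  have "approx r (\<lambda>n. sqrt (\<tau> (e n) B * \<tau> (e n) B - 4 * \<kappa> * (e n * e n * det B)))
      (\<lambda>n. sqrt (\<tau> (e n) (V n) * \<tau> (e n) (V n) - 4 * \<kappa> * (e n * e n * det (V n)))) (B $ 2 $ 2)
      (\<lambda>n. t n $ 3)" by (simp add: field_simps)
  from approx_mult[OF approx_add[OF A\<tau> this] approx_const[of r "1 / 2"]]
  show "approx r (\<lambda>n. top_eig \<rho> \<kappa> (e n) B) (\<lambda>n. top_eig \<rho> \<kappa> (e n) (V n)) (B $ 2 $ 2) (\<lambda>n. t n $ 3)"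
    by (simp add: top_eig_def Let_def \<tau>_def)
qed

text \<open>At each index a counterexample is chosen if there is one; the statement for this single
  bounded sequence rules it out. Statements about sequences thus become uniform on balls.\<close>

lemma eventually_uniform:
  fixes R :: real and Q :: "nat \<Rightarrow> 'a::real_normed_vector \<Rightarrow> bool"
  assumes "\<And>y. (\<And>n. norm (y n) \<le> R) \<Longrightarrow> eventually (\<lambda>n. Q n (y n)) sequentially"
  shows "eventually (\<lambda>n. \<forall>y. norm y \<le> R \<longrightarrow> Q n y) sequentially"
proof (cases "0 \<le> R")
  case True
  define y where "y n = (if \<exists>y. norm y \<le> R \<and> \<not> Q n y then SOME y. norm y \<le> R \<and> \<not> Q n y else 0)" for n
  have s: "norm (y n) \<le> R \<and> \<not> Q n (y n)" if "\<exists>y. norm y \<le> R \<and> \<not> Q n y" for n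
    using someI_ex[OF that] that by (simp add: y_def)
  have "norm (y n) \<le> R" for n using s[of n] True by (cases "\<exists>y. norm y \<le> R \<and> \<not> Q n y") (auto simp: y_def)
  from assms[OF this] show ?thesis by eventually_elim (use s in blast)
next
  case False
  then have "norm y \<le> R \<longrightarrow> Q n y" for n y using norm_ge_zero[of y] by linarith
  then show ?thesis by simp
qed

text \<open>The scale terms and the logarithm of the squared determinant of \<open>P\<close> are
  common to both matrices and cancel in the differences. Uniformity in \<open>t\<close> is what
  permits a random \<open>t\<close> to be inserted outcome by outcome.\<close>

theorem log_eigenval_expansion:
  fixes P B :: "real^2^2" and x y r :: "nat \<Rightarrow> real"
  assumes P: "det P \<noteq> 0" "norm (column 1 P) = 1" "norm (column 2 P) = 1"
    and B: "B $ 1 $ 2 = B $ 2 $ 1" "0 < B $ 2 $ 2" "0 < det B"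
    and xy: "\<And>n. 0 < x n" "\<And>n. 0 < y n" "(\<lambda>n. x n / y n) \<longlonglongrightarrow> 0"
    and r: "filterlim r at_top sequentially" and \<epsilon>: "0 < \<epsilon>"
  defines "W \<equiv> \<lambda>n t. scaled P (x n) (y n) (B + (1 / r n) *\<^sub>R smat t)"
  shows "eventually (\<lambda>n. \<forall>t. norm t \<le> R \<longrightarrow> (\<forall>i. 0 < ord_eigenval (W n t) i) \<and>
    norm ((\<chi> i. r n * (ln (ord_eigenval (W n t) i) - ln (ord_eigenval (scaled P (x n) (y n) B) i))) - Q_block B *v t) < \<epsilon>)
    sequentially"
proof (rule eventually_uniform)
  fix t :: "nat \<Rightarrow> real^3" assume tR: "\<And>n. norm (t n) \<le> R"
  have t: "Bseq (\<lambda>n. t n $ i)" for i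
    by (rule BseqI'[of _ R]) (use order_trans[OF component_le_norm_cart tR] in simp)
  define \<rho> \<kappa> where "\<rho> = column 1 P \<bullet> column 2 P" and "\<kappa> = (det P)\<^sup>2"
  define V where "V n = B + (1 / r n) *\<^sub>R smat (t n)" for n
  define f f' where "f n = top_eig \<rho> \<kappa> (x n / y n) B" and "f' n = top_eig \<rho> \<kappa> (x n / y n) (V n)" for n
  define ld where "ld n = B $ 1 $ 1 * t n $ 3 + B $ 2 $ 2 * t n $ 1 - 2 * (B $ 1 $ 2 * t n $ 2)" for n
  have Af: "approx r f f' (B $ 2 $ 2) (\<lambda>n. t n $ 3)" and Ad: "approx r (\<lambda>_. det B) (\<lambda>n. det (V n)) (det B) ld"
    unfolding f_def[abs_def] f'_def[abs_def] V_def[abs_def] ld_def[abs_def]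
    by (rule approx_top_eig[OF r t xy(3) B(1,2)])+
  have sV: "V n $ 1 $ 2 = V n $ 2 $ 1" for n using B(1) by (simp add: V_def)
  have "eventually (\<lambda>n. 0 < f n) sequentially" "eventually (\<lambda>n. 0 < f' n) sequentially"
    using Af B(2) unfolding approx_def by (auto intro: order_tendstoD)
  moreover have "eventually (\<lambda>n. 0 < det (V n)) sequentially"
    using Ad B(3) unfolding approx_def by (auto intro: order_tendstoD)
  ultimately have ev: "eventually (\<lambda>n. 0 < f n \<and> 0 < f' n \<and> 0 < det (V n)) sequentially"
    by eventually_elim simp
  define u where "u n = (\<chi> i. r n * (ln (ord_eigenval (W n (t n)) i) - ln (ord_eigenval (scaled P (x n) (y n) B) i))) - Q_block B *v t n" for n
  \<comment> \<open>The first row is the differential of \<open>ln (det V) - ln v_22\<close> at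
    \<open>B\<close>; \<open>ld\<close> is the differential of the determinant, and the second
    logarithm accounts for the -1 in the last entry.\<close>
  have Q: "(Q_block B *v t n) $ 2 = inverse (B $ 2 $ 2) * t n $ 3"
    "(Q_block B *v t n) $ 1 = inverse (det B) * ld n - inverse (B $ 2 $ 2) * t n $ 3" for n
    using B by (simp_all add: Q_block_def matrix_vector_mult_def sum_3 ld_def field_simps)
  note L2 = approx_ln[OF Af B(2)] and L1 = approx_diff[OF approx_ln[OF Ad B(3)] approx_ln[OF Af B(2)]]
  have "eventually (\<lambda>n. r n * (ln (f' n) - ln (f n)) - inverse (B $ 2 $ 2) * t n $ 3 = u n $ 2) sequentially"
    using ev
  proof eventually_elim
    case (elim n)
    then show ?case
      using ord_eigenval_scaled(2)[OF sV _ P xy(1,2), of n n n] ord_eigenval_scaled(2)[OF B(1,3) P xy(1,2), of n n]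
      unfolding u_def W_def Q V_def[symmetric] by (simp add: Q f_def f'_def \<rho>_def \<kappa>_def)
  qed
  then have u2: "(\<lambda>n. u n $ 2) \<longlonglongrightarrow> 0" using L2 unfolding approx_def by (auto intro: Lim_transform_eventually)
  have "eventually (\<lambda>n. r n * (ln (det (V n)) - ln (f' n) - (ln (det B) - ln (f n))) -
      (inverse (det B) * ld n - inverse (B $ 2 $ 2) * t n $ 3) = u n $ 1) sequentially"
    using ev
  proof eventually_elim
    case (elim n)
    have "ln (ord_eigenval (W n (t n)) 1) - ln (ord_eigenval (scaled P (x n) (y n) B) 1) =
        ln (det (V n)) - ln (f' n) - (ln (det B) - ln (f n))"
      using elim ord_eigenval_scaled(3)[OF sV _ P xy(1,2), of n n n] ord_eigenval_scaled(3)[OF B(1,3) P xy(1,2), of n n]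
      unfolding W_def V_def[symmetric] by (simp add: f_def f'_def \<rho>_def \<kappa>_def)
    then show ?case unfolding u_def by (simp add: Q)
  qed
  then have u1: "(\<lambda>n. u n $ 1) \<longlonglongrightarrow> 0" using L1 unfolding approx_def by (auto intro: Lim_transform_eventually)
  have "u \<longlonglongrightarrow> 0"
  proof (rule vec_tendstoI)
    show "(\<lambda>n. u n $ i) \<longlonglongrightarrow> 0 $ i" for i using u1 u2 exhaust_2[of i] by auto
  qed
  then have "eventually (\<lambda>n. norm (u n) < \<epsilon>) sequentially" using \<epsilon> by (auto dest!: tendstoD simp: dist_norm)
  then show "eventually (\<lambda>n. (\<forall>i. 0 < ord_eigenval (W n (t n)) i) \<and>
    norm ((\<chi> i. r n * (ln (ord_eigenval (W n (t n)) i) - ln (ord_eigenval (scaled P (x n) (y n) B) i))) - Q_block B *v t n) < \<epsilon>)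
    sequentially"
    using ev
  proof eventually_elim
    case (elim n)
    then show ?case
      using ord_eigenval_scaled(1)[OF sV _ P xy(1,2), of n n n] unfolding u_def
      by (simp add: W_def V_def[symmetric] f'_def \<rho>_def \<kappa>_def)
  qed
qed

section \<open>Limits of the logarithmic ratios\<close>

lemma log_ratio_limit:
  fixes L g :: "nat \<Rightarrow> real"
  assumes L: "filterlim L at_top sequentially" and g: "g \<longlonglongrightarrow> g0"
  shows "(\<lambda>n. (2 * (h * L n) + g n) / (2 * (L n + k))) \<longlonglongrightarrow> h"
proof -
  have top: "filterlim (\<lambda>n. 2 * (L n + k)) at_top sequentially"
    using filterlim_tendsto_pos_mult_at_top[OF tendsto_const[of 2] _ filterlim_tendsto_add_at_top[OF tendsto_const[of k] L]]
    by (simp add: add.commute)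
  have "(\<lambda>n. (g n - 2 * (h * k)) / (2 * (L n + k))) \<longlonglongrightarrow> 0"
    by (rule tendsto_divide_0[OF tendsto_diff[OF g tendsto_const] filterlim_at_top_imp_at_infinity[OF top]])
  from tendsto_add[OF tendsto_const[of h] this]
  have lim: "(\<lambda>n. h + (g n - 2 * (h * k)) / (2 * (L n + k))) \<longlonglongrightarrow> h" by simp
  have "eventually (\<lambda>n. 2 * (L n + k) > 0) sequentially" using top by (simp add: filterlim_at_top_dense)
  then have "eventually (\<lambda>n. h + (g n - 2 * (h * k)) / (2 * (L n + k)) = (2 * (h * L n) + g n) / (2 * (L n + k))) sequentially"
  proof eventually_elim
    case (elim n)
    then have "L n + k \<noteq> 0" by simp
    then show ?case by (simp add: field_simps)
  qed
  from Lim_transform_eventually[OF lim this] show ?thesis .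
qed

lemma log_eigenval_ratio_limit:
  fixes P B :: "real^2^2" and a :: "nat \<Rightarrow> real"
  assumes P: "det P \<noteq> 0" "norm (column 1 P) = 1" "norm (column 2 P) = 1"
    and B: "B $ 1 $ 2 = B $ 2 $ 1" "0 < B $ 2 $ 2" "0 < det B"
    and a: "\<And>n. 0 < a n" "filterlim a at_top sequentially" and h: "h1 < h2" and c: "0 < c"
  shows "(\<lambda>n. ln (ord_eigenval (scaled P (a n powr h1) (a n powr h2) B) i) / (2 * ln (a n * c)))
    \<longlonglongrightarrow> (if i = 1 then h1 else h2)"
proof -
  define \<rho> \<kappa> where "\<rho> = column 1 P \<bullet> column 2 P" and "\<kappa> = (det P)\<^sup>2"
  define e where "e n = a n powr h1 / a n powr h2" for n
  define f where "f n = top_eig \<rho> \<kappa> (e n) B" for n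
  have L: "filterlim (\<lambda>n. ln (a n)) at_top sequentially"
    by (rule filterlim_compose[OF ln_at_top a(2)])
  have e: "e \<longlonglongrightarrow> 0"
  proof -
    have "(\<lambda>n. a n powr (h1 - h2)) \<longlonglongrightarrow> 0" using h by (intro tendsto_neg_powr a(2)) simp
    then show ?thesis by (simp add: e_def[abs_def] powr_diff)
  qed
  \<comment> \<open>Rate and zero perturbation are dummies here: only the limit of \<open>f\<close>
    is taken from the expansion.\<close>
  have "approx (\<lambda>n. real n) f (\<lambda>n. top_eig \<rho> \<kappa> (e n) (B + (1 / real n) *\<^sub>R smat 0)) (B $ 2 $ 2) (\<lambda>n. (0::real^3) $ 3)"
    unfolding f_def[abs_def]
    by (rule approx_top_eig(1)[where t = "\<lambda>_. 0", OF filterlim_real_sequentially _ e B(1,2)]) simp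
  then have flim: "f \<longlonglongrightarrow> B $ 2 $ 2" by (simp add: approx_def)
  then have "eventually (\<lambda>n. 0 < f n) sequentially" using B(2) by (rule order_tendstoD)
  moreover have "eventually (\<lambda>n. 1 < a n) sequentially" using a(2) by (simp add: filterlim_at_top_dense)
  moreover have g: "(\<lambda>n. ln (f n)) \<longlonglongrightarrow> ln (B $ 2 $ 2)" using flim B(2) by (intro tendsto_ln) auto
  moreover note ord = ord_eigenval_scaled[OF B(1,3) P, folded \<rho>_def \<kappa>_def]
  have pos: "0 < a n powr h" for n h using a(1)[of n] by simp
  show ?thesis
  proof (cases "i = 1")
    case True
    have "(\<lambda>n. ln \<kappa> + ln (det B) - ln (f n)) \<longlonglongrightarrow> ln \<kappa> + ln (det B) - ln (B $ 2 $ 2)"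
      by (intro tendsto_intros g) (use B in auto)
    note lim = log_ratio_limit[OF L this, of h1 "ln c"]
    have "eventually (\<lambda>n. (2 * (h1 * ln (a n)) + (ln \<kappa> + ln (det B) - ln (f n))) / (2 * (ln (a n) + ln c)) =
        ln (ord_eigenval (scaled P (a n powr h1) (a n powr h2) B) i) / (2 * ln (a n * c))) sequentially"
      using \<open>eventually (\<lambda>n. 0 < f n) sequentially\<close>
    proof eventually_elim
      case (elim n)
      then show ?case using ord(3)[OF pos pos, of n h1 n h2] True a(1)[of n] c
        by (simp add: f_def e_def ln_powr ln_mult)
    qed
    from Lim_transform_eventually[OF lim this] True show ?thesis by simp
  next
    case False
    then have i: "i = 2" using exhaust_2[of i] by auto
    note lim = log_ratio_limit[OF L g, of h2 "ln c"]
    have "eventually (\<lambda>n. (2 * (h2 * ln (a n)) + ln (f n)) / (2 * (ln (a n) + ln c)) =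
        ln (ord_eigenval (scaled P (a n powr h1) (a n powr h2) B) i) / (2 * ln (a n * c))) sequentially"
      using \<open>eventually (\<lambda>n. 0 < f n) sequentially\<close>
    proof eventually_elim
      case (elim n)
      then show ?case using ord(2)[OF pos pos, of n h1 n h2] i a(1)[of n] c
        by (simp add: f_def e_def ln_powr ln_mult)
    qed
    from Lim_transform_eventually[OF lim this] False show ?thesis by simp
  qed
qed

section \<open>Linearization\<close>

context prob_space
begin

text \<open>For late \<open>n\<close> the events can occur only where \<open>T\<close> is outside a
  ball, and tightness makes the probability of that as small as desired.\<close>

lemma tight_rare_event:
  fixes T :: "nat \<Rightarrow> 'a \<Rightarrow> 'b::euclidean_space"
  assumes [measurable]: "\<And>n. T n \<in> borel_measurable M"
    and tight: "\<And>e. e > 0 \<Longrightarrow> \<exists>R. eventually (\<lambda>n. prob {w \<in> space M. R < norm (T n w)} < e) sequentially"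
    and sub: "\<And>n. A n \<subseteq> space M"
    and key: "\<And>R. eventually (\<lambda>n. \<forall>w\<in>space M. norm (T n w) \<le> R \<longrightarrow> w \<notin> A n) sequentially"
  shows "(\<lambda>n. prob (A n)) \<longlonglongrightarrow> 0"
proof (rule tendstoI)
  fix e :: real assume "0 < e"
  with tight obtain R where "eventually (\<lambda>n. prob {w \<in> space M. R < norm (T n w)} < e) sequentially" by blast
  then show "eventually (\<lambda>n. dist (prob (A n)) 0 < e) sequentially"
    using key[of R]
  proof eventually_elim
    case (elim n)
    have "A n \<subseteq> {w \<in> space M. R < norm (T n w)}"
    proof
      fix w assume "w \<in> A n"
      then have "w \<in> space M" "\<not> norm (T n w) \<le> R" using elim(2) sub[of n] by blast+
      then show "w \<in> {w \<in> space M. R < norm (T n w)}" by simp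
    qed
    then have "prob (A n) \<le> prob {w \<in> space M. R < norm (T n w)}" by (intro finite_measure_mono) auto
    then show ?case using elim(1) by (simp add: dist_real_def)
  qed
qed

lemma tight_likely_event:
  fixes T :: "nat \<Rightarrow> 'a \<Rightarrow> 'b::euclidean_space"
  assumes T: "\<And>n. T n \<in> borel_measurable M"
    and tight: "\<And>e. e > 0 \<Longrightarrow> \<exists>R. eventually (\<lambda>n. prob {w \<in> space M. R < norm (T n w)} < e) sequentially"
    and E: "\<And>n. E n \<in> events"
    and key: "\<And>R. eventually (\<lambda>n. \<forall>w\<in>space M. norm (T n w) \<le> R \<longrightarrow> w \<in> E n) sequentially"
  shows "(\<lambda>n. prob (E n)) \<longlonglongrightarrow> 1"
proof -
  have "(\<lambda>n. prob (space M - E n)) \<longlonglongrightarrow> 0"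
  proof (rule tight_rare_event[OF T tight])
    show "eventually (\<lambda>n. \<forall>w\<in>space M. norm (T n w) \<le> R \<longrightarrow> w \<notin> space M - E n) sequentially" for R
      using key[of R] by eventually_elim auto
  qed auto
  from tendsto_diff[OF tendsto_const[of 1] this] show ?thesis by (simp add: prob_compl[OF E])
qed

lemma conv_in_prob_on_of_tight:
  fixes T :: "nat \<Rightarrow> 'a \<Rightarrow> 'b::euclidean_space" and X :: "nat \<Rightarrow> 'a \<Rightarrow> 'c::metric_space"
  assumes T: "\<And>n. T n \<in> borel_measurable M"
    and tight: "\<And>e. e > 0 \<Longrightarrow> \<exists>R. eventually (\<lambda>n. prob {w \<in> space M. R < norm (T n w)} < e) sequentially"
    and E: "\<And>n. E n \<in> events" and X: "\<And>n. X n \<in> borel_measurable (restrict_space M (E n))"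
    and key: "\<And>R \<epsilon>. 0 < \<epsilon> \<Longrightarrow> eventually (\<lambda>n. \<forall>w\<in>space M. norm (T n w) \<le> R \<longrightarrow> w \<in> E n \<and> dist (X n w) x < \<epsilon>) sequentially"
  shows "conv_in_prob_on M E X x"
  unfolding conv_in_prob_on_def
proof (intro conjI allI impI E X)
  show "(\<lambda>n. prob (E n)) \<longlonglongrightarrow> 1"
  proof (rule tight_likely_event[OF T tight E])
    show "eventually (\<lambda>n. \<forall>w\<in>space M. norm (T n w) \<le> R \<longrightarrow> w \<in> E n) sequentially" for R
      using key[OF zero_less_one, of R] by (rule eventually_mono) auto
  qed
  fix \<epsilon> :: real assume "0 < \<epsilon>"
  show "(\<lambda>n. prob {w \<in> E n. dist (X n w) x \<ge> \<epsilon>}) \<longlonglongrightarrow> 0"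
  proof (rule tight_rare_event[OF T tight])
    show "{w \<in> E n. dist (X n w) x \<ge> \<epsilon>} \<subseteq> space M" for n using sets.sets_into_space[OF E[of n]] by auto
    show "eventually (\<lambda>n. \<forall>w\<in>space M. norm (T n w) \<le> R \<longrightarrow> w \<notin> {w \<in> E n. dist (X n w) x \<ge> \<epsilon>}) sequentially" for R
      using key[OF \<open>0 < \<epsilon>\<close>, of R] by eventually_elim force
  qed
qed

text \<open>Where \<open>T\<close> is bounded by \<open>R\<close>, \<open>X\<close> is close to
  \<open>Q T\<close> uniformly; elsewhere two characteristic exponentials differ by at most 2, on an
  event of small probability. Hence \<open>X\<close> inherits tightness and the limit of the
  characteristic functions, and the multivariate continuity theorem applies.\<close>

lemma conv_in_distr_on_of_linearization:
  fixes T :: "nat \<Rightarrow> 'a \<Rightarrow> real^'k" and X :: "nat \<Rightarrow> 'a \<Rightarrow> real^'l" and Q :: "real^'k^'l"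
  assumes T[measurable]: "\<And>n. T n \<in> borel_measurable M"
    and tight: "\<And>e. e > 0 \<Longrightarrow> \<exists>R. eventually (\<lambda>n. prob {w \<in> space M. R < norm (T n w)} < e) sequentially"
    and E[measurable]: "\<And>n. E n \<in> events" and X: "\<And>n. X n \<in> borel_measurable (restrict_space M (E n))"
    and key: "\<And>R \<epsilon>. 0 < \<epsilon> \<Longrightarrow> eventually (\<lambda>n. \<forall>w\<in>space M. norm (T n w) \<le> R \<longrightarrow> w \<in> E n \<and> norm (X n w - Q *v T n w) < \<epsilon>) sequentially"
    and char: "\<And>v. (\<lambda>n. CLINT w|M. iexp (v \<bullet> T n w)) \<longlonglongrightarrow> complex_of_real (exp (- (v \<bullet> (S *v v)) / 2))"
  shows "\<exists>\<mu>. is_mvnormal \<mu> (Q ** S ** transpose Q) \<and> conv_in_distr_on M E X \<mu>"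
proof -
  \<comment> \<open>Nothing is known about \<open>X\<close> outside \<open>E\<close>. Setting it to
    0 there gives variables on the whole space, and changes the integral of \<open>f\<close> by
    \<open>(1 - prob (E n)) * f 0\<close>, which tends to 0.\<close>
  define Z where "Z n w = indicator (E n) w *\<^sub>R X n w" for n w
  have Z[measurable]: "Z n \<in> borel_measurable M" for n
    using X[of n] unfolding Z_def[abs_def] by (subst (asm) borel_measurable_restrict_space_iff) auto
  have PE: "(\<lambda>n. prob (E n)) \<longlonglongrightarrow> 1"
  proof (rule tight_likely_event[OF T tight E])
    show "eventually (\<lambda>n. \<forall>w\<in>space M. norm (T n w) \<le> R \<longrightarrow> w \<in> E n) sequentially" for R
      using key[OF zero_less_one, of R] by (rule eventually_mono) auto
  qed
  have keyZ: "eventually (\<lambda>n. \<forall>w\<in>space M. norm (T n w) \<le> R \<longrightarrow> norm (Z n w - Q *v T n w) < \<epsilon>) sequentially"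
    if "0 < \<epsilon>" for R \<epsilon> using key[OF that, of R] by eventually_elim (auto simp: Z_def)
  have iexpI: "complex_integrable M (\<lambda>w. iexp (Y w))" if [measurable]: "Y \<in> borel_measurable M" for Y
    by (rule integrable_const_bound[of _ 1]) auto
  \<comment> \<open>Limits of characteristic functions have modulus at most 1, so the Gaussian
    exponent cannot be positive.\<close>
  have psd: "0 \<le> v \<bullet> (S *v v)" for v
  proof -
    have "norm (complex_of_real (exp (- (v \<bullet> (S *v v)) / 2))) \<le> 1"
    proof (rule Lim_norm_ubound[OF _ char])
      have "norm (CLINT w|M. iexp (v \<bullet> T n w)) \<le> (LINT w|M. 1)" for n
        by (rule norm_integral_le) (auto intro!: iexpI)
      then show "eventually (\<lambda>n. norm (CLINT w|M. iexp (v \<bullet> T n w)) \<le> 1) sequentially" by (simp add: prob_space)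
    qed simp
    then show ?thesis by simp
  qed
  have QS: "u \<bullet> ((Q ** S ** transpose Q) *v u) = (transpose Q *v u) \<bullet> (S *v (transpose Q *v u))" for u
    by (simp add: matrix_vector_mul_assoc[symmetric] dot_lmul_matrix[symmetric])
  have uQ: "u \<bullet> (Q *v t) = (transpose Q *v u) \<bullet> t" for u t
    by (simp add: dot_lmul_matrix)
  obtain \<mu> where \<mu>: "is_mvnormal \<mu> (Q ** S ** transpose Q)"
      "\<And>u. (CLINT x|\<mu>. iexp (u \<bullet> x)) = complex_of_real (exp (- (u \<bullet> ((Q ** S ** transpose Q) *v u)) / 2))"
    using exists_mvnormal[of "Q ** S ** transpose Q"] psd unfolding QS by blast
  have \<mu>p: "prob_space \<mu>" "sets \<mu> = sets borel" using \<mu>(1) by (auto simp: is_mvnormal_def)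
  have charZ: "(\<lambda>n. CLINT w|M. iexp (u \<bullet> Z n w)) \<longlonglongrightarrow> (CLINT x|\<mu>. iexp (u \<bullet> x))" for u
  proof -
    define v where "v = transpose Q *v u"
    have "(\<lambda>n. (CLINT w|M. iexp (u \<bullet> Z n w)) - (CLINT w|M. iexp (v \<bullet> T n w))) \<longlonglongrightarrow> 0"
    proof (rule tendstoI)
      fix e :: real assume e: "0 < e"
      define \<eta> where "\<eta> = (e / 2) / (norm u + 1)"
      have \<eta>: "0 < \<eta>" "norm u * \<eta> \<le> e / 2"
      proof -
        have pos: "0 < norm u + 1" by (simp add: add_nonneg_pos)
        show "0 < \<eta>" using e pos by (simp add: \<eta>_def)
        moreover have "norm u + 1 \<noteq> 0" using pos by simp
        then have "\<eta> * (norm u + 1) = e / 2" using nonzero_eq_divide_eq[of "norm u + 1" \<eta> "e / 2"] \<eta>_def by blast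
        ultimately show "norm u * \<eta> \<le> e / 2" by (simp add: algebra_simps)
      qed
      obtain R where "eventually (\<lambda>n. prob {w \<in> space M. R < norm (T n w)} < e / 4) sequentially"
        using tight[of "e / 4"] e by auto
      then show "eventually (\<lambda>n. dist ((CLINT w|M. iexp (u \<bullet> Z n w)) - (CLINT w|M. iexp (v \<bullet> T n w))) 0 < e) sequentially"
        using keyZ[OF \<eta>(1), of R]
      proof eventually_elim
        case (elim n)
        let ?A = "{w \<in> space M. R < norm (T n w)}"
        have A: "?A \<in> events" by measurable
        have iA: "integrable M (indicat_real ?A)"
          using A by (intro integrable_real_indicator) (auto simp: emeasure_eq_measure)
        have "?A \<inter> space M = ?A" by auto
        then have EA: "expectation (indicat_real ?A) = prob ?A" using A by simp
        have i: "integrable M (\<lambda>w. iexp (u \<bullet> Z n w))" "integrable M (\<lambda>w. iexp (v \<bullet> T n w))"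
          by (auto intro!: iexpI)
        have "cmod ((CLINT w|M. iexp (u \<bullet> Z n w)) - (CLINT w|M. iexp (v \<bullet> T n w))) =
            cmod (CLINT w|M. iexp (u \<bullet> Z n w) - iexp (v \<bullet> T n w))"
          using i by simp
        also have "\<dots> \<le> (LINT w|M. cmod (iexp (u \<bullet> Z n w) - iexp (v \<bullet> T n w)))"
          by (rule integral_norm_bound)
        also have "\<dots> \<le> (LINT w|M. norm u * \<eta> + 2 * indicator ?A w)"
        proof (rule integral_mono)
          show "integrable M (\<lambda>w. cmod (iexp (u \<bullet> Z n w) - iexp (v \<bullet> T n w)))"
            by (intro integrable_norm Bochner_Integration.integrable_diff i)
          show "integrable M (\<lambda>w. norm u * \<eta> + 2 * indicator ?A w)" using iA by simp
          fix w assume w: "w \<in> space M"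
          show "cmod (iexp (u \<bullet> Z n w) - iexp (v \<bullet> T n w)) \<le> norm u * \<eta> + 2 * indicator ?A w"
          proof (cases "R < norm (T n w)")
            case True
            have "cmod (iexp (u \<bullet> Z n w) - iexp (v \<bullet> T n w)) \<le> 2"
              using norm_triangle_ineq4[of "iexp (u \<bullet> Z n w)" "iexp (v \<bullet> T n w)"] by simp
            then show ?thesis using True w \<eta>(1) by (simp add: add_increasing)
          next
            case False
            have "cmod (iexp (u \<bullet> Z n w) - iexp (v \<bullet> T n w)) \<le> \<bar>u \<bullet> Z n w - v \<bullet> T n w\<bar>" by (rule cmod_iexp_diff_le)
            also have "\<dots> = \<bar>u \<bullet> (Z n w - Q *v T n w)\<bar>" by (simp add: inner_diff_right uQ v_def)
            also have "\<dots> \<le> norm u * norm (Z n w - Q *v T n w)" by (rule Cauchy_Schwarz_ineq2)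
            also have "\<dots> \<le> norm u * \<eta>" using elim(2) w False by (intro mult_left_mono) auto
            finally show ?thesis using False by simp
          qed
        qed
        also have "\<dots> = norm u * \<eta> + 2 * prob ?A" using iA EA by (simp add: prob_space)
        also have "\<dots> < e" using elim(1) \<eta>(2) by simp
        finally show ?case by (simp add: dist_norm)
      qed
    qed
    from tendsto_add[OF this char[of v]] show ?thesis by (simp add: \<mu>(2) QS v_def)
  qed
  have tightZ: "\<exists>r>0. eventually (\<lambda>n. prob {w \<in> space M. r < norm (Z n w)} < e) sequentially" if e: "e > 0" for e
  proof -
    obtain R where R: "eventually (\<lambda>n. prob {w \<in> space M. R < norm (T n w)} < e) sequentially" using tight[OF e] by blast
    obtain C where C: "0 \<le> C" "\<And>t. norm (Q *v t) \<le> norm t * C"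
      using bounded_linear.nonneg_bounded[OF matrix_vector_mul_bounded_linear[of Q]] by blast
    have "eventually (\<lambda>n. \<forall>w\<in>space M. norm (T n w) \<le> R \<longrightarrow> norm (Z n w - Q *v T n w) < 1) sequentially"
      by (rule keyZ) simp
    with R have "eventually (\<lambda>n. prob {w \<in> space M. \<bar>R\<bar> * C + 1 < norm (Z n w)} < e) sequentially"
    proof eventually_elim
      case (elim n)
      have "{w \<in> space M. \<bar>R\<bar> * C + 1 < norm (Z n w)} \<subseteq> {w \<in> space M. R < norm (T n w)}"
      proof safe
        fix w assume w: "w \<in> space M" "\<bar>R\<bar> * C + 1 < norm (Z n w)"
        show "R < norm (T n w)"
        proof (rule ccontr)
          assume "\<not> R < norm (T n w)"
          then have R: "norm (T n w) \<le> R" by simp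
          have "norm (Z n w) \<le> norm (Z n w - Q *v T n w) + norm (Q *v T n w)"
            using norm_triangle_ineq[of "Z n w - Q *v T n w" "Q *v T n w"] by simp
          also have "\<dots> \<le> 1 + \<bar>R\<bar> * C"
          proof (rule add_mono)
            show "norm (Z n w - Q *v T n w) \<le> 1" using elim(2) w(1) R by force
            have "norm (T n w) * C \<le> \<bar>R\<bar> * C" using R C(1) by (intro mult_right_mono) auto
            then show "norm (Q *v T n w) \<le> \<bar>R\<bar> * C" using C(2)[of "T n w"] by linarith
          qed
          finally show False using w(2) by simp
        qed
      qed
      then have "prob {w \<in> space M. \<bar>R\<bar> * C + 1 < norm (Z n w)} \<le> prob {w \<in> space M. R < norm (T n w)}"
        by (intro finite_measure_mono) auto
      then show ?case using elim(1) by simp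
    qed
    then show ?thesis using C(1) by (intro exI[of _ "\<bar>R\<bar> * C + 1"]) (auto intro: add_nonneg_pos)
  qed
  have "conv_in_distr_on M E X \<mu>"
    unfolding conv_in_distr_on_def
  proof (intro conjI allI impI E X PE)
    fix f :: "real^'l \<Rightarrow> real" assume f: "continuous_on UNIV f \<and> bounded (range f)"
    then obtain b where b: "\<And>x. \<bar>f x\<bar> \<le> b" by (auto simp: bounded_iff)
    have [measurable]: "f \<in> borel_measurable borel" using f by (auto intro: borel_measurable_continuous_onI)
    have "(\<lambda>n. LINT w|M. f (Z n w)) \<longlonglongrightarrow> (LINT x|\<mu>. f x)"
      using f by (intro levy_continuity_multi[OF prob_space_axioms \<mu>p Z charZ tightZ]) auto
    from tendsto_diff[OF this tendsto_mult[OF tendsto_diff[OF tendsto_const[of 1] PE] tendsto_const[of "f 0"]]]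
    have "(\<lambda>n. (LINT w|M. f (Z n w)) - (1 - prob (E n)) * f 0) \<longlonglongrightarrow> (LINT x|\<mu>. f x)" by simp
    moreover have "(LINT w:E n|M. f (X n w)) = (LINT w|M. f (Z n w)) - (1 - prob (E n)) * f 0" for n
    proof -
      have "(LINT w:E n|M. f (X n w)) = (LINT w|M. f (Z n w) - (1 - indicator (E n) w) * f 0)"
        unfolding set_lebesgue_integral_def
        by (rule Bochner_Integration.integral_cong) (auto simp: Z_def indicator_def)
      moreover have "integrable M (\<lambda>w. f (Z n w))"
        by (rule integrable_const_bound[of _ b]) (use b in auto)
      moreover have "integrable M (indicat_real (E n))"
        using E[of n] by (intro integrable_real_indicator) (auto simp: emeasure_eq_measure)
      moreover have "expectation (indicat_real (E n)) = prob (E n)"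
        using sets.Int_space_eq2[OF E[of n]] by simp
      ultimately show ?thesis by (simp add: prob_space left_diff_distrib)
    qed
    ultimately show "(\<lambda>n. LINT w:E n|M. f (X n w)) \<longlonglongrightarrow> (LINT x|\<mu>. f x)" by simp
  qed
  then show ?thesis using \<mu>(1) by blast
qed

end

section \<open>The asymptotic covariance\<close>

text \<open>Isserlis' formula for four variables: of the three pairings, the centering removes the
  one that pairs within each product.\<close>

lemma (in gaussian_space) cov_products:
  assumes X: "X \<in> G" and Y: "Y \<in> G" and Z: "Z \<in> G" and W: "W \<in> G"
  shows "expectation (\<lambda>w. (X w * Y w - cov X Y) * (Z w * W w - cov Z W)) = cov X Z * cov Y W + cov X W * cov Y Z"
proof -
  have "wick X (\<lambda>w. Z w * W w * Y w) (\<lambda>w. (cov X Z * W w + Z w * cov X W) * Y w + Z w * W w * cov X Y)"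
    by (rule wick_mult[OF wick_mult[OF wick_mem[OF Z] W] Y])
  from wick_expectation[OF this X]
  have "expectation (\<lambda>w. X w * (Z w * W w * Y w)) =
    expectation (\<lambda>w. (cov X Z * W w + Z w * cov X W) * Y w + Z w * W w * cov X Y)" .
  also have "\<dots> = expectation (\<lambda>w. cov X Z * (Y w * W w) + cov X W * (Y w * Z w) + cov X Y * (Z w * W w))"
    by (simp add: algebra_simps)
  finally have 4: "expectation (\<lambda>w. X w * Y w * (Z w * W w)) =
      expectation (\<lambda>w. cov X Z * (Y w * W w) + cov X W * (Y w * Z w) + cov X Y * (Z w * W w))"
    by (simp add: mult_ac)
  note am = am_mem[OF X] am_mem[OF Y] am_mem[OF Z] am_mem[OF W]
  have i: "integrable M (\<lambda>w. X w * Y w * (Z w * W w))" "integrable M (\<lambda>w. X w * Y w)" "integrable M (\<lambda>w. Z w * W w)"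
    "integrable M (\<lambda>w. Y w * W w)" "integrable M (\<lambda>w. Y w * Z w)"
    using am by (auto intro!: all_moments_integrable all_moments_mult)
  have "expectation (\<lambda>w. (X w * Y w - cov X Y) * (Z w * W w - cov Z W)) =
      expectation (\<lambda>w. X w * Y w * (Z w * W w) - cov Z W * (X w * Y w) - cov X Y * (Z w * W w) + cov X Y * cov Z W)"
    by (rule Bochner_Integration.integral_cong) (auto simp: algebra_simps)
  also have "\<dots> = cov X Z * cov Y W + cov X W * cov Y Z"
    using i 4 by (simp add: prob_space)
  finally show ?thesis .
qed

lemma inverse_quadratic_summable: "(\<lambda>z::int. 1 / (1 + (of_int z)\<^sup>2) :: real) summable_on UNIV"
proof -
  define f where "f z = (1 / (1 + (of_int z)\<^sup>2) :: real)" for z :: int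
  have s: "summable (\<lambda>n. inverse ((real n)\<^sup>2))" using inverse_power_summable[of 2] by simp
  have "summable (\<lambda>n. inverse ((real (Suc n))\<^sup>2))" using s by (subst summable_Suc_iff)
  then have s': "summable (\<lambda>n. 1 / (1 + (real n)\<^sup>2) * 2)"
  proof -
    assume a: "summable (\<lambda>n. inverse ((real (Suc n))\<^sup>2))"
    have "1 / (1 + (real n)\<^sup>2) * 2 \<le> 4 * inverse ((real (Suc n))\<^sup>2)" for n
    proof -
      \<comment> \<open>The difference of the two sides is the square of
        \<open>n - 1\<close>.\<close>
      have "(real (Suc n))\<^sup>2 \<le> 2 * (1 + (real n)\<^sup>2)"
        using zero_le_power2[of "real n - 1"] by (simp add: power2_eq_square algebra_simps)
      then show ?thesis by (simp add: divide_simps add_pos_nonneg)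
    qed
    then show ?thesis
      by (intro summable_comparison_test[OF _ summable_mult[OF a, of 4]] exI[of _ 0]) (auto simp: add_nonneg_nonneg)
  qed
  then have "summable (\<lambda>n. f (int n))" using summable_mult_D[of 2 "\<lambda>n. 1 / (1 + (real n)\<^sup>2)"] by (simp add: f_def mult.commute)
  then have n: "(\<lambda>n. f (int n)) summable_on UNIV"
    by (subst summable_on_UNIV_nonneg_real_iff) (auto simp: f_def)
  then have 1: "f summable_on (range int)"
    by (subst summable_on_reindex) (auto simp: comp_def)
  have n0: "(\<lambda>n. f (int n)) summable_on {0<..}" using n by (rule summable_on_subset_banach) simp
  have 2: "f summable_on ((\<lambda>n. - int n) ` {0<..})"
    using n0 by (subst summable_on_reindex) (auto simp: comp_def f_def inj_on_def)
  have "range int \<union> (\<lambda>n. - int n) ` {0<..} = UNIV"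
  proof -
    have "z \<in> range int \<union> (\<lambda>n. - int n) ` {0<..}" for z
    proof (cases "0 \<le> z")
      case True
      then have "z = int (nat z)" by simp
      then show ?thesis by blast
    next
      case False
      then have "z = - int (nat (- z))" "nat (- z) \<in> {0<..}" by auto
      then show ?thesis by blast
    qed
    then show ?thesis by blast
  qed
  moreover have "f summable_on (range int \<union> (\<lambda>n. - int n) ` {0<..})"
    by (rule summable_on_Un_disjoint[OF 1 2]) auto
  ultimately have "f summable_on UNIV" by simp
  then show ?thesis by (simp only: f_def[abs_def])
qed

lemma summable_on_finite_sum:
  fixes f :: "'i \<Rightarrow> 'z \<Rightarrow> real"
  shows "(\<And>i. i \<in> I \<Longrightarrow> f i summable_on A) \<Longrightarrow> (\<lambda>z. \<Sum>i\<in>I. f i z) summable_on A"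
  by (induction I rule: infinite_finite_induct) (auto intro: summable_on_add)

lemma infsum_finite_sum:
  fixes f :: "'i \<Rightarrow> 'z \<Rightarrow> real"
  shows "(\<And>i. i \<in> I \<Longrightarrow> f i summable_on A) \<Longrightarrow> (\<Sum>i\<in>I. infsum (f i) A) = infsum (\<lambda>z. \<Sum>i\<in>I. f i z) A"
proof (induction I rule: infinite_finite_induct)
  case (insert i I)
  have "(\<lambda>z. \<Sum>i\<in>I. f i z) summable_on A" by (rule summable_on_finite_sum) (use insert in auto)
  then show ?case using insert by (simp add: infsum_add)
qed auto

definition ix :: "3 \<Rightarrow> 2" where "ix r = fst (vecS_index r)"

definition iy :: "3 \<Rightarrow> 2" where "iy r = snd (vecS_index r)"

lemma vec_index_simps [simp]: "ix 1 = 1" "ix 2 = 1" "ix 3 = 2" "iy 1 = 1" "iy 2 = 2" "iy 3 = 2"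
  by (simp_all add: ix_def iy_def vecS_index_def)

text \<open>\<open>P_cal\<close> is the symmetric square of the inverse of \<open>P\<close>, that
  is, the matrix of the congruence \<open>S -> P^(-1) S P^(-T)\<close> in the coordinates vec_S; its
  factors 2 stand for the two off-diagonal entries. The covariance of products in the sense of
  Isserlis is compatible with it, a polynomial identity checked for all nine index pairs.\<close>

lemma P_cal_congruence:
  fixes \<Omega> P :: "real^2^2"
  defines "N a b \<equiv> (\<Sum>i\<in>UNIV. \<Sum>k\<in>UNIV. matrix_inv P $ a $ i * matrix_inv P $ b $ k * \<Omega> $ i $ k)"
  shows "(\<Sum>r'\<in>UNIV. \<Sum>s'\<in>UNIV. P_cal P $ r $ r' * P_cal P $ s $ s' *
      (\<Omega> $ ix r' $ ix s' * \<Omega> $ iy r' $ iy s' + \<Omega> $ ix r' $ iy s' * \<Omega> $ iy r' $ ix s')) =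
    N (ix r) (ix s) * N (iy r) (iy s) + N (ix r) (iy s) * N (iy r) (ix s)"
proof -
  let ?p = "matrix_inv P"
  define p11 p12 p21 p22 where "p11 = ?p $ 1 $ 1" and "p12 = ?p $ 1 $ 2" and "p21 = ?p $ 2 $ 1" and "p22 = ?p $ 2 $ 2"
  define o11 o12 o21 o22 where "o11 = \<Omega> $ 1 $ 1" and "o12 = \<Omega> $ 1 $ 2" and "o21 = \<Omega> $ 2 $ 1" and "o22 = \<Omega> $ 2 $ 2"
  have "\<forall>r s. (\<Sum>r'\<in>UNIV. \<Sum>s'\<in>UNIV. P_cal P $ r $ r' * P_cal P $ s $ s' *
      (\<Omega> $ ix r' $ ix s' * \<Omega> $ iy r' $ iy s' + \<Omega> $ ix r' $ iy s' * \<Omega> $ iy r' $ ix s')) =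
    N (ix r) (ix s) * N (iy r) (iy s) + N (ix r) (iy s) * N (iy r) (ix s)"
    unfolding forall_3 sum_3 N_def sum_2 P_cal_def Let_def vector_3 vec_index_simps
      p11_def[symmetric] p12_def[symmetric] p21_def[symmetric] p22_def[symmetric]
      o11_def[symmetric] o12_def[symmetric] o21_def[symmetric] o22_def[symmetric]
    by (intro conjI; algebra)
  then show ?thesis by blast
qed

context ofbm_wavelet
begin

lemma cc_decay: "\<exists>C\<ge>0. \<forall>i l y. \<bar>cc i l j j' y\<bar> \<le> C / (1 + y\<^sup>2)"
proof -
  have "\<forall>p. \<exists>C\<ge>0. \<forall>y. \<bar>cc (fst p) (snd p) j j' y\<bar> \<le> C / (1 + y\<^sup>2)"
  proof
    fix p :: "2 \<times> 2"
    let ?c = "\<bar>\<Gamma> $ fst p $ snd p * K (fst p) (snd p)\<bar>"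
    obtain C where C: "0 \<le> C" "\<And>y. \<bar>J (\<eta> (fst p) (snd p)) j j' y\<bar> \<le> C / (1 + y\<^sup>2)"
      using J_decay[OF \<eta>_bounds] by blast
    have "\<bar>cc (fst p) (snd p) j j' y\<bar> \<le> ?c * C / (1 + y\<^sup>2)" for y
      unfolding cc_def abs_minus_cancel abs_mult[of "_ * _" "J _ _ _ _"] times_divide_eq_right[symmetric]
      by (intro mult_left_mono C) simp
    then show "\<exists>C\<ge>0. \<forall>y. \<bar>cc (fst p) (snd p) j j' y\<bar> \<le> C / (1 + y\<^sup>2)"
      using C(1) by (intro exI[of _ "?c * C"]) simp
  qed
  then obtain C where C: "\<And>p. 0 \<le> C p" "\<And>p y. \<bar>cc (fst p) (snd p) j j' y\<bar> \<le> C p / (1 + y\<^sup>2)" by metis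
  have "\<bar>cc i l j j' y\<bar> \<le> (\<Sum>p\<in>UNIV. C p) / (1 + y\<^sup>2)" for i l y
  proof -
    have "C (i, l) \<le> (\<Sum>p\<in>UNIV. C p)" by (rule member_le_sum) (auto intro: C)
    then have "C (i, l) / (1 + y\<^sup>2) \<le> (\<Sum>p\<in>UNIV. C p) / (1 + y\<^sup>2)" by (intro divide_right_mono) auto
    then show ?thesis using C(2)[of "(i, l)" y] by simp
  qed
  then show ?thesis by (intro exI[of _ "\<Sum>p\<in>UNIV. C p"]) (auto intro: sum_nonneg C)
qed

lemma cc_prod_summable:
  assumes g: "1 \<le> g"
  shows "(\<lambda>z::int. norm (cc i l j j' (of_int z * g) * cc i' l' j j' (of_int z * g))) summable_on UNIV"
proof -
  obtain C where C: "0 \<le> C" "\<And>i l y. \<bar>cc i l j j' y\<bar> \<le> C / (1 + y\<^sup>2)" using cc_decay by blast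
  have b: "\<bar>cc i l j j' (of_int z * g)\<bar> \<le> C / (1 + (of_int z)\<^sup>2)" for i l and z :: int
  proof -
    have "\<bar>of_int z :: real\<bar> * 1 \<le> \<bar>of_int z\<bar> * g" using g by (intro mult_left_mono) auto
    then have "(of_int z)\<^sup>2 \<le> (of_int z * g)\<^sup>2" unfolding abs_le_square_iff[symmetric] using g by (simp add: abs_mult)
    then have "C / (1 + (of_int z * g)\<^sup>2) \<le> C / (1 + (of_int z)\<^sup>2)"
      using C(1) by (intro divide_left_mono) (auto intro!: mult_pos_pos add_pos_nonneg)
    then show ?thesis using C(2)[of i l "of_int z * g"] by linarith
  qed
  show ?thesis
  proof (rule summable_on_comparison_test)
    show "(\<lambda>z::int. C\<^sup>2 * (1 / (1 + (of_int z)\<^sup>2))) summable_on UNIV"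
      by (intro summable_on_cmult_right inverse_quadratic_summable)
    fix z :: int
    let ?q = "1 / (1 + (of_int z)\<^sup>2) :: real"
    have "0 < 1 + (of_int z :: real)\<^sup>2" by (simp add: add_pos_nonneg)
    then have q: "0 \<le> ?q" "?q \<le> 1" by (simp_all add: divide_le_eq)
    have "norm (cc i l j j' (of_int z * g) * cc i' l' j j' (of_int z * g)) \<le> (C * ?q) * (C * ?q)"
      unfolding real_norm_def abs_mult using b[of i l z] b[of i' l' z] C(1) q(1) by (intro mult_mono) auto
    also have "\<dots> = C\<^sup>2 * (?q * ?q)" by (simp add: power2_eq_square)
    also have "\<dots> \<le> C\<^sup>2 * ?q" using q mult_left_mono[OF q(2) q(1)] by (intro mult_left_mono) simp_all
    finally show "norm (cc i l j j' (of_int z * g) * cc i' l' j j' (of_int z * g)) \<le> C\<^sup>2 * ?q" .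
  qed simp
qed

lemma mat_powr_H:
  assumes "0 \<le> c"
  shows "mat_powr c H = P ** diag2 (c powr h\<^sub>1) (c powr h\<^sub>2) ** Pinv"
    "mat_powr c (transpose H) = transpose Pinv ** diag2 (c powr h\<^sub>1) (c powr h\<^sub>2) ** transpose P"
proof -
  have HP: "H = P ** diag2 h\<^sub>1 h\<^sub>2 ** Pinv" using H by (simp add: Pinv_def)
  have tr: "transpose (diag2 x y) = diag2 x y" for x y by (simp add: vec_eq_iff transpose_def diag2_nth)
  have HT: "transpose H = transpose Pinv ** diag2 h\<^sub>1 h\<^sub>2 ** transpose P"
    unfolding HP by (simp add: matrix_transpose_mul tr matrix_mul_assoc)
  have i: "transpose Pinv ** transpose P = mat 1" "transpose P ** transpose Pinv = mat 1"
    by (simp_all add: matrix_transpose_mul[symmetric] P_Pinv)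
  show "mat_powr c H = P ** diag2 (c powr h\<^sub>1) (c powr h\<^sub>2) ** Pinv"
    unfolding HP by (rule mat_powr_diag2[OF P_Pinv assms])
  show "mat_powr c (transpose H) = transpose Pinv ** diag2 (c powr h\<^sub>1) (c powr h\<^sub>2) ** transpose P"
    unfolding HT by (rule mat_powr_diag2[OF i assms])
qed

text \<open>The change of basis diagonalises the matrix powers, so the integrand is a sum of scalar
  powers with exponents \<open>\<eta> i k\<close>, and the double integrals are values of
  \<open>J\<close>. The factor -1/2 meets the factor 2 of \<open>rr_Sigma\<close>, which leaves
  \<open>cc\<close>.\<close>

lemma Omega_mat_eq:
  "Omega_mat \<psi> H (Sigma_BH M B) j j' z $ a $ b =
    (\<Sum>i\<in>UNIV. \<Sum>k\<in>UNIV. P $ a $ i * P $ b $ k * cc i k j j' (of_int z * real (gcd (2 ^ j) (2 ^ j'))))"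
proof -
  define y where "y = of_int z * real (gcd (2 ^ j) (2 ^ j'))"
  define \<delta> where "\<delta> t t' = \<bar>2 ^ j * t - 2 ^ j' * t' + y\<bar>" for t t'
  define S' where "S' = Pinv ** Sigma_BH M B ** transpose Pinv"
  define E where "E i k = outer (column i P) (column k P)" for i k
  have E: "E i k $ a $ b = P $ a $ i * P $ b $ k" for i k a b by (simp add: E_def outer_def column_def)
  have mp: "mat_powr c H ** Sigma_BH M B ** mat_powr c (transpose H) = (\<Sum>i\<in>UNIV. \<Sum>k\<in>UNIV. (c powr \<eta> i k * S' $ i $ k) *\<^sub>R E i k)"
    if "0 \<le> c" for c
  proof -
    let ?d = "diag2 (c powr h\<^sub>1) (c powr h\<^sub>2)"
    have "mat_powr c H ** Sigma_BH M B ** mat_powr c (transpose H) = P ** (?d ** S' ** ?d) ** transpose P"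
      unfolding mat_powr_H[OF that] S'_def by (simp add: matrix_mul_assoc)
    also have "\<dots> = (\<Sum>i\<in>UNIV. \<Sum>k\<in>UNIV. (c powr \<eta> i k * S' $ i $ k) *\<^sub>R E i k)"
      by (simp add: vec_eq_iff matrix_matrix_mult_def sum_2 forall_2 diag2_nth transpose_def E \<eta>_def powr_add algebra_simps)
    finally show ?thesis .
  qed
  have e: "0 \<le> \<eta> i k" for i k using \<eta>_bounds(1)[of i k] by simp
  have i1: "integrable lborel (\<lambda>t'. \<psi> t' * \<delta> t t' powr \<eta> i k)" for t i k
    using psi_powr_integrable(1)[OF e[of i k], of "- (2 ^ j')" "2 ^ j * t + y"] by (simp add: \<delta>_def algebra_simps)
  define I where "I i k t = (LINT t'|lborel. \<psi> t' * \<delta> t t' powr \<eta> i k)" for i k t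
  have i2: "integrable lborel (\<lambda>t. \<psi> t * I i k t)" for i k
    unfolding I_def \<delta>_def by (rule J_inner_integrable[OF e])
  have inner: "(LINT t'|lborel. (\<psi> t * \<psi> t') *\<^sub>R (mat_powr (\<delta> t t') H ** Sigma_BH M B ** mat_powr (\<delta> t t') (transpose H))) =
      (\<Sum>i\<in>UNIV. \<Sum>k\<in>UNIV. (\<psi> t * I i k t) *\<^sub>R (S' $ i $ k *\<^sub>R E i k))" for t
  proof -
    have "(\<psi> t * \<psi> t') *\<^sub>R (mat_powr (\<delta> t t') H ** Sigma_BH M B ** mat_powr (\<delta> t t') (transpose H)) =
        (\<Sum>i\<in>UNIV. \<Sum>k\<in>UNIV. (\<psi> t' * \<delta> t t' powr \<eta> i k) *\<^sub>R ((\<psi> t * S' $ i $ k) *\<^sub>R E i k))" for t'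
      unfolding mp[of "\<delta> t t'", OF abs_ge_zero[of "2 ^ j * t - 2 ^ j' * t' + y", folded \<delta>_def]]
      by (simp add: scaleR_sum_right mult_ac)
    moreover have "(LINT t'|lborel. (\<Sum>i\<in>UNIV. \<Sum>k\<in>UNIV. (\<psi> t' * \<delta> t t' powr \<eta> i k) *\<^sub>R ((\<psi> t * S' $ i $ k) *\<^sub>R E i k))) =
        (\<Sum>i\<in>UNIV. \<Sum>k\<in>UNIV. I i k t *\<^sub>R ((\<psi> t * S' $ i $ k) *\<^sub>R E i k))"
      by (simp only: Bochner_Integration.integral_sum Bochner_Integration.integrable_sum integrable_scaleR_left i1
          integral_scaleR_left I_def)
    ultimately show ?thesis by (simp add: mult_ac)
  qed
  have "(LINT t|lborel. LINT t'|lborel. (\<psi> t * \<psi> t') *\<^sub>R (mat_powr (\<delta> t t') H ** Sigma_BH M B ** mat_powr (\<delta> t t') (transpose H))) =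
      (\<Sum>i\<in>UNIV. \<Sum>k\<in>UNIV. J (\<eta> i k) j j' y *\<^sub>R (S' $ i $ k *\<^sub>R E i k))"
  proof -
    have "J (\<eta> i k) j j' y = (LINT t|lborel. \<psi> t * I i k t)" for i k by (simp add: J_def I_def \<delta>_def)
    then show ?thesis unfolding inner using i2 by simp
  qed
  then have Om: "Omega_mat \<psi> H (Sigma_BH M B) j j' z =
      (- (1/2)) *\<^sub>R (\<Sum>i\<in>UNIV. \<Sum>k\<in>UNIV. J (\<eta> i k) j j' y *\<^sub>R (S' $ i $ k *\<^sub>R E i k))"
    by (simp add: Omega_mat_def Let_def \<delta>_def y_def)
  show ?thesis
    unfolding Om S'_def rr_Sigma[symmetric]
    by (simp add: E cc_def y_def[symmetric] sum_2 algebra_simps)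
qed

definition cprod :: "3 \<Rightarrow> 3 \<Rightarrow> nat \<Rightarrow> nat \<Rightarrow> real \<Rightarrow> real" where
  "cprod r s j j' y = cc (ix r) (ix s) j j' y * cc (iy r) (iy s) j j' y + cc (ix r) (iy s) j j' y * cc (iy r) (ix s) j j' y"

lemma cprod_summable:
  assumes "1 \<le> g" shows "(\<lambda>z::int. norm (cprod r s j j' (of_int z * g))) summable_on UNIV"
proof (rule summable_on_comparison_test[OF summable_on_add[OF cc_prod_summable[OF assms] cc_prod_summable[OF assms]]])
  show "norm (cprod r s j j' (of_int z * g)) \<le>
      norm (cc (ix r) (ix s) j j' (of_int z * g) * cc (iy r) (iy s) j j' (of_int z * g)) +
      norm (cc (ix r) (iy s) j j' (of_int z * g) * cc (iy r) (ix s) j j' (of_int z * g))" for z :: int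
    unfolding cprod_def by (rule norm_triangle_ineq)
qed simp

text \<open>The congruence is applied at every lag under the sum, where the matrix is
  \<open>P N P^T\<close> with \<open>N\<close> the covariances in the eigenbasis. Quadratic decay
  gives the summability that allows the finite sums to be exchanged with the sum over lags.\<close>

lemma P_cal_G_mat:
  "(\<Sum>r'\<in>UNIV. \<Sum>s'\<in>UNIV. P_cal P $ r $ r' * P_cal P $ s $ s' * G_mat \<psi> H (Sigma_BH M B) j j' $ r' $ s') =
    2 powr (- real (j + j') / 2) * real (gcd (2 ^ j) (2 ^ j')) *
    infsum (\<lambda>z::int. cprod r s j j' (of_int z * real (gcd (2 ^ j) (2 ^ j')))) UNIV"
proof -
  define g where "g = real (gcd (2 ^ j) (2 ^ j'))"
  have "gcd (2 ^ j) (2 ^ j') \<noteq> (0::nat)" by simp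
  then have g: "1 \<le> g" unfolding g_def by linarith
  define \<kappa> where "\<kappa> = 2 powr (- real (j + j') / 2) * g"
  define \<Omega> where "\<Omega> = Omega_mat \<psi> H (Sigma_BH M B) j j'"
  have \<Omega>: "\<Omega> z $ a $ b = (\<Sum>i\<in>UNIV. \<Sum>k\<in>UNIV. P $ a $ i * P $ b $ k * cc i k j j' (of_int z * g))" for z a b
    unfolding \<Omega>_def g_def by (rule Omega_mat_eq)
  have ccs: "(\<lambda>z::int. cc i l j j' (of_int z * g) * cc i' l' j j' (of_int z * g)) summable_on UNIV" for i l i' l'
    by (rule abs_summable_summable[OF cc_prod_summable[OF g]])
  have \<Omega>s: "(\<lambda>z. \<Omega> z $ a $ b * \<Omega> z $ a' $ b') summable_on UNIV" for a b a' b'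
  proof -
    have "\<Omega> z $ a $ b * \<Omega> z $ a' $ b' = (\<Sum>i\<in>UNIV. \<Sum>i'\<in>UNIV. \<Sum>k\<in>UNIV. \<Sum>k'\<in>UNIV.
        (P $ a $ i * P $ b $ k * (P $ a' $ i' * P $ b' $ k')) * (cc i k j j' (of_int z * g) * cc i' k' j j' (of_int z * g)))" for z
      unfolding \<Omega> sum_product by (intro sum.cong refl) (simp add: mult_ac)
    then show ?thesis by (simp only:) (intro summable_on_finite_sum summable_on_cmult_right ccs)
  qed
  define \<Theta> where "\<Theta> r' s' z = \<Omega> z $ ix r' $ ix s' * \<Omega> z $ iy r' $ iy s' + \<Omega> z $ ix r' $ iy s' * \<Omega> z $ iy r' $ ix s'" for r' s' z
  have \<Theta>s: "\<Theta> r' s' summable_on UNIV" for r' s'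
    unfolding \<Theta>_def[abs_def] by (intro summable_on_add \<Omega>s)
  have G: "G_mat \<psi> H (Sigma_BH M B) j j' $ r' $ s' = \<kappa> * infsum (\<Theta> r' s') UNIV" for r' s'
    by (simp add: G_mat_def Let_def case_prod_beta ix_def iy_def \<Theta>_def[abs_def] \<Omega>_def \<kappa>_def g_def)
  have "(\<Sum>r'\<in>UNIV. \<Sum>s'\<in>UNIV. P_cal P $ r $ r' * P_cal P $ s $ s' * G_mat \<psi> H (Sigma_BH M B) j j' $ r' $ s') =
      \<kappa> * (\<Sum>r'\<in>UNIV. \<Sum>s'\<in>UNIV. infsum (\<lambda>z. P_cal P $ r $ r' * P_cal P $ s $ s' * \<Theta> r' s' z) UNIV)"
    unfolding G infsum_cmult_right' sum_distrib_left by (simp add: mult_ac)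
  also have "(\<Sum>r'\<in>UNIV. \<Sum>s'\<in>UNIV. infsum (\<lambda>z. P_cal P $ r $ r' * P_cal P $ s $ s' * \<Theta> r' s' z) UNIV) =
      infsum (\<lambda>z. \<Sum>r'\<in>UNIV. \<Sum>s'\<in>UNIV. P_cal P $ r $ r' * P_cal P $ s $ s' * \<Theta> r' s' z) UNIV"
  proof -
    have "(\<Sum>s'\<in>UNIV. infsum (\<lambda>z. P_cal P $ r $ r' * P_cal P $ s $ s' * \<Theta> r' s' z) UNIV) =
        infsum (\<lambda>z. \<Sum>s'\<in>UNIV. P_cal P $ r $ r' * P_cal P $ s $ s' * \<Theta> r' s' z) UNIV" for r'
      by (rule infsum_finite_sum) (intro summable_on_cmult_right \<Theta>s)
    then have "(\<Sum>r'\<in>UNIV. \<Sum>s'\<in>UNIV. infsum (\<lambda>z. P_cal P $ r $ r' * P_cal P $ s $ s' * \<Theta> r' s' z) UNIV) =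
        (\<Sum>r'\<in>UNIV. infsum (\<lambda>z. \<Sum>s'\<in>UNIV. P_cal P $ r $ r' * P_cal P $ s $ s' * \<Theta> r' s' z) UNIV)"
      by (intro sum.cong refl)
    also have "\<dots> = infsum (\<lambda>z. \<Sum>r'\<in>UNIV. \<Sum>s'\<in>UNIV. P_cal P $ r $ r' * P_cal P $ s $ s' * \<Theta> r' s' z) UNIV"
      by (rule infsum_finite_sum) (intro summable_on_finite_sum summable_on_cmult_right \<Theta>s)
    finally show ?thesis .
  qed
  also have "(\<lambda>z. \<Sum>r'\<in>UNIV. \<Sum>s'\<in>UNIV. P_cal P $ r $ r' * P_cal P $ s $ s' * \<Theta> r' s' z) = (\<lambda>z. cprod r s j j' (of_int z * g))"
  proof
    fix z
    define N where "N = (\<chi> i k. cc i k j j' (of_int z * g))"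
    have "\<Omega> z = P ** N ** transpose P"
      by (simp add: vec_eq_iff \<Omega> N_def matrix_matrix_mult_def transpose_def sum_distrib_right sum_distrib_left mult_ac) (simp add: sum_2 algebra_simps)
    then have "Pinv ** \<Omega> z ** transpose Pinv = (Pinv ** P) ** N ** transpose (Pinv ** P)"
      by (simp add: matrix_transpose_mul matrix_mul_assoc)
    then have N: "Pinv ** \<Omega> z ** transpose Pinv = N" by (simp add: P_Pinv)
    have "(\<Sum>i\<in>UNIV. \<Sum>k\<in>UNIV. matrix_inv P $ a $ i * matrix_inv P $ b $ k * \<Omega> z $ i $ k) = (Pinv ** \<Omega> z ** transpose Pinv) $ a $ b" for a b
      by (simp add: Pinv_def matrix_matrix_mult_def transpose_def sum_2 algebra_simps)
    then have N': "(\<Sum>i\<in>UNIV. \<Sum>k\<in>UNIV. matrix_inv P $ a $ i * matrix_inv P $ b $ k * \<Omega> z $ i $ k) = cc a b j j' (of_int z * g)" for a b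
      unfolding N by (simp add: N_def)
    show "(\<Sum>r'\<in>UNIV. \<Sum>s'\<in>UNIV. P_cal P $ r $ r' * P_cal P $ s $ s' * \<Theta> r' s' z) = cprod r s j j' (of_int z * g)"
      unfolding \<Theta>_def P_cal_congruence N' cprod_def ..
  qed
  finally show ?thesis by (simp add: \<kappa>_def g_def)
qed

end

lemma sum_UNIV_prod: "(\<Sum>u\<in>UNIV. f u) = (\<Sum>p\<in>UNIV. \<Sum>r\<in>UNIV. f (p, r))" for f :: "'m::finite \<times> 'r::finite \<Rightarrow> real"
  by (simp add: sum.cartesian_product)

lemma sum_block_diag: "(\<Sum>v\<in>UNIV. block_diag A $ u $ v * f v) = (\<Sum>r\<in>UNIV. A (fst u) $ snd u $ r * f (fst u, r))"
proof -
  have "(\<Sum>v\<in>UNIV. block_diag A $ u $ v * f v) = (\<Sum>p\<in>UNIV. if fst u = p then (\<Sum>r\<in>UNIV. A (fst u) $ snd u $ r * f (p, r)) else 0)"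
    unfolding sum_UNIV_prod by (rule sum.cong) (auto simp: block_diag_def)
  then show ?thesis by simp
qed

text \<open>Brings the matrix of the theorem into the form of the limit in
  \<open>two_scale_average\<close>, with covariances in the eigenbasis only.\<close>

lemma (in ofbm_wavelet) Sigma_B_nth:
  fixes oct :: "'m::finite \<Rightarrow> nat" and u v :: "'m \<times> 3"
  defines "j \<equiv> oct (fst u)" and "j' \<equiv> oct (fst v)"
  shows "Sigma_B \<psi> P H (Sigma_BH M B) oct $ u $ v = 2 powr (- real (j + j') / 2) * real (gcd (2 ^ j) (2 ^ j')) *
    infsum (\<lambda>z::int. cprod (snd u) (snd v) j j' (of_int z * real (gcd (2 ^ j) (2 ^ j')))) UNIV"
proof -
  let ?A = "block_diag (\<lambda>_::'m. P_cal P)" and ?F = "F_mat \<psi> H (Sigma_BH M B) oct"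
  have "Sigma_B \<psi> P H (Sigma_BH M B) oct $ u $ v = (\<Sum>v'\<in>UNIV. ?A $ v $ v' * (\<Sum>u'\<in>UNIV. ?A $ u $ u' * ?F $ u' $ v'))"
    unfolding Sigma_B_def by (simp add: matrix_matrix_mult_def transpose_def mult.commute)
  also have "\<dots> = (\<Sum>s'\<in>UNIV. P_cal P $ snd v $ s' * (\<Sum>r'\<in>UNIV. P_cal P $ snd u $ r' * G_mat \<psi> H (Sigma_BH M B) j j' $ r' $ s'))"
    unfolding sum_block_diag by (simp add: F_mat_def j_def j'_def)
  also have "\<dots> = (\<Sum>r'\<in>UNIV. \<Sum>s'\<in>UNIV. P_cal P $ snd u $ r' * P_cal P $ snd v $ s' * G_mat \<psi> H (Sigma_BH M B) j j' $ r' $ s')"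
    unfolding sum_distrib_left by (subst sum.swap) (simp add: mult_ac)
  finally show ?thesis unfolding P_cal_G_mat .
qed

section \<open>The central limit theorem for the sample wavelet variance\<close>

lemma sum_of_bool_index:
  fixes v :: "3 \<Rightarrow> real" and Y :: "2 \<Rightarrow> 2 \<Rightarrow> real"
  shows "(\<Sum>i\<in>UNIV. \<Sum>l\<in>UNIV. (\<Sum>r\<in>UNIV. v r * of_bool (i = ix r \<and> l = iy r)) * Y i l) = (\<Sum>r\<in>UNIV. v r * Y (ix r) (iy r))"
  by (simp add: sum_3 sum_2)

text \<open>All sizes are powers of 2 and enter through their exponents: the scale is
  \<open>2 ^ lev\<close>, the sample size will be \<open>2 ^ (lev + m)\<close>, and octave
  \<open>p\<close> has \<open>2 ^ (m - oct p)\<close> coefficients. \<open>oct_le\<close> makes this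
  subtraction exact.\<close>

locale ofbm_clt = ofbm_wavelet N R M B P H A h\<^sub>1 h\<^sub>2 \<psi> N\<^sub>\<psi> \<alpha> D
  for N :: "'v measure" and R :: "real set \<Rightarrow> 'v \<Rightarrow> complex^2" and M :: "'b measure" and B P H A h\<^sub>1 h\<^sub>2 \<psi> N\<^sub>\<psi> \<alpha> D +
  fixes oct :: "'m::finite \<Rightarrow> nat" and lev m :: "nat \<Rightarrow> nat"
  assumes oct_le: "oct p \<le> m n" and m: "filterlim m at_top sequentially"
begin

definition hh :: "2 \<Rightarrow> real" where "hh i = (if i = 1 then h\<^sub>1 else h\<^sub>2)"

definition x :: "nat \<Rightarrow> 'm \<Rightarrow> nat \<Rightarrow> 2 \<Rightarrow> 'b \<Rightarrow> real" where
  "x n p k i w = (2 ^ lev n) powr (- hh i) * d (lev n + oct p) (int k) i w"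

definition Kn :: "nat \<Rightarrow> 'm \<Rightarrow> nat" where "Kn n p = 2 ^ (m n - oct p)"

definition cq :: "'m \<Rightarrow> 'm \<Rightarrow> nat \<Rightarrow> nat \<Rightarrow> 2 \<Rightarrow> 2 \<Rightarrow> real" where
  "cq p q k k' i l = cc i l (oct p) (oct q) (2 ^ oct p * real k - 2 ^ oct q * real k')"

text \<open>Block \<open>p\<close> holds vec_S of the square root of the number of coefficients
  times \<open>V - B\<close>, in the eigenbasis and after rescaling.\<close>

definition T :: "nat \<Rightarrow> 'b \<Rightarrow> real^('m \<times> 3)" where
  "T n w = (\<chi> u. (\<Sum>k=1..Kn n (fst u). x n (fst u) k (ix (snd u)) w * x n (fst u) k (iy (snd u)) w -
     cc (ix (snd u)) (iy (snd u)) (oct (fst u)) (oct (fst u)) 0) / sqrt (real (Kn n (fst u))))"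

lemma x_mem: "x n p k i \<in> G"
  unfolding x_def[abs_def] by (intro scale_mem d_mem)

text \<open>The factor that \<open>J_scale\<close> produces is the scale to the power
  \<open>h_i + h_l\<close>, and the normalisation of the two coefficients removes exactly this. The
  covariance is left as a function of octaves and positions alone.\<close>

lemma cov_x: "expectation (\<lambda>w. x n p k i w * x n q k' l w) = cq p q k k' i l"
proof -
  define a where "a = (2 ^ lev n :: real)"
  have a: "a > 0" by (simp add: a_def)
  have "expectation (\<lambda>w. x n p k i w * x n q k' l w) = a powr (- hh i) * a powr (- hh l) *
      expectation (\<lambda>w. d (lev n + oct p) (int k) i w * d (lev n + oct q) (int k') l w)"
    unfolding x_def a_def[symmetric] by (subst integral_mult_right_zero[symmetric]) (simp add: mult_ac)
  also have "\<dots> = a powr (- hh i) * a powr (- hh l) * cc i l (lev n + oct p) (lev n + oct q) (2 ^ lev n * (2 ^ oct p * real k - 2 ^ oct q * real k'))"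
    unfolding cov_d by (simp add: power_add right_diff_distrib mult.assoc)
  also have "\<dots> = (a powr (- hh i) * a powr (- hh l) * a powr \<eta> i l) * cq p q k k' i l"
  proof -
    have "J (\<eta> i l) (lev n + oct p) (lev n + oct q) (2 ^ lev n * y) = a powr \<eta> i l * J (\<eta> i l) (oct p) (oct q) y" for y
      unfolding a_def by (rule J_scale[OF \<eta>_bounds(1)])
    then show ?thesis unfolding cc_def cq_def by simp
  qed
  also have "a powr (- hh i) * a powr (- hh l) * a powr \<eta> i l = 1"
    using a by (simp add: powr_add[symmetric] hh_def \<eta>_def)
  finally show ?thesis by simp
qed

lemma Kn_pos: "0 < Kn n p" by (simp add: Kn_def)

lemma Kn_mult: "Kn n p * 2 ^ oct p = 2 ^ m n"
  using oct_le[of p n] by (simp add: Kn_def flip: power_add)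

lemma Kn_at_top: "filterlim (\<lambda>n. Kn n p) at_top sequentially"
proof (rule filterlim_at_top_mono)
  show "filterlim (\<lambda>n. m n - oct p) at_top sequentially"
    by (rule filterlim_compose[OF filterlim_minus_const_nat_at_top m])
  show "eventually (\<lambda>n. m n - oct p \<le> Kn n p) sequentially"
    by (rule always_eventually) (simp add: Kn_def less_imp_le less_exp)
qed

lemma am_x: "all_moments M (x n p k i)" by (rule am_mem[OF x_mem])

lemma T_measurable: "T n \<in> borel_measurable M"
proof -
  have [measurable]: "x n p k i \<in> borel_measurable M" for p k i by (rule all_moments_measurable[OF am_x])
  have "(\<lambda>w. T n w $ u) \<in> borel_measurable M" for u unfolding T_def by simp
  then show ?thesis by (subst borel_measurable_euclidean_space) (auto simp: Basis_vec_def inner_axis)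
qed

lemma T_nth_all_moments: "all_moments M (\<lambda>w. T n w $ u)"
proof -
  have "all_moments M (\<lambda>w. (1 / sqrt (real (Kn n (fst u)))) * (\<Sum>k=1..Kn n (fst u). x n (fst u) k (ix (snd u)) w * x n (fst u) k (iy (snd u)) w -
     cc (ix (snd u)) (iy (snd u)) (oct (fst u)) (oct (fst u)) 0))"
    by (intro all_moments_cmult all_moments_sum all_moments_diff all_moments_mult am_x all_moments_const)
  then show ?thesis by (simp add: T_def)
qed

lemma cov_T:
  "expectation (\<lambda>w. T n w $ u * T n w $ v) =
    (\<Sum>k=1..Kn n (fst u). \<Sum>k'=1..Kn n (fst v). cprod (snd u) (snd v) (oct (fst u)) (oct (fst v)) (2 ^ oct (fst u) * real k - 2 ^ oct (fst v) * real k'))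
      / sqrt (real (Kn n (fst u)) * real (Kn n (fst v)))"
proof -
  define p q where "p = fst u" and "q = fst v"
  define Y where "Y p r k w = x n p k (ix r) w * x n p k (iy r) w - cov (x n p k (ix r)) (x n p k (iy r))" for p r k w
  have amY: "all_moments M (Y p r k)" for p r k
    unfolding Y_def[abs_def] by (intro all_moments_diff all_moments_mult am_x all_moments_const)
  have T: "T n w $ u = (\<Sum>k=1..Kn n (fst u). Y (fst u) (snd u) k w) / sqrt (real (Kn n (fst u)))" for u w
    by (simp add: T_def Y_def cov_x cq_def)
  have YY: "expectation (\<lambda>w. Y p r k w * Y q s k' w) = cprod r s (oct p) (oct q) (2 ^ oct p * real k - 2 ^ oct q * real k')" for p q r s k k'
    unfolding Y_def cov_products[OF x_mem x_mem x_mem x_mem] unfolding cov_x cprod_def cq_def by simp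
  have int: "integrable M (\<lambda>w. Y p r k w * Y q s k' w)" for p q r s k k'
    by (intro all_moments_integrable all_moments_mult amY)
  have "expectation (\<lambda>w. T n w $ u * T n w $ v) =
      expectation (\<lambda>w. (\<Sum>k=1..Kn n p. \<Sum>k'=1..Kn n q. Y p (snd u) k w * Y q (snd v) k' w) * (1 / sqrt (real (Kn n p) * real (Kn n q))))"
    unfolding T p_def[symmetric] q_def[symmetric] sum_product[symmetric] by (simp add: real_sqrt_mult)
  also have "\<dots> = (\<Sum>k=1..Kn n p. \<Sum>k'=1..Kn n q. expectation (\<lambda>w. Y p (snd u) k w * Y q (snd v) k' w)) * (1 / sqrt (real (Kn n p) * real (Kn n q)))"
    using int by simp
  finally show ?thesis unfolding YY by (simp add: p_def q_def)
qed

lemma cov_T_tendsto: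
  "(\<lambda>n. expectation (\<lambda>w. T n w $ u * T n w $ v)) \<longlonglongrightarrow> Sigma_B \<psi> P H (Sigma_BH M B) oct $ u $ v"
  unfolding cov_T Sigma_B_nth
proof (rule two_scale_average)
  show "(\<lambda>z::int. norm (cprod (snd u) (snd v) (oct (fst u)) (oct (fst v)) (of_int z))) summable_on UNIV"
    using cprod_summable[of 1] by simp
  show "eventually (\<lambda>n. Kn n (fst u) * 2 ^ oct (fst u) = Kn n (fst v) * 2 ^ oct (fst v)) sequentially"
    by (simp add: Kn_mult)
qed (rule Kn_at_top)+

lemma T_tight:
  assumes e: "0 < e"
  shows "\<exists>r. eventually (\<lambda>n. prob {w \<in> space M. r < norm (T n w)} < e) sequentially"
proof -
  have i: "integrable M (\<lambda>w. T n w $ u * T n w $ u)" for n u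
    by (intro all_moments_integrable all_moments_mult T_nth_all_moments)
  have n2: "(norm (T n w))\<^sup>2 = (\<Sum>u\<in>UNIV. T n w $ u * T n w $ u)" for n w
    by (simp add: power2_norm_eq_inner inner_vec_def)
  have in2: "integrable M (\<lambda>w. (norm (T n w))\<^sup>2)" for n unfolding n2 using i by simp
  define c where "c = (\<Sum>u\<in>UNIV. Sigma_B \<psi> P H (Sigma_BH M B) oct $ u $ u)"
  have "(\<lambda>n. expectation (\<lambda>w. (norm (T n w))\<^sup>2)) \<longlonglongrightarrow> c"
  proof -
    have "expectation (\<lambda>w. (norm (T n w))\<^sup>2) = (\<Sum>u\<in>UNIV. expectation (\<lambda>w. T n w $ u * T n w $ u))" for n
      unfolding n2 using i by simp
    then show ?thesis unfolding c_def by (simp only:) (intro tendsto_sum cov_T_tendsto)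
  qed
  then have ev: "eventually (\<lambda>n. expectation (\<lambda>w. (norm (T n w))\<^sup>2) < c + 1) sequentially"
    by (rule order_tendstoD) simp
  \<comment> \<open>Markov's inequality for the squared norm, whose expectation is eventually below
    \<open>|c| + 1\<close>.\<close>
  define r where "r = sqrt ((\<bar>c\<bar> + 1) / e)"
  have r: "0 < r" "r\<^sup>2 = (\<bar>c\<bar> + 1) / e" using e by (auto simp: r_def add_nonneg_pos)
  have "eventually (\<lambda>n. prob {w \<in> space M. r < norm (T n w)} < e) sequentially"
    using ev
  proof eventually_elim
    case (elim n)
    note [measurable] = T_measurable
    let ?A = "{w \<in> space M. r < norm (T n w)}"
    have A: "?A \<in> events" by measurable
    have iA: "integrable M (indicat_real ?A)"
      using A by (intro integrable_real_indicator) (auto simp: emeasure_eq_measure)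
    have "?A \<inter> space M = ?A" by auto
    then have EA: "expectation (indicat_real ?A) = prob ?A" using A by simp
    have "r\<^sup>2 * prob {w \<in> space M. r < norm (T n w)} = expectation (\<lambda>w. r\<^sup>2 * indicator {w \<in> space M. r < norm (T n w)} w)"
      using iA EA by simp
    also have "\<dots> \<le> expectation (\<lambda>w. (norm (T n w))\<^sup>2)"
    proof (rule integral_mono[OF _ in2])
      show "integrable M (\<lambda>w. r\<^sup>2 * indicator ?A w)" using iA by simp
      show "r\<^sup>2 * indicator ?A w \<le> (norm (T n w))\<^sup>2" for w
        using r(1) by (auto simp: indicator_def intro!: power_mono)
    qed
    also have "\<dots> < \<bar>c\<bar> + 1" using elim by simp
    also have "\<dots> = r\<^sup>2 * e" using e by (simp add: r(2))
    finally show ?case using r(1) by simp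
  qed
  then show ?thesis by blast
qed

text \<open>The coefficients of all octaves in one index set, so that covariances between octaves
  are treated like those within an octave.\<close>

definition I :: "nat \<Rightarrow> ('m \<times> nat \<times> 2) set" where
  "I n = (SIGMA p:UNIV. {1..Kn n p} \<times> UNIV)"

definition xf :: "nat \<Rightarrow> 'm \<times> nat \<times> 2 \<Rightarrow> 'b \<Rightarrow> real" where
  "xf n = (\<lambda>(p, k, i). x n p k i)"

lemma sum_I: "(\<Sum>z\<in>I n. f z) = (\<Sum>p\<in>UNIV. \<Sum>k=1..Kn n p. \<Sum>i\<in>UNIV. f (p, k, i))" for f :: "_ \<Rightarrow> real"
proof -
  have "(\<Sum>z\<in>I n. f z) = (\<Sum>p\<in>UNIV. \<Sum>y\<in>{1..Kn n p} \<times> UNIV. f (p, y))"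
    unfolding I_def by (subst sum.Sigma) auto
  then show ?thesis by (simp add: sum.cartesian_product case_prod_beta)
qed

text \<open>Couples only the two components of one and the same coefficient; all dependence between
  coefficients is in the covariance matrix.\<close>

definition blk :: "('m \<Rightarrow> 2 \<Rightarrow> 2 \<Rightarrow> real) \<Rightarrow> 'm \<times> nat \<times> 2 \<Rightarrow> 'm \<times> nat \<times> 2 \<Rightarrow> real" where
  "blk \<beta> = (\<lambda>(p, k, i) (q, k', l). if p = q \<and> k = k' then \<beta> p i l else 0)"

lemma sum_blk:
  assumes "1 \<le> k" "k \<le> Kn n p"
  shows "(\<Sum>z\<in>I n. blk \<beta> (p, k, i) z * f z) = (\<Sum>l\<in>UNIV. \<beta> p i l * f (p, k, l))"
proof -
  define c where "c = (\<Sum>l\<in>UNIV. \<beta> p i l * f (p, k, l))"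
  have inner: "(\<Sum>l\<in>UNIV. blk \<beta> (p, k, i) (q, k', l) * f (q, k', l)) = (if p = q \<and> k = k' then c else 0)" for q k'
    by (auto simp: blk_def c_def)
  have "(\<Sum>z\<in>I n. blk \<beta> (p, k, i) z * f z) = (\<Sum>q\<in>UNIV. \<Sum>k'=1..Kn n q. if p = q \<and> k = k' then c else 0)"
    unfolding sum_I inner ..
  also have "\<dots> = (\<Sum>q\<in>UNIV. if p = q then c else 0)"
  proof (rule sum.cong[OF refl])
    fix q
    show "(\<Sum>k'=1..Kn n q. if p = q \<and> k = k' then c else 0) = (if p = q then c else 0)"
      using assms by (cases "p = q") simp_all
  qed
  also have "\<dots> = c" by simp
  finally show ?thesis by (simp add: c_def)
qed

lemma gaussian_family_xf: "gaussian_family M G (I n) (xf n)"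
proof (unfold_locales)
  show "finite (I n)" unfolding I_def by (intro finite_SigmaI) auto
  show "xf n z \<in> G" if "z \<in> I n" for z by (cases z) (simp add: xf_def x_mem)
qed

lemma row_bound_blk:
  assumes \<beta>: "\<And>p i l. \<bar>\<beta> p i l\<bar> \<le> b p" and b: "\<And>p. 2 * b p \<le> b0"
  shows "row_bound (I n) (blk \<beta>) b0"
  unfolding row_bound_def
proof
  fix z assume z: "z \<in> I n"
  obtain p k i where zp: "z = (p, k, i)" by (cases z)
  have k: "1 \<le> k" "k \<le> Kn n p" using z by (auto simp: zp I_def)
  have a: "\<bar>blk \<beta> z y\<bar> = blk (\<lambda>p i l. \<bar>\<beta> p i l\<bar>) z y * 1" for y by (simp add: blk_def split: prod.splits)
  have "(\<Sum>y\<in>I n. \<bar>blk \<beta> z y\<bar>) = (\<Sum>l\<in>UNIV. \<bar>\<beta> p i l\<bar> * 1)"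
    unfolding a unfolding zp by (rule sum_blk[OF k])
  also have "\<dots> \<le> (\<Sum>l\<in>(UNIV::2 set). b p)" by (intro sum_mono) (simp add: \<beta>)
  also have "\<dots> \<le> b0" using b[of p] by simp
  finally show "(\<Sum>y\<in>I n. \<bar>blk \<beta> z y\<bar>) \<le> b0" .
qed

text \<open>For a fixed row the lag is an injective function of the position in the other octave, so
  each row sum is at most the sum of \<open>C / (1 + z^2)\<close> over all integers, whatever the
  number of coefficients.\<close>

lemma row_bound_cov: "\<exists>c\<ge>0. \<forall>n. row_bound (I n) (\<lambda>y z. cov (xf n y) (xf n z)) c"
proof -
  define S where "S = infsum (\<lambda>z::int. 1 / (1 + (of_int z)\<^sup>2) :: real) UNIV"
  have "\<forall>pq. \<exists>C\<ge>0. \<forall>i l y. \<bar>cc i l (oct (fst pq)) (oct (snd pq)) y\<bar> \<le> C / (1 + y\<^sup>2)"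
    using cc_decay by blast
  then obtain C where C: "\<And>pq. 0 \<le> C pq" "\<And>pq i l y. \<bar>cc i l (oct (fst pq)) (oct (snd pq)) y\<bar> \<le> C pq / (1 + y\<^sup>2)"
    by metis
  define c where "c = (\<Sum>pq\<in>UNIV. 2 * (C pq * S))"
  have S0: "0 \<le> S" unfolding S_def by (rule infsum_nonneg) (simp add: add_nonneg_nonneg)
  have rowsum: "(\<Sum>k'=1..Kn n q. \<bar>cq p q k k' i l\<bar>) \<le> C (p, q) * S" for n p q k i l
  proof -
    define z where "z k' = 2 ^ oct p * int k - 2 ^ oct q * int k'" for k'
    have inj: "inj_on z {1..Kn n q}" by (auto simp: inj_on_def z_def)
    have "(\<Sum>k'=1..Kn n q. \<bar>cq p q k k' i l\<bar>) \<le> (\<Sum>k'=1..Kn n q. C (p, q) * (1 / (1 + (of_int (z k'))\<^sup>2)))"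
      using C(2)[of i l "(p, q)"] by (intro sum_mono) (simp add: cq_def z_def)
    also have "\<dots> = C (p, q) * (\<Sum>y\<in>z ` {1..Kn n q}. 1 / (1 + (of_int y)\<^sup>2))"
      unfolding sum_distrib_left by (subst sum.reindex[OF inj]) (simp add: comp_def)
    also have "\<dots> \<le> C (p, q) * S"
      unfolding S_def using C(1)
      by (intro mult_left_mono finite_sum_le_infsum inverse_quadratic_summable) (auto simp: add_nonneg_nonneg)
    finally show ?thesis .
  qed
  have "row_bound (I n) (\<lambda>y z. cov (xf n y) (xf n z)) c" for n
    unfolding row_bound_def
  proof
    fix y assume "y \<in> I n"
    obtain p k i where yp: "y = (p, k, i)" by (cases y)
    have "(\<Sum>z\<in>I n. \<bar>cov (xf n y) (xf n z)\<bar>) = (\<Sum>q\<in>UNIV. \<Sum>l\<in>UNIV. \<Sum>k'=1..Kn n q. \<bar>cq p q k k' i l\<bar>)"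
      unfolding sum_I yp xf_def case_prod_conv cov_x by (intro sum.cong refl sum.swap)
    also have "\<dots> \<le> (\<Sum>q\<in>UNIV. \<Sum>l\<in>(UNIV::2 set). C (p, q) * S)" by (intro sum_mono rowsum)
    also have "\<dots> = (\<Sum>q\<in>UNIV. 2 * (C (p, q) * S))" by simp
    also have "\<dots> \<le> (\<Sum>p\<in>UNIV. \<Sum>q\<in>UNIV. 2 * (C (p, q) * S))"
      by (rule member_le_sum[of p UNIV "\<lambda>p. \<Sum>q\<in>UNIV. 2 * (C (p, q) * S)"]) (auto intro!: sum_nonneg mult_nonneg_nonneg C S0)
    also have "\<dots> = c" unfolding c_def by (simp add: sum.cartesian_product)
    finally show "(\<Sum>z\<in>I n. \<bar>cov (xf n y) (xf n z)\<bar>) \<le> c" .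
  qed
  moreover have "0 \<le> c" unfolding c_def by (intro sum_nonneg mult_nonneg_nonneg C S0) simp
  ultimately show ?thesis by blast
qed

text \<open>A linear functional of \<open>T\<close> is one quadratic form with entries of order
  \<open>2 ^ (- m / 2)\<close>. The number of variables is of order \<open>2 ^ m\<close> and the
  covariance has bounded rows, so the moments converge to those of a normal law, and these give the
  characteristic function.\<close>

lemma char_T:
  "(\<lambda>n. CLINT w|M. iexp (v \<bullet> T n w)) \<longlonglongrightarrow> complex_of_real (exp (- (v \<bullet> (Sigma_B \<psi> P H (Sigma_BH M B) oct *v v)) / 2))"
proof -
  let ?S = "Sigma_B \<psi> P H (Sigma_BH M B) oct"
  define \<sigma> where "\<sigma> = v \<bullet> (?S *v v)"
  define Q where "Q n w = v \<bullet> T n w" for n w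
  have Q: "Q n w = (\<Sum>u\<in>UNIV. v $ u * T n w $ u)" for n w by (simp add: Q_def inner_vec_def)
  have amQ: "all_moments M (Q n)" for n
    unfolding Q[abs_def] by (intro all_moments_sum all_moments_cmult T_nth_all_moments)
  have var: "(\<lambda>n. expectation (\<lambda>w. (Q n w)\<^sup>2)) \<longlonglongrightarrow> \<sigma>"
  proof -
    have i: "integrable M (\<lambda>w. T n w $ u * T n w $ u')" for n u u'
      by (intro all_moments_integrable all_moments_mult T_nth_all_moments)
    have "(Q n w)\<^sup>2 = (\<Sum>u\<in>UNIV. \<Sum>u'\<in>UNIV. (v $ u * v $ u') * (T n w $ u * T n w $ u'))" for n w
      unfolding Q power2_eq_square sum_product by (intro sum.cong refl) (simp add: mult_ac)
    then have "expectation (\<lambda>w. (Q n w)\<^sup>2) = (\<Sum>u\<in>UNIV. \<Sum>u'\<in>UNIV. (v $ u * v $ u') * expectation (\<lambda>w. T n w $ u * T n w $ u'))" for n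
      using i by simp
    moreover have "\<sigma> = (\<Sum>u\<in>UNIV. \<Sum>u'\<in>UNIV. (v $ u * v $ u') * ?S $ u $ u')"
      by (simp add: \<sigma>_def inner_vec_def matrix_vector_mult_def sum_distrib_left mult_ac)
    ultimately show ?thesis by (simp only:) (intro tendsto_sum tendsto_mult tendsto_const cov_T_tendsto)
  qed
  have \<sigma>0: "0 \<le> \<sigma>" by (rule LIMSEQ_le_const[OF var]) (auto intro!: exI)
  \<comment> \<open>The coefficient of the mixed product stands at position (1,2) only. The matrix
    is thus not symmetric, and its transpose is bounded separately.\<close>
  define \<beta> where "\<beta> n p i l = (\<Sum>r\<in>UNIV. v $ (p, r) * of_bool (i = ix r \<and> l = iy r)) / sqrt (real (Kn n p))" for n p i l
  define A where "A n = blk (\<beta> n)" for n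
  have qf: "gaussian_family.qf M (I n) (xf n) (A n) w = Q n w" for n w
  proof -
    define Y where "Y p k i l = x n p k i w * x n p k l w - cq p p k k i l" for p k i l
    have "gaussian_family.qf M (I n) (xf n) (A n) w = (\<Sum>z\<in>I n. \<Sum>y\<in>I n. A n z y * (xf n z w * xf n y w - cov (xf n z) (xf n y)))"
      by (rule gaussian_family.qf_def[OF gaussian_family_xf])
    also have "\<dots> = (\<Sum>p\<in>UNIV. \<Sum>k=1..Kn n p. \<Sum>i\<in>UNIV. \<Sum>l\<in>UNIV. \<beta> n p i l * Y p k i l)"
      unfolding A_def sum_I[of "\<lambda>z. \<Sum>y\<in>I n. _ z y"]
      by (intro sum.cong refl) (simp add: sum_blk xf_def cov_x Y_def)
    also have "\<dots> = (\<Sum>p\<in>UNIV. \<Sum>k=1..Kn n p. \<Sum>r\<in>UNIV. (v $ (p, r) / sqrt (real (Kn n p))) * Y p k (ix r) (iy r))"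
    proof (intro sum.cong refl)
      fix p k
      define S0 where "S0 i l = (\<Sum>r\<in>UNIV. v $ (p, r) * of_bool (i = ix r \<and> l = iy r))" for i l
      have "\<beta> n p i l = S0 i l / sqrt (real (Kn n p))" for i l by (simp only: \<beta>_def S0_def)
      then have "(\<Sum>i\<in>UNIV. \<Sum>l\<in>UNIV. \<beta> n p i l * Y p k i l) = (\<Sum>i\<in>UNIV. \<Sum>l\<in>UNIV. S0 i l * Y p k i l) / sqrt (real (Kn n p))"
        by (simp add: sum_divide_distrib)
      also have "\<dots> = (\<Sum>r\<in>UNIV. (v $ (p, r) / sqrt (real (Kn n p))) * Y p k (ix r) (iy r))"
        unfolding S0_def sum_of_bool_index by (simp add: sum_divide_distrib)
      finally show "(\<Sum>i\<in>UNIV. \<Sum>l\<in>UNIV. \<beta> n p i l * Y p k i l) =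
          (\<Sum>r\<in>UNIV. (v $ (p, r) / sqrt (real (Kn n p))) * Y p k (ix r) (iy r))" .
    qed
    also have "\<dots> = (\<Sum>p\<in>UNIV. \<Sum>r\<in>UNIV. v $ (p, r) * ((\<Sum>k=1..Kn n p. Y p k (ix r) (iy r)) / sqrt (real (Kn n p))))"
      by (intro sum.cong refl, subst sum.swap) (simp add: sum_distrib_left sum_divide_distrib)
    also have "\<dots> = Q n w"
      unfolding Q sum_UNIV_prod by (simp add: T_def Y_def cq_def)
    finally show ?thesis .
  qed
  obtain c where c: "0 \<le> c" "\<And>n. row_bound (I n) (\<lambda>y z. cov (xf n y) (xf n z)) c" using row_bound_cov by blast
  define V where "V = (\<Sum>u\<in>UNIV. \<bar>v $ u\<bar>)"
  \<comment> \<open>A common bound for the ratios of \<open>2 ^ m\<close> to the number of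
    coefficients of an octave, which are the numbers \<open>2 ^ oct p\<close>.\<close>
  define O' where "O' = (\<Sum>p\<in>UNIV. 2 ^ oct p :: real)"
  have V0: "0 \<le> V" by (simp add: V_def sum_nonneg)
  define b0 where "b0 n = 2 * (V * (sqrt O' / sqrt (2 ^ m n)))" for n
  have Kinv: "1 / sqrt (real (Kn n p)) \<le> sqrt O' / sqrt (2 ^ m n)" for n p
  proof -
    have "(2 ^ oct p :: real) \<le> O'" unfolding O'_def by (rule member_le_sum) auto
    moreover have "(2 ^ m n :: real) = real (Kn n p) * 2 ^ oct p" using arg_cong[OF Kn_mult[of n p], of real] by simp
    ultimately have "1 / real (Kn n p) \<le> O' / 2 ^ m n" using Kn_pos[of n p] by (simp add: field_simps)
    then have "sqrt (1 / real (Kn n p)) \<le> sqrt (O' / 2 ^ m n)" by (rule real_sqrt_le_mono)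
    then show ?thesis by (simp add: real_sqrt_divide)
  qed
  have num: "\<bar>\<Sum>r\<in>UNIV. v $ (p, r) * of_bool (i = ix r \<and> l = iy r)\<bar> \<le> V" for p i l
  proof -
    have "\<bar>\<Sum>r\<in>UNIV. v $ (p, r) * of_bool (i = ix r \<and> l = iy r)\<bar> \<le> (\<Sum>r\<in>UNIV. \<bar>v $ (p, r)\<bar>)"
      by (intro order_trans[OF sum_abs] sum_mono) (simp add: abs_mult)
    also have "\<dots> \<le> V"
      unfolding V_def sum_UNIV_prod by (rule member_le_sum[of p UNIV "\<lambda>p. \<Sum>r\<in>UNIV. \<bar>v $ (p, r)\<bar>"]) (auto intro: sum_nonneg)
    finally show ?thesis .
  qed
  have bd: "\<bar>\<beta> n p i l\<bar> \<le> V * (sqrt O' / sqrt (2 ^ m n))" for n p i l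
  proof -
    have "\<bar>\<beta> n p i l\<bar> = \<bar>\<Sum>r\<in>UNIV. v $ (p, r) * of_bool (i = ix r \<and> l = iy r)\<bar> * (1 / sqrt (real (Kn n p)))"
      unfolding \<beta>_def by simp
    also have "\<dots> \<le> V * (sqrt O' / sqrt (2 ^ m n))"
      by (rule mult_mono[OF num Kinv V0]) simp
    finally show ?thesis .
  qed
  have rA: "row_bound (I n) (A n) (b0 n)" for n
    unfolding A_def by (rule row_bound_blk[where b = "\<lambda>_. V * (sqrt O' / sqrt (2 ^ m n))", OF bd]) (simp add: b0_def)
  have rA': "row_bound (I n) (tp (A n)) (b0 n)" for n
  proof -
    have "tp (A n) = blk (\<lambda>p i l. \<beta> n p l i)"
      by (auto simp: tp_def A_def blk_def fun_eq_iff)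
    then show ?thesis
      by (simp only:) (rule row_bound_blk[where b = "\<lambda>_. V * (sqrt O' / sqrt (2 ^ m n))" and \<beta> = "\<lambda>p i l. \<beta> n p l i", OF bd],
          simp add: b0_def)
  qed
  have O0: "0 \<le> O'" by (simp add: O'_def sum_nonneg)
  have b00: "0 \<le> b0 n" for n using V0 O0 by (simp add: b0_def)
  have mat_bd: "gaussian_family.mat_bd M (I n) (xf n) (A n) (b0 n * c)" for n
    unfolding gaussian_family.mat_bd_def[OF gaussian_family_xf]
    using row_bound_mm[OF rA c(2) c(1)] row_bound_mm[OF rA' c(2) c(1)] b00[of n] c(1) by simp
  \<comment> \<open>Two components for each of at most \<open>2 ^ m\<close> coefficients in each
    octave; its square therefore bounds the number of variables.\<close>
  define s where "s n = sqrt (2 * real (card (UNIV :: 'm set)) * 2 ^ m n)" for n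
  have card1: "1 \<le> real (card (UNIV :: 'm set))" using finite_UNIV_card_ge_0[where 'a = 'm] by simp
  then have card2: "1 \<le> 2 * real (card (UNIV :: 'm set))" by linarith
  have mom: "(\<lambda>n. expectation (\<lambda>w. Q n w ^ k)) \<longlonglongrightarrow> gmom \<sigma> k" for k
    unfolding qf[symmetric]
  proof (rule qf_moments_tendsto[where I = I and X = xf and s = s and a = "\<lambda>n. b0 n * c"])
    show "gaussian_family M G (I n) (xf n)" for n by (rule gaussian_family_xf)
    show "1 \<le> s n" for n
    proof -
      have "1 * 1 \<le> (2 * real (card (UNIV :: 'm set))) * (2 ^ m n :: real)"
        by (intro mult_mono card2) auto
      then show ?thesis unfolding s_def by (simp only: real_sqrt_ge_1_iff mult_1)
    qed
    show "real (card (I n)) \<le> (s n)\<^sup>2" for n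
    proof -
      have "card (I n) = (\<Sum>p\<in>UNIV. card ({1..Kn n p} \<times> (UNIV :: 2 set)))"
        unfolding I_def by (rule card_SigmaI) auto
      then have "real (card (I n)) = (\<Sum>p\<in>(UNIV::'m set). 2 * real (Kn n p))"
        by (simp add: card_cartesian_product mult.commute)
      also have "\<dots> \<le> (\<Sum>p\<in>(UNIV::'m set). 2 * 2 ^ m n)"
      proof (rule sum_mono)
        fix p
        have "Kn n p \<le> 2 ^ m n" unfolding Kn_def by (rule power_increasing) auto
        then have "real (Kn n p) \<le> real (2 ^ m n)" by (rule of_nat_mono)
        then show "2 * real (Kn n p) \<le> 2 * 2 ^ m n" by simp
      qed
      finally show ?thesis by (simp add: s_def)
    qed
    show "filterlim s at_top sequentially"
    proof -
      have "filterlim (\<lambda>n. real (m n)) at_top sequentially"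
        by (rule filterlim_compose[OF filterlim_real_sequentially m])
      then have 1: "filterlim (\<lambda>n. sqrt (real (m n))) at_top sequentially"
        by (rule filterlim_compose[OF sqrt_at_top])
      show ?thesis
      proof (rule filterlim_at_top_mono[OF 1], rule always_eventually, rule allI)
        fix n
        have "real (m n) \<le> 2 ^ m n" using of_nat_mono[OF less_imp_le[OF less_exp[of "m n"]], where 'a = real] by simp
        also have "\<dots> \<le> (2 * real (card (UNIV :: 'm set))) * 2 ^ m n"
          using mult_right_mono[OF card2, of "2 ^ m n"] by simp
        finally show "sqrt (real (m n)) \<le> s n" unfolding s_def by (rule real_sqrt_le_mono)
      qed
    qed
    show "gaussian_family.mat_bd M (I n) (xf n) (A n) (b0 n * c)" for n by (rule mat_bd)
    show "s n * (b0 n * c) \<le> 2 * sqrt (2 * real (card (UNIV :: 'm set))) * V * sqrt O' * c" for n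
      by (simp add: s_def b0_def real_sqrt_mult)
    show "(\<lambda>n. expectation (\<lambda>w. (gaussian_family.qf M (I n) (xf n) (A n) w)\<^sup>2)) \<longlonglongrightarrow> \<sigma>"
      unfolding qf by (rule var)
  qed
  from char_tendsto_of_moments[OF amQ \<sigma>0 mom, of 1] show ?thesis by (simp add: Q_def \<sigma>_def)
qed

end

section \<open>The estimators\<close>

lemma matrix_inv_eqI:
  fixes A A' :: "real^'n^'n"
  assumes "A ** A' = mat 1" "A' ** A = mat 1" shows "matrix_inv A = A'"
proof -
  have "\<exists>X. A ** X = mat 1 \<and> X ** A = mat 1" using assms by blast
  from someI_ex[OF this] have "matrix_inv A ** A = mat 1" by (simp add: matrix_inv_def)
  then have "matrix_inv A ** (A ** A') = A'" by (simp add: matrix_mul_assoc)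
  then show ?thesis using assms(1) by simp
qed

lemma outer_matrix_vector: "outer (M *v x) (N *v y) = M ** outer x y ** transpose N" for M N :: "real^2^2"
  by (simp add: vec_eq_iff outer_def matrix_vector_mult_def matrix_matrix_mult_def transpose_def sum_2 algebra_simps)

lemma scaled_scaleR: "scaled P x y (c *\<^sub>R V) = c *\<^sub>R scaled P x y V"
  by (simp add: scaled_def vec_eq_iff matrix_matrix_mult_def sum_2 algebra_simps)

lemma scaled_sum: "scaled P x y (\<Sum>k\<in>K. V k) = (\<Sum>k\<in>K. scaled P x y (V k))"
proof -
  have "scaled P x y (U + V) = scaled P x y U + scaled P x y V" for U V
    by (simp add: scaled_def vec_eq_iff matrix_matrix_mult_def sum_2 algebra_simps)
  moreover have "scaled P x y 0 = 0" using scaled_scaleR[of P x y 0 0] by simp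
  ultimately show ?thesis by (induction K rule: infinite_finite_induct) auto
qed

lemma scaled_nth:
  "scaled P x y V $ a $ b = (\<Sum>i\<in>UNIV. \<Sum>k\<in>UNIV. P $ a $ i * P $ b $ k *
    ((if i = 1 then x else y) * (if k = 1 then x else y) * V $ i $ k))"
  by (simp add: scaled_def matrix_matrix_mult_def transpose_def sum_2 diag2_nth algebra_simps)

lemma borel_measurable_ord_eigenval:
  fixes S :: "'a \<Rightarrow> real^2^2"
  assumes [measurable]: "\<And>i k. (\<lambda>w. S w $ i $ k) \<in> borel_measurable M" and "\<And>w. S w $ 1 $ 2 = S w $ 2 $ 1"
  shows "(\<lambda>w. ord_eigenval (S w) i) \<in> borel_measurable M"
proof -
  have [measurable]: "(\<lambda>w. trace (S w)) \<in> borel_measurable M" "(\<lambda>w. det (S w)) \<in> borel_measurable M"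
    unfolding trace_def det_2 by measurable
  show ?thesis
    using exhaust_2[of i]
  proof
    assume "i = 1"
    then show ?thesis using assms(2) by (simp add: ord_eigenval_symmetric(1))
  next
    assume "i = 2"
    then show ?thesis using assms(2) by (simp add: ord_eigenval_symmetric(2))
  qed
qed

lemma vec_borel_measurableI:
  fixes f :: "'c \<Rightarrow> real^'k"
  assumes "\<And>i. (\<lambda>w. f w $ i) \<in> borel_measurable M'" shows "f \<in> borel_measurable M'"
  by (subst borel_measurable_euclidean_space) (use assms in \<open>auto simp: Basis_vec_def inner_axis\<close>)

text \<open>The assumptions on the octaves hold only from some index on, so the limits are proved
  for a shifted sequence. Measurability is part of the notion for every index and is therefore a
  separate premise.\<close>

lemma conv_in_prob_on_offset:
  fixes M :: "'w measure" and X :: "nat \<Rightarrow> 'w \<Rightarrow> 'b::metric_space"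
  assumes "\<And>n. E n \<in> sets M" "\<And>n. X n \<in> borel_measurable (restrict_space M (E n))"
    and "conv_in_prob_on M (\<lambda>n. E (n + k)) (\<lambda>n. X (n + k)) x"
  shows "conv_in_prob_on M E X x"
  using assms LIMSEQ_offset[of "\<lambda>n. measure M (E n)" k]
    LIMSEQ_offset[of "\<lambda>n. measure M {\<omega> \<in> E n. dist (X n \<omega>) x \<ge> _}" k]
  unfolding conv_in_prob_on_def by blast

lemma conv_in_distr_on_offset:
  fixes M :: "'w measure" and X :: "nat \<Rightarrow> 'w \<Rightarrow> 'b::metric_space"
  assumes "\<And>n. E n \<in> sets M" "\<And>n. X n \<in> borel_measurable (restrict_space M (E n))"
    and "conv_in_distr_on M (\<lambda>n. E (n + k)) (\<lambda>n. X (n + k)) \<mu>"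
  shows "conv_in_distr_on M E X \<mu>"
  unfolding conv_in_distr_on_def
proof (intro conjI allI impI)
  note c = assms(3)[unfolded conv_in_distr_on_def]
  show "E n \<in> sets M" "X n \<in> borel_measurable (restrict_space M (E n))" for n by (fact assms)+
  show "(\<lambda>n. measure M (E n)) \<longlonglongrightarrow> 1" by (rule LIMSEQ_offset[of _ k]) (use c in blast)
  fix f :: "'b \<Rightarrow> real" assume "continuous_on UNIV f \<and> bounded (range f)"
  with c have "(\<lambda>n. LINT \<omega>:E (n + k)|M. f (X (n + k) \<omega>)) \<longlonglongrightarrow> (LINT x|\<mu>. f x)" by blast
  then show "(\<lambda>n. LINT \<omega>:E n|M. f (X n \<omega>)) \<longlonglongrightarrow> (LINT x|\<mu>. f x)"
    by (rule LIMSEQ_offset[of "\<lambda>n. LINT \<omega>:E n|M. f (X n \<omega>)" k])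
qed

section \<open>Measurability of the estimators and the matrix B\<close>

context ofbm_wavelet
begin

lemma D_nth_measurable: "(\<lambda>w. D (2 ^ j) k w $ i) \<in> borel_measurable M"
proof -
  have "D (2 ^ j) k \<in> borel_measurable M" by (rule sq_integrableD(1)[OF D_sq])
  then have "(\<lambda>w. D (2 ^ j) k w \<bullet> axis i 1) \<in> borel_measurable M" by simp
  then show ?thesis by (simp add: inner_axis)
qed

lemma ord_eigenval_W_measurable:
  "(\<lambda>w. ord_eigenval (W_sample D \<nu> (2 ^ j) w) i) \<in> borel_measurable M"
proof (rule borel_measurable_ord_eigenval)
  note [measurable] = D_nth_measurable
  show "(\<lambda>w. W_sample D \<nu> (2 ^ j) w $ i $ k) \<in> borel_measurable M" for i k
    unfolding W_sample_def outer_def by simp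
  show "W_sample D \<nu> (2 ^ j) w $ 1 $ 2 = W_sample D \<nu> (2 ^ j) w $ 2 $ 1" for w
    by (simp add: W_sample_def outer_def mult.commute)
qed

lemma pos_event_measurable: "pos_event M D \<nu> (2 ^ j) \<in> sets M"
proof -
  note [measurable] = ord_eigenval_W_measurable
  show ?thesis unfolding pos_event_def by measurable
qed

lemma h_hat_measurable: "(\<lambda>w. h_hat D \<nu> (2 ^ j) i w) \<in> borel_measurable M"
proof -
  note [measurable] = ord_eigenval_W_measurable
  show ?thesis unfolding h_hat_def by measurable
qed

definition Bm :: "nat \<Rightarrow> real^2^2" where "Bm j = (\<chi> i k. cc i k j j 0)"

lemma cov_d0: "expectation (\<lambda>w. d j 0 i w * d j 0 k w) = Bm j $ i $ k"
  using cov_d[of j 0 i j 0 k] by (simp add: Bm_def)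

lemma Bm_symmetric: "Bm j $ i $ k = Bm j $ k $ i"
  unfolding cov_d0[symmetric] by (simp add: mult.commute)

lemma d0_integrable: "integrable M (\<lambda>w. d j k i w * d j k' l w)"
  by (intro all_moments_integrable all_moments_mult am_mem d_mem)

lemma Bm_posdef: assumes "u \<noteq> 0" shows "0 < (\<Sum>i\<in>UNIV. \<Sum>k\<in>UNIV. u $ i * u $ k * Bm j $ i $ k)"
proof -
  have "(\<Sum>i\<in>UNIV. u $ i * d j 0 i w)\<^sup>2 = (\<Sum>i\<in>UNIV. \<Sum>k\<in>UNIV. (u $ i * u $ k) * (d j 0 i w * d j 0 k w))" for w
    unfolding power2_eq_square sum_product by (intro sum.cong refl) (simp add: mult_ac)
  then have "expectation (\<lambda>w. (\<Sum>i\<in>UNIV. u $ i * d j 0 i w)\<^sup>2) = (\<Sum>i\<in>UNIV. \<Sum>k\<in>UNIV. u $ i * u $ k * Bm j $ i $ k)"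
    using d0_integrable by (simp add: cov_d0)
  then show ?thesis using cov_d_posdef[OF assms, of j] by simp
qed

lemma Bm_pos: "0 < Bm j $ 2 $ 2" "0 < det (Bm j)"
proof -
  have nz: "vector [0, 1] \<noteq> (0 :: real^2)" by (simp add: vec_eq_iff forall_2)
  show 22: "0 < Bm j $ 2 $ 2" using Bm_posdef[OF nz, of j] by (simp add: sum_2)
  \<comment> \<open>At the vector \<open>(b_22, - b_12)\<close> the form of \<open>B\<close> takes
    the value \<open>b_22 * det B\<close>.\<close>
  define u :: "real^2" where "u = vector [Bm j $ 2 $ 2, - Bm j $ 1 $ 2]"
  have "u \<noteq> 0" using 22 by (simp add: u_def vec_eq_iff forall_2)
  from Bm_posdef[OF this, of j] have "0 < Bm j $ 2 $ 2 * det (Bm j)"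
    using Bm_symmetric[of j 2 1] by (simp add: u_def sum_2 det_2 algebra_simps)
  then show "0 < det (Bm j)" using 22 by (simp add: zero_less_mult_iff)
qed

text \<open>Self-similarity multiplies the (i,k) entry in the eigenbasis by the scale to the power
  \<open>h_i + h_k\<close>, which is the congruence with the diagonal matrix of the two
  powers.\<close>

lemma EW_scaled: "EW M D (2 ^ (l + j)) = scaled P ((2 ^ l) powr h\<^sub>1) ((2 ^ l) powr h\<^sub>2) (Bm j)"
proof -
  define a where "a = (2 ^ l :: real)"
  define E where "E i k = outer (column i P) (column k P)" for i k
  have E: "E i k $ b $ c = P $ b $ i * P $ c $ k" for i k b c by (simp add: E_def outer_def column_def)
  have Dd: "D (2 ^ (l + j)) 0 w = P *v (\<chi> i. d (l + j) 0 i w)" for w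
  proof -
    have "(\<chi> i. d (l + j) 0 i w) = Pinv *v D (2 ^ (l + j)) 0 w" by (simp add: d_def)
    then show ?thesis by (simp add: matrix_vector_mul_assoc P_Pinv)
  qed
  have "outer (D (2 ^ (l + j)) 0 w) (D (2 ^ (l + j)) 0 w) = (\<Sum>i\<in>UNIV. \<Sum>k\<in>UNIV. (d (l + j) 0 i w * d (l + j) 0 k w) *\<^sub>R E i k)" for w
    unfolding Dd by (simp add: vec_eq_iff outer_def matrix_vector_mult_def E sum_2 algebra_simps)
  then have "EW M D (2 ^ (l + j)) = (\<Sum>i\<in>UNIV. \<Sum>k\<in>UNIV. Bm (l + j) $ i $ k *\<^sub>R E i k)"
    unfolding EW_def using d0_integrable by (simp add: cov_d0)
  moreover have "Bm (l + j) $ i $ k = a powr \<eta> i k * Bm j $ i $ k" for i k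
    using J_scale[OF \<eta>_bounds(1), of i k l j j 0] by (simp add: Bm_def cc_def a_def)
  ultimately show ?thesis
    by (simp add: vec_eq_iff scaled_nth E sum_2 \<eta>_def powr_add a_def algebra_simps)
qed

lemma B_mat_eq: "B_mat P M D (2 ^ j) = Bm j"
proof -
  have "EW M D (2 ^ j) = P ** Bm j ** transpose P"
    using EW_scaled[of 0 j] by (simp add: scaled_def diag2_1)
  moreover have "matrix_inv (transpose P) = transpose Pinv"
    by (rule matrix_inv_eqI) (simp_all add: matrix_transpose_mul[symmetric] P_Pinv)
  ultimately have "B_mat P M D (2 ^ j) = (Pinv ** P) ** Bm j ** transpose (Pinv ** P)"
    by (simp add: B_mat_def Pinv_def[symmetric] matrix_transpose_mul matrix_mul_assoc)
  then show ?thesis by (simp add: P_Pinv)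
qed

end

locale ofbm_estimator = ofbm_clt N R M B P H A h\<^sub>1 h\<^sub>2 \<psi> N\<^sub>\<psi> \<alpha> D oct lev m
  for N :: "'v measure" and R :: "real set \<Rightarrow> 'v \<Rightarrow> complex^2" and M :: "'b measure" and B P H A h\<^sub>1 h\<^sub>2 \<psi> N\<^sub>\<psi> \<alpha> D
    and oct :: "'m::finite \<Rightarrow> nat" and lev m +
  assumes unit: "norm (column i P) = 1" and lev: "filterlim lev at_top sequentially"
begin

definition a :: "nat \<Rightarrow> real" where "a n = 2 ^ lev n"
definition \<nu> :: "nat \<Rightarrow> nat" where "\<nu> n = 2 ^ (lev n + m n)"
definition sc :: "nat \<Rightarrow> 'm \<Rightarrow> nat" where "sc n p = 2 ^ (lev n + oct p)"
definition Tp :: "nat \<Rightarrow> 'm \<Rightarrow> 'b \<Rightarrow> real^3" where "Tp n p w = (\<chi> r. T n w $ (p, r))"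
definition rn :: "nat \<Rightarrow> 'm \<Rightarrow> real" where "rn n p = sqrt (real (Kn n p))"

lemma K_eff_eq: "K_eff (\<nu> n) (sc n p) = Kn n p"
proof -
  have "(2::nat) ^ (lev n + m n) = 2 ^ (lev n + oct p) * 2 ^ (m n - oct p)"
    using oct_le[of p n] by (simp flip: power_add)
  then show ?thesis by (simp add: K_eff_def \<nu>_def sc_def Kn_def)
qed

lemma norm_Tp_le: "norm (Tp n p w) \<le> norm (T n w)"
proof (rule power2_le_imp_le)
  have "(norm (Tp n p w))\<^sup>2 = (\<Sum>r\<in>UNIV. (T n w $ (p, r))\<^sup>2)"
    unfolding power2_norm_eq_inner by (simp add: inner_vec_def Tp_def power2_eq_square)
  also have "\<dots> \<le> (\<Sum>p\<in>UNIV. \<Sum>r\<in>UNIV. (T n w $ (p, r))\<^sup>2)"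
    by (rule member_le_sum[of p UNIV "\<lambda>p. \<Sum>r\<in>UNIV. (T n w $ (p, r))\<^sup>2"]) (auto intro: sum_nonneg)
  also have "\<dots> = (norm (T n w))\<^sup>2"
    unfolding power2_norm_eq_inner inner_vec_def sum_UNIV_prod by (simp add: power2_eq_square)
  finally show "(norm (Tp n p w))\<^sup>2 \<le> (norm (T n w))\<^sup>2" .
qed simp

text \<open>A coefficient vector is \<open>P diag(a^h_1, a^h_2)\<close> applied to the normalised
  vector. Outer products turn this into a congruence, which commutes with averaging, and the average
  of the normalised outer products is \<open>B\<close> plus the error that \<open>T\<close>
  records.\<close>

lemma W_sample_eq:
  "W_sample D (\<nu> n) (sc n p) w = scaled P (a n powr h\<^sub>1) (a n powr h\<^sub>2) (Bm (oct p) + (1 / rn n p) *\<^sub>R smat (Tp n p w))"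
proof -
  let ?j = "lev n + oct p" and ?S = "scaled P (a n powr h\<^sub>1) (a n powr h\<^sub>2)"
  have a0: "0 < a n" by (simp add: a_def)
  define xv where "xv k = (\<chi> i. x n p k i w)" for k
  have out: "outer (D (2 ^ ?j) (int k) w) (D (2 ^ ?j) (int k) w) = ?S (outer (xv k) (xv k))" for k
  proof -
    have "Pinv *v D (2 ^ ?j) (int k) w = diag2 (a n powr h\<^sub>1) (a n powr h\<^sub>2) *v xv k"
      using a0 by (simp add: vec_eq_iff forall_2 matrix_vector_mult_def[of "diag2 _ _"] sum_2 diag2_nth xv_def x_def d_def[symmetric]
          hh_def a_def[symmetric] powr_minus)
    then have "P *v (Pinv *v D (2 ^ ?j) (int k) w) = (P ** diag2 (a n powr h\<^sub>1) (a n powr h\<^sub>2)) *v xv k"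
      by (simp add: matrix_vector_mul_assoc)
    then have "D (2 ^ ?j) (int k) w = (P ** diag2 (a n powr h\<^sub>1) (a n powr h\<^sub>2)) *v xv k"
      by (simp add: matrix_vector_mul_assoc P_Pinv)
    moreover have "transpose (diag2 u v) = diag2 u v" for u v by (simp add: vec_eq_iff transpose_def diag2_nth)
    ultimately show ?thesis
      by (simp add: outer_matrix_vector scaled_def matrix_transpose_mul matrix_mul_assoc)
  qed
  have K0: "0 < real (Kn n p)" using Kn_pos[of n p] by simp
  have r2: "rn n p * rn n p = real (Kn n p)" using K0 by (simp add: rn_def)
  have Tn: "(1 / rn n p) * T n w $ (p, r) = (\<Sum>k=1..Kn n p. x n p k (ix r) w * x n p k (iy r) w) / real (Kn n p) - Bm (oct p) $ ix r $ iy r" for r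
  proof -
    have "(1 / rn n p) * T n w $ (p, r) = (\<Sum>k=1..Kn n p. x n p k (ix r) w * x n p k (iy r) w - Bm (oct p) $ ix r $ iy r) / (rn n p * rn n p)"
      by (simp add: T_def rn_def Bm_def)
    then show ?thesis unfolding r2 sum_subtractf using K0 by (simp add: diff_divide_distrib)
  qed
  have V: "(1 / real (Kn n p)) *\<^sub>R (\<Sum>k=1..Kn n p. outer (xv k) (xv k)) = Bm (oct p) + (1 / rn n p) *\<^sub>R smat (Tp n p w)"
    using Tn[of 1] Tn[of 2] Tn[of 3] Bm_symmetric[of "oct p" 2 1]
    by (simp add: vec_eq_iff forall_2 outer_def xv_def Tp_def mult.commute)
  have "W_sample D (\<nu> n) (sc n p) w = (1 / real (Kn n p)) *\<^sub>R (\<Sum>k=1..Kn n p. ?S (outer (xv k) (xv k)))"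
    unfolding W_sample_def K_eff_eq by (simp add: sc_def out)
  also have "\<dots> = ?S ((1 / real (Kn n p)) *\<^sub>R (\<Sum>k=1..Kn n p. outer (xv k) (xv k)))"
    by (simp add: scaled_scaleR scaled_sum)
  finally show ?thesis unfolding V .
qed

lemma EW_eq: "EW M D (sc n p) = scaled P (a n powr h\<^sub>1) (a n powr h\<^sub>2) (Bm (oct p))"
  unfolding sc_def a_def by (rule EW_scaled)

lemma a_pos: "0 < a n" by (simp add: a_def)

lemma a_at_top: "filterlim a at_top sequentially"
proof (rule filterlim_at_top_mono[OF filterlim_compose[OF filterlim_real_sequentially lev]], rule always_eventually, rule allI)
  show "real (lev n) \<le> a n" for n
    using of_nat_mono[OF less_imp_le[OF less_exp[of "lev n"]], where 'a = real] by (simp add: a_def)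
qed

lemma rn_at_top: "filterlim (\<lambda>n. rn n p) at_top sequentially"
  unfolding rn_def
  by (rule filterlim_compose[OF sqrt_at_top filterlim_compose[OF filterlim_real_sequentially Kn_at_top]])

lemma detP: "det P \<noteq> 0" using P by (simp add: invertible_det_nz)

definition dl :: "nat \<Rightarrow> 'm \<Rightarrow> 'b \<Rightarrow> 2 \<Rightarrow> real" where
  "dl n p w i = ln (ord_eigenval (W_sample D (\<nu> n) (sc n p) w) i) - ln (ord_eigenval (EW M D (sc n p)) i)"

lemma block_expansion:
  assumes "0 < \<epsilon>"
  shows "eventually (\<lambda>n. \<forall>w\<in>space M. norm (T n w) \<le> r \<longrightarrow> w \<in> pos_event M D (\<nu> n) (sc n p) \<and>
    norm ((\<chi> i. rn n p * dl n p w i) - Q_block (Bm (oct p)) *v Tp n p w) < \<epsilon>) sequentially"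
proof -
  have e: "(\<lambda>n. a n powr h\<^sub>1 / a n powr h\<^sub>2) \<longlonglongrightarrow> 0"
  proof -
    have "(\<lambda>n. a n powr (h\<^sub>1 - h\<^sub>2)) \<longlonglongrightarrow> 0" using h by (intro tendsto_neg_powr a_at_top) simp
    then show ?thesis by (simp add: powr_diff)
  qed
  have pos: "0 < a n powr h" for n h using a_pos[of n] by simp
  from log_eigenval_expansion[OF detP unit unit Bm_symmetric Bm_pos pos pos e rn_at_top assms, of r "oct p" p]
  show ?thesis
  proof eventually_elim
    case (elim n)
    show ?case
    proof (intro ballI impI)
      fix w assume w: "w \<in> space M" "norm (T n w) \<le> r"
      have "norm (Tp n p w) \<le> r" using norm_Tp_le[of n p w] w(2) by linarith
      with elim show "w \<in> pos_event M D (\<nu> n) (sc n p) \<and>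
          norm ((\<chi> i. rn n p * dl n p w i) - Q_block (Bm (oct p)) *v Tp n p w) < \<epsilon>"
        using w(1) unfolding pos_event_def dl_def W_sample_eq EW_eq by blast
    qed
  qed
qed

lemma ln_sc_at_top: "filterlim (\<lambda>n. ln (real (sc n p))) at_top sequentially"
proof -
  have "real (sc n p) = 2 ^ oct p * a n" for n by (simp add: sc_def a_def power_add mult.commute)
  moreover have "filterlim (\<lambda>n. 2 ^ oct p * a n) at_top sequentially"
    by (rule filterlim_tendsto_pos_mult_at_top[OF tendsto_const _ a_at_top]) simp
  ultimately show ?thesis by (simp only:) (rule filterlim_compose[OF ln_at_top])
qed

lemma h_E_limit: "(\<lambda>n. \<chi> i. h_E M D (sc n p) i) \<longlonglongrightarrow> (vector [h\<^sub>1, h\<^sub>2] :: real^2)"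
proof (rule vec_tendstoI)
  fix i :: 2
  have "real (sc n p) = a n * 2 ^ oct p" for n by (simp add: sc_def a_def power_add)
  then have "(\<lambda>n. h_E M D (sc n p) i) \<longlonglongrightarrow> (if i = 1 then h\<^sub>1 else h\<^sub>2)"
    unfolding h_E_def EW_eq
    using log_eigenval_ratio_limit[OF detP unit unit Bm_symmetric Bm_pos a_pos a_at_top h(2), of "2 ^ oct p" "oct p" i] by simp
  moreover have "(vector [h\<^sub>1, h\<^sub>2] :: real^2) $ i = (if i = 1 then h\<^sub>1 else h\<^sub>2)"
    using exhaust_2[of i] by auto
  ultimately show "(\<lambda>n. (\<chi> i. h_E M D (sc n p) i) $ i) \<longlonglongrightarrow> (vector [h\<^sub>1, h\<^sub>2] :: real^2) $ i" by simp
qed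

text \<open>Where \<open>T\<close> is bounded, the sample log eigenvalues differ from the expected
  ones by the order of \<open>1 / rn\<close>; division by the logarithm of the scale keeps this
  small. The deterministic exponents have the right limit by \<open>h_E_limit\<close>.\<close>

theorem h_hat_consistent:
  "conv_in_prob_on M (\<lambda>n. pos_event M D (\<nu> n) (sc n p)) (\<lambda>n w. \<chi> i. h_hat D (\<nu> n) (sc n p) i w) (vector [h\<^sub>1, h\<^sub>2] :: real^2)"
proof (rule conv_in_prob_on_of_tight[OF T_measurable T_tight])
  show "pos_event M D (\<nu> n) (sc n p) \<in> events" for n unfolding sc_def by (rule pos_event_measurable)
  show "(\<lambda>w. \<chi> i. h_hat D (\<nu> n) (sc n p) i w) \<in> borel_measurable (restrict_space M (pos_event M D (\<nu> n) (sc n p)))" for n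
    by (rule measurable_restrict_space1, rule vec_borel_measurableI) (simp add: sc_def h_hat_measurable)
  fix R0 \<epsilon> :: real assume \<epsilon>: "0 < \<epsilon>"
  let ?h = "vector [h\<^sub>1, h\<^sub>2] :: real^2" and ?Q = "Q_block (Bm (oct p))"
  obtain C where C: "0 \<le> C" "\<And>t. norm (?Q *v t) \<le> norm t * C"
    using bounded_linear.nonneg_bounded[OF matrix_vector_mul_bounded_linear[of ?Q]] by blast
  \<comment> \<open>Times \<open>rn\<close>, the logarithmic errors have norm at most
    \<open>|R0| C\<close> from the linear part plus 1 from the remainder. With the denominator
    \<open>2 ln s\<close> each component is at most \<open>q / 2\<close>, and there are two
    components.\<close>
  define q where "q n = (\<bar>R0\<bar> * C + 1) / (rn n p * ln (real (sc n p)))" for n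
  have q: "q \<longlonglongrightarrow> 0"
    unfolding q_def[abs_def]
    by (rule tendsto_divide_0[OF tendsto_const filterlim_at_top_imp_at_infinity[OF filterlim_at_top_mult_at_top[OF rn_at_top ln_sc_at_top]]])
  have "eventually (\<lambda>n. q n < \<epsilon> / 2) sequentially"
    by (rule order_tendstoD(2)[OF q]) (use \<epsilon> in simp)
  moreover have "eventually (\<lambda>n. dist (\<chi> i. h_E M D (sc n p) i) ?h < \<epsilon> / 2) sequentially"
    using h_E_limit[of p] \<epsilon> by (intro tendstoD) auto
  moreover have "eventually (\<lambda>n. 0 < rn n p) sequentially" using rn_at_top[of p, unfolded filterlim_at_top_dense] by (rule spec)
  moreover have "eventually (\<lambda>n. 0 < ln (real (sc n p))) sequentially" using ln_sc_at_top[of p, unfolded filterlim_at_top_dense] by (rule spec)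
  moreover note block_expansion[OF zero_less_one, of R0 p]
  ultimately show "eventually (\<lambda>n. \<forall>w\<in>space M. norm (T n w) \<le> R0 \<longrightarrow> w \<in> pos_event M D (\<nu> n) (sc n p) \<and>
      dist (\<chi> i. h_hat D (\<nu> n) (sc n p) i w) ?h < \<epsilon>) sequentially"
  proof eventually_elim
    case (elim n)
    show ?case
    proof (intro ballI impI conjI)
      fix w assume w: "w \<in> space M" "norm (T n w) \<le> R0"
      show "w \<in> pos_event M D (\<nu> n) (sc n p)" using elim(5) w by blast
      have "norm ((\<chi> i. rn n p * dl n p w i) - ?Q *v Tp n p w) < 1" using elim(5) w by blast
      moreover have "norm (?Q *v Tp n p w) \<le> \<bar>R0\<bar> * C"
      proof -
        have "norm (Tp n p w) * C \<le> \<bar>R0\<bar> * C" using norm_Tp_le[of n p w] w(2) C(1) by (intro mult_right_mono) auto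
        then show ?thesis using C(2)[of "Tp n p w"] by linarith
      qed
      ultimately have n1: "norm (\<chi> i. rn n p * dl n p w i) \<le> \<bar>R0\<bar> * C + 1"
        using norm_triangle_ineq[of "(\<chi> i. rn n p * dl n p w i) - ?Q *v Tp n p w" "?Q *v Tp n p w"] by simp
      define L where "L = ln (real (sc n p))"
      have pos: "0 < rn n p" "0 < L" using elim(3,4) by (auto simp: L_def)
      have comp: "\<bar>dl n p w i / (2 * L)\<bar> \<le> q n / 2" for i
      proof -
        have "\<bar>rn n p * dl n p w i\<bar> \<le> \<bar>R0\<bar> * C + 1"
          using component_le_norm_cart[of "\<chi> i. rn n p * dl n p w i" i] n1 by simp
        then have "rn n p * \<bar>dl n p w i\<bar> \<le> \<bar>R0\<bar> * C + 1" using pos by (simp add: abs_mult)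
        then have "\<bar>dl n p w i\<bar> \<le> (\<bar>R0\<bar> * C + 1) / rn n p" using pos by (simp add: pos_le_divide_eq mult.commute)
        then have "\<bar>dl n p w i\<bar> / (2 * L) \<le> ((\<bar>R0\<bar> * C + 1) / rn n p) / (2 * L)" using pos by (intro divide_right_mono) auto
        then show ?thesis using pos by (simp add: q_def L_def[symmetric] mult_ac)
      qed
      have diff: "(\<chi> i. h_hat D (\<nu> n) (sc n p) i w) - (\<chi> i. h_E M D (sc n p) i) = (\<chi> i. dl n p w i / (2 * L))"
        by (simp add: vec_eq_iff h_hat_def h_E_def dl_def L_def diff_divide_distrib)
      have "dist (\<chi> i. h_hat D (\<nu> n) (sc n p) i w) (\<chi> i. h_E M D (sc n p) i) \<le> (\<Sum>i\<in>(UNIV::2 set). \<bar>dl n p w i / (2 * L)\<bar>)"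
        unfolding dist_norm diff using norm_le_l1_cart[of "\<chi> i. dl n p w i / (2 * L)"] by simp
      also have "\<dots> \<le> q n" using comp[of 1] comp[of 2] by (simp add: sum_2)
      finally show "dist (\<chi> i. h_hat D (\<nu> n) (sc n p) i w) ?h < \<epsilon>"
        using elim(1,2) dist_triangle[of "\<chi> i. h_hat D (\<nu> n) (sc n p) i w" ?h "\<chi> i. h_E M D (sc n p) i"] by linarith
    qed
  qed
qed

definition Xn :: "nat \<Rightarrow> 'b \<Rightarrow> real^('m \<times> 2)" where
  "Xn n w = (\<chi> u. let s = sc n (fst u) in 2 * ln (real s) * sqrt (real (K_eff (\<nu> n) s)) *
     (h_hat D (\<nu> n) s (snd u) w - h_E M D s (snd u)))"

text \<open>The factor \<open>2 ln s\<close> undoes the division in the estimators as soon as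
  \<open>ln s > 0\<close>, so the vector is \<open>rn\<close> times the differences of log
  eigenvalues, to which the block expansion applies. There are finitely many octaves, so one
  threshold serves all blocks.\<close>

theorem h_hat_normal:
  "\<exists>\<mu>. is_mvnormal \<mu> (Q_cal P M D oct ** Sigma_B \<psi> P H (Sigma_BH M B) oct ** transpose (Q_cal P M D oct)) \<and>
    conv_in_distr_on M (\<lambda>n. \<Inter>p. pos_event M D (\<nu> n) (sc n p)) Xn \<mu>"
proof (rule conv_in_distr_on_of_linearization[OF T_measurable T_tight _ _ _ char_T])
  show "(\<Inter>p. pos_event M D (\<nu> n) (sc n p)) \<in> events" for n
    unfolding sc_def by (intro sets.finite_INT pos_event_measurable) auto
  show "Xn n \<in> borel_measurable (restrict_space M (\<Inter>p. pos_event M D (\<nu> n) (sc n p)))" for n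
  proof (rule measurable_restrict_space1, rule vec_borel_measurableI)
    note [measurable] = h_hat_measurable
    show "(\<lambda>w. Xn n w $ u) \<in> borel_measurable M" for u
      unfolding Xn_def Let_def sc_def by simp
  qed
  fix R0 \<epsilon> :: real assume \<epsilon>: "0 < \<epsilon>"
  let ?Q = "Q_cal P M D oct"
  \<comment> \<open>The norm is bounded by the sum over all \<open>2 * card\<close> components, each
    below \<open>\<epsilon>'\<close>.\<close>
  define \<epsilon>' where "\<epsilon>' = \<epsilon> / (2 * real (card (UNIV :: 'm set)))"
  have card: "0 < real (card (UNIV :: 'm set))" using finite_UNIV_card_ge_0[where 'a = 'm] by simp
  have \<epsilon>': "0 < \<epsilon>'" using \<epsilon> card by (simp add: \<epsilon>'_def)
  have "eventually (\<lambda>n. \<forall>p. \<forall>w\<in>space M. norm (T n w) \<le> R0 \<longrightarrow> w \<in> pos_event M D (\<nu> n) (sc n p) \<and>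
      norm ((\<chi> i. rn n p * dl n p w i) - Q_block (Bm (oct p)) *v Tp n p w) < \<epsilon>') sequentially"
    by (rule eventually_all_finite) (rule block_expansion[OF \<epsilon>'])
  moreover have "eventually (\<lambda>n. \<forall>p. 0 < ln (real (sc n p))) sequentially"
    by (rule eventually_all_finite) (use ln_sc_at_top[unfolded filterlim_at_top_dense] in blast)
  ultimately show "eventually (\<lambda>n. \<forall>w\<in>space M. norm (T n w) \<le> R0 \<longrightarrow> w \<in> (\<Inter>p. pos_event M D (\<nu> n) (sc n p)) \<and>
      norm (Xn n w - ?Q *v T n w) < \<epsilon>) sequentially"
  proof eventually_elim
    case (elim n)
    show ?case
    proof (intro ballI impI conjI)
      fix w assume w: "w \<in> space M" "norm (T n w) \<le> R0"
      show "w \<in> (\<Inter>p. pos_event M D (\<nu> n) (sc n p))" using elim(1) w by blast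
      define y where "y p = (\<chi> i. rn n p * dl n p w i) - Q_block (Bm (oct p)) *v Tp n p w" for p
      have y: "norm (y p) < \<epsilon>'" for p unfolding y_def using elim(1) w by blast
      have X: "Xn n w $ (p, i) = rn n p * dl n p w i" for p i
      proof -
        have "0 < ln (real (sc n p))" using elim(2) by blast
        then show ?thesis
          by (simp add: Xn_def Let_def K_eff_eq rn_def h_hat_def h_E_def dl_def diff_divide_distrib[symmetric])
      qed
      have "(?Q *v T n w) $ (p, i) = (Q_block (Bm (oct p)) *v Tp n p w) $ i" for p i
        unfolding Q_cal_def matrix_vector_mult_def vec_lambda_beta sum_block_diag
        by (simp add: B_mat_eq Tp_def)
      then have comp: "(Xn n w - ?Q *v T n w) $ (p, i) = y p $ i" for p i
        by (simp add: X y_def)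
      have "norm (Xn n w - ?Q *v T n w) \<le> (\<Sum>u\<in>UNIV. \<bar>(Xn n w - ?Q *v T n w) $ u\<bar>)" by (rule norm_le_l1_cart)
      also have "\<dots> = (\<Sum>p\<in>UNIV. \<Sum>i\<in>UNIV. \<bar>y p $ i\<bar>)" unfolding sum_UNIV_prod comp ..
      also have "\<dots> < (\<Sum>p\<in>(UNIV::'m set). 2 * \<epsilon>')"
      proof (rule sum_strict_mono)
        fix p
        have "\<bar>y p $ i\<bar> < \<epsilon>'" for i using component_le_norm_cart[of "y p" i] y[of p] by simp
        from this[of 1] this[of 2] show "(\<Sum>i\<in>UNIV. \<bar>y p $ i\<bar>) < 2 * \<epsilon>'" by (simp add: sum_2)
      qed auto
      also have "\<dots> = \<epsilon>" using card by (simp add: \<epsilon>'_def)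
      finally show "norm (Xn n w - ?Q *v T n w) < \<epsilon>" .
    qed
  qed
qed

end

text \<open>The two summands are nonnegative, so each is eventually small. The second being below 1
  gives \<open>n < 3 * l n\<close>, because \<open>1 + 2 h < 3\<close>; the first being below
  \<open>2 ^ (- Z)\<close> gives \<open>l n + Z < n\<close>.\<close>

lemma scale_exponents:
  fixes l :: "nat \<Rightarrow> nat" and h :: real
  assumes h: "0 < h" "h < 1"
    and lim: "(\<lambda>n. real (2 ^ l n) / real (2 ^ n) + real (2 ^ n) / real (2 ^ l n) powr (1 + 2 * h)) \<longlonglongrightarrow> 0"
  shows "filterlim l at_top sequentially" "filterlim (\<lambda>n. n - l n) at_top sequentially"
proof -
  have "eventually (\<lambda>n. n \<le> 3 * l n) sequentially"
  proof -
    have "eventually (\<lambda>n. real (2 ^ l n) / real (2 ^ n) + real (2 ^ n) / real (2 ^ l n) powr (1 + 2 * h) < 1) sequentially"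
      using lim by (rule order_tendstoD) simp
    then show ?thesis
    proof eventually_elim
      case (elim n)
      have "0 \<le> real (2 ^ l n) / real (2 ^ n)" by simp
      with elim have "real (2 ^ n) / real (2 ^ l n) powr (1 + 2 * h) < 1" by linarith
      then have "real (2 ^ n) < real (2 ^ l n) powr (1 + 2 * h)" by (simp add: divide_less_eq)
      also have "real (2 ^ l n) powr (1 + 2 * h) = 2 powr (real (l n) * (1 + 2 * h))"
        by (simp add: powr_powr flip: powr_realpow)
      also have "real (2 ^ n) = 2 powr real n" by (simp add: powr_realpow)
      finally have "real n < real (l n) * (1 + 2 * h)" by simp
      also have "\<dots> \<le> real (l n) * 3" using h by (intro mult_left_mono) auto
      finally show ?case by linarith
    qed
  qed
  then show "filterlim l at_top sequentially"
    unfolding filterlim_at_top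
  proof (intro allI)
    fix Z :: nat
    assume a: "eventually (\<lambda>n. n \<le> 3 * l n) sequentially"
    show "eventually (\<lambda>n. Z \<le> l n) sequentially"
      using a eventually_ge_at_top[of "3 * Z"] by eventually_elim simp
  qed
  show "filterlim (\<lambda>n. n - l n) at_top sequentially"
    unfolding filterlim_at_top
  proof
    fix Z :: nat
    have "eventually (\<lambda>n. real (2 ^ l n) / real (2 ^ n) + real (2 ^ n) / real (2 ^ l n) powr (1 + 2 * h) < 1 / 2 ^ Z) sequentially"
      using lim by (rule order_tendstoD) simp
    then show "eventually (\<lambda>n. Z \<le> n - l n) sequentially"
    proof eventually_elim
      case (elim n)
      have "0 \<le> real (2 ^ n) / real (2 ^ l n) powr (1 + 2 * h)" by simp
      with elim have "real (2 ^ l n) / real (2 ^ n) < 1 / 2 ^ Z" by linarith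
      then have "(2::real) ^ (l n + Z) < 2 ^ n" by (simp add: divide_simps power_add)
      then have "l n + Z < n" by (rule power_less_imp_less_exp[rotated]) simp
      then show ?case by simp
    qed
  qed
qed

theorem theorem4p1:
  fixes N :: "'v measure" and R :: "real set \<Rightarrow> 'v \<Rightarrow> complex^2"
    and M :: "'w measure" and B :: "real \<Rightarrow> 'w \<Rightarrow> real^2"
    and P H :: "real^2^2" and A :: "complex^2^2" and h\<^sub>1 h\<^sub>2 :: real
    and \<psi> :: "real \<Rightarrow> real" and N\<^sub>\<psi> :: nat and \<alpha> :: real
    and D :: "nat \<Rightarrow> int \<Rightarrow> 'w \<Rightarrow> real^2"
    and oct :: "'m::{finite,linorder} \<Rightarrow> nat"
    and a :: "nat \<Rightarrow> nat"
  assumes "0 < h\<^sub>1" "h\<^sub>1 < h\<^sub>2" "h\<^sub>2 < 1"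
    and "invertible P" and "\<forall>i. norm (column i P) = 1"
    and "H = P ** diag2 h\<^sub>1 h\<^sub>2 ** matrix_inv P"
    and "rank (Re_mat (A ** hermitian A)) = 2"
    and "Im_mat (A ** hermitian A) = 0"
    and "ofbm N R M H A B"
    and "wavelet \<psi> N\<^sub>\<psi> \<alpha>"
    and "wavelet_coeffs M \<psi> B D"
    and "strict_mono oct"
    and "\<forall>n. \<exists>l. a (2 ^ n) = 2 ^ l"
    and "eventually (\<lambda>n. \<forall>p. real (a (2 ^ n)) \<le> real (2 ^ n) / 2 ^ oct p) sequentially"
    and "(\<lambda>n. real (a (2 ^ n)) / real (2 ^ n)
              + real (2 ^ n) / real (a (2 ^ n)) powr (1 + 2 * h\<^sub>1)) \<longlonglongrightarrow> 0"
  shows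
    "(\<forall>p.
        conv_in_prob_on M (\<lambda>n. pos_event M D (2 ^ n) (a (2 ^ n) * 2 ^ oct p))
          (\<lambda>n \<omega>. \<chi> i. h_hat D (2 ^ n) (a (2 ^ n) * 2 ^ oct p) i \<omega>)
          (vector [h\<^sub>1, h\<^sub>2] :: real^2) \<and>
        (\<lambda>n. \<chi> i. h_E M D (a (2 ^ n) * 2 ^ oct p) i) \<longlonglongrightarrow> (vector [h\<^sub>1, h\<^sub>2] :: real^2)) \<and>
     (\<exists>\<mu> :: (real^('m \<times> 2)) measure.
        is_mvnormal \<mu>
          (Q_cal P M D oct ** Sigma_B \<psi> P H (Sigma_BH M B) oct ** transpose (Q_cal P M D oct)) \<and>
        conv_in_distr_on M
          (\<lambda>n. \<Inter>p. pos_event M D (2 ^ n) (a (2 ^ n) * 2 ^ oct p))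
          (\<lambda>n \<omega>. \<chi> u. let s = a (2 ^ n) * 2 ^ oct (fst u) in
              2 * ln (real s) * sqrt (real (K_eff (2 ^ n) s)) *
              (h_hat D (2 ^ n) s (snd u) \<omega> - h_E M D s (snd u)))
          \<mu>)"
proof -
  obtain l where l: "\<And>n. a (2 ^ n) = 2 ^ l n" using assms(13) by metis
  interpret W: ofbm_wavelet N R M B P H A h\<^sub>1 h\<^sub>2 \<psi> N\<^sub>\<psi> \<alpha> D
    by unfold_locales (fact assms)+
  have sc0: "a (2 ^ n) * 2 ^ oct p = 2 ^ (l n + oct p)" for n p by (simp add: l power_add)
  have lims: "filterlim l at_top sequentially" "filterlim (\<lambda>n. n - l n) at_top sequentially"
    using scale_exponents[of h\<^sub>1 l] assms(1,2,3,15) by (simp_all add: l)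
  \<comment> \<open>The locale demands the inequality between octaves and exponents at every index.
    All sequences are therefore shifted by \<open>n0\<close>, and the offset lemmas undo the shift
    at the end.\<close>
  obtain n0 where n0: "\<And>n p. n0 \<le> n \<Longrightarrow> l n + oct p \<le> n"
  proof -
    from assms(14) obtain n0 where n0: "\<And>n p. n0 \<le> n \<Longrightarrow> real (a (2 ^ n)) \<le> real (2 ^ n) / 2 ^ oct p"
      unfolding eventually_sequentially by blast
    have "l n + oct p \<le> n" if "n0 \<le> n" for n p
    proof (rule power_le_imp_le_exp)
      show "(2::real) ^ (l n + oct p) \<le> 2 ^ n"
        using n0[OF that, of p] by (simp add: l power_add pos_le_divide_eq)
    qed simp
    then show ?thesis by (rule that)
  qed
  have shift: "filterlim (\<lambda>n. f (n + n0)) at_top sequentially" if "filterlim f at_top sequentially" for f :: "nat \<Rightarrow> nat"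
    by (rule filterlim_compose[OF that filterlim_add_const_nat_at_top])
  interpret E: ofbm_estimator N R M B P H A h\<^sub>1 h\<^sub>2 \<psi> N\<^sub>\<psi> \<alpha> D oct "\<lambda>n. l (n + n0)" "\<lambda>n. n + n0 - l (n + n0)"
  proof unfold_locales
    show "oct p \<le> n + n0 - l (n + n0)" for n p using n0[of "n + n0" p] by simp
    show "filterlim (\<lambda>n. n + n0 - l (n + n0)) at_top sequentially" by (rule shift[OF lims(2)])
    show "norm (column i P) = 1" for i using assms(5) by blast
    show "filterlim (\<lambda>n. l (n + n0)) at_top sequentially" by (rule shift[OF lims(1)])
  qed
  have nu: "E.\<nu> n = 2 ^ (n + n0)" for n
  proof -
    \<comment> \<open>Any block index will do: its octave is nonnegative, so \<open>l\<close> is at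
      most the exponent of the sample size and the truncated subtraction is exact.\<close>
    have "l (n + n0) + oct undefined \<le> n + n0" by (rule n0) simp
    then show ?thesis by (simp add: E.\<nu>_def)
  qed
  have sc: "E.sc n p = a (2 ^ (n + n0)) * 2 ^ oct p" for n p by (simp add: E.sc_def sc0)
  have E_meas: "pos_event M D (2 ^ n) (a (2 ^ n) * 2 ^ oct p) \<in> sets M" for n p
    unfolding sc0 by (rule W.pos_event_measurable)
  have h_meas: "(\<lambda>\<omega>. h_hat D (2 ^ n) (a (2 ^ n) * 2 ^ oct p) i \<omega>) \<in> borel_measurable M" for n p i
    unfolding sc0 by (rule W.h_hat_measurable)
  have part1: "conv_in_prob_on M (\<lambda>n. pos_event M D (2 ^ n) (a (2 ^ n) * 2 ^ oct p))
      (\<lambda>n \<omega>. \<chi> i. h_hat D (2 ^ n) (a (2 ^ n) * 2 ^ oct p) i \<omega>) (vector [h\<^sub>1, h\<^sub>2] :: real^2)" for p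
  proof (rule conv_in_prob_on_offset[where k = n0, OF E_meas])
    show "(\<lambda>\<omega>. \<chi> i. h_hat D (2 ^ n) (a (2 ^ n) * 2 ^ oct p) i \<omega>) \<in>
        borel_measurable (restrict_space M (pos_event M D (2 ^ n) (a (2 ^ n) * 2 ^ oct p)))" for n
      by (rule measurable_restrict_space1, rule vec_borel_measurableI) (simp add: h_meas)
    show "conv_in_prob_on M (\<lambda>n. pos_event M D (2 ^ (n + n0)) (a (2 ^ (n + n0)) * 2 ^ oct p))
        (\<lambda>n \<omega>. \<chi> i. h_hat D (2 ^ (n + n0)) (a (2 ^ (n + n0)) * 2 ^ oct p) i \<omega>) (vector [h\<^sub>1, h\<^sub>2] :: real^2)"
      using E.h_hat_consistent[of p] unfolding nu sc .
  qed
  have part2: "(\<lambda>n. \<chi> i. h_E M D (a (2 ^ n) * 2 ^ oct p) i) \<longlonglongrightarrow> (vector [h\<^sub>1, h\<^sub>2] :: real^2)" for p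
    by (rule LIMSEQ_offset[where k = n0]) (use E.h_E_limit[of p] in \<open>unfold sc\<close>)
  let ?X = "\<lambda>n \<omega>. \<chi> u. let s = a (2 ^ n) * 2 ^ oct (fst u) in
      2 * ln (real s) * sqrt (real (K_eff (2 ^ n) s)) * (h_hat D (2 ^ n) s (snd u) \<omega> - h_E M D s (snd u))"
  have Xn: "E.Xn = (\<lambda>n. ?X (n + n0))"
    by (intro ext) (simp only: E.Xn_def nu sc)
  obtain \<mu> where \<mu>: "is_mvnormal \<mu> (Q_cal P M D oct ** Sigma_B \<psi> P H (Sigma_BH M B) oct ** transpose (Q_cal P M D oct))"
    "conv_in_distr_on M (\<lambda>n. \<Inter>p. pos_event M D (2 ^ (n + n0)) (a (2 ^ (n + n0)) * 2 ^ oct p)) (\<lambda>n. ?X (n + n0)) \<mu>"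
    using E.h_hat_normal unfolding nu sc Xn by blast
  have "conv_in_distr_on M (\<lambda>n. \<Inter>p. pos_event M D (2 ^ n) (a (2 ^ n) * 2 ^ oct p)) ?X \<mu>"
  proof (rule conv_in_distr_on_offset[where k = n0])
    show "(\<Inter>p. pos_event M D (2 ^ n) (a (2 ^ n) * 2 ^ oct p)) \<in> sets M" for n
      by (intro sets.finite_INT E_meas) auto
    show "?X n \<in> borel_measurable (restrict_space M (\<Inter>p. pos_event M D (2 ^ n) (a (2 ^ n) * 2 ^ oct p)))" for n
    proof (rule measurable_restrict_space1, rule vec_borel_measurableI)
      note [measurable] = h_meas
      show "(\<lambda>w. ?X n w $ u) \<in> borel_measurable M" for u unfolding Let_def by simp
    qed
    show "conv_in_distr_on M (\<lambda>n. \<Inter>p. pos_event M D (2 ^ (n + n0)) (a (2 ^ (n + n0)) * 2 ^ oct p)) (\<lambda>n. ?X (n + n0)) \<mu>"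
      by (rule \<mu>(2))
  qed
  with \<mu>(1) part1 part2 show ?thesis by blast
qed

end
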